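(* Suppose that $a_1,\ldots,a_\ell\in\mathcal{H}$ are jointly ergodic for a system $(X,\mathcal{X},\mu,T_1,\ldots,T_\ell)$. Then the following holds: (i) The sequences $a_1,\ldots,a_\ell$ satisfy the product ergodicity condition on the system. (ii) Suppose additionally that for every $i\neq j$ and $c_i,c_j\in\mathbb{R}$, the function $c_ia_i-c_ja_j$ is either an almost rational polynomial or stays logarithmically away from $\mathbb{Q}[x]$. Then the sequences $a_1,\ldots,a_\ell$ satisfy the difference ergodicity condition on the system.
   Context: A system $(X,\mathcal{X},\mu,T_1,\ldots,T_\ell)$ consists of commuting invertible measure preserving transformations $T_1,\ldots,T_\ell$ acting on a Lebesgue probability space $(X,\mathcal{X},\mu)$; $T$ acts on functions by $Tf=f\circ T$. Write $[N]=\{1,\ldots,N\}$ and $\mathbb{E}_{n\in[N]}=\frac1N\sum_{n=1}^N$. Hardy sequences: let $B$ be the ring of germs at $\infty$ of real-valued functions defined on half-lines $(x_0,\infty)$. A Hardy field is a subfield of $(B,+,\cdot)$ closed under differentiation. Fix a Hardy field $\mathcal{H}_0$ closed under composition and compositional inversion of functions, when defined, and let $\mathcal{H}=\{a\in\mathcal{H}_0:\ a(x)\ll x^d \text{ for some } d>0\}$, where $a\ll b$ means $|a(x)|\le C|b(x)|$ for some $C>0$ and all large $x$. An $a\in\mathcal{H}$ is identified with the sequence $(a(n))_n$ (finitely many undefined terms are irrelevant). A function $a\in\mathcal{H}$ is an almost rational polynomial if there is $p\in\mathbb{Q}[x]$ such that $a(x)-p(x)$ converges (to a real number) as $x\to\infty$.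 It stays logarithmically away from $\mathbb{Q}[x]$ if $\lim_{x\to\infty}\frac{|a(x)-p(x)|}{\log x}=\infty$ for all $p\in\mathbb{Q}[x]$. Joint ergodicity: $a_1,\ldots,a_\ell$ are jointly ergodic for the system if for all $f_1,\ldots,f_\ell\in L^\infty(\mu)$, $\lim_{N\to\infty}\left\|\mathbb{E}_{n\in[N]}\prod_{j=1}^\ell T_j^{\lfloor a_j(n)\rfloor}f_j-\prod_{j=1}^\ell\int f_j\,d\mu\right\|_{L^2(\mu)}=0$. A sequence $(S_n)_n$ of measure preserving transformations of a probability space $(Y,\mathcal{Y},\nu)$ is ergodic if $\lim_{N\to\infty}\|\mathbb{E}_{n\in[N]}S_nf-\int f\,d\nu\|_{L^2(\nu)}=0$ for all $f\in L^\infty(\nu)$. Difference ergodicity condition: $(T_i^{\lfloor a_i(n)\rfloor}T_j^{-\lfloor a_j(n)\rfloor})_n$ is ergodic on $(X,\mathcal{X},\mu)$ for all distinct $i,j\in\{1,\ldots,\ell\}$. Product ergodicity condition: $(T_1^{\lfloor a_1(n)\rfloor}\times\cdots\times T_\ell^{\lfloor a_\ell(n)\rfloor})_n$ is ergodic on the product space $(X^\ell,\mathcal{X}^{\otimes\ell},\mu^\ell)$. *)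

theory Defs
  imports
    "HOL-Probability.Probability"
    "HOL-Library.Landau_Symbols"
    "HOL-Computational_Algebra.Polynomial"
begin

section \<open>Hardy fields\<close>

text \<open>
  A germ at infinity is represented by all total functions that eventually agree with it, so a set
  of germs is a set of functions that is closed under eventual equality, and equality of germs is
  eventual equality.  The values of a representative outside a half-line are irrelevant.
\<close>

definition germ_set :: "(real \<Rightarrow> real) set \<Rightarrow> bool" where
  "germ_set H \<longleftrightarrow>
     (\<forall>f\<in>H. \<forall>g. (\<forall>\<^sub>F x in at_top. f x = g x) \<longrightarrow> g \<in> H)"

definition hardy_field :: "(real \<Rightarrow> real) set \<Rightarrow> bool" where
  "hardy_field H \<longleftrightarrow>
     germ_set H \<and>
     (\<lambda>_. 1) \<in> H \<and>
     (\<forall>f\<in>H. \<forall>g\<in>H. (\<lambda>x. f x + g x) \<in> H) \<and>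
     (\<forall>f\<in>H. (\<lambda>x. - f x) \<in> H) \<and>
     (\<forall>f\<in>H. \<forall>g\<in>H. (\<lambda>x. f x * g x) \<in> H) \<and>
     (\<forall>f\<in>H. \<not> (\<forall>\<^sub>F x in at_top. f x = 0) \<longrightarrow>
        (\<exists>g\<in>H. \<forall>\<^sub>F x in at_top. f x * g x = 1)) \<and>
     (\<forall>f\<in>H. \<exists>g\<in>H. \<forall>\<^sub>F x in at_top. (f has_real_derivative g x) (at x))"

text \<open>
  The germ of \<open>f \<circ> g\<close> at infinity is defined when \<open>g\<close> tends to \<open>+\<infinity>\<close>; likewise the compositional
  inverse of \<open>f\<close> is a germ at infinity when \<open>f\<close> tends to \<open>+\<infinity>\<close>.
\<close>

definition closed_under_composition :: "(real \<Rightarrow> real) set \<Rightarrow> bool" where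
  "closed_under_composition H \<longleftrightarrow>
     (\<forall>f\<in>H. \<forall>g\<in>H. filterlim g at_top at_top \<longrightarrow> f \<circ> g \<in> H)"

definition compositional_inverse :: "(real \<Rightarrow> real) \<Rightarrow> (real \<Rightarrow> real) \<Rightarrow> bool" where
  "compositional_inverse f g \<longleftrightarrow>
     filterlim f at_top at_top \<and> filterlim g at_top at_top \<and>
     (\<forall>\<^sub>F x in at_top. f (g x) = x) \<and> (\<forall>\<^sub>F x in at_top. g (f x) = x)"

definition closed_under_inversion :: "(real \<Rightarrow> real) set \<Rightarrow> bool" where
  "closed_under_inversion H \<longleftrightarrow>
     (\<forall>f\<in>H. \<forall>g. compositional_inverse f g \<longrightarrow> g \<in> H)"

definition polynomial_growth_part :: "(real \<Rightarrow> real) set \<Rightarrow> (real \<Rightarrow> real) set" where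
  "polynomial_growth_part H = {a \<in> H. \<exists>d>0. a \<in> O[at_top](\<lambda>x. x powr d)}"

abbreviation rpoly :: "rat poly \<Rightarrow> real \<Rightarrow> real" where
  "rpoly p \<equiv> poly (map_poly of_rat p)"

definition almost_rational_polynomial :: "(real \<Rightarrow> real) \<Rightarrow> bool" where
  "almost_rational_polynomial a \<longleftrightarrow>
     (\<exists>p. \<exists>L. ((\<lambda>x. a x - rpoly p x) \<longlongrightarrow> L) at_top)"

definition stays_log_away :: "(real \<Rightarrow> real) \<Rightarrow> bool" where
  "stays_log_away a \<longleftrightarrow>
     (\<forall>p. filterlim (\<lambda>x. \<bar>a x - rpoly p x\<bar> / ln x) at_top at_top)"


section \<open>Systems\<close>

definition isomorphic_mod_0 :: "'a measure \<Rightarrow> 'b measure \<Rightarrow> bool" where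
  "isomorphic_mod_0 M N \<longleftrightarrow>
     (\<exists>A\<in>null_sets M. \<exists>B\<in>null_sets N. \<exists>\<phi>.
        let M' = restrict_space M (space M - A); N' = restrict_space N (space N - B) in
          bij_betw \<phi> (space M') (space N') \<and>
          \<phi> \<in> M' \<rightarrow>\<^sub>M N' \<and> inv_into (space M') \<phi> \<in> N' \<rightarrow>\<^sub>M M' \<and>
          distr M' N' \<phi> = N')"

text \<open>
  A probability space that, modulo null sets, consists of an interval with Lebesgue measure and
  countably many atoms.  Passing to the completion accommodates both usual conventions: a complete
  Lebesgue space (which is its own completion) and a standard Borel probability space.
\<close>

definition lebesgue_prob_space :: "'a measure \<Rightarrow> bool" where
  "lebesgue_prob_space M \<longleftrightarrow>
     prob_space M \<and>
     (\<exists>D a. countable D \<and> D \<subseteq> space M \<and>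
        (\<forall>d\<in>D. {d} \<in> sets (completion M) \<and> emeasure (completion M) {d} > 0) \<and>
        0 \<le> a \<and>
        isomorphic_mod_0 (restrict_space (completion M) (space M - D)) (lebesgue_on {0..a::real}))"

definition invertible_measure_preserving :: "'a measure \<Rightarrow> ('a \<Rightarrow> 'a) \<Rightarrow> bool" where
  "invertible_measure_preserving M T \<longleftrightarrow>
     bij_betw T (space M) (space M) \<and>
     T \<in> M \<rightarrow>\<^sub>M M \<and> inv_into (space M) T \<in> M \<rightarrow>\<^sub>M M \<and>
     distr M M T = M"

text \<open>The index set of a family of \<open>l\<close> transformations, functions or sequences is \<open>{1..l}\<close>.\<close>

definition mp_system :: "'a measure \<Rightarrow> nat \<Rightarrow> (nat \<Rightarrow> 'a \<Rightarrow> 'a) \<Rightarrow> bool" where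
  "mp_system M l T \<longleftrightarrow>
     lebesgue_prob_space M \<and>
     (\<forall>i\<in>{1..l}. invertible_measure_preserving M (T i)) \<and>
     (\<forall>i\<in>{1..l}. \<forall>j\<in>{1..l}. \<forall>x\<in>space M. T i (T j x) = T j (T i x))"

definition int_iterate :: "'a measure \<Rightarrow> ('a \<Rightarrow> 'a) \<Rightarrow> int \<Rightarrow> 'a \<Rightarrow> 'a" where
  "int_iterate M T k =
     (if 0 \<le> k then T ^^ nat k else inv_into (space M) T ^^ nat (- k))"


section \<open>Ergodicity conditions\<close>

definition Linfty :: "'a measure \<Rightarrow> ('a \<Rightarrow> complex) set" where
  "Linfty M = {f \<in> borel_measurable M. \<exists>C. AE x in M. norm (f x) \<le> C}"

definition L2norm :: "'a measure \<Rightarrow> ('a \<Rightarrow> complex) \<Rightarrow> real" where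
  "L2norm M f = sqrt (\<integral>x. (norm (f x))\<^sup>2 \<partial>M)"

definition average :: "nat \<Rightarrow> (nat \<Rightarrow> complex) \<Rightarrow> complex" where
  "average N u = (\<Sum>n=1..N. u n) / of_nat N"

definition jointly_ergodic ::
  "'a measure \<Rightarrow> nat \<Rightarrow> (nat \<Rightarrow> 'a \<Rightarrow> 'a) \<Rightarrow> (nat \<Rightarrow> real \<Rightarrow> real) \<Rightarrow> bool" where
  "jointly_ergodic M l T a \<longleftrightarrow>
     (\<forall>f. (\<forall>j\<in>{1..l}. f j \<in> Linfty M) \<longrightarrow>
       (\<lambda>N. L2norm M (\<lambda>x.
              average N (\<lambda>n. \<Prod>j=1..l. f j (int_iterate M (T j) \<lfloor>a j (real n)\<rfloor> x))
              - (\<Prod>j=1..l. \<integral>y. f j y \<partial>M)))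
       \<longlonglongrightarrow> 0)"

definition ergodic_sequence :: "'b measure \<Rightarrow> (nat \<Rightarrow> 'b \<Rightarrow> 'b) \<Rightarrow> bool" where
  "ergodic_sequence M S \<longleftrightarrow>
     (\<forall>f\<in>Linfty M.
       (\<lambda>N. L2norm M (\<lambda>x. average N (\<lambda>n. f (S n x)) - (\<integral>y. f y \<partial>M))) \<longlonglongrightarrow> 0)"

definition difference_ergodicity ::
  "'a measure \<Rightarrow> nat \<Rightarrow> (nat \<Rightarrow> 'a \<Rightarrow> 'a) \<Rightarrow> (nat \<Rightarrow> real \<Rightarrow> real) \<Rightarrow> bool" where
  "difference_ergodicity M l T a \<longleftrightarrow>
     (\<forall>i\<in>{1..l}. \<forall>j\<in>{1..l}. i \<noteq> j \<longrightarrow>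
       ergodic_sequence M
         (\<lambda>n. int_iterate M (T i) \<lfloor>a i (real n)\<rfloor> \<circ> int_iterate M (T j) (- \<lfloor>a j (real n)\<rfloor>)))"

definition product_ergodicity ::
  "'a measure \<Rightarrow> nat \<Rightarrow> (nat \<Rightarrow> 'a \<Rightarrow> 'a) \<Rightarrow> (nat \<Rightarrow> real \<Rightarrow> real) \<Rightarrow> bool" where
  "product_ergodicity M l T a \<longleftrightarrow>
     ergodic_sequence (\<Pi>\<^sub>M i\<in>{1..l}. M)
       (\<lambda>n x. \<lambda>j\<in>{1..l}. int_iterate M (T j) \<lfloor>a j (real n)\<rfloor> (x j))"

end

theory Submission
 imports Defs
begin

text \<open>
  Write \<open>e(x) = exp(2 pi i x)\<close>, \<open>[x]\<close> for the floor of \<open>x\<close>, and \<open>E_n\<close> for the average over \<open>n \<le> N\<close>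
  as \<open>N\<close> grows.  Everything rests on exponential sums along Hardy functions.  A Hardy function \<open>f\<close>
  of polynomial growth for which \<open>x (f - p)'(x)\<close> is unbounded for every rational polynomial \<open>p\<close>
  satisfies \<open>E_n e(f(n)) \<rightarrow> 0\<close> (\<open>equidistributing_away\<close>, Boshernitzan's theorem): take differences
  until the limit is zero, descend by van der Corput's inequality, and finish with estimates for
  functions of small first or second difference.  Real combinations of Hardy functions have to be
  admitted here; they are eventually of constant sign although they need not lie in the field.

  Part (i), product ergodicity.  By density it suffices to treat the indicator of a rectangle
  \<open>A_1 \<times> ... \<times> A_l\<close>.  The square of the \<open>L2\<close> norm of its ergodic average is the double average over
  \<open>n, m\<close> of \<open>\<Prod>j c_j([a_j n] - [a_j m])\<close>, where \<open>c_j(k) = \<mu>(A_j \<inter> T_j^(-k) A_j)\<close>, and this has to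
  converge to \<open>\<Prod>j \<mu>(A_j)^2\<close>.  By Herglotz's theorem \<open>c_j\<close> is the Fourier transform of a measure.
  The continuous part of that measure does not contribute: this is Wiener's lemma along the sequence
  \<open>[a_j n]\<close> (\<open>Wiener_along_sequence\<close>), which holds because \<open>E_n e(s a_j(n)) \<rightarrow> 0\<close> for all but countably
  many \<open>s\<close>.  An atom at \<open>lam_j\<close> comes from an eigenfunction \<open>g_j\<close> of \<open>T_j\<close>, of constant modulus by
  ergodicity.  Joint ergodicity, applied to \<open>g_1, ..., g_l\<close>, shows that
  \<open>E_n e(\<Sum>j lam_j [a_j n]) \<rightarrow> 0\<close> unless all \<open>lam_j\<close> are zero (\<open>eigenvalues_average\<close>), so only the atoms
  at zero remain and they give the product of the \<open>\<mu>(A_j)^2\<close>.  If \<open>a_j\<close> is too slow for the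
  countability statement (\<open>x a_j'(x)\<close> is bounded), then \<open>[a_j n]\<close> is constant on long blocks and
  ergodicity along it forces every measurable set to have measure 0 or 1 (\<open>trivial_of_slow_ergodic\<close>).

  Part (ii), difference ergodicity.  Joint ergodicity gives the weak convergence
  \<open>E_n \<integral> f(T_i^[a_i n] x) g(T_j^[a_j n] x) \<rightarrow> \<integral> f \<integral> g\<close>, and moving \<open>T_j\<close> to the other side turns it into
  weak convergence of the averages of \<open>f\<close> along \<open>T_i^[a_i n] T_j^(-[a_j n])\<close>.  To make it strong it is
  enough to know that these averages converge in \<open>L2\<close> at all.  They do as soon as the multipliers
  \<open>E_n e(t [a_i n] + s [a_j n])\<close> converge for every \<open>t\<close> and \<open>s\<close>: by positive definiteness, a bounded
  sequence of trigonometric polynomials that tends to zero pointwise tends to zero in spectral norm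
  (\<open>spectral_null_sequence\<close>).  Instead of a spectral measure on the torus this uses only a positive
  functional on trigonometric polynomials, for which bounded convergence has an elementary proof
  (\<open>bounded_convergence\<close>).  The convergence of the multipliers (\<open>convergent_average_floor_pair\<close>) is the
  place where the dichotomy of the hypothesis enters: each function is either essentially a rational
  polynomial, whose phases are periodic, or equidistributing.
\<close>

section \<open>Exponentials and Cesaro averages\<close>

definition ee :: "real => complex" where
 "ee x = cis (2 * pi * x)"

lemma ee_0 [simp]: "ee 0 = 1" by (simp add: ee_def)
lemma norm_ee [simp]: "norm (ee x) = 1" by (simp add: ee_def)
lemma ee_nonzero [simp]: "ee x \<noteq> 0" using norm_ee[of x] by force
lemma ee_add: "ee (x + y) = ee x * ee y" by (simp add: ee_def cis_mult distrib_left)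
lemma cnj_ee: "cnj (ee x) = ee (- x)" by (simp add: ee_def cis_cnj)
lemma ee_diff: "ee (x - y) = ee x * cnj (ee y)" by (simp add: ee_def cis_cnj cis_mult right_diff_distrib)
lemma ee_of_int [simp]: "ee (of_int k) = 1" by (simp add: ee_def cis_multiple_2pi)
lemma ee_of_nat [simp]: "ee (of_nat k) = 1" using ee_of_int[of "int k"] by simp
lemma ee_mult_of_nat: "ee (of_nat k * x) = ee x ^ k"
proof -
 have "2 * pi * (of_nat k * x) = of_nat k * (2 * pi * x)" by simp
 thus ?thesis unfolding ee_def by (simp only: Complex.DeMoivre)
qed
lemma ee_sum: "finite A ==> ee (\<Sum>i\<in>A. f i) = (\<Prod>i\<in>A. ee (f i))"
 by (induction A rule: finite_induct) (simp_all add: ee_add)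
lemma continuous_on_ee [continuous_intros]:
 "continuous_on S f ==> continuous_on S (\<lambda>x. ee (f x))"
 unfolding ee_def cis_conv_exp by (intro continuous_intros)
lemma isCont_ee: "isCont ee x"
 using continuous_on_ee[OF continuous_on_id, of UNIV] by (simp add: continuous_on_eq_continuous_at)
lemma tendsto_ee [tendsto_intros]: "(f \<longlongrightarrow> l) F ==> ((\<lambda>x. ee (f x)) \<longlongrightarrow> ee l) F"
 by (rule isCont_tendsto_compose[OF isCont_ee])
lemma measurable_ee [measurable]: "ee \<in> borel_measurable borel"
 by (intro borel_measurable_continuous_onI continuous_on_ee continuous_on_id)

lemma norm_one_minus_ee: "norm (1 - ee x) = 2 * \<bar>sin (pi * x)\<bar>"
proof -
 have "(norm (1 - ee x))\<^sup>2 = (1 - cos (2*pi*x))\<^sup>2 + (sin (2*pi*x))\<^sup>2"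
  by (simp add: ee_def cmod_power2)
 also have "... = 2 - 2 * cos (2 * (pi*x))"
  using sin_cos_squared_add[of "2*pi*x"] by (simp add: power2_eq_square algebra_simps)
 also have "... = (2 * \<bar>sin (pi * x)\<bar>)\<^sup>2"
  by (simp add: cos_double_sin power_mult_distrib)
 finally show ?thesis by (smt (verit) norm_ge_zero power2_eq_iff)
qed

lemma norm_ee_diff_le: "norm (ee x - ee y) <= 2 * pi * \<bar>x - y\<bar>"
proof -
 have "ee x - ee y = ee x * (1 - ee (y - x))"
  by (simp add: algebra_simps ee_add[symmetric])
 hence "norm (ee x - ee y) = norm (1 - ee (y - x))" by (simp only: norm_mult norm_ee mult_1)
 also have "... <= 2 * \<bar>pi * (y - x)\<bar>"
  unfolding norm_one_minus_ee using abs_sin_x_le_abs_x[of "pi*(y-x)"] by linarith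
 finally show ?thesis by (simp add: abs_mult abs_minus_commute)
qed

text \<open>
  Crude, but enough to bound \<open>1 - e(x)\<close> from below by a multiple of \<open>x\<close>
  near zero.
\<close>

lemma sin_ge_third:
 fixes x :: real
 assumes "0 <= x" "x <= pi/2" shows "x / 3 <= sin x"
proof -
 have "\<bar>sin x - (\<Sum>m<3. sin_coeff m * x ^ m)\<bar> <= inverse (fact 3) * \<bar>x\<bar> ^ 3"
  by (rule Maclaurin_sin_bound)
 moreover have "(\<Sum>m<3. sin_coeff m * x ^ m) = x"
  by (simp add: numeral_3_eq_3 sin_coeff_def)
 ultimately have "\<bar>sin x - x\<bar> <= x^3/6" using assms by (simp add: fact_numeral field_simps)
 hence 1: "sin x >= x - x^3/6" by linarith
 have "x < 2" using assms pi_half_less_two by linarith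
 hence "x * (x * x) <= x * (2 * 2)" using assms by (intro mult_mono) auto
 thus ?thesis using 1 by (simp add: power3_eq_cube algebra_simps)
qed

lemma norm_one_minus_ee_ge: assumes "0 <= x" "x <= 1/2" shows "norm (1 - ee x) >= 2 * x"
proof -
 have "pi * x / 3 <= sin (pi * x)" using assms mult_left_mono[of x "1/2" pi] by (intro sin_ge_third) auto
 moreover have "3 * x <= pi * x" using assms pi_gt3 by (intro mult_right_mono) auto
 ultimately show ?thesis unfolding norm_one_minus_ee by linarith
qed

lemma ee_eq_1_iff: "ee x = 1 \<longleftrightarrow> x \<in> \<int>"
proof
 assume "ee x = 1"
 hence "sin (pi * x) = 0" using norm_one_minus_ee[of x] by simp
 then obtain i :: int where "pi * x = of_int i * pi" using sin_zero_iff_int2 by blast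
 hence "x = of_int i" by simp
 thus "x \<in> \<int>" by simp
next
 assume "x \<in> \<int>" thus "ee x = 1" by (auto elim: Ints_cases)
qed

lemma norm_average_le:
 assumes "\<And>n. norm (u n) <= C" "C >= 0" shows "norm (average N u) <= C"
proof -
 have "norm (\<Sum>n=1..N. u n) <= (\<Sum>n=1..N. C)" by (rule sum_norm_le) (use assms in auto)
 thus ?thesis using assms(2) by (cases "N = 0") (simp_all add: average_def norm_divide field_simps)
qed

lemma average_add: "average N (\<lambda>n. u n + v n) = average N u + average N v"
 by (simp add: average_def sum.distrib add_divide_distrib)
lemma average_diff: "average N (\<lambda>n. u n - v n) = average N u - average N v"
 by (simp add: average_def sum_subtractf diff_divide_distrib)
lemma average_cmult: "average N (\<lambda>n. c * u n) = c * average N u"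
 by (simp add: average_def sum_distrib_left)
lemma average_cmult_right: "average N (\<lambda>n. u n * c) = average N u * c"
 by (simp add: average_def sum_distrib_right)
lemma average_sum: "average N (\<lambda>n. \<Sum>i\<in>I. u i n) = (\<Sum>i\<in>I. average N (u i))"
 unfolding average_def sum_divide_distrib[symmetric] by (subst sum.swap) simp
lemma average_const: "N > 0 ==> average N (\<lambda>_. c) = c"
 by (simp add: average_def)
lemma cnj_average: "cnj (average N u) = average N (\<lambda>n. cnj (u n))"
 by (simp add: average_def)

lemma average_const_tendsto: "(\<lambda>N. average N (\<lambda>_. c)) \<longlonglongrightarrow> c"
 by (rule tendsto_eventually, rule eventually_mono[OF eventually_gt_at_top[of 0]]) (rule average_const)

text \<open>
  The constant \<open>C\<close> may depend on \<open>\<epsilon>\<close>: it absorbs the finitely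
  many initial terms on which an asymptotic hypothesis says nothing.
\<close>

lemma average_tendsto_zeroI:
 assumes "\<And>\<epsilon>. \<epsilon> > 0 ==> \<exists>C. \<forall>\<^sub>F N in sequentially. norm (\<Sum>n=1..N. u n) <= C + \<epsilon> * real N"
 shows "(\<lambda>N. average N u) \<longlonglongrightarrow> 0"
proof (rule tendstoI)
 fix e :: real assume "e > 0"
 then obtain C where C: "\<forall>\<^sub>F N in sequentially. norm (\<Sum>n=1..N. u n) <= C + e/2 * real N"
  using assms[of "e/2"] by auto
 have "\<forall>\<^sub>F N::nat in sequentially. real N > 2 * \<bar>C\<bar> / e + 1"
  by (rule eventually_sequentiallyI[of "nat \<lceil>2 * \<bar>C\<bar> / e + 1\<rceil> + 1"]) linarith
 with C show "\<forall>\<^sub>F N in sequentially. dist (average N u) 0 < e"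
 proof eventually_elim
  case (elim N)
  have "2 * \<bar>C\<bar> / e >= 0" using \<open>e > 0\<close> by simp
  hence N: "real N > 0" using elim by linarith
  have "2 * \<bar>C\<bar> < e * real N" using elim(2) \<open>e > 0\<close> by (simp add: field_simps)
  hence "norm (\<Sum>n=1..N. u n) < e * real N" using elim(1) by linarith
  thus ?case using N by (simp add: average_def norm_divide field_simps)
 qed
qed

lemma average_tendsto_zero_of_null:
 assumes "u \<longlonglongrightarrow> 0" shows "(\<lambda>N. average N u) \<longlonglongrightarrow> 0"
proof (rule average_tendsto_zeroI)
 fix \<epsilon> :: real assume "\<epsilon> > 0"
 then obtain n0 where n0: "\<And>n. n >= n0 ==> norm (u n) < \<epsilon>"
  using assms by (auto simp: LIMSEQ_iff)
 have "norm (\<Sum>n=1..N. u n) <= (\<Sum>n\<in>{..n0}. norm (u n)) + \<epsilon> * real N" for N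
 proof -
  have "norm (\<Sum>n=1..N. u n) <= (\<Sum>n=1..N. (if n <= n0 then norm (u n) else 0) + \<epsilon>)"
   by (rule sum_norm_le) (use n0 \<open>\<epsilon> > 0\<close> in \<open>auto simp: less_imp_le\<close>)
  also have "... = (\<Sum>n\<in>{1..N} \<inter> {..n0}. norm (u n)) + \<epsilon> * real N"
   by (simp add: sum.distrib sum.If_cases atMost_def)
  also have "(\<Sum>n\<in>{1..N} \<inter> {..n0}. norm (u n)) <= (\<Sum>n\<in>{..n0}. norm (u n))"
   by (rule sum_mono2) auto
  finally show ?thesis by simp
 qed
 thus "\<exists>C. \<forall>\<^sub>F N in sequentially. norm (\<Sum>n=1..N. u n) <= C + \<epsilon> * real N"
  by (intro exI always_eventually allI)
qed

lemma average_tendsto_of_tendsto: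
 assumes "u \<longlonglongrightarrow> L" shows "(\<lambda>N. average N u) \<longlonglongrightarrow> L"
proof -
 have "(\<lambda>n. u n - L) \<longlonglongrightarrow> 0" using assms by (simp add: LIM_zero)
 from tendsto_add[OF average_tendsto_zero_of_null[OF this] average_const_tendsto[of L]]
 show ?thesis by (simp add: average_diff)
qed

lemma sum_shift_nat:
 fixes u :: "nat => complex"
 assumes "\<And>n. norm (u n) <= C"
 shows "norm ((\<Sum>n=1..N. u (n + k)) - (\<Sum>n=1..N. u n)) <= 2 * C * real k"
proof (induction k)
 case (Suc k)
 have *: "(\<Sum>n=1..N. u (n + Suc k)) = (\<Sum>n=1..N. u (n + k)) + u (Suc N + k) - u (1 + k)"
  by (induction N) (auto simp: algebra_simps)
 have "(\<Sum>n=1..N. u (n + Suc k)) - (\<Sum>n=1..N. u n)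
   = ((\<Sum>n=1..N. u (n + k)) - (\<Sum>n=1..N. u n)) + (u (Suc N + k) - u (1 + k))"
  unfolding * by simp
 also have "norm ... <= 2 * C * real k + (C + C)"
  by (intro norm_triangle_mono Suc norm_triangle_le_diff add_mono assms)
 finally show ?case by (simp add: algebra_simps)
qed auto

lemma average_shift:
 assumes "\<And>n. norm (u n) <= C"
 shows "(\<lambda>N. average N (\<lambda>n. u (n + k)) - average N u) \<longlonglongrightarrow> 0"
 unfolding average_diff[symmetric]
proof (rule average_tendsto_zeroI)
 fix \<epsilon> :: real assume "\<epsilon> > 0"
 have "norm (\<Sum>n=1..N. u (n + k) - u n) <= 2 * C * real k + \<epsilon> * real N" for N
  using sum_shift_nat[OF assms, where N=N and k=k] \<open>\<epsilon> > 0\<close>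
  unfolding sum_subtractf by (intro add_increasing2) auto
 thus "\<exists>D. \<forall>\<^sub>F N in sequentially. norm (\<Sum>n=1..N. u (n + k) - u n) <= D + \<epsilon> * real N"
  by (intro exI always_eventually allI)
qed

text \<open>
  Shifting an average changes it by a null sequence, so its limit points \<open>z\<close> satisfy
  \<open>z = w z\<close>. For \<open>u n = e(f n)\<close> the hypothesis says that the first
  difference of \<open>f\<close> has a limit that is not an integer.
\<close>

lemma average_tendsto_zero_of_ratio:
 assumes bd: "\<And>n. norm (u n) <= C" and lim: "(\<lambda>n. u (Suc n) - w * u n) \<longlonglongrightarrow> 0" and "w \<noteq> 1"
 shows "(\<lambda>N. average N u) \<longlonglongrightarrow> 0"
proof -
 have "(\<lambda>N. average N (\<lambda>n. u (n+1) - w * u n)) \<longlonglongrightarrow> 0"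
  using average_tendsto_zero_of_null[OF lim] by simp
 from tendsto_diff[OF this average_shift[of u C 1, OF bd]]
 have "(\<lambda>N. (1 - w) * average N u) \<longlonglongrightarrow> 0"
  by (simp add: average_diff average_cmult algebra_simps)
 from tendsto_mult_left[OF this, of "1/(1-w)"] \<open>w \<noteq> 1\<close> show ?thesis by simp
qed

lemma average_tendsto_zero_shifted:
 assumes "\<And>n. norm (u n) <= C" "(\<lambda>N. average N u) \<longlonglongrightarrow> 0"
 shows "(\<lambda>N. average N (\<lambda>n. u (n + k))) \<longlonglongrightarrow> 0"
 using tendsto_add[OF average_shift[of u C k, OF assms(1)] assms(2)] by simp

text \<open>
  Up to an error of order \<open>H / N\<close> the average of \<open>u\<close> is the average of
  the block means \<open>(u(n+1) + ... + u(n+H)) / H\<close>. Cauchy-Schwarz and expanding the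
  square leave the correlations \<open>u(n+h) cnj (u(n+k))\<close>.
\<close>

lemma van_der_Corput_finite:
 fixes u :: "nat => complex"
 assumes bd: "\<And>n. norm (u n) <= 1" and "H >= 1" "N >= 1"
 shows "real H * norm (average N u)
  <= sqrt (\<Sum>h<H. \<Sum>k<H. norm (average N (\<lambda>n. u (n + h) * cnj (u (n + k))))) + 2 * real H * real H / real N"
proof -
 define v where "v n = (\<Sum>h<H. u (n + h))" for n
 have 1: "norm (of_nat H * (\<Sum>n=1..N. u n) - (\<Sum>n=1..N. v n)) <= 2 * real H * real H"
 proof -
  have "of_nat H * (\<Sum>n=1..N. u n) - (\<Sum>n=1..N. v n) = (\<Sum>h<H. (\<Sum>n=1..N. u n) - (\<Sum>n=1..N. u (n + h)))"
  proof -
   have "(\<Sum>n=1..N. v n) = (\<Sum>h<H. \<Sum>n=1..N. u (n + h))" unfolding v_def by (rule sum.swap)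
   thus ?thesis by (simp add: sum_subtractf)
  qed
  also have "norm ... <= (\<Sum>h<H. 2 * real H)"
  proof (rule sum_norm_le)
   fix h assume "h \<in> {..<H}"
   thus "norm ((\<Sum>n=1..N. u n) - (\<Sum>n=1..N. u (n + h))) <= 2 * real H"
    using sum_shift_nat[of u 1, OF bd, where N=N and k=h] by (simp add: norm_minus_commute)
  qed
  finally show ?thesis by simp
 qed
 have "(norm (\<Sum>n=1..N. v n))\<^sup>2 <= (\<Sum>n=1..N. norm (v n))\<^sup>2"
  by (intro power_mono norm_sum) auto
 also have "... <= (\<Sum>n=1..N. (norm (v n))\<^sup>2) * real N"
  using sum_squared_le_sum_of_squares[of "\<lambda>n. norm (v n)" "{1..N}"] by simp
 finally have 2: "(norm (\<Sum>n=1..N. v n) / real N)\<^sup>2 <= (\<Sum>n=1..N. (norm (v n))\<^sup>2) / real N"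
  using \<open>N >= 1\<close> by (simp add: power_divide field_simps power2_eq_square)
 have "complex_of_real ((\<Sum>n=1..N. (norm (v n))\<^sup>2) / real N) = average N (\<lambda>n. v n * cnj (v n))"
  by (simp only: average_def of_real_divide of_real_sum complex_norm_square of_real_of_nat_eq)
 also have "... = (\<Sum>h<H. \<Sum>k<H. average N (\<lambda>n. u (n + h) * cnj (u (n + k))))"
  by (simp add: v_def cnj_sum sum_product average_sum)
 finally have "norm (complex_of_real ((\<Sum>n=1..N. (norm (v n))\<^sup>2) / real N)) \<le>
   (\<Sum>h<H. \<Sum>k<H. norm (average N (\<lambda>n. u (n + h) * cnj (u (n + k)))))"
  using order.trans[OF norm_sum sum_mono[OF norm_sum]] by simp
 hence "(\<Sum>n=1..N. (norm (v n))\<^sup>2) / real N \<le>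
   (\<Sum>h<H. \<Sum>k<H. norm (average N (\<lambda>n. u (n + h) * cnj (u (n + k)))))"
  unfolding norm_of_real by linarith
 with 2 have 3: "norm (\<Sum>n=1..N. v n) / real N \<le>
   sqrt (\<Sum>h<H. \<Sum>k<H. norm (average N (\<lambda>n. u (n + h) * cnj (u (n + k)))))"
  by (intro real_le_rsqrt) linarith
 have "real H * norm (\<Sum>n=1..N. u n) <= norm (\<Sum>n=1..N. v n) + 2 * real H * real H"
  using norm_triangle_sub[of "of_nat H * (\<Sum>n=1..N. u n)" "\<Sum>n=1..N. v n"] 1
  by (simp add: norm_mult)
 hence "real H * norm (\<Sum>n=1..N. u n) / real N <= norm (\<Sum>n=1..N. v n) / real N + 2 * real H * real H / real N"
  unfolding add_divide_distrib[symmetric] by (intro divide_right_mono) auto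
 thus ?thesis using 3 by (simp add: average_def norm_divide)
qed

text \<open>
  Among the \<open>H^2\<close> pairs \<open>(h, k)\<close> only the \<open>H\<close> diagonal ones
  do not vanish in the limit, which leaves \<open>1/H\<close>.
\<close>

theorem van_der_Corput:
 fixes u :: "nat => complex"
 assumes bd: "\<And>n. norm (u n) <= 1"
  and corr: "\<And>h. h >= 1 ==> (\<lambda>N. average N (\<lambda>n. u (n + h) * cnj (u n))) \<longlonglongrightarrow> 0"
 shows "(\<lambda>N. average N u) \<longlonglongrightarrow> 0"
proof (rule tendstoI)
 have bd2: "norm (u i * cnj (u j)) <= 1" for i j
  using mult_mono[OF bd[of i] bd[of j]] by (simp add: norm_mult)
 have less: "(\<lambda>N. average N (\<lambda>n. u (n + h) * cnj (u (n + k)))) \<longlonglongrightarrow> 0" if "k < h" for h k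
  using average_tendsto_zero_shifted[of "\<lambda>n. u (n + (h-k)) * cnj (u n)" 1 k] bd2 corr[of "h-k"] that by simp
 have neq: "(\<lambda>N. average N (\<lambda>n. u (n + h) * cnj (u (n + k)))) \<longlonglongrightarrow> 0" if "k \<noteq> h" for h k
 proof (cases "k < h")
  case False
  hence "h < k" using that by simp
  from tendsto_cnj[OF less[OF this]] show ?thesis by (simp add: cnj_average mult.commute)
 qed (use less in auto)
 fix e :: real assume e: "e > 0"
 obtain H0 :: nat where H0: "real H0 > 8 / (e * e)" using reals_Archimedean2 by blast
 define H where "H = Suc H0"
 have "8 < real H0 * (e * e)" using H0 e by (simp add: pos_divide_less_eq)
 also have "... <= real H * (e * e)" using e by (intro mult_right_mono) (auto simp: H_def)
 finally have H: "H >= 1" "real H * (e * e) > 8" by (simp_all add: H_def)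
 have "(\<lambda>N. \<Sum>h<H. \<Sum>k<H. if h = k then 0 else norm (average N (\<lambda>n. u (n + h) * cnj (u (n + k)))))
   \<longlonglongrightarrow> (\<Sum>h<H. \<Sum>k<H. 0)"
 proof (intro tendsto_sum)
  fix h k
  show "(\<lambda>N. if h = k then 0 else norm (average N (\<lambda>n. u (n + h) * cnj (u (n + k))))) \<longlonglongrightarrow> 0"
  proof (cases "h = k")
   case False
   hence "(\<lambda>N. norm (average N (\<lambda>n. u (n + h) * cnj (u (n + k))))) \<longlonglongrightarrow> 0"
    by (intro tendsto_norm_zero neq) simp
   thus ?thesis using False by simp
  qed simp
 qed
 hence "\<forall>\<^sub>F N in sequentially. (\<Sum>h<H. \<Sum>k<H. if h = k then 0 else norm (average N (\<lambda>n. u (n + h) * cnj (u (n + k))))) < 1"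
 proof (rule order_tendstoD(2))
  show "(\<Sum>h<H. \<Sum>k<H. 0) < (1::real)" by simp
 qed
 moreover have "\<forall>\<^sub>F N in sequentially. 2 * real H * real H / real N < e / 2 * real H"
  by (rule order_tendstoD(2)[OF lim_const_over_n]) (use e H in auto)
 ultimately show "\<forall>\<^sub>F N in sequentially. dist (average N u) 0 < e"
  using eventually_ge_at_top[of 1]
 proof eventually_elim
  case (elim N)
  have "(\<Sum>h<H. \<Sum>k<H. norm (average N (\<lambda>n. u (n + h) * cnj (u (n + k))))) \<le>
    (\<Sum>h<H. \<Sum>k<H. (if h = k then 1 else 0) + (if h = k then 0 else norm (average N (\<lambda>n. u (n + h) * cnj (u (n + k))))))"
   by (intro sum_mono) (auto intro!: norm_average_le bd2)
  also have "... <= real H + 1" using elim(1) by (simp add: sum.distrib)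
  also have "... <= (e / 2 * real H)\<^sup>2"
  proof -
   have "8 * real H <= (real H * (e*e)) * real H"
    using H by (intro mult_right_mono) auto
   have "1 <= real H" using H(1) by simp
   hence "4 * (real H + 1) <= 8 * real H" by simp
   also note \<open>8 * real H <= (real H * (e*e)) * real H\<close>
   also have "(real H * (e*e)) * real H = 4 * (e / 2 * real H)\<^sup>2" by (simp add: power2_eq_square)
   finally show ?thesis by (rule mult_left_le_imp_le) simp
  qed
  finally have "sqrt (\<Sum>h<H. \<Sum>k<H. norm (average N (\<lambda>n. u (n + h) * cnj (u (n + k))))) <= e / 2 * real H"
   using e by (intro real_le_lsqrt) (auto intro!: sum_nonneg)
  hence "real H * norm (average N u) < real H * e"
   using van_der_Corput_finite[of u H N, OF bd H(1) elim(3)] elim(2) by (simp add: mult.commute)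
  thus ?case using H by simp
 qed
qed

section \<open>Exponential sums with small differences\<close>

text \<open>
  With \<open>Z = 1 / (1 - e(\<theta>))\<close> each term is
  \<open>(e(g n) - e(g (n+1))) Z n\<close>. Summation by parts applies, and the variation of
  \<open>Z\<close> telescopes because \<open>\<theta>\<close> is monotone.
\<close>

lemma Kusmin_Landau:
 fixes g :: "nat => real"
 assumes rng: "\<And>n. A <= n ==> n < B ==> lam <= g (Suc n) - g n \<and> g (Suc n) - g n <= 1/2"
  and dec: "\<And>n. A <= n ==> Suc n < B ==> g (Suc (Suc n)) - g (Suc n) <= g (Suc n) - g n"
  and lam: "lam > 0"
 shows "norm (\<Sum>n\<in>{A..<B}. ee (g n)) <= 3 / lam"
proof (cases "A < B")
 case True
 define \<theta> where "\<theta> n = g (Suc n) - g n" for n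
 define Z where "Z n = 1 / (1 - ee (\<theta> n))" for n
 have th: "lam <= \<theta> n" "\<theta> n <= 1/2" if "A <= n" "n < B" for n using rng[OF that] by (auto simp: \<theta>_def)
 have ge: "norm (1 - ee (\<theta> n)) >= 2 * \<theta> n" if "A <= n" "n < B" for n
  using norm_one_minus_ee_ge[of "\<theta> n"] th[OF that] lam by auto
 have nz: "1 - ee (\<theta> n) \<noteq> 0" if "A <= n" "n < B" for n
 proof
  assume "1 - ee (\<theta> n) = 0"
  hence "norm (1 - ee (\<theta> n)) = 0" by simp
  thus False using ge[OF that] th[OF that] lam by linarith
 qed
 have nz': "ee (\<theta> n) \<noteq> 1" if "A <= n" "n < B" for n using nz[OF that] by auto
 have ZZ: "ee (g n) = (ee (g n) - ee (g (Suc n))) * Z n" if "A <= n" "n < B" for n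
 proof -
  have "ee (g (Suc n)) = ee (g n) * ee (\<theta> n)" by (simp add: \<theta>_def ee_add[symmetric])
  hence "ee (g n) - ee (g (Suc n)) = ee (g n) * (1 - ee (\<theta> n))" by (simp add: algebra_simps)
  thus ?thesis using nz[OF that] by (simp add: Z_def)
 qed
 have Zb: "norm (Z n) <= 1 / (2 * lam)" if "A <= n" "n < B" for n
  using ge[OF that] th[OF that] lam unfolding Z_def norm_divide norm_one
  by (intro divide_left_mono) (auto simp: nz'[OF that])
 have diff: "norm (Z (Suc n) - Z n) <= 2 * (1 / \<theta> (Suc n) - 1 / \<theta> n)" if "A <= n" "Suc n < B" for n
 proof -
  have n: "A <= n" "n < B" "A <= Suc n" using that by auto
  have p: "\<theta> n > 0" "\<theta> (Suc n) > 0" using th(1)[of n] th(1)[of "Suc n"] n that lam by auto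
  have "Z (Suc n) - Z n = (ee (\<theta> (Suc n)) - ee (\<theta> n)) / ((1 - ee (\<theta> (Suc n))) * (1 - ee (\<theta> n)))"
   using nz[of n] nz[of "Suc n"] n that unfolding Z_def by (simp add: diff_frac_eq)
  hence "norm (Z (Suc n) - Z n) = norm (ee (\<theta> (Suc n)) - ee (\<theta> n)) / (norm (1 - ee (\<theta> (Suc n))) * norm (1 - ee (\<theta> n)))"
   by (simp add: norm_divide norm_mult)
  also have "... <= (2 * pi * \<bar>\<theta> (Suc n) - \<theta> n\<bar>) / ((2 * \<theta> (Suc n)) * (2 * \<theta> n))"
   by (intro frac_le norm_ee_diff_le mult_mono ge) (use p n that in auto)
  also have "... = (pi / 2) * ((\<theta> n - \<theta> (Suc n)) / (\<theta> (Suc n) * \<theta> n))"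
  proof -
   have "\<theta> (Suc n) <= \<theta> n" using dec[of n] that by (simp add: \<theta>_def)
   thus ?thesis by simp
  qed
  also have "(\<theta> n - \<theta> (Suc n)) / (\<theta> (Suc n) * \<theta> n) = 1 / \<theta> (Suc n) - 1 / \<theta> n"
   using p by (simp add: diff_frac_eq)
  also have "(pi/2) * ... <= 2 * ..."
   using pi_half_less_two dec[of n] that p by (intro mult_right_mono) (auto simp: \<theta>_def intro!: divide_left_mono)
  finally show ?thesis .
 qed
 have abel: "(\<Sum>n=A..<A + Suc k. ee (g n)) = ee (g A) * Z A - ee (g (A + Suc k)) * Z (A + k)
   + (\<Sum>n=A..<A+k. ee (g (Suc n)) * (Z (Suc n) - Z n))" if "A + k < B" for k
  using that
 proof (induction k)
  case 0 thus ?case using ZZ[of A] by (simp add: algebra_simps)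
 next
  case (Suc k)
  have "(\<Sum>n=A..<A + Suc (Suc k). ee (g n)) = (\<Sum>n=A..<A + Suc k. ee (g n)) + ee (g (A + Suc k))" by simp
  also have "... = (ee (g A) * Z A - ee (g (A + Suc k)) * Z (A + k)
   + (\<Sum>n=A..<A+k. ee (g (Suc n)) * (Z (Suc n) - Z n)))
   + (ee (g (A + Suc k)) - ee (g (A + Suc (Suc k)))) * Z (A + Suc k)"
   using Suc.IH ZZ[of "A + Suc k"] Suc.prems by (intro arg_cong2[of _ _ _ _ "(+)"]) simp_all
  finally show ?case by (simp add: algebra_simps del: sum_subtractf)
 qed
 have tele: "(\<Sum>n=A..<A+k. 2 * (1 / \<theta> (Suc n) - 1 / \<theta> n)) = 2 * (1 / \<theta> (A+k) - 1 / \<theta> A)" for k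
  by (induction k) auto
 obtain k where k: "B = A + Suc k" using True by (metis add_Suc_right less_iff_Suc_add)
 have "norm (\<Sum>n\<in>{A..<B}. ee (g n)) <= norm (ee (g A) * Z A) + norm (ee (g (A + Suc k)) * Z (A + k))
   + norm (\<Sum>n=A..<A+k. ee (g (Suc n)) * (Z (Suc n) - Z n))"
  using abel[of k] k by (simp only: lessI add_less_cancel_left) (intro norm_triangle_mono norm_triangle_ineq4 order_refl)
 also have "norm (\<Sum>n=A..<A+k. ee (g (Suc n)) * (Z (Suc n) - Z n)) <= (\<Sum>n=A..<A+k. 2 * (1 / \<theta> (Suc n) - 1 / \<theta> n))"
  by (rule sum_norm_le) (use diff k in \<open>auto simp: norm_mult\<close>)
 also have "... <= 2 * (1 / lam - 0)"
 proof -
  have "1 / \<theta> (A+k) <= 1 / lam" using th[of "A+k"] k lam by (intro divide_left_mono) auto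
  moreover have "1 / \<theta> A >= 0" using th[of A] k lam by simp
  ultimately show ?thesis unfolding tele by (intro mult_left_mono diff_mono) auto
 qed
 also have "norm (ee (g A) * Z A) + norm (ee (g (A + Suc k)) * Z (A + k)) + 2 * (1 / lam - 0) \<le>
   1 / (2*lam) + 1 / (2*lam) + 2 * (1 / lam - 0)"
  using Zb[of A] Zb[of "A + k"] k by (simp add: norm_mult)
 finally show ?thesis using lam by (simp add: field_simps)
qed (use lam in auto)

text \<open>
  If \<open>\<theta>\<close> decreases to zero, the Kusmin-Landau bound for the sum up to
  \<open>N\<close> is a multiple of \<open>1 / \<theta> N\<close>, which is \<open>o(N)\<close>
  exactly when \<open>N \<theta> N\<close> tends to infinity.
\<close>

theorem first_difference_test:
 fixes f :: "nat => real"
 defines "\<theta> \<equiv> \<lambda>n. f (Suc n) - f n"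
 assumes dec: "\<forall>\<^sub>F n in sequentially. \<theta> (Suc n) <= \<theta> n"
  and lim: "\<theta> \<longlonglongrightarrow> 0"
  and big: "filterlim (\<lambda>n. real n * \<theta> n) at_top sequentially"
 shows "(\<lambda>N. average N (\<lambda>n. ee (f n))) \<longlonglongrightarrow> 0"
proof (rule average_tendsto_zeroI)
 fix \<epsilon> :: real assume e: "\<epsilon> > 0"
 have "\<forall>\<^sub>F n in sequentially. \<theta> n < 1/2" by (rule order_tendstoD(2)[OF lim]) simp
 moreover have "\<forall>\<^sub>F n in sequentially. real n * \<theta> n >= 6 / \<epsilon>" using big by (simp add: filterlim_at_top)
 ultimately have "\<forall>\<^sub>F n in sequentially. \<theta> n < 1/2 \<and> real n * \<theta> n >= 6 / \<epsilon> \<and> \<theta> (Suc n) <= \<theta> n \<and> n >= 1"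
  using dec eventually_ge_at_top[of 1] by eventually_elim auto
 then obtain A where A: "\<And>n. n >= A ==> \<theta> n < 1/2 \<and> real n * \<theta> n >= 6 / \<epsilon> \<and> \<theta> (Suc n) <= \<theta> n \<and> n >= 1"
  by (auto simp: eventually_sequentially)
 have A1: "A >= 1" using A[of A] by simp
 have mono: "\<theta> m <= \<theta> n" if "A <= n" "n <= m" for m n
  using that(2)
 proof (induction m rule: dec_induct)
  case (step k)
  have "\<theta> (Suc k) <= \<theta> k" using A[of k] step(1) that(1) by auto
  thus ?case using step by linarith
 qed simp
 have "norm (\<Sum>n=1..N. ee (f n)) <= real A + \<epsilon> * real N" if "N > A" for N
 proof -
  have pos: "0 < \<theta> N"
  proof -
   have "0 < 6 / \<epsilon>" using e by simp
   also have "... <= real N * \<theta> N" using A[of N] that by auto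
   finally show ?thesis using that by (simp add: zero_less_mult_iff)
  qed
  have "norm (\<Sum>n\<in>{A..<Suc N}. ee (f n)) <= norm (\<Sum>n\<in>{A..<N}. ee (f n)) + 1"
   using that norm_triangle_ineq[of "\<Sum>n\<in>{A..<N}. ee (f n)" "ee (f N)"] by simp
  also have "norm (\<Sum>n\<in>{A..<N}. ee (f n)) <= 3 / \<theta> N"
  proof (rule Kusmin_Landau)
   fix n assume n: "A <= n" "n < N"
   show "\<theta> N <= f (Suc n) - f n \<and> f (Suc n) - f n <= 1/2"
    using A[OF n(1)] mono[of n N] n by (auto simp: \<theta>_def)
  next
   fix n assume n: "A <= n" "Suc n < N"
   show "f (Suc (Suc n)) - f (Suc n) <= f (Suc n) - f n"
    using A[of n] n by (auto simp: \<theta>_def)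
  qed (rule pos)
  also have "3 / \<theta> N + 1 <= \<epsilon> * real N"
  proof -
   have "6 <= \<epsilon> * real N * \<theta> N" using A[of N] that e by (simp add: field_simps)
   hence "6 / \<theta> N <= \<epsilon> * real N" using pos by (simp add: pos_divide_le_eq)
   moreover have "3 / \<theta> N >= 1" using pos A[of N] that by (simp add: pos_le_divide_eq)
   ultimately show ?thesis by linarith
  qed
  finally have 1: "norm (\<Sum>n\<in>{A..<Suc N}. ee (f n)) <= \<epsilon> * real N" by simp
  have "{1..N} = {1..<A} \<union> {A..<Suc N}" using that A1 by auto
  hence "(\<Sum>n=1..N. ee (f n)) = (\<Sum>n=1..<A. ee (f n)) + (\<Sum>n=A..<Suc N. ee (f n))"
   by (simp only:) (rule sum.union_disjoint, auto)
  also have "norm ... <= real A + \<epsilon> * real N"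
   by (intro norm_triangle_mono 1) (rule order.trans[OF norm_sum], simp)
  finally show ?thesis .
 qed
 thus "\<exists>C. \<forall>\<^sub>F N in sequentially. norm (\<Sum>n=1..N. ee (f n)) <= C + \<epsilon> * real N"
  by (intro exI[of _ "real A"] eventually_mono[OF eventually_gt_at_top[of A]])
qed

text \<open>
  The off-diagonal terms are grouped by the difference \<open>h\<close> of the indices.
\<close>

lemma sum_mult_cnj_expand:
 fixes v :: "nat => complex"
 shows "(\<Sum>n=1..M. v n) * cnj (\<Sum>n=1..M. v n) = (\<Sum>n=1..M. v n * cnj (v n))
  + (\<Sum>h=1..M. (\<Sum>n=1..M-h. v (n + h) * cnj (v n)) + cnj (\<Sum>n=1..M-h. v (n + h) * cnj (v n)))"
proof (induction M)
 case (Suc M)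
 define G where "G h n = v (n + h) * cnj (v n)" for h n
 have "(\<Sum>h=1..Suc M. (\<Sum>n=1..Suc M-h. G h n)) = (\<Sum>h=1..M. (\<Sum>n=1..Suc (M-h). G h n))"
  by (simp add: Suc_diff_le)
 also have "... = (\<Sum>h=1..M. (\<Sum>n=1..M-h. G h n)) + (\<Sum>h=1..M. G h (Suc (M - h)))"
  by (simp add: sum.distrib)
 also have "(\<Sum>h=1..M. G h (Suc (M - h))) = (\<Sum>n=1..M. v (Suc M) * cnj (v n))"
  by (rule sum.reindex_bij_witness[where i="\<lambda>n. Suc M - n" and j="\<lambda>h. Suc M - h"])
    (auto simp: G_def Suc_diff_le)
 also have "... = v (Suc M) * cnj (\<Sum>n=1..M. v n)" by (simp add: sum_distrib_left)
 finally have *: "(\<Sum>h=1..Suc M. (\<Sum>n=1..Suc M-h. G h n)) = (\<Sum>h=1..M. (\<Sum>n=1..M-h. G h n)) + v (Suc M) * cnj (\<Sum>n=1..M. v n)" .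
 have **: "(\<Sum>h=1..K. X h + cnj (X h)) = (\<Sum>h=1..K. X h) + cnj (\<Sum>h=1..K. X h)" for K and X :: "nat => complex"
  by (simp add: sum.distrib)
 show ?case using Suc.IH unfolding ** G_def[symmetric] *
  by (simp add: algebra_simps)
qed auto

lemma norm_sum_square_le:
 fixes v :: "nat => complex"
 assumes "\<And>n. norm (v n) <= 1"
 shows "(norm (\<Sum>n=1..M. v n))\<^sup>2 <= real M + 2 * (\<Sum>h=1..M. norm (\<Sum>n=1..M-h. v (n + h) * cnj (v n)))"
proof -
 have "complex_of_real ((norm (\<Sum>n=1..M. v n))\<^sup>2) = (\<Sum>n=1..M. v n) * cnj (\<Sum>n=1..M. v n)"
  by (rule complex_norm_square)
 hence "(norm (\<Sum>n=1..M. v n))\<^sup>2 = norm ((\<Sum>n=1..M. v n) * cnj (\<Sum>n=1..M. v n))"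
  by (metis abs_of_nonneg norm_of_real zero_le_power2)
 also have "... <= (\<Sum>n=1..M. 1) + (\<Sum>h=1..M. norm (\<Sum>n=1..M-h. v (n + h) * cnj (v n)) + norm (\<Sum>n=1..M-h. v (n + h) * cnj (v n)))"
  unfolding sum_mult_cnj_expand
 proof (rule norm_triangle_mono; rule sum_norm_le)
  fix n show "norm (v n * cnj (v n)) <= 1" using mult_mono[OF assms[of n] assms[of n]] by (simp add: norm_mult)
 next
  fix h show "norm ((\<Sum>n=1..M-h. v (n + h) * cnj (v n)) + cnj (\<Sum>n=1..M-h. v (n + h) * cnj (v n))) \<le>
   norm (\<Sum>n=1..M-h. v (n + h) * cnj (v n)) + norm (\<Sum>n=1..M-h. v (n + h) * cnj (v n))"
   using norm_triangle_ineq[of "\<Sum>n=1..M-h. v (n + h) * cnj (v n)" "cnj (\<Sum>n=1..M-h. v (n + h) * cnj (v n))"]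
   by (simp only: complex_mod_cnj)
 qed
 also have "... = real M + 2 * (\<Sum>h=1..M. norm (\<Sum>n=1..M-h. v (n + h) * cnj (v n)))"
  unfolding mult_2[symmetric] sum_distrib_left[symmetric] by simp
 finally show ?thesis .
qed

text \<open>
  It is enough to control the blocks \<open>(M, M + M div m]\<close>: from an initial segment one
  passes to a segment longer by the factor \<open>1 + 1/m\<close>, so the block estimates add up
  like a geometric series.
\<close>

lemma average_tendsto_zero_blocks:
 fixes u :: "nat => complex"
 assumes bd: "\<And>n. norm (u n) <= 1" and "m >= 1"
  and blk: "\<And>\<epsilon>. \<epsilon> > 0 ==> \<exists>N0. \<forall>N\<ge>N0. norm (\<Sum>k=1..N div m. u (N + k)) <= \<epsilon> * real (N div m)"
 shows "(\<lambda>N. average N u) \<longlonglongrightarrow> 0"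
proof (rule average_tendsto_zeroI)
 fix e :: real assume e: "e > 0"
 then obtain N0 where N0: "\<And>N. N >= N0 ==> norm (\<Sum>k=1..N div m. u (N + k)) <= e/2 * real (N div m)"
  using blk[of "e/2"] by auto
 define q where "q = Suc (nat \<lceil>2 / e\<rceil>)"
 have q: "1 <= e/2 * real q" "q >= 1"
 proof -
  have "2 / e <= real q" unfolding q_def by linarith
  thus "1 <= e/2 * real q" using e by (simp add: field_simps)
 qed (simp add: q_def)
 define N1 where "N1 = max N0 (m * q)"
 have N1q: "M div m >= q" if "M >= N1" for M
  using that div_le_mono[of "m*q" M m] \<open>m >= 1\<close> by (auto simp: N1_def)
 define g where "g M = M + M div m" for M
 have g_Suc: "g (Suc M) <= g M + 2" for M by (simp add: g_def div_Suc)
 have g_ge: "M <= g M" for M by (simp add: g_def)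
 have "norm (\<Sum>n=1..N. u n) <= real (g N1) + e * real N" for N
 proof (induction N rule: less_induct)
  case (less N)
  show ?case
  proof (cases "N < g N1")
   case True
   have "norm (\<Sum>n=1..N. u n) <= (\<Sum>n=1..N. 1)" by (rule sum_norm_le) (use bd in auto)
   thus ?thesis using True e by (intro add_increasing2) auto
  next
   case False
   \<comment> \<open>the last block that ends before \<open>N\<close>; as \<open>g\<close> grows by at most 2, at most one term is left over\<close>
   define M where "M = (GREATEST M. g M <= N)"
   have b: "M <= N" if "g M <= N" for M using g_ge[of M] that by linarith
   have "g M <= N" unfolding M_def using False by (intro GreatestI_nat[of "\<lambda>M. g M <= N" N1 N]) (auto dest: b)
   have MN1: "M >= N1" unfolding M_def using False by (intro Greatest_le_nat[of "\<lambda>M. g M <= N" N1 N]) (auto dest: b)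
   have "\<not> g (Suc M) <= N"
   proof
    assume "g (Suc M) <= N"
    hence "Suc M <= M" unfolding M_def by (rule Greatest_le_nat[of "\<lambda>M. g M <= N"]) (rule b)
    thus False by simp
   qed
   hence N: "N = g M \<or> N = Suc (g M)" using g_Suc[of M] \<open>g M <= N\<close> by linarith
   have dm: "M div m >= q" "M div m >= 1" using N1q[OF MN1] q(2) by auto
   have "M < N" using dm \<open>g M <= N\<close> by (auto simp: g_def)
   have gsum: "(\<Sum>n=1..g M. u n) = (\<Sum>n=1..M. u n) + (\<Sum>k=1..M div m. u (M + k))"
   proof -
    have "{1..g M} = {1..M} \<union> {M+1..M+M div m}" by (auto simp: g_def)
    hence "(\<Sum>n=1..g M. u n) = (\<Sum>n=1..M. u n) + (\<Sum>n=M+1..M+M div m. u n)"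
     by (simp only:) (rule sum.union_disjoint, auto)
    also have "(\<Sum>n=M+1..M+M div m. u n) = (\<Sum>k=1..M div m. u (M + k))"
     by (rule sum.reindex_bij_witness[where i="\<lambda>k. M + k" and j="\<lambda>n. n - M"]) auto
    finally show ?thesis .
   qed
   have "norm (\<Sum>n=1..N. u n) <= norm (\<Sum>n=1..g M. u n) + 1"
    using N bd[of "Suc (g M)"] norm_triangle_ineq[of "\<Sum>n=1..g M. u n" "u (Suc (g M))"] by auto
   also have "norm (\<Sum>n=1..g M. u n) <= (real (g N1) + e * real M) + e/2 * real (M div m)"
    unfolding gsum by (intro norm_triangle_mono less.IH \<open>M < N\<close> N0) (use MN1 N1_def in auto)
   also have "1 <= e/2 * real (M div m)"
    using q(1) dm(1) e by (smt (verit) mult_left_mono of_nat_mono half_gt_zero)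
   finally have "norm (\<Sum>n=1..N. u n) <= real (g N1) + e * real (M + M div m)"
    by (simp add: algebra_simps)
   also have "e * real (M + M div m) <= e * real N" using e \<open>g M <= N\<close> by (simp add: g_def)
   finally show ?thesis by simp
  qed
 qed
 thus "\<exists>C. \<forall>\<^sub>F N in sequentially. norm (\<Sum>n=1..N. u n) <= C + e * real N"
  by (intro exI always_eventually allI)
qed

lemma sum_inverse_sqrt_le: "(\<Sum>h=1..M. 1 / sqrt (real h)) <= 2 * sqrt (real M)"
proof (induction M)
 case (Suc M)
 have "1 / sqrt (real (Suc M)) <= 2 * (sqrt (real (Suc M)) - sqrt (real M))"
 proof -
  have a: "sqrt (real M) <= sqrt (real (Suc M))" "sqrt (real (Suc M)) > 0" by auto
  have "(sqrt (real (Suc M)) - sqrt (real M)) * (sqrt (real (Suc M)) + sqrt (real M)) = 1"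
   by (simp add: algebra_simps flip: power2_eq_square)
  moreover have "(sqrt (real (Suc M)) - sqrt (real M)) * (sqrt (real (Suc M)) + sqrt (real M))
   <= (sqrt (real (Suc M)) - sqrt (real M)) * (2 * sqrt (real (Suc M)))"
   using a by (intro mult_left_mono) auto
  ultimately have "1 <= (2 * (sqrt (real (Suc M)) - sqrt (real M))) * sqrt (real (Suc M))"
   by (simp only: mult.assoc mult.left_commute)
  thus ?thesis using a by (simp only: pos_divide_le_eq)
 qed
 thus ?case using Suc by simp
qed auto

text \<open>
  This covers slopes that grow to infinity as slowly as a logarithm, where van der Corput's
  inequality with a fixed number of shifts loses too much. On a block of length
  \<open>M = N div m\<close> the square of the sum is expanded into correlations with shift
  \<open>h\<close>; their phases have differences between a multiple of \<open>h / N^2\<close> and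
  \<open>1/2\<close>, so that Kusmin-Landau applies to each of them. The divisor \<open>m\<close>
  makes the block short enough for the upper bound.
\<close>

theorem second_difference_test:
 fixes f :: "nat => real"
 defines "s \<equiv> \<lambda>n. f (n + 2) - 2 * f (n + 1) + f n"
 assumes dec: "\<forall>\<^sub>F n in sequentially. s (Suc n) <= s n"
  and upper: "\<forall>\<^sub>F n in sequentially. real n * s n <= C"
  and lower: "filterlim (\<lambda>n. (real n)\<^sup>2 * s n) at_top sequentially"
 shows "(\<lambda>N. average N (\<lambda>n. ee (f n))) \<longlonglongrightarrow> 0"
proof -
 define m where "m = Suc (nat \<lceil>2 * \<bar>C\<bar>\<rceil>)"
 have "2 * \<bar>C\<bar> <= real (nat \<lceil>2 * \<bar>C\<bar>\<rceil>)" by linarith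
 hence "2 * \<bar>C\<bar> <= real m" unfolding m_def of_nat_Suc by linarith
 hence m: "m >= 1" "C <= real m / 2" by (simp_all add: m_def)
 show ?thesis
 proof (rule average_tendsto_zero_blocks[OF _ m(1)])
  fix \<epsilon> :: real assume e: "\<epsilon> > 0"
  \<comment> \<open>chosen such that \<open>48 m^2 / K\<close>, which comes out of the Kusmin-Landau bound, is \<open>(\<epsilon>^2 / 8)^2\<close>\<close>
  define K where "K = (8 / \<epsilon>\<^sup>2)\<^sup>2 * (48 * (real m)\<^sup>2)"
  have K: "K > 0" using e m by (simp add: K_def)
  have "\<forall>\<^sub>F n in sequentially. s (Suc n) <= s n \<and> real n * s n <= C \<and> (real n)\<^sup>2 * s n >= K"
   using dec upper lower unfolding filterlim_at_top by (intro eventually_conj) blast+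
  then obtain n0 where n0: "\<And>n. n >= n0 ==> s (Suc n) <= s n \<and> real n * s n <= C \<and> (real n)\<^sup>2 * s n >= K"
   by (auto simp: eventually_sequentially)
  define q where "q = Suc (nat \<lceil>2 / \<epsilon>\<^sup>2\<rceil>)"
  have q: "q >= 1" "2 / \<epsilon>\<^sup>2 <= real q" unfolding q_def by linarith+
  define N0 where "N0 = max (Suc n0) (m * q)"
  have mono: "s k <= s n" if "n0 <= n" "n <= k" for k n
   using that(2)
  proof (induction k rule: dec_induct)
   case (step j)
   have "s (Suc j) <= s j" using n0[of j] step(1) that(1) by auto
   thus ?case using step by linarith
  qed simp
  have "norm (\<Sum>k=1..N div m. ee (f (N + k))) <= \<epsilon> * real (N div m)" if N: "N >= N0" for N
  proof -
   define M where "M = N div m"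
   have Nn0: "N > n0" using N by (simp add: N0_def)
   have Mq: "M >= q" using N div_le_mono[of "m*q" N m] m(1) by (simp add: M_def N0_def)
   have M1: "M >= 1" using Mq q by simp
   have MN: "m * M <= N" "N < m * M + m" unfolding M_def
    using mult_div_mod_eq[of m N] mod_less_divisor[of m N] m(1) by linarith+
   have MN': "M <= N" using MN m(1) by (metis le_trans mult_le_mono1 nat_mult_1)
   have N2: "real N <= 2 * real m * real M"
   proof -
    have "m <= m * M" using M1 by simp
    hence "N <= 2 * m * M" using MN(2) by linarith
    thus ?thesis by (metis of_nat_le_iff of_nat_mult of_nat_numeral)
   qed
   define v where "v k = ee (f (N + k))" for k
   have inner: "norm (\<Sum>n=1..M-h. v (n + h) * cnj (v n)) <= real M * sqrt (48 * (real m)\<^sup>2 / K) * (sqrt (real M) * (1 / sqrt (real h)))"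
    if h: "h \<in> {1..M}" for h
   proof -
    define g where "g n = f (N + n + h) - f (N + n)" for n
    have gd: "g (Suc n) - g n = (\<Sum>i<h. s (N + n + i))" for n
    proof -
     have "(\<Sum>i<h. s (N + n + i)) = (f (Suc (N + n + h)) - f (N + n + h)) - (f (Suc (N + n)) - f (N + n))" for h
      by (induction h) (simp_all add: s_def)
     thus ?thesis by (simp add: g_def)
    qed
    have s_lo: "K / (4 * (real N)\<^sup>2) <= s k" if "k >= N" "k <= 2 * N" for k
    proof -
     have kp: "real k > 0" using that Nn0 by simp
     have "K / (4 * (real N)\<^sup>2) <= K / (real k)\<^sup>2"
     proof (rule divide_left_mono)
      have "(real k)\<^sup>2 <= (2 * real N)\<^sup>2" using that by (intro power_mono) auto
      thus "(real k)\<^sup>2 <= 4 * (real N)\<^sup>2" by (simp add: power_mult_distrib)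
     qed (use K kp Nn0 in auto)
     also have "... <= s k" using n0[of k] kp Nn0 that by (simp add: pos_divide_le_eq mult.commute)
     finally show ?thesis .
    qed
    have s_hi: "s k <= real m / 2 / real N" if "k >= N" for k
    proof -
     have "s k <= s N" using mono[of N k] that Nn0 by simp
     also have "real N * s N <= real m / 2" using n0[of N] Nn0 m(2) by auto
     hence "s N <= real m / 2 / real N" using Nn0 by (subst pos_le_divide_eq) (auto simp: mult.commute)
     finally show ?thesis .
    qed
    define lam where "lam = real h * (K / (4 * (real N)\<^sup>2))"
    have lam: "lam > 0" using K h Nn0 by (simp add: lam_def)
    have "(\<Sum>n=1..M-h. v (n + h) * cnj (v n)) = (\<Sum>n\<in>{1..<Suc (M-h)}. ee (g n))"
     by (rule sum.cong) (auto simp: v_def g_def ee_diff add.assoc)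
    also have "norm ... <= 3 / lam"
    proof (rule Kusmin_Landau)
     fix n assume n: "1 <= n" "n < Suc (M - h)"
     have rng: "N + n + i >= N" "N + n + i <= 2 * N" if "i < h" for i using n that h MN' by auto
     have "lam <= (\<Sum>i<h. s (N + n + i))"
      unfolding lam_def using sum_mono[of "{..<h}" "\<lambda>_. K / (4 * (real N)\<^sup>2)" "\<lambda>i. s (N + n + i)"] s_lo rng by auto
     moreover have "(\<Sum>i<h. s (N + n + i)) <= 1 / 2"
     proof -
      have "(\<Sum>i<h. s (N + n + i)) <= (\<Sum>i<h. real m / 2 / real N)" by (intro sum_mono s_hi rng) auto
      also have "... = real h * real m / (2 * real N)" by simp
      also have "... <= 1/2"
      proof -
       have "h * m <= N" using h MN(1) by (metis atLeastAtMost_iff le_trans mult.commute mult_le_mono1)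
       hence "real h * real m <= real N" by (metis of_nat_le_iff of_nat_mult)
       thus ?thesis using Nn0 by (simp add: field_simps)
      qed
      finally show ?thesis .
     qed
     ultimately show "lam <= g (Suc n) - g n \<and> g (Suc n) - g n <= 1/2" unfolding gd by simp
    next
     fix n assume "1 <= n" "Suc n < Suc (M - h)"
     show "g (Suc (Suc n)) - g (Suc n) <= g (Suc n) - g n" unfolding gd
      by (rule sum_mono) (use n0 Nn0 in auto)
    qed (rule lam)
    also have "3 / lam = 12 * (real N)\<^sup>2 / (K * real h)"
     using K h Nn0 by (simp add: lam_def field_simps)
    also have "... <= 12 * (2 * real m * real M)\<^sup>2 / (K * real h)"
     using K h N2 by (intro divide_right_mono mult_left_mono power_mono) auto
    also have "... = (real M)\<^sup>2 * (48 * (real m)\<^sup>2 / K) / real h"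
     by (simp add: power_mult_distrib)
    finally have b1: "norm (\<Sum>n=1..M-h. v (n + h) * cnj (v n)) <= (real M)\<^sup>2 * (48 * (real m)\<^sup>2 / K) / real h" .
    have "norm (\<Sum>n=1..M-h. v (n + h) * cnj (v n)) <= (\<Sum>n=1..M-h. 1)"
     by (rule sum_norm_le) (simp add: v_def norm_mult)
    also have "... <= real M" by simp
    finally have b2: "norm (\<Sum>n=1..M-h. v (n + h) * cnj (v n)) <= real M" .
    \<comment> \<open>the geometric mean of the trivial bound and the Kusmin-Landau bound avoids the harmonic sum\<close>
    have "(norm (\<Sum>n=1..M-h. v (n + h) * cnj (v n)))\<^sup>2 <= ((real M)\<^sup>2 * (48 * (real m)\<^sup>2 / K) / real h) * real M"
     unfolding power2_eq_square[of "norm _"] by (intro mult_mono b1 b2) (use K in auto)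
    also have "... = (real M * sqrt (48 * (real m)\<^sup>2 / K) * (sqrt (real M) * (1 / sqrt (real h))))\<^sup>2"
     using K h by (simp add: power_mult_distrib power_divide)
    finally show ?thesis by (rule power2_le_imp_le) (use K in auto)
   qed
   have "(norm (\<Sum>k=1..M. v k))\<^sup>2 <= real M + 2 * (\<Sum>h=1..M. norm (\<Sum>n=1..M-h. v (n + h) * cnj (v n)))"
    by (rule norm_sum_square_le) (simp add: v_def)
   also have "(\<Sum>h=1..M. norm (\<Sum>n=1..M-h. v (n + h) * cnj (v n))) \<le>
     (\<Sum>h=1..M. real M * sqrt (48 * (real m)\<^sup>2 / K) * (sqrt (real M) * (1 / sqrt (real h))))"
    by (rule sum_mono) (rule inner)
   also have "... = real M * sqrt (48 * (real m)\<^sup>2 / K) * sqrt (real M) * (\<Sum>h=1..M. 1 / sqrt (real h))"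
    by (simp add: sum_distrib_left mult.assoc)
   also have "... <= real M * sqrt (48 * (real m)\<^sup>2 / K) * sqrt (real M) * (2 * sqrt (real M))"
    by (intro mult_left_mono sum_inverse_sqrt_le) (use K in auto)
   also have "... = 2 * (real M)\<^sup>2 * sqrt (48 * (real m)\<^sup>2 / K)"
    by (simp add: power2_eq_square)
   also have "sqrt (48 * (real m)\<^sup>2 / K) = \<epsilon>\<^sup>2 / 8"
   proof -
    have "48 * (real m)\<^sup>2 / K = (\<epsilon>\<^sup>2 / 8)\<^sup>2" using e m by (simp add: K_def power_divide)
    thus ?thesis by simp
   qed
   finally have fin: "(norm (\<Sum>k=1..M. v k))\<^sup>2 <= real M + \<epsilon>\<^sup>2 / 2 * (real M)\<^sup>2" by simp
   have "real M <= \<epsilon>\<^sup>2 / 2 * (real M)\<^sup>2"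
   proof -
    have "2 / \<epsilon>\<^sup>2 <= real M" using q(2) Mq by linarith
    hence "1 <= \<epsilon>\<^sup>2 / 2 * real M" using e by (simp add: field_simps)
    hence "1 * real M <= (\<epsilon>\<^sup>2 / 2 * real M) * real M" by (intro mult_right_mono) auto
    thus ?thesis by (simp add: power2_eq_square)
   qed
   with fin have "(norm (\<Sum>k=1..M. v k))\<^sup>2 <= \<epsilon>\<^sup>2 / 2 * (real M)\<^sup>2 + \<epsilon>\<^sup>2 / 2 * (real M)\<^sup>2" by linarith
   also have "... = (\<epsilon> * real M)\<^sup>2" by (simp add: power_mult_distrib)
   finally have "norm (\<Sum>k=1..M. v k) <= \<epsilon> * real M" by (rule power2_le_imp_le) (use e in auto)
   thus ?thesis by (simp add: v_def M_def)
  qed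
  thus "\<exists>N0. \<forall>N\<ge>N0. norm (\<Sum>k=1..N div m. ee (f (N + k))) <= \<epsilon> * real (N div m)" by blast
 qed simp
qed

text \<open>Finite Fourier inversion.\<close>

lemma periodic_expand:
 fixes u :: "nat => complex"
 assumes "Q > 0" and per: "\<And>n. u (n + Q) = u n"
 shows "u n = (\<Sum>j<Q. (\<Sum>r<Q. u r * ee (- real j * real r / real Q)) / of_nat Q * ee (real j * real n / real Q))"
proof -
 have per': "u (n + k * Q) = u n" for n k
  by (induction k) (use per[of "n + _ * Q"] in \<open>auto simp: algebra_simps\<close>)
 have un: "u n = u (n mod Q)" using per'[of "n mod Q" "n div Q"] by (simp add: mod_mult_div_eq mult.commute)
 have geo: "(\<Sum>j<Q. ee (- real j * real r / real Q) * ee (real j * real n / real Q)) = (if r = n mod Q then of_nat Q else 0)"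
  if "r < Q" for r
 proof -
  define w where "w = ee ((real n - real r) / real Q)"
  have "(\<Sum>j<Q. ee (- real j * real r / real Q) * ee (real j * real n / real Q)) = (\<Sum>j<Q. w ^ j)"
   unfolding w_def ee_mult_of_nat[symmetric] ee_add[symmetric]
   by (intro sum.cong refl arg_cong[of _ _ ee]) (use assms(1) in \<open>simp add: field_simps\<close>)
  also have "... = (if r = n mod Q then of_nat Q else 0)"
  proof (cases "r = n mod Q")
   case True
   have "real n = real Q * real (n div Q) + real (n mod Q)"
    by (metis mult_div_mod_eq of_nat_add of_nat_mult)
   hence "(real n - real r) / real Q = of_nat (n div Q)" using assms(1) True by (simp add: field_simps)
   hence "w = 1" unfolding w_def by (simp only: ee_of_nat)
   thus ?thesis using True by simp
  next
   case False
   have "w ^ Q = ee (real n - real r)" unfolding w_def ee_mult_of_nat[symmetric] using assms(1) by simp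
   also have "... = 1" using ee_of_int[of "int n - int r"] by simp
   finally have "w ^ Q = 1" .
   moreover have "w \<noteq> 1"
   proof
    assume "w = 1"
    then obtain k :: int where k: "(real n - real r) / real Q = of_int k"
     unfolding w_def ee_eq_1_iff by (auto elim: Ints_cases)
    hence "real n - real r = of_int k * real Q" using assms(1) by (simp add: field_simps)
    hence "of_int (int n - int r) = (of_int (k * int Q) :: real)" by simp
    hence "int n - int r = k * int Q" by (simp only: of_int_eq_iff)
    hence "int n = int r + k * int Q" by simp
    hence "int n mod int Q = int r" using that by simp
    hence "int (n mod Q) = int r" by (simp add: zmod_int)
    thus False using False by simp
   qed
   ultimately show ?thesis using False sum_gp_strict[of w Q] by simp
  qed
  finally show ?thesis .
 qed
 have "(\<Sum>j<Q. (\<Sum>r<Q. u r * ee (- real j * real r / real Q)) / of_nat Q * ee (real j * real n / real Q))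
   = (\<Sum>j<Q. \<Sum>r<Q. u r / of_nat Q * (ee (- real j * real r / real Q) * ee (real j * real n / real Q)))"
  by (simp add: sum_divide_distrib sum_distrib_right mult.assoc)
 also have "... = (\<Sum>r<Q. u r / of_nat Q * (\<Sum>j<Q. ee (- real j * real r / real Q) * ee (real j * real n / real Q)))"
  by (subst sum.swap) (simp add: sum_distrib_left)
 also have "... = (\<Sum>r<Q. if r = n mod Q then u r else 0)"
  by (intro sum.cong refl) (use geo assms(1) in auto)
 also have "... = u (n mod Q)" using assms(1) by simp
 finally show ?thesis using un by simp
qed

section \<open>Real combinations of functions in a Hardy field\<close>

definition lin_comb :: "(real \<times> (real => real)) list => real => real" where
 "lin_comb xs x = (\<Sum>p\<leftarrow>xs. fst p * snd p x)"

text \<open>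
  A Hardy field need not contain the real constants, so it need not contain the combinations
  \<open>c_i a_i - c_j a_j\<close>. They lie in its real span, which inherits the properties that
  matter: eventual constancy of sign and, consequently, the existence of limits.
\<close>

definition real_span :: "(real => real) set => (real => real) set" where
 "real_span H = {f. \<exists>xs. (\<forall>p\<in>set xs. snd p \<in> H) \<and> (\<forall>\<^sub>F x in at_top. f x = lin_comb xs x)}"

definition sign_definite :: "(real => real) => bool" where
 "sign_definite f \<longleftrightarrow> (\<forall>\<^sub>F x in at_top. f x > 0) \<or> (\<forall>\<^sub>F x in at_top. f x = 0) \<or> (\<forall>\<^sub>F x in at_top. f x < 0)"

lemma lin_comb_Nil [simp]: "lin_comb [] x = 0"
 and lin_comb_Cons [simp]: "lin_comb (p # xs) x = fst p * snd p x + lin_comb xs x"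
 and lin_comb_append [simp]: "lin_comb (xs @ ys) x = lin_comb xs x + lin_comb ys x"
 by (simp_all add: lin_comb_def)

lemma sign_definite_cong:
 assumes "sign_definite f" "\<forall>\<^sub>F x in at_top. f x = g x" shows "sign_definite g"
proof -
 have *: "(\<forall>\<^sub>F x in at_top. P (g x)) \<longleftrightarrow> (\<forall>\<^sub>F x in at_top. P (f x))" for P
  by (rule eventually_cong[OF eventually_mono[OF assms(2)]]) auto
 show ?thesis
  using assms(1) *[of "\<lambda>y. y > 0"] *[of "\<lambda>y. y = 0"] *[of "\<lambda>y. y < 0"] by (simp add: sign_definite_def)
qed

lemma sign_definite_posI: "(\<And>x. x > c ==> f x > 0) ==> sign_definite f"
 unfolding sign_definite_def by (rule disjI1, rule eventually_mono[OF eventually_gt_at_top[of c]])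

lemma sign_definite_negI: "(\<And>x. x > c ==> f x < 0) ==> sign_definite f"
 unfolding sign_definite_def by (rule disjI2, rule disjI2, rule eventually_mono[OF eventually_gt_at_top[of c]])

text \<open>By the intermediate value theorem.\<close>

lemma eventually_nonzero_sign_definite:
 fixes f :: "real => real"
 assumes "\<forall>\<^sub>F x in at_top. f x \<noteq> 0" "\<forall>\<^sub>F x in at_top. isCont f x"
 shows "sign_definite f"
proof -
 obtain b where b: "\<And>x. x >= b ==> f x \<noteq> 0 \<and> isCont f x"
  using eventually_conj[OF assms] by (auto simp: eventually_at_top_linorder)
 have con: "connected (f ` {b..})"
  by (intro connected_continuous_image connected_Ici continuous_at_imp_continuous_on) (use b in auto)
 have no0: "0 \<notin> f ` {b..}" using b by auto
 show ?thesis
 proof (cases "f b > 0")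
  case True
  have "f x > 0" if "x >= b" for x
  proof (rule ccontr)
   assume "\<not> f x > 0"
   hence "0 \<in> f ` {b..}" using connectedD_interval[OF con, of "f x" "f b" 0] True that by auto
   thus False using no0 by simp
  qed
  thus ?thesis by (intro sign_definite_posI[of b]) simp
 next
  case False
  have "f x < 0" if "x >= b" for x
  proof (rule ccontr)
   assume "\<not> f x < 0"
   hence "0 \<in> f ` {b..}" using connectedD_interval[OF con, of "f b" "f x" 0] False that by auto
   thus False using no0 by simp
  qed
  thus ?thesis by (intro sign_definite_negI[of b]) simp
 qed
qed

lemma sign_definite_uminus: "sign_definite f ==> sign_definite (\<lambda>x. - f x)"
 by (auto simp: sign_definite_def)

lemma filterlim_add_const_at_top: "filterlim (\<lambda>x::real. x + c) at_top at_top"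
 using filterlim_tendsto_add_at_top[OF tendsto_const[of c] filterlim_ident] by (simp add: add.commute)

lemma eq_of_zero_derivative:
 fixes f :: "real => real"
 assumes d: "\<And>x. x >= b ==> (f has_real_derivative 0) (at x)" and "x > b"
 shows "f x = f b"
proof (rule DERIV_isconst_end[OF assms(2)])
 show "continuous_on {b..x} f" by (intro continuous_at_imp_continuous_on ballI DERIV_isCont[OF d]) auto
qed (use d in auto)

text \<open>A function whose derivative has a constant sign is eventually monotone.\<close>

lemma sign_definite_of_derivative:
 fixes f :: "real => real"
 assumes "\<forall>\<^sub>F x in at_top. (f has_real_derivative g x) (at x)" "sign_definite g"
 shows "sign_definite f"
proof -
 have pos: "sign_definite f" if d: "\<forall>\<^sub>F x in at_top. (f has_real_derivative g x) (at x)"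
  and p: "\<forall>\<^sub>F x in at_top. g x > 0" for f g :: "real => real"
 proof -
  obtain b where b: "\<And>x. x >= b ==> (f has_real_derivative g x) (at x) \<and> g x > 0"
   using eventually_conj[OF d p] by (auto simp: eventually_at_top_linorder)
  have inc: "f x < f y" if "b <= x" "x < y" for x y
   by (rule DERIV_pos_imp_increasing[OF that(2)]) (use b that in \<open>meson order.trans\<close>)
  show ?thesis
  proof (cases "\<exists>x\<ge>b. f x >= 0")
   case True
   then obtain c where c: "c >= b" "f c >= 0" by auto
   have "f x > 0" if "x > c" for x using inc[OF c(1) that] c by simp
   thus ?thesis by (intro sign_definite_posI[of c])
  next
   case False
   hence "f x < 0" if "x > b" for x using that by (meson less_imp_le not_le)
   thus ?thesis by (rule sign_definite_negI)
  qed
 qed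
 from assms(2) consider "\<forall>\<^sub>F x in at_top. g x > 0" | "\<forall>\<^sub>F x in at_top. g x = 0" | "\<forall>\<^sub>F x in at_top. g x < 0"
  unfolding sign_definite_def by blast
 thus ?thesis
 proof cases
  case 1 thus ?thesis using pos[OF assms(1)] by blast
 next
  case 2
  obtain b where b: "\<And>x. x >= b ==> (f has_real_derivative g x) (at x) \<and> g x = 0"
   using eventually_conj[OF assms(1) 2] by (auto simp: eventually_at_top_linorder)
  have "f x = f b" if "x > b" for x
   by (rule eq_of_zero_derivative[OF _ that]) (use b in metis)
  hence ev: "\<forall>\<^sub>F x in at_top. f b = f x" by (intro eventually_mono[OF eventually_gt_at_top[of b]]) simp
  have "sign_definite (\<lambda>_. f b)" using less_linear[of 0 "f b"] by (auto simp: sign_definite_def)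
  thus ?thesis using ev by (rule sign_definite_cong)
 next
  case 3
  have "sign_definite (\<lambda>x. - f x)"
   by (rule pos[of _ "\<lambda>x. - g x"]) (use assms(1) 3 in \<open>auto elim!: eventually_mono intro!: DERIV_minus\<close>)
  thus ?thesis using sign_definite_uminus by force
 qed
qed

lemma sign_definite_mult:
 assumes "sign_definite f" "sign_definite g" shows "sign_definite (\<lambda>x. f x * g x)"
proof -
 have sgn: "sign_definite h \<longleftrightarrow> (\<exists>s. \<forall>\<^sub>F x in at_top. sgn (h x) = s)" for h :: "real => real"
 proof
  assume "sign_definite h"
  thus "\<exists>s. \<forall>\<^sub>F x in at_top. sgn (h x) = s" unfolding sign_definite_def
  proof (elim disjE)
   assume "\<forall>\<^sub>F x in at_top. h x > 0" thus ?thesis by (intro exI[of _ 1]) (auto elim: eventually_mono)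
  next
   assume "\<forall>\<^sub>F x in at_top. h x = 0" thus ?thesis by (intro exI[of _ 0]) (auto elim: eventually_mono)
  next
   assume "\<forall>\<^sub>F x in at_top. h x < 0" thus ?thesis by (intro exI[of _ "-1"]) (auto elim: eventually_mono)
  qed
 next
  assume "\<exists>s. \<forall>\<^sub>F x in at_top. sgn (h x) = s"
  then obtain s where s: "\<forall>\<^sub>F x in at_top. sgn (h x) = s" by blast
  consider "s > 0" | "s = 0" | "s < 0" by linarith
  thus "sign_definite h"
  proof cases
   case 1
   have "\<forall>\<^sub>F x in at_top. h x > 0" by (rule eventually_mono[OF s]) (use 1 in \<open>auto simp: sgn_real_def split: if_splits\<close>)
   thus ?thesis by (simp add: sign_definite_def)
  next
   case 2
   have "\<forall>\<^sub>F x in at_top. h x = 0" by (rule eventually_mono[OF s]) (use 2 in \<open>auto simp: sgn_real_def split: if_splits\<close>)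
   thus ?thesis by (simp add: sign_definite_def)
  next
   case 3
   have "\<forall>\<^sub>F x in at_top. h x < 0" by (rule eventually_mono[OF s]) (use 3 in \<open>auto simp: sgn_real_def split: if_splits\<close>)
   thus ?thesis by (simp add: sign_definite_def)
  qed
 qed
 obtain s t where "\<forall>\<^sub>F x in at_top. sgn (f x) = s" "\<forall>\<^sub>F x in at_top. sgn (g x) = t"
  using assms unfolding sgn by blast
 hence "\<forall>\<^sub>F x in at_top. sgn (f x * g x) = s * t" by eventually_elim (simp add: sgn_mult)
 thus ?thesis unfolding sgn by blast
qed

locale hardy =
 fixes H :: "(real => real) set"
 assumes hardy: "hardy_field H"
begin

lemma germ: "f \<in> H ==> (\<forall>\<^sub>F x in at_top. f x = g x) ==> g \<in> H"
 using hardy unfolding hardy_field_def germ_set_def by blast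
lemma one_in: "(\<lambda>_. 1) \<in> H"
 and add_in: "f \<in> H ==> g \<in> H ==> (\<lambda>x. f x + g x) \<in> H"
 and minus_in: "f \<in> H ==> (\<lambda>x. - f x) \<in> H"
 and mult_in: "f \<in> H ==> g \<in> H ==> (\<lambda>x. f x * g x) \<in> H"
 and inverse_in: "f \<in> H ==> \<not> (\<forall>\<^sub>F x in at_top. f x = 0) ==> \<exists>g\<in>H. \<forall>\<^sub>F x in at_top. f x * g x = 1"
 and deriv_in: "f \<in> H ==> \<exists>g\<in>H. \<forall>\<^sub>F x in at_top. (f has_real_derivative g x) (at x)"
 using hardy unfolding hardy_field_def by blast+

text \<open>
  A nonzero element has an inverse and therefore no zeros near infinity; being differentiable, it
  is continuous.
\<close>

lemma sign_definite_H: assumes "f \<in> H" shows "sign_definite f"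
proof (cases "\<forall>\<^sub>F x in at_top. f x = 0")
 case False
 then obtain g where "\<forall>\<^sub>F x in at_top. f x * g x = 1" using inverse_in[OF assms] by blast
 hence nz: "\<forall>\<^sub>F x in at_top. f x \<noteq> 0" by (auto elim: eventually_mono)
 obtain g where "\<forall>\<^sub>F x in at_top. (f has_real_derivative g x) (at x)" using deriv_in[OF assms] by blast
 hence "\<forall>\<^sub>F x in at_top. isCont f x" by (rule eventually_mono) (rule DERIV_isCont)
 with nz show ?thesis by (rule eventually_nonzero_sign_definite)
qed (simp add: sign_definite_def)

lemma lin_comb_derivative:
 assumes "\<forall>p\<in>set xs. snd p \<in> H"
 shows "\<exists>ys. length ys = length xs \<and> (\<forall>p\<in>set ys. snd p \<in> H) \<and>
  (\<forall>\<^sub>F x in at_top. (lin_comb xs has_real_derivative lin_comb ys x) (at x))"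
 using assms
proof (induction xs)
 case (Cons p xs)
 then obtain ys where ys: "length ys = length xs" "\<forall>p\<in>set ys. snd p \<in> H"
  "\<forall>\<^sub>F x in at_top. (lin_comb xs has_real_derivative lin_comb ys x) (at x)" by auto
 obtain g where g: "g \<in> H" "\<forall>\<^sub>F x in at_top. (snd p has_real_derivative g x) (at x)"
  using deriv_in[of "snd p"] Cons.prems by auto
 have "\<forall>\<^sub>F x in at_top. (lin_comb (p # xs) has_real_derivative lin_comb ((fst p, g) # ys) x) (at x)"
  using ys(3) g(2)
 proof eventually_elim
  case (elim x)
  show ?case unfolding lin_comb_Cons fst_conv snd_conv by (intro DERIV_add DERIV_cmult elim)
 qed
 thus ?case using ys g by (intro exI[of _ "(fst p, g) # ys"]) (auto simp del: lin_comb_Cons)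
next
 case Nil
 have "lin_comb [] = (\<lambda>_. 0)" by auto
 thus ?case by (intro exI[of _ "[]"]) auto
qed

text \<open>
  The argument of Rolle: dividing by one of the functions and differentiating turns its term into
  zero and leaves a combination of fewer functions.
\<close>

lemma sign_definite_lin_comb:
 "\<forall>p\<in>set xs. snd p \<in> H ==> sign_definite (lin_comb xs)"
proof (induction "length xs" arbitrary: xs)
 case 0 thus ?case by (simp add: sign_definite_def)
next
 case (Suc n)
 then obtain c f ys where xs: "xs = (c, f) # ys" "length ys = n" by (cases xs) auto
 have f: "f \<in> H" and ys: "\<forall>p\<in>set ys. snd p \<in> H" using Suc.prems xs by auto
 show ?case
 proof (cases "\<forall>\<^sub>F x in at_top. f x = 0")
  case True
  have "sign_definite (lin_comb ys)" using Suc.hyps(1)[of ys] xs ys by simp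
  moreover have "\<forall>\<^sub>F x in at_top. lin_comb ys x = lin_comb xs x"
   using True by eventually_elim (simp add: xs)
  ultimately show ?thesis by (rule sign_definite_cong)
 next
  case False
  then obtain g where g: "g \<in> H" "\<forall>\<^sub>F x in at_top. f x * g x = 1" using inverse_in[OF f] by blast
  define zs where "zs = map (\<lambda>p. (fst p, \<lambda>x. snd p x * g x)) ys"
  have zs: "\<forall>p\<in>set zs. snd p \<in> H" using ys g by (auto simp: zs_def intro: mult_in)
  have zsx: "lin_comb zs x = lin_comb ys x * g x" for x
   unfolding zs_def by (induction ys) (auto simp: algebra_simps)
  obtain ws where ws: "length ws = length zs" "\<forall>p\<in>set ws. snd p \<in> H"
   "\<forall>\<^sub>F x in at_top. (lin_comb zs has_real_derivative lin_comb ws x) (at x)"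
   using lin_comb_derivative[OF zs] by blast
  have "sign_definite (lin_comb ws)" using Suc.hyps(1)[of ws] ws xs by (simp add: zs_def)
  moreover have "\<forall>\<^sub>F x in at_top. ((\<lambda>x. c + lin_comb zs x) has_real_derivative lin_comb ws x) (at x)"
   using ws(3) by eventually_elim (auto intro!: derivative_eq_intros)
  ultimately have "sign_definite (\<lambda>x. c + lin_comb zs x)" by (rule sign_definite_of_derivative[rotated])
  hence "sign_definite (\<lambda>x. f x * (c + lin_comb zs x))" by (rule sign_definite_mult[OF sign_definite_H[OF f]])
  moreover have "\<forall>\<^sub>F x in at_top. f x * (c + lin_comb zs x) = lin_comb xs x"
   using g(2)
  proof eventually_elim
   case (elim x)
   have "f x * (c + lin_comb zs x) = c * f x + (f x * g x) * lin_comb ys x"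
    by (simp add: zsx algebra_simps)
   thus ?case unfolding elim by (simp add: xs)
  qed
  ultimately show ?thesis by (rule sign_definite_cong)
 qed
qed

lemma sign_definite_span: assumes "f \<in> real_span H" shows "sign_definite f"
proof -
 obtain xs where xs: "\<forall>p\<in>set xs. snd p \<in> H" "\<forall>\<^sub>F x in at_top. f x = lin_comb xs x"
  using assms unfolding real_span_def by blast
 show ?thesis by (rule sign_definite_cong[OF sign_definite_lin_comb[OF xs(1)]]) (use xs(2) in \<open>auto elim: eventually_mono\<close>)
qed

lemma span_base: "f \<in> H ==> f \<in> real_span H"
 unfolding real_span_def by (auto intro!: exI[of _ "[(1, f)]"])
lemma span_add: assumes "f \<in> real_span H" "g \<in> real_span H" shows "(\<lambda>x. f x + g x) \<in> real_span H"
proof -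
 obtain xs ys where *: "\<forall>p\<in>set xs. snd p \<in> H" "\<forall>\<^sub>F x in at_top. f x = lin_comb xs x"
  "\<forall>p\<in>set ys. snd p \<in> H" "\<forall>\<^sub>F x in at_top. g x = lin_comb ys x"
  using assms unfolding real_span_def by blast
 have "\<forall>\<^sub>F x in at_top. f x + g x = lin_comb (xs @ ys) x" using *(2,4) by eventually_elim simp
 thus ?thesis unfolding real_span_def using * by (intro CollectI exI[of _ "xs @ ys"]) auto
qed
lemma span_mult_H: assumes "f \<in> real_span H" "g \<in> H" shows "(\<lambda>x. g x * f x) \<in> real_span H"
proof -
 obtain xs where *: "\<forall>p\<in>set xs. snd p \<in> H" "\<forall>\<^sub>F x in at_top. f x = lin_comb xs x"
  using assms unfolding real_span_def by blast
 have eq: "g x * lin_comb xs x = lin_comb (map (\<lambda>p. (fst p, \<lambda>x. g x * snd p x)) xs) x" for x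
  by (induction xs) (auto simp: algebra_simps)
 have "\<forall>\<^sub>F x in at_top. g x * f x = lin_comb (map (\<lambda>p. (fst p, \<lambda>x. g x * snd p x)) xs) x"
  using *(2) by eventually_elim (simp add: eq)
 thus ?thesis unfolding real_span_def using * assms(2)
  by (intro CollectI exI[of _ "map (\<lambda>p. (fst p, \<lambda>x. g x * snd p x)) xs"]) (auto intro: mult_in)
qed
lemma span_cmult: assumes "f \<in> real_span H" shows "(\<lambda>x. c * f x) \<in> real_span H"
proof -
 obtain xs where *: "\<forall>p\<in>set xs. snd p \<in> H" "\<forall>\<^sub>F x in at_top. f x = lin_comb xs x"
  using assms unfolding real_span_def by blast
 have eq: "c * lin_comb xs x = lin_comb (map (\<lambda>p. (c * fst p, snd p)) xs) x" for x
  by (induction xs) (auto simp: algebra_simps)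
 have "\<forall>\<^sub>F x in at_top. c * f x = lin_comb (map (\<lambda>p. (c * fst p, snd p)) xs) x"
  using *(2) by eventually_elim (simp add: eq)
 thus ?thesis unfolding real_span_def using *
  by (intro CollectI exI[of _ "map (\<lambda>p. (c * fst p, snd p)) xs"]) auto
qed
lemma span_const: "(\<lambda>_. c) \<in> real_span H"
 using span_cmult[OF span_base[OF one_in], of c] by simp
lemma span_minus: "f \<in> real_span H ==> (\<lambda>x. - f x) \<in> real_span H"
 using span_cmult[of f "-1"] by simp
lemma span_diff: "f \<in> real_span H ==> g \<in> real_span H ==> (\<lambda>x. f x - g x) \<in> real_span H"
 using span_add[OF _ span_minus, of f g] by simp

lemma span_gt_or_le: assumes "f \<in> real_span H"
 shows "(\<forall>\<^sub>F x in at_top. f x > c) \<or> (\<forall>\<^sub>F x in at_top. f x <= c)"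
proof -
 from sign_definite_span[OF span_diff[OF assms span_const[of c]]]
 consider "\<forall>\<^sub>F x in at_top. f x - c > 0" | "\<forall>\<^sub>F x in at_top. f x - c = 0" | "\<forall>\<^sub>F x in at_top. f x - c < 0"
  unfolding sign_definite_def by blast
 thus ?thesis
 proof cases
  case 1 show ?thesis by (intro disjI1 eventually_mono[OF 1]) simp
 next
  case 2 show ?thesis by (intro disjI2 eventually_mono[OF 2]) simp
 next
  case 3 show ?thesis by (intro disjI2 eventually_mono[OF 3]) simp
 qed
qed

lemma span_ge_or_lt: assumes "f \<in> real_span H"
 shows "(\<forall>\<^sub>F x in at_top. f x >= c) \<or> (\<forall>\<^sub>F x in at_top. f x < c)"
 using sign_definite_span[OF span_diff[OF assms span_const[of c]]] unfolding sign_definite_def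
 by (elim disjE) (auto elim!: eventually_mono)

text \<open>
  The function is eventually on one side of every constant, so its limit is the supremum of the
  constants below it.
\<close>

lemma span_limit:
 assumes "f \<in> real_span H"
 shows "(\<exists>L. (f \<longlongrightarrow> L) at_top) \<or> filterlim f at_top at_top \<or> filterlim f at_bot at_top"
proof -
 define A where "A = {c. \<forall>\<^sub>F x in at_top. f x >= c}"
 consider "A = {}" | "A \<noteq> {}" "\<not> bdd_above A" | "A \<noteq> {}" "bdd_above A" by (cases "A = {}"; cases "bdd_above A") simp_all
 thus ?thesis
 proof cases
  case 1
  hence "\<forall>\<^sub>F x in at_top. f x < c" for c using span_ge_or_lt[OF assms, of c] by (auto simp: A_def)
  hence "filterlim f at_bot at_top" unfolding filterlim_at_bot by (meson eventually_mono less_imp_le)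
  thus ?thesis by blast
 next
  case 2
  have "\<forall>\<^sub>F x in at_top. f x >= c" for c
  proof -
   obtain d where "d \<in> A" "d > c" using 2 unfolding bdd_above_def by (meson not_le)
   hence "\<forall>\<^sub>F x in at_top. f x >= d" by (simp add: A_def)
   thus ?thesis by (rule eventually_mono) (use \<open>d > c\<close> in linarith)
  qed
  thus ?thesis unfolding filterlim_at_top by blast
 next
  case 3
  have "(f \<longlongrightarrow> Sup A) at_top"
  proof (rule order_tendstoI)
   fix a assume "a < Sup A"
   then obtain d where "d \<in> A" "a < d" using less_cSup_iff[OF 3] by blast
   hence "\<forall>\<^sub>F x in at_top. f x >= d" by (simp add: A_def)
   thus "\<forall>\<^sub>F x in at_top. a < f x" by (rule eventually_mono) (use \<open>a < d\<close> in linarith)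
  next
   fix a assume "Sup A < a"
   hence "a \<notin> A" using cSup_upper[OF _ 3(2), of a] by auto
   thus "\<forall>\<^sub>F x in at_top. f x < a" using span_ge_or_lt[OF assms, of a] by (auto simp: A_def)
  qed
  thus ?thesis by blast
 qed
qed

end

text \<open>
  A function that tends to infinity is eventually strictly increasing, so it has a compositional
  inverse in the field, and the identity is their composition.
\<close>

lemma (in hardy) identity_of_at_top:
 assumes comp: "closed_under_composition H" and inv: "closed_under_inversion H"
  and h: "h \<in> H" "filterlim h at_top at_top"
 shows "(\<lambda>x. x) \<in> H"
proof -
 obtain h' where h': "h' \<in> H" "\<forall>\<^sub>F x in at_top. (h has_real_derivative h' x) (at x)"
  using deriv_in[OF h(1)] by blast
 have "\<forall>\<^sub>F x in at_top. h' x > 0"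
 proof (rule ccontr)
  assume "\<not> ?thesis"
  hence "\<forall>\<^sub>F x in at_top. h' x <= 0" using span_gt_or_le[OF span_base[OF h'(1)], of 0] by blast
  from eventually_conj[OF h'(2) this]
  obtain b where b: "\<And>x. x >= b ==> (h has_real_derivative h' x) (at x) \<and> h' x <= 0"
   by (auto simp: eventually_at_top_linorder)
  have "h x <= h b" if "x >= b" for x
   by (rule DERIV_nonpos_imp_nonincreasing[OF that]) (use b in blast)
  moreover have "\<forall>\<^sub>F x in at_top. h x > h b" using h(2) filterlim_at_top_dense by blast
  ultimately have "\<forall>\<^sub>F x::real in at_top. False" using eventually_ge_at_top[of b]
  proof -
   assume le: "\<And>x. x >= b ==> h x <= h b" and gt: "\<forall>\<^sub>F x in at_top. h x > h b"
   show ?thesis using gt eventually_ge_at_top[of b] by eventually_elim (use le in force)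
  qed
  thus False by simp
 qed
 from eventually_conj[OF h'(2) this]
 obtain b where b: "\<And>x. x >= b ==> (h has_real_derivative h' x) (at x) \<and> h' x > 0"
  by (auto simp: eventually_at_top_linorder)
 have inc: "h x < h y" if "b <= x" "x < y" for x y
  by (rule DERIV_pos_imp_increasing[OF that(2)]) (use b that in \<open>meson order.trans\<close>)
 have ex: "\<exists>x\<ge>b. h x = y" if "y >= h b" for y
 proof -
  have "\<forall>\<^sub>F x in at_top. h x >= y" using h(2) filterlim_at_top by blast
  then obtain c where c: "c >= b" "h c >= y" unfolding eventually_at_top_linorder by (metis linorder_linear)
  have "\<exists>x. b <= x \<and> x <= c \<and> h x = y"
   by (rule IVT) (use c that b in \<open>auto dest!: DERIV_isCont\<close>)
  thus ?thesis by auto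
 qed
 define g where "g y = (SOME x. x >= b \<and> h x = y)" for y
 have g: "g y >= b \<and> h (g y) = y" if "y >= h b" for y
  unfolding g_def by (rule someI_ex) (use ex[OF that] in auto)
 have gh: "g (h x) = x" if "x >= b" for x
 proof -
  have "h x >= h b" using inc[of b x] that by (cases "x = b") auto
  from g[OF this] have "g (h x) >= b" "h (g (h x)) = h x" by auto
  thus ?thesis using inc[of x "g (h x)"] inc[of "g (h x)" x] that by (metis less_irrefl linorder_neqE)
 qed
 have "compositional_inverse h g"
  unfolding compositional_inverse_def
 proof (intro conjI h(2))
  show "filterlim g at_top at_top"
   unfolding filterlim_at_top
  proof
   fix Z
   show "\<forall>\<^sub>F y in at_top. g y >= Z"
    using eventually_ge_at_top[of "max (h b) (h (max Z b))"]
   proof eventually_elim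
    case (elim y)
    thus ?case using g[of y] inc[of "g y" "max Z b"] by (cases "g y < max Z b") auto
   qed
  qed
  show "\<forall>\<^sub>F x in at_top. h (g x) = x" using eventually_ge_at_top[of "h b"] by eventually_elim (use g in auto)
  show "\<forall>\<^sub>F x in at_top. g (h x) = x" using eventually_ge_at_top[of b] by eventually_elim (use gh in auto)
 qed
 hence "g \<in> H" "filterlim g at_top at_top"
  using inv h(1) unfolding closed_under_inversion_def by (blast, simp add: compositional_inverse_def)
 hence "h \<circ> g \<in> H" using comp h(1) unfolding closed_under_composition_def by blast
 thus ?thesis by (rule germ) (use eventually_ge_at_top[of "h b"] in \<open>eventually_elim, use g in auto\<close>)
qed

text \<open>
  If \<open>a\<close> itself has a finite limit, its derivative is nonzero and comes arbitrarily
  close to zero, so the inverse of the derivative tends to infinity in absolute value.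
\<close>

lemma (in hardy) identity_of_nonconstant:
 assumes comp: "closed_under_composition H" and inv: "closed_under_inversion H"
  and a: "a \<in> H" "\<not> (\<exists>c. \<forall>\<^sub>F x in at_top. a x = c)"
 shows "(\<lambda>x. x) \<in> H"
proof -
 note id = identity_of_at_top[OF comp inv]
 have id': "(\<lambda>x. x) \<in> H" if "h \<in> H" "filterlim h at_bot at_top" for h
  by (rule id[OF minus_in[OF that(1)]]) (use that(2) in \<open>simp add: filterlim_uminus_at_bot\<close>)
 obtain a' where a': "a' \<in> H" "\<forall>\<^sub>F x in at_top. (a has_real_derivative a' x) (at x)"
  using deriv_in[OF a(1)] by blast
 have nz: "\<not> (\<forall>\<^sub>F x in at_top. a' x = 0)"
 proof
  assume "\<forall>\<^sub>F x in at_top. a' x = 0"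
  from eventually_conj[OF a'(2) this]
  obtain b where b: "\<And>x. x >= b ==> (a has_real_derivative a' x) (at x) \<and> a' x = 0"
   by (auto simp: eventually_at_top_linorder)
  have "a x = a b" if "x > b" for x
   by (rule eq_of_zero_derivative[OF _ that]) (use b in metis)
  hence "\<forall>\<^sub>F x in at_top. a x = a b" by (intro eventually_mono[OF eventually_gt_at_top[of b]])
  thus False using a(2) by blast
 qed
 consider L where "(a \<longlongrightarrow> L) at_top" | "filterlim a at_top at_top" | "filterlim a at_bot at_top"
  using span_limit[OF span_base[OF a(1)]] by blast
 thus ?thesis
 proof cases
  case 1
  have no: "\<not> (\<forall>\<^sub>F x in at_top. \<bar>a' x\<bar> >= c)" if "c > 0" for c
  proof
   assume "\<forall>\<^sub>F x in at_top. \<bar>a' x\<bar> >= c"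
   from eventually_conj[OF a'(2) this]
   obtain b where b: "\<And>x. x >= b ==> (a has_real_derivative a' x) (at x) \<and> \<bar>a' x\<bar> >= c"
    by (auto simp: eventually_at_top_linorder)
   have step: "\<bar>a (x + 1) - a x\<bar> >= c" if "x >= b" for x
   proof -
    have "\<exists>z>x. z < x + 1 \<and> a (x + 1) - a x = (x + 1 - x) * a' z"
     by (rule MVT2) (use b that in auto)
    then obtain z where "z > x" "z < x + 1" "a (x + 1) - a x = (x + 1 - x) * a' z" by blast
    thus ?thesis using b[of z] that by auto
   qed
   have "((\<lambda>x. a (x + 1) - a x) \<longlongrightarrow> L - L) at_top"
    by (intro tendsto_diff 1 filterlim_compose[OF 1 filterlim_add_const_at_top])
   hence "((\<lambda>x. \<bar>a (x + 1) - a x\<bar>) \<longlongrightarrow> 0) at_top" by (simp add: tendsto_rabs_zero)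
   hence "\<forall>\<^sub>F x in at_top. \<bar>a (x + 1) - a x\<bar> < c" using that by (rule order_tendstoD)
   hence "\<forall>\<^sub>F x::real in at_top. False" using eventually_ge_at_top[of b]
    by eventually_elim (use step in force)
   thus False by simp
  qed
  obtain g where g: "g \<in> H" "\<forall>\<^sub>F x in at_top. a' x * g x = 1" using inverse_in[OF a'(1) nz] by blast
  consider M where "(g \<longlongrightarrow> M) at_top" | "filterlim g at_top at_top" | "filterlim g at_bot at_top"
   using span_limit[OF span_base[OF g(1)]] by blast
  thus ?thesis
  proof cases
   case 1
   have "\<forall>\<^sub>F x in at_top. \<bar>g x\<bar> < \<bar>M\<bar> + 1"
    by (rule order_tendstoD(2)[OF tendsto_rabs[OF 1]]) simp
   with g(2) have "\<forall>\<^sub>F x in at_top. \<bar>a' x\<bar> >= 1 / (\<bar>M\<bar> + 1)"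
   proof eventually_elim
    case (elim x)
    have "1 = \<bar>a' x\<bar> * \<bar>g x\<bar>" using elim(1) by (metis abs_mult abs_one)
    also have "... <= \<bar>a' x\<bar> * (\<bar>M\<bar> + 1)" using elim(2) by (intro mult_left_mono) auto
    finally show ?case by (simp add: pos_divide_le_eq)
   qed
   thus ?thesis using no[of "1 / (\<bar>M\<bar> + 1)"] by simp
  qed (use id id' g in blast)+
 qed (use id id' a in blast)+
qed

section \<open>Exponential averages of Hardy functions\<close>

text \<open>
  Differences replace derivatives throughout: the span is closed under them, they are compatible
  with restriction to the integers, and the phases of correlations are sums of differences.
\<close>

definition fdiff :: "(real => real) => real => real" where
 "fdiff f x = f (x + 1) - f x"

text \<open>
  The sum of \<open>h\<close> shifts turns \<open>fdiff f\<close> into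
  \<open>f(x + h) - f(x)\<close>, the phase of a correlation.
\<close>

definition shift_sum :: "nat => (real => real) => real => real" where
 "shift_sum h f x = (\<Sum>i<h. f (x + real i))"

lemma fdiff_shift_sum: "fdiff (shift_sum h f) = shift_sum h (fdiff f)"
 by (auto simp: fdiff_def shift_sum_def sum_subtractf add_ac fun_eq_iff)

lemma fdiff_pow_shift_sum: "(fdiff ^^ k) (shift_sum h f) = shift_sum h ((fdiff ^^ k) f)"
 by (induction k) (simp_all add: fdiff_shift_sum)

lemma shift_sum_fdiff: "shift_sum h (fdiff f) x = f (x + real h) - f x"
 by (induction h) (auto simp: shift_sum_def fdiff_def add_ac)

lemma fdiff_pow_diff: "(fdiff ^^ k) (\<lambda>x. f x - g x) = (\<lambda>x. (fdiff ^^ k) f x - (fdiff ^^ k) g x)"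
 by (induction k) (auto simp: fdiff_def fun_eq_iff)
lemma fdiff_pow_add: "(fdiff ^^ k) (\<lambda>x. f x + g x) = (\<lambda>x. (fdiff ^^ k) f x + (fdiff ^^ k) g x)"
 by (induction k) (auto simp: fdiff_def fun_eq_iff)
lemma fdiff_pow_cmult: "(fdiff ^^ k) (\<lambda>x. c * f x) = (\<lambda>x. c * (fdiff ^^ k) f x)"
 by (induction k) (auto simp: fdiff_def fun_eq_iff right_diff_distrib)

lemma filterlim_shift:
 assumes "filterlim f F at_top" shows "filterlim (\<lambda>x. f (x + c)) F (at_top :: real filter)"
 by (rule filterlim_compose[OF assms filterlim_add_const_at_top])

lemma eventually_shift:
 assumes "\<forall>\<^sub>F x in at_top. P x" shows "\<forall>\<^sub>F x in at_top. P (x + c :: real)"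
 by (rule eventually_compose_filterlim[OF assms filterlim_add_const_at_top])

lemma fdiff_tendsto_0: assumes "(f \<longlongrightarrow> L) at_top" shows "(fdiff f \<longlongrightarrow> 0) at_top"
 using tendsto_diff[OF filterlim_shift[OF assms, of 1] assms] by (simp add: fdiff_def[abs_def])

lemma shift_sum_tendsto: assumes "(f \<longlongrightarrow> L) at_top" shows "(shift_sum h f \<longlongrightarrow> real h * L) at_top"
proof -
 have "((\<lambda>x. \<Sum>i<h. f (x + real i)) \<longlongrightarrow> (\<Sum>i<h. L)) at_top"
  by (intro tendsto_sum filterlim_shift assms)
 thus ?thesis by (simp add: shift_sum_def[abs_def])
qed

lemma shift_sum_at_top: assumes "filterlim f at_top at_top" "h >= 1"
 shows "filterlim (shift_sum h f) at_top at_top"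
 unfolding filterlim_at_top
proof
 fix Z
 have "\<forall>\<^sub>F x in at_top. f x >= \<bar>Z\<bar>" using assms(1) filterlim_at_top by blast
 hence "\<forall>\<^sub>F x in at_top. \<forall>i\<in>{..<h}. f (x + real i) >= \<bar>Z\<bar>"
  by (intro eventually_ball_finite ballI eventually_shift) simp_all
 thus "\<forall>\<^sub>F x in at_top. shift_sum h f x >= Z"
 proof eventually_elim
  case (elim x)
  have "(\<Sum>i<h. \<bar>Z\<bar>) <= shift_sum h f x" unfolding shift_sum_def by (rule sum_mono) (use elim in auto)
  moreover have "1 * \<bar>Z\<bar> <= real h * \<bar>Z\<bar>" using assms(2) by (intro mult_right_mono) auto
  ultimately show ?case by simp
 qed
qed

lemma filterlim_real_nat: "filterlim f F at_top ==> filterlim (\<lambda>n. f (real n)) F sequentially"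
 by (rule filterlim_compose[OF _ filterlim_real_sequentially])

lemma eventually_real_nat: "\<forall>\<^sub>F x in at_top. P x ==> \<forall>\<^sub>F n in sequentially. P (real n)"
 by (rule eventually_compose_filterlim[OF _ filterlim_real_sequentially])

lemma not_at_top_of_fdiff_nonpos:
 assumes "\<forall>\<^sub>F x in at_top. fdiff g x <= 0" shows "\<exists>C. \<forall>\<^sub>F n in sequentially. g (real n) <= C"
proof -
 obtain N where N: "\<And>n. n >= N ==> fdiff g (real n) <= 0"
  using eventually_real_nat[OF assms] by (auto simp: eventually_sequentially)
 have "g (real n) <= g (real N)" if "n >= N" for n
  using that
 proof (induction n rule: dec_induct)
  case (step n)
  thus ?case using N[of n] by (simp add: fdiff_def add.commute)
 qed simp
 thus ?thesis unfolding eventually_sequentially by blast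
qed

lemma not_both_at_top_and_bounded:
 fixes g :: "real => real"
 assumes "filterlim g at_top at_top" "\<forall>\<^sub>F n in sequentially. g (real n) <= C" shows False
proof -
 have "\<forall>\<^sub>F n in sequentially. g (real n) > C"
  using filterlim_real_nat[OF assms(1), unfolded filterlim_at_top_dense] by blast
 with assms(2) have "\<forall>\<^sub>F n::nat in sequentially. False" by eventually_elim simp
 thus False by simp
qed

lemma rpoly_0 [simp]: "rpoly 0 x = 0" by simp
lemma rpoly_pCons [simp]: "rpoly (pCons a p) x = of_rat a + x * rpoly p x"
 by (simp add: map_poly_pCons)
lemma rpoly_add: "rpoly (p + q) x = rpoly p x + rpoly q x"
proof -
 have "map_poly of_rat (p + q) = (map_poly of_rat p + map_poly of_rat q :: real poly)"
  by (intro poly_eqI) (simp add: coeff_map_poly of_rat_add)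
 thus ?thesis by simp
qed
lemma rpoly_smult: "rpoly (smult c p) x = of_rat c * rpoly p x"
proof -
 have "map_poly of_rat (smult c p) = (smult (of_rat c) (map_poly of_rat p) :: real poly)"
  by (intro poly_eqI) (simp add: coeff_map_poly of_rat_mult)
 thus ?thesis by simp
qed
lemma rpoly_mult: "rpoly (p * q) x = rpoly p x * rpoly q x"
 by (induction p) (simp_all add: rpoly_add rpoly_smult algebra_simps)

text \<open>
  The binomial polynomial, for which the iterated difference is exact. It removes a rational limit
  of \<open>(fdiff ^^ k) f\<close>.
\<close>

fun binom_poly :: "nat => rat poly" where
 "binom_poly 0 = 1"
| "binom_poly (Suc k) = smult (1 / of_nat (Suc k)) (binom_poly k * [:- of_nat k, 1:])"

lemma rpoly_binom_poly: "rpoly (binom_poly k) x = x gchoose k"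
proof (induction k)
 case 0 thus ?case by (simp add: one_pCons)
next
 case (Suc k)
 have "rpoly (binom_poly (Suc k)) x = (1 / real (Suc k)) * ((x gchoose k) * (x - real k))"
  by (simp only: binom_poly.simps rpoly_smult rpoly_mult Suc.IH)
    (simp add: of_rat_divide of_rat_add of_rat_minus)
 also have "... = x gchoose Suc k"
  using gbinomial_absorb_comp[of x k] gbinomial_absorption[of k x] Suc_times_gbinomial[of k "x-1"]
  by (simp add: gbinomial_mult_1 field_simps)
 finally show ?case .
qed

lemma fdiff_gbinomial: "(fdiff ^^ k) (\<lambda>x. x gchoose k) = (\<lambda>_. 1)"
proof (induction k)
 case (Suc k)
 have "fdiff (\<lambda>x. x gchoose Suc k) = (\<lambda>x. x gchoose k)"
  by (auto simp: fdiff_def gbinomial_Suc_Suc)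
 thus ?case using Suc by (simp add: funpow_swap1)
qed auto

lemma exists_common_denominator: "\<exists>d>0. \<exists>q. \<forall>x. real d * rpoly p x = poly (map_poly of_int q) x"
proof (induction p)
 case 0 show ?case by (intro exI[of _ 1] conjI exI[of _ 0]) auto
next
 case (pCons a p)
 then obtain d q where d: "d > 0" "\<And>x. real d * rpoly p x = poly (map_poly of_int q) x" by blast
 obtain m n where a: "a = Fract m n" "n > 0" by (cases a) auto
 have a': "of_rat a * real_of_int n = of_int m" using a by (simp add: of_rat_rat)
 have sm: "poly (map_poly of_int (smult c q)) x = real_of_int c * poly (map_poly of_int q) x" for c x
 proof -
  have "map_poly of_int (smult c q) = (smult (of_int c) (map_poly of_int q) :: real poly)"
   by (intro poly_eqI) (simp add: coeff_map_poly)
  thus ?thesis by simp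
 qed
 show ?case
 proof (intro exI[of _ "d * nat n"] conjI exI[of _ "pCons (m * int d) (smult n q)"] allI)
  fix x
  have "real (d * nat n) * rpoly (pCons a p) x = real d * (of_rat a * of_int n) + x * of_int n * (real d * rpoly p x)"
   using a(2) by (simp add: algebra_simps)
  thus "real (d * nat n) * rpoly (pCons a p) x = poly (map_poly of_int (pCons (m * int d) (smult n q))) x"
   by (simp only: d(2) a') (simp add: map_poly_pCons sm algebra_simps)
 qed (use d a in auto)
qed

lemma int_poly_congruent:
 "\<exists>k::int. poly (map_poly of_int q) (x + real d) - poly (map_poly of_int q) x = real d * of_int k" if "x = real n"
proof -
 have "\<exists>j k::int. poly (map_poly of_int q) (real n) = real_of_int j \<and>
   poly (map_poly of_int q) (real n + real d) - poly (map_poly of_int q) (real n) = real d * of_int k"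
 proof (induction q)
  case 0 show ?case by (intro exI[of _ 0]) auto
 next
  case (pCons a q)
  then obtain j k :: int where jk1: "poly (map_poly of_int q) (real n) = real_of_int j"
   "poly (map_poly of_int q) (real n + real d) - poly (map_poly of_int q) (real n) = real d * of_int k" by blast
  hence jk: "poly (map_poly of_int q) (real n) = real_of_int j"
   "poly (map_poly of_int q) (real n + real d) = real_of_int j + real d * of_int k" by linarith+
  have e: "poly (map_poly of_int (pCons a q)) y = real_of_int a + y * poly (map_poly of_int q) y" for y
   by (simp add: map_poly_pCons)
  show ?case unfolding e jk
   by (intro exI[of _ "a + int n * j"] exI[of _ "j + int n * k + int d * k"]) (simp add: algebra_simps)
 qed
 thus ?thesis using that by auto
qed

text \<open>
  Multiplied by a common denominator, a rational polynomial has integer coefficients, so its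
  values modulo one are periodic.
\<close>

lemma ee_rpoly_periodic: "\<exists>Q>0. \<forall>n. ee (rpoly p (real (n + Q))) = ee (rpoly p (real n))"
proof -
 obtain d q where d: "d > 0" "\<And>x. real d * rpoly p x = poly (map_poly of_int q) x"
  using exists_common_denominator[of p] by blast
 have "ee (rpoly p (real (n + d))) = ee (rpoly p (real n))" for n
 proof -
  obtain k :: int where k: "poly (map_poly of_int q) (real n + real d) - poly (map_poly of_int q) (real n) = real d * of_int k"
   using int_poly_congruent[of "real n" n q d] by blast
  hence "real d * (rpoly p (real n + real d) - rpoly p (real n)) = real d * of_int k"
   by (simp only: d(2)[symmetric] right_diff_distrib[symmetric])
  hence "rpoly p (real (n + d)) = rpoly p (real n) + of_int k" using d(1) by simp
  thus ?thesis by (simp only: ee_add ee_of_int mult_1_right)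
 qed
 thus ?thesis using d(1) by blast
qed

locale hardy_id = hardy +
 assumes comp: "closed_under_composition H" and id_in: "(\<lambda>x. x) \<in> H"
begin

lemma span_mult_id: "f \<in> real_span H ==> (\<lambda>x. x * f x) \<in> real_span H"
 using span_mult_H[OF _ id_in, of f] by simp

lemma span_shift: assumes "f \<in> real_span H" shows "(\<lambda>x. f (x + 1)) \<in> real_span H"
proof -
 obtain xs where xs: "\<forall>p\<in>set xs. snd p \<in> H" "\<forall>\<^sub>F x in at_top. f x = lin_comb xs x"
  using assms unfolding real_span_def by blast
 have shH: "(\<lambda>x. g (x + 1)) \<in> H" if "g \<in> H" for g
  using comp that add_in[OF id_in one_in] filterlim_add_const_at_top[of 1]
  unfolding closed_under_composition_def comp_def by blast
 have eq: "lin_comb xs (x + 1) = lin_comb (map (\<lambda>p. (fst p, \<lambda>x. snd p (x + 1))) xs) x" for x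
  by (induction xs) auto
 show ?thesis unfolding real_span_def
  using xs(1) eventually_shift[OF xs(2), of 1] unfolding eq
  by (intro CollectI exI[of _ "map (\<lambda>p. (fst p, \<lambda>x. snd p (x + 1))) xs"]) (auto intro: shH)
qed

lemma span_fdiff: "f \<in> real_span H ==> fdiff f \<in> real_span H"
 unfolding fdiff_def[abs_def] by (intro span_diff span_shift)
lemma span_fdiff_pow: "f \<in> real_span H ==> (fdiff ^^ k) f \<in> real_span H"
 by (induction k) (auto intro: span_fdiff)
lemma span_sum: "finite I ==> (\<And>i. i \<in> I ==> f i \<in> real_span H) ==> (\<lambda>x. \<Sum>i\<in>I. f i x) \<in> real_span H"
 by (induction I rule: finite_induct) (auto intro: span_add span_const)
lemma span_shift_nat: "f \<in> real_span H ==> (\<lambda>x. f (x + real i)) \<in> real_span H"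
proof (induction i)
 case (Suc i)
 from span_shift[OF Suc.IH[OF Suc.prems]] show ?case by (simp add: add_ac)
qed simp
lemma span_shift_sum: "f \<in> real_span H ==> shift_sum h f \<in> real_span H"
 unfolding shift_sum_def[abs_def] by (intro span_sum span_shift_nat) auto
lemma span_rpoly: "rpoly p \<in> real_span H"
proof (induction p)
 case (pCons a p)
 have "(\<lambda>x. of_rat a + x * rpoly p x) \<in> real_span H" by (intro span_add span_const span_mult_id pCons.IH)
 thus ?case by simp
qed (use span_const[of 0] in simp)

lemma fdiff_eventually_nonpos:
 assumes "g \<in> real_span H" "(g \<longlongrightarrow> 0) at_top" "\<forall>\<^sub>F x in at_top. g x > 0"
 shows "\<forall>\<^sub>F x in at_top. fdiff g x <= 0"
proof (rule ccontr)
 assume "\<not> ?thesis"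
 hence "\<forall>\<^sub>F x in at_top. fdiff g x > 0" using span_gt_or_le[OF span_fdiff[OF assms(1)], of 0] by blast
 from eventually_conj[OF this assms(3)]
 have "\<forall>\<^sub>F n in sequentially. fdiff g (real n) > 0 \<and> g (real n) > 0"
  by (rule eventually_real_nat)
 then obtain N where N: "\<And>n. n >= N ==> fdiff g (real n) > 0 \<and> g (real n) > 0" by (auto simp: eventually_sequentially)
 have "g (real n) >= g (real N)" if "n >= N" for n
  using that
 proof (induction n rule: dec_induct)
  case (step n)
  thus ?case using N[of n] by (simp add: fdiff_def add.commute)
 qed simp
 hence "\<forall>\<^sub>F n in sequentially. g (real n) >= g (real N)" unfolding eventually_sequentially by blast
 hence "0 >= g (real N)"
  by (intro tendsto_lowerbound[OF filterlim_real_nat[OF assms(2)]]) auto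
 thus False using N[of N] by simp
qed

definition equidistributing :: "(real => real) => bool" where
 "equidistributing f \<longleftrightarrow> (\<lambda>N. average N (\<lambda>n. ee (f (real n)))) \<longlonglongrightarrow> 0"

lemma equidistributing_uminus:
 assumes "equidistributing (\<lambda>x. - f x)" shows "equidistributing f"
 using tendsto_cnj[OF assms[unfolded equidistributing_def]]
 by (simp add: equidistributing_def cnj_average cnj_ee)

text \<open>
  Up to a sign this is the first difference test; the slope is eventually monotone because the
  second difference has a constant sign.
\<close>

lemma equidistributing_first_difference:
 assumes f: "f \<in> real_span H" and lim: "(fdiff f \<longlongrightarrow> 0) at_top"
  and big: "filterlim (\<lambda>x. x * fdiff f x) at_top at_top \<or> filterlim (\<lambda>x. x * fdiff f x) at_bot at_top"
 shows "equidistributing f"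
proof -
 have pos: "equidistributing f" if f: "f \<in> real_span H" and lim: "(fdiff f \<longlongrightarrow> 0) at_top"
  and big: "filterlim (\<lambda>x. x * fdiff f x) at_top at_top" for f
 proof -
  have "\<forall>\<^sub>F x in at_top. x * fdiff f x > 0" using big by (simp add: filterlim_at_top_dense)
  hence gt: "\<forall>\<^sub>F x in at_top. fdiff f x > 0" using eventually_gt_at_top[of 0]
   by eventually_elim (simp add: zero_less_mult_iff)
  have d: "\<forall>\<^sub>F n in sequentially. fdiff (fdiff f) (real n) <= 0"
   by (rule eventually_real_nat[OF fdiff_eventually_nonpos[OF span_fdiff[OF f] lim gt]])
  have eq: "f (real (Suc n)) - f (real n) = fdiff f (real n)" for n by (simp add: fdiff_def add.commute)
  show ?thesis unfolding equidistributing_def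
  proof (rule first_difference_test, unfold eq)
   show "\<forall>\<^sub>F n in sequentially. fdiff f (real (Suc n)) <= fdiff f (real n)"
    using d by eventually_elim (simp add: fdiff_def add_ac)
  qed (use filterlim_real_nat[OF lim] filterlim_real_nat[OF big] in auto)
 qed
 show ?thesis using big
 proof
  assume "filterlim (\<lambda>x. x * fdiff f x) at_bot at_top"
  moreover have "fdiff (\<lambda>x. - f x) = (\<lambda>x. - fdiff f x)" by (auto simp: fdiff_def)
  ultimately have "equidistributing (\<lambda>x. - f x)"
   using tendsto_minus[OF lim] by (intro pos span_minus f) (auto simp: filterlim_uminus_at_bot)
  thus ?thesis by (rule equidistributing_uminus)
 qed (use pos f lim in blast)
qed

lemma equidistributing_noninteger_slope:
 assumes "(fdiff f \<longlongrightarrow> L) at_top" "L \<notin> \<int>" shows "equidistributing f"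
 unfolding equidistributing_def
proof (rule average_tendsto_zero_of_ratio[where C=1])
 show "ee L \<noteq> 1" using assms(2) by (simp add: ee_eq_1_iff)
 have "(\<lambda>n. ee (fdiff f (real n)) - ee L) \<longlonglongrightarrow> 0"
  by (intro LIM_zero tendsto_ee filterlim_real_nat assms(1))
 hence "(\<lambda>n. norm (ee (fdiff f (real n)) - ee L)) \<longlonglongrightarrow> 0" by (rule tendsto_norm_zero)
 moreover have "norm (ee (f (real (Suc n))) - ee L * ee (f (real n))) = norm (ee (fdiff f (real n)) - ee L)" for n
 proof -
  have "ee (f (real (Suc n))) = ee (fdiff f (real n)) * ee (f (real n))"
   by (simp add: fdiff_def ee_add[symmetric] add.commute)
  hence "ee (f (real (Suc n))) - ee L * ee (f (real n)) = (ee (fdiff f (real n)) - ee L) * ee (f (real n))"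
   by (simp add: algebra_simps)
  thus ?thesis by (simp add: norm_mult)
 qed
 ultimately have "(\<lambda>n. norm (ee (f (real (Suc n))) - ee L * ee (f (real n)))) \<longlonglongrightarrow> 0" by simp
 thus "(\<lambda>n. ee (f (real (Suc n))) - ee L * ee (f (real n))) \<longlonglongrightarrow> 0" by (rule tendsto_norm_zero_cancel)
qed simp

lemma equidistributing_van_der_Corput:
 assumes "\<And>h. h >= 1 ==> equidistributing (shift_sum h (fdiff f))"
 shows "equidistributing f"
 unfolding equidistributing_def
proof (rule van_der_Corput)
 fix h :: nat assume "h >= 1"
 from assms[OF this] show "(\<lambda>N. average N (\<lambda>n. ee (f (real (n + h))) * cnj (ee (f (real n))))) \<longlonglongrightarrow> 0"
  unfolding equidistributing_def shift_sum_fdiff by (simp add: ee_diff)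
qed simp

text \<open>
  The first difference tends to infinity and the second, \<open>s\<close>, to zero. If
  \<open>x s(x)\<close> tends to infinity, the phases of the correlations satisfy the first
  difference test. If \<open>x s(x)\<close> has a finite limit, the second difference test
  applies; its hypothesis that \<open>x^2 s(x)\<close> tends to infinity holds since otherwise the
  first difference would be bounded by a convergent series.
\<close>

lemma equidistributing_slope_at_top:
 assumes f: "f \<in> real_span H" and inf: "filterlim (fdiff f) at_top at_top"
  and lim: "(fdiff (fdiff f) \<longlongrightarrow> 0) at_top"
 shows "equidistributing f"
proof -
 define s where "s = fdiff (fdiff f)"
 have s: "s \<in> real_span H" unfolding s_def by (intro span_fdiff f)
 have spos: "\<forall>\<^sub>F x in at_top. s x > 0"
 proof (rule ccontr)
  assume "\<not> ?thesis"
  hence "\<forall>\<^sub>F x in at_top. fdiff (fdiff f) x <= 0" using span_gt_or_le[OF s, of 0] by (auto simp: s_def)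
  thus False using not_at_top_of_fdiff_nonpos not_both_at_top_and_bounded[OF inf] by blast
 qed
 have dec: "\<forall>\<^sub>F x in at_top. fdiff s x <= 0"
  by (rule fdiff_eventually_nonpos[OF s _ spos]) (use lim in \<open>simp add: s_def\<close>)
 have not_bot: "\<not> filterlim g at_bot at_top" if "\<forall>\<^sub>F x in at_top. g x > 0" for g :: "real => real"
 proof
  assume "filterlim g at_bot at_top"
  hence "\<forall>\<^sub>F x in at_top. g x <= 0" by (simp add: filterlim_at_bot)
  with that have "\<forall>\<^sub>F x::real in at_top. False" by eventually_elim simp
  thus False by simp
 qed
 have xspos: "\<forall>\<^sub>F x in at_top. x * s x > 0" using spos eventually_gt_at_top[of 0] by eventually_elim simp
 hence xxspos: "\<forall>\<^sub>F x in at_top. x * (x * s x) > 0" using eventually_gt_at_top[of 0] by eventually_elim simp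
 consider L where "((\<lambda>x. x * s x) \<longlongrightarrow> L) at_top" | "filterlim (\<lambda>x. x * s x) at_top at_top"
  using span_limit[OF span_mult_id[OF s]] not_bot[OF xspos] by blast
 thus ?thesis
 proof cases
  case 1
  have up: "\<forall>\<^sub>F x in at_top. x * s x <= L + 1"
   by (rule eventually_mono[OF order_tendstoD(2)[OF 1, of "L+1"]]) auto
  have low: "filterlim (\<lambda>x. x * (x * s x)) at_top at_top"
  proof (rule ccontr)
   assume "\<not> ?thesis"
   then obtain M where "((\<lambda>x. x * (x * s x)) \<longlongrightarrow> M) at_top"
    using span_limit[OF span_mult_id[OF span_mult_id[OF s]]] not_bot[OF xxspos] by blast
   hence "\<forall>\<^sub>F x in at_top. x * (x * s x) < \<bar>M\<bar> + 1" by (rule order_tendstoD) auto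
   hence "\<forall>\<^sub>F n in sequentially. real n * (real n * s (real n)) < \<bar>M\<bar> + 1" by (rule eventually_real_nat)
   then obtain N where N: "\<And>n. n >= N ==> real n * (real n * s (real n)) < \<bar>M\<bar> + 1" by (auto simp: eventually_sequentially)
   define C where "C = \<bar>M\<bar> + 1"
   define N1 where "N1 = max N 2"
   \<comment> \<open>\<open>s n \<le> C / n^2 \<le> C / (n - 1) - C / n\<close> telescopes\<close>
   have step: "fdiff f (real (Suc n)) + C / real n <= fdiff f (real n) + C / (real n - 1)" if "n >= N1" for n
   proof -
    have n: "real n >= 2" "n >= N" using that by (auto simp: N1_def)
    have "fdiff f (real (Suc n)) - fdiff f (real n) = s (real n)" by (simp add: s_def fdiff_def add_ac)
    also have "... <= C / (real n * real n)" using N[OF n(2)] n(1) by (simp add: C_def pos_le_divide_eq mult_ac)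
    also have "... <= C / (real n * (real n - 1))"
     using n by (intro divide_left_mono mult_left_mono mult_pos_pos) (auto simp: C_def)
    also have "... = C / (real n - 1) - C / real n" using n by (simp add: field_simps)
    finally show ?thesis by simp
   qed
   have bd: "fdiff f (real n) + C / (real n - 1) <= fdiff f (real N1) + C / (real N1 - 1)" if "n >= N1" for n
    using that
   proof (induction n rule: dec_induct)
    case (step n)
    thus ?case using \<open>n >= N1 ==> fdiff f (real (Suc n)) + C / real n <= fdiff f (real n) + C / (real n - 1)\<close> by simp
   qed simp
   have "fdiff f (real n) <= fdiff f (real N1) + C / (real N1 - 1)" if "n >= N1" for n
   proof -
    have "C / (real n - 1) >= 0" using that by (auto simp: C_def N1_def)
    thus ?thesis using bd[OF that] by linarith
   qed
   hence "\<forall>\<^sub>F n in sequentially. fdiff f (real n) <= fdiff f (real N1) + C / (real N1 - 1)"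
    unfolding eventually_sequentially by blast
   thus False by (rule not_both_at_top_and_bounded[OF inf])
  qed
  have eq: "f (real (n + 2)) - 2 * f (real (n + 1)) + f (real n) = s (real n)" for n
   by (simp add: s_def fdiff_def add_ac)
  show ?thesis unfolding equidistributing_def
  proof (rule second_difference_test[where C="L+1"], unfold eq)
   show "\<forall>\<^sub>F n in sequentially. s (real (Suc n)) <= s (real n)"
    using eventually_real_nat[OF dec] by eventually_elim (simp add: fdiff_def add_ac)
   show "\<forall>\<^sub>F n in sequentially. real n * s (real n) <= L + 1" by (rule eventually_real_nat[OF up])
   show "filterlim (\<lambda>n. (real n)\<^sup>2 * s (real n)) at_top sequentially"
    using filterlim_real_nat[OF low] by (simp add: power2_eq_square mult_ac)
  qed
 next
  case 2
  show ?thesis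
  proof (rule equidistributing_van_der_Corput)
   fix h :: nat assume h: "h >= 1"
   have fd: "fdiff (shift_sum h (fdiff f)) = shift_sum h s" by (simp add: fdiff_shift_sum s_def)
   show "equidistributing (shift_sum h (fdiff f))"
   proof (rule equidistributing_first_difference)
    show "shift_sum h (fdiff f) \<in> real_span H" by (intro span_shift_sum span_fdiff f)
    show "(fdiff (shift_sum h (fdiff f)) \<longlongrightarrow> 0) at_top"
     unfolding fd using shift_sum_tendsto[OF lim, of h] by (simp add: s_def)
    have "filterlim (\<lambda>x. x * shift_sum h s x) at_top at_top"
    proof (rule filterlim_at_top_mono[OF 2])
     have "\<forall>\<^sub>F x in at_top. \<forall>i\<in>{..<h}. s (x + real i) > 0"
      by (intro eventually_ball_finite ballI eventually_shift spos) simp_all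
     thus "\<forall>\<^sub>F x in at_top. x * s x <= x * shift_sum h s x" using eventually_gt_at_top[of 0]
     proof eventually_elim
      case (elim x)
      have "s x = (\<Sum>i\<in>{0}. s (x + real i))" by simp
      also have "... <= shift_sum h s x" unfolding shift_sum_def
       by (rule sum_mono2) (use h elim in \<open>auto simp: less_imp_le\<close>)
      finally show ?case using elim by simp
     qed
    qed
    thus "filterlim (\<lambda>x. x * fdiff (shift_sum h (fdiff f)) x) at_top at_top \<or>
       filterlim (\<lambda>x. x * fdiff (shift_sum h (fdiff f)) x) at_bot at_top" unfolding fd by blast
   qed
  qed
 qed
qed

text \<open>
  Van der Corput lowers the order \<open>k\<close>: the \<open>h\<close>-th correlation has a
  \<open>k\<close>-th difference with limit \<open>h L\<close>, again irrational or infinite. It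
  ends at slopes with an irrational or infinite limit.
\<close>

lemma equidistributing_irrational_or_infinite:
 assumes "f \<in> real_span H" "((fdiff ^^ Suc (Suc k)) f \<longlongrightarrow> 0) at_top"
  and "(\<exists>L. L \<notin> \<rat> \<and> ((fdiff ^^ Suc k) f \<longlongrightarrow> L) at_top) \<or> filterlim ((fdiff ^^ Suc k) f) at_top at_top
   \<or> filterlim ((fdiff ^^ Suc k) f) at_bot at_top"
 shows "equidistributing f"
 using assms
proof (induction k arbitrary: f)
 case 0
 from 0(3) show ?case
 proof (elim disjE exE conjE)
  fix L assume "L \<notin> \<rat>" "((fdiff ^^ Suc 0) f \<longlongrightarrow> L) at_top"
  thus ?thesis using Ints_subset_Rats by (intro equidistributing_noninteger_slope[of f L]) auto
 next
  assume "filterlim ((fdiff ^^ Suc 0) f) at_top at_top"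
  thus ?thesis using 0 by (intro equidistributing_slope_at_top) auto
 next
  assume a: "filterlim ((fdiff ^^ Suc 0) f) at_bot at_top"
  have e: "(fdiff ^^ k) (\<lambda>x. - f x) = (\<lambda>x. - (fdiff ^^ k) f x)" for k using fdiff_pow_cmult[of k "-1" f] by simp
  have "equidistributing (\<lambda>x. - f x)"
  proof (rule equidistributing_slope_at_top[OF span_minus[OF 0(1)]])
   show "filterlim (fdiff (\<lambda>x. - f x)) at_top at_top" using a e[of 1] by (simp add: filterlim_uminus_at_bot)
   show "(fdiff (fdiff (\<lambda>x. - f x)) \<longlongrightarrow> 0) at_top" using tendsto_minus[OF 0(2)] e[of 2] by (simp add: numeral_2_eq_2)
  qed
  thus ?thesis by (rule equidistributing_uminus)
 qed
next
 case (Suc k)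
 show ?case
 proof (rule equidistributing_van_der_Corput)
  fix h :: nat assume h: "h >= 1"
  have e: "(fdiff ^^ j) (shift_sum h (fdiff f)) = shift_sum h ((fdiff ^^ Suc j) f)" for j
   by (simp add: fdiff_pow_shift_sum funpow_swap1)
  show "equidistributing (shift_sum h (fdiff f))"
  proof (rule Suc.IH, unfold e)
   show "shift_sum h (fdiff f) \<in> real_span H" by (intro span_shift_sum span_fdiff Suc.prems)
   show "(shift_sum h ((fdiff ^^ Suc (Suc (Suc k))) f) \<longlongrightarrow> 0) at_top"
    using shift_sum_tendsto[OF Suc.prems(2), of h] by simp
   from Suc.prems(3) show "(\<exists>L. L \<notin> \<rat> \<and> (shift_sum h ((fdiff ^^ Suc (Suc k)) f) \<longlongrightarrow> L) at_top) \<or>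
     filterlim (shift_sum h ((fdiff ^^ Suc (Suc k)) f)) at_top at_top \<or>
     filterlim (shift_sum h ((fdiff ^^ Suc (Suc k)) f)) at_bot at_top"
   proof (elim disjE exE conjE)
    fix L assume L: "L \<notin> \<rat>" "((fdiff ^^ Suc (Suc k)) f \<longlongrightarrow> L) at_top"
    have "real h * L \<notin> \<rat>"
    proof
     assume "real h * L \<in> \<rat>"
     hence "(real h * L) / real h \<in> \<rat>" by (intro Rats_divide) auto
     thus False using L h by simp
    qed
    thus ?thesis using shift_sum_tendsto[OF L(2), of h] by blast
   next
    assume "filterlim ((fdiff ^^ Suc (Suc k)) f) at_top at_top"
    thus ?thesis using shift_sum_at_top h by blast
   next
    assume a: "filterlim ((fdiff ^^ Suc (Suc k)) f) at_bot at_top"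
    hence "filterlim (shift_sum h (\<lambda>x. - (fdiff ^^ Suc (Suc k)) f x)) at_top at_top"
     by (intro shift_sum_at_top h) (simp add: filterlim_uminus_at_bot)
    hence "filterlim (shift_sum h ((fdiff ^^ Suc (Suc k)) f)) at_bot at_top"
     by (simp add: filterlim_uminus_at_bot shift_sum_def[abs_def] sum_negf)
    thus ?thesis by blast
   qed
  qed
 qed
qed

text \<open>
  The logarithmic distance of \<open>f\<close> to the rational polynomials, in terms of
  differences. The condition is stable under adding rational polynomials and is what the
  exponential sums need.
\<close>

definition away :: "(real => real) => bool" where
 "away f \<longleftrightarrow> (\<forall>p. \<not> (\<exists>C. \<forall>\<^sub>F x in at_top. \<bar>x * fdiff (\<lambda>x. f x - rpoly p x) x\<bar> <= C))"

lemma away_add_rpoly: assumes "away f" shows "away (\<lambda>x. f x + rpoly p x)"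
 unfolding away_def
proof
 fix q
 have "rpoly (q + smult (-1) p) x = rpoly q x - rpoly p x" for x
  unfolding rpoly_add rpoly_smult by simp
 hence "(\<lambda>x. f x + rpoly p x - rpoly q x) = (\<lambda>x. f x - rpoly (q + smult (-1) p) x)" by auto
 thus "\<not> (\<exists>C. \<forall>\<^sub>F x in at_top. \<bar>x * fdiff (\<lambda>x. f x + rpoly p x - rpoly q x) x\<bar> <= C)"
  using assms unfolding away_def by metis
qed

lemma away_limit:
 assumes "f \<in> real_span H" "away f"
 shows "filterlim (\<lambda>x. x * fdiff f x) at_top at_top \<or> filterlim (\<lambda>x. x * fdiff f x) at_bot at_top"
proof (rule ccontr)
 assume "\<not> ?thesis"
 then obtain L where L: "((\<lambda>x. x * fdiff f x) \<longlongrightarrow> L) at_top"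
  using span_limit[OF span_mult_id[OF span_fdiff[OF assms(1)]]] by blast
 have "\<forall>\<^sub>F x in at_top. \<bar>x * fdiff f x\<bar> <= \<bar>L\<bar> + 1"
  by (rule eventually_mono[OF order_tendstoD(2)[OF tendsto_rabs[OF L], of "\<bar>L\<bar> + 1"]]) auto
 moreover have "(\<lambda>x. f x - rpoly 0 x) = f" by simp
 ultimately show False using assms(2) unfolding away_def by metis
qed

text \<open>
  An irrational or infinite limit, or a noninteger slope, has been treated. If the limit of the
  highest nonvanishing difference is rational, subtracting a rational polynomial lowers the order
  by one. The phases of this polynomial are periodic, and their Fourier expansion adds only linear
  terms with rational slope, which preserve \<open>away\<close>.
\<close>

lemma equidistributing_away_aux:
 assumes "f \<in> real_span H" "away f" "((fdiff ^^ Suc k) f \<longlongrightarrow> 0) at_top"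
 shows "equidistributing f"
 using assms
proof (induction k arbitrary: f)
 case 0
 thus ?case using equidistributing_first_difference away_limit by auto
next
 case (Suc k)
 show ?case
 proof (cases "\<exists>L\<in>\<rat>. ((fdiff ^^ Suc k) f \<longlongrightarrow> L) at_top")
  case False
  thus ?thesis using span_limit[OF span_fdiff_pow[OF Suc.prems(1), of "Suc k"]]
   by (intro equidistributing_irrational_or_infinite[OF Suc.prems(1,3)]) blast
 next
  case True
  then obtain r where r: "((fdiff ^^ Suc k) f \<longlongrightarrow> of_rat r) at_top" unfolding Rats_def by blast
  show ?thesis
  proof (cases "k = 0 \<and> of_rat r \<notin> (\<int> :: real set)")
   case True
   thus ?thesis using r by (intro equidistributing_noninteger_slope) auto
  next
   case c: False
   \<comment> \<open>its iterated difference is the constant \<open>r\<close>\<close>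
   define p where "p = smult r (binom_poly (Suc k))"
   have pd: "(fdiff ^^ Suc k) (rpoly p) = (\<lambda>_. of_rat r)"
   proof -
    have "rpoly p = (\<lambda>x. of_rat r * (x gchoose Suc k))" by (auto simp: p_def rpoly_smult rpoly_binom_poly simp del: binom_poly.simps)
    thus ?thesis using fdiff_gbinomial[of "Suc k"] by (simp only: fdiff_pow_cmult mult_1_right)
   qed
   define g where "g = (\<lambda>x. f x + rpoly (smult (-1) p) x)"
   have g: "g = (\<lambda>x. f x - rpoly p x)" unfolding g_def rpoly_smult by simp
   have gs: "g \<in> real_span H" unfolding g_def by (intro span_add span_rpoly Suc.prems)
   have ga: "away g" unfolding g_def by (intro away_add_rpoly Suc.prems)
   have gl: "((fdiff ^^ Suc k) g \<longlongrightarrow> 0) at_top"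
    unfolding g fdiff_pow_diff pd using tendsto_diff[OF r tendsto_const[of "of_rat r"]] by simp
   have eg: "ee (f x) = ee (rpoly p x) * ee (g x)" for x by (simp add: g ee_add[symmetric])
   show ?thesis
   proof (cases "k = 0")
    case True
    have "p = [:0, r:]" using True by (simp add: p_def one_pCons)
    moreover from c True obtain m :: int where m: "of_rat r = (of_int m :: real)" by (auto elim: Ints_cases)
    ultimately have "ee (rpoly p (real n)) = 1" for n
     using ee_of_int[of "int n * m"] by (simp add: m)
    hence "ee (f (real n)) = ee (g (real n))" for n by (simp add: eg)
    moreover have "equidistributing g" by (rule Suc.IH[OF gs ga gl])
    ultimately show ?thesis by (simp add: equidistributing_def)
   next
    case False
    obtain Q where Q: "Q > 0" "\<And>n. ee (rpoly p (real (n + Q))) = ee (rpoly p (real n))"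
     using ee_rpoly_periodic[of p] by blast
    define c where "c j = (\<Sum>r<Q. ee (rpoly p (real r)) * ee (- real j * real r / real Q)) / of_nat Q" for j
    have ex: "ee (rpoly p (real n)) = (\<Sum>j<Q. c j * ee (real j * real n / real Q))" for n
     using periodic_expand[of Q "\<lambda>n. ee (rpoly p (real n))" n] Q by (simp add: c_def)
    have "equidistributing (\<lambda>x. g x + rpoly [:0, of_nat j / of_nat Q:] x)" for j
    proof (rule Suc.IH)
     show "(\<lambda>x. g x + rpoly [:0, of_nat j / of_nat Q:] x) \<in> real_span H" by (intro span_add gs span_rpoly)
     show "away (\<lambda>x. g x + rpoly [:0, of_nat j / of_nat Q:] x)" by (intro away_add_rpoly ga)
     obtain k' where k': "k = Suc k'" using False by (cases k) auto
     have "fdiff (rpoly [:0, of_nat j / of_nat Q:]) = (\<lambda>x. of_rat (of_nat j / of_nat Q))"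
      by (auto simp: fdiff_def algebra_simps)
     hence 1: "(fdiff ^^ Suc (Suc 0)) (rpoly [:0, of_nat j / of_nat Q:]) = (\<lambda>x. 0)"
      by (simp only: funpow.simps comp_def id_def) (rule ext, simp only: fdiff_def diff_self)
     have z: "(fdiff ^^ i) (\<lambda>x. 0) = (\<lambda>x. 0)" for i by (induction i) (auto simp: fdiff_def)
     have "(fdiff ^^ (k' + Suc (Suc 0))) (rpoly [:0, of_nat j / of_nat Q:]) = (\<lambda>x. 0)"
      unfolding funpow_add comp_def 1 by (rule z)
     hence k0: "(fdiff ^^ Suc k) (rpoly [:0, of_nat j / of_nat Q:]) = (\<lambda>x. 0)" by (simp add: k')
     thus "((fdiff ^^ Suc k) (\<lambda>x. g x + rpoly [:0, of_nat j / of_nat Q:] x) \<longlongrightarrow> 0) at_top"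
      unfolding fdiff_pow_add k0 using gl by (simp only: add_0_right)
    qed
    hence E: "(\<lambda>N. average N (\<lambda>n. ee (g (real n) + real n * (real j / real Q)))) \<longlonglongrightarrow> 0" for j
     by (simp add: equidistributing_def of_rat_divide)
    have "(\<lambda>N. \<Sum>j<Q. c j * average N (\<lambda>n. ee (g (real n) + real n * (real j / real Q)))) \<longlonglongrightarrow> (\<Sum>j<Q. c j * 0)"
     by (intro tendsto_sum tendsto_mult_left E)
    moreover have "(\<Sum>j<Q. c j * average N (\<lambda>n. ee (g (real n) + real n * (real j / real Q)))) = average N (\<lambda>n. ee (f (real n)))" for N
     unfolding average_cmult[symmetric] average_sum[symmetric] eg ex sum_distrib_right
     by (simp add: ee_add mult_ac)
    ultimately show ?thesis by (simp add: equidistributing_def)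
   qed
  qed
 qed
qed

lemma id_pow_in: "(\<lambda>x. x ^ m) \<in> H"
 by (induction m) (auto intro: one_in mult_in id_in)

lemma fdiff_power_le: assumes "x >= 1" shows "fdiff (\<lambda>x. x ^ Suc m) x <= 3 ^ Suc m * x ^ m"
proof (induction m)
 case 0 show ?case by (simp add: fdiff_def)
next
 case (Suc m)
 have d0: "fdiff (\<lambda>x. x ^ Suc m) x >= 0" using assms by (simp add: fdiff_def mult_mono power_mono)
 have "fdiff (\<lambda>x. x ^ Suc (Suc m)) x = (x + 1) * fdiff (\<lambda>x. x ^ Suc m) x + x ^ Suc m"
  by (simp add: fdiff_def algebra_simps)
 also have "... <= (2 * x) * (3 ^ Suc m * x ^ m) + x ^ Suc m"
  using assms d0 Suc by (intro add_mono mult_mono) auto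
 also have "... = (2 * 3 ^ Suc m + 1) * x ^ Suc m" by (simp add: algebra_simps)
 also have "... <= 3 ^ Suc (Suc m) * x ^ Suc m"
  using assms one_le_power[of "3::real" "Suc m"] by (intro mult_right_mono) auto
 finally show ?case .
qed

text \<open>
  A difference that exceeded every multiple of \<open>x^m\<close> would, summed up, exceed the
  bound on \<open>f\<close>; its constant sign makes this a dichotomy.
\<close>

lemma fdiff_growth_upper:
 assumes f: "f \<in> real_span H" and bd: "\<forall>\<^sub>F x in at_top. \<bar>f x\<bar> <= C * x ^ Suc m"
 shows "\<exists>D. \<forall>\<^sub>F x in at_top. fdiff f x <= D * x ^ m"
proof (rule ccontr)
 assume no: "\<not> ?thesis"
 define K where "K = \<bar>C\<bar> + 1"
 define g where "g x = f x - K * x ^ Suc m" for x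
 have "(\<lambda>x. fdiff f x - (K * 3 ^ Suc m) * x ^ m) \<in> real_span H"
  by (intro span_diff span_cmult span_fdiff f span_base id_pow_in)
 from span_gt_or_le[OF this, of 0] no have "\<forall>\<^sub>F x in at_top. fdiff f x - (K * 3 ^ Suc m) * x ^ m > 0"
 proof (elim disjE)
  assume "\<forall>\<^sub>F x in at_top. fdiff f x - (K * 3 ^ Suc m) * x ^ m <= 0"
  hence "\<forall>\<^sub>F x in at_top. fdiff f x <= (K * 3 ^ Suc m) * x ^ m" by eventually_elim simp
  thus ?thesis using no by blast
 qed simp
 hence "\<forall>\<^sub>F x in at_top. fdiff g x >= 0" using eventually_ge_at_top[of 1]
 proof eventually_elim
  case (elim x)
  have "K * fdiff (\<lambda>x. x ^ Suc m) x <= K * (3 ^ Suc m * x ^ m)"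
   using fdiff_power_le[OF elim(2)] by (intro mult_left_mono) (auto simp: K_def)
  moreover have "fdiff g x = fdiff f x - K * fdiff (\<lambda>x. x ^ Suc m) x"
   by (simp add: fdiff_def g_def algebra_simps)
  ultimately show ?case using elim(1) by (simp add: mult.assoc)
 qed
 hence "\<forall>\<^sub>F x in at_top. fdiff (\<lambda>x. - g x) x <= 0" by eventually_elim (simp add: fdiff_def)
 then obtain c where c: "\<forall>\<^sub>F n in sequentially. - g (real n) <= c" using not_at_top_of_fdiff_nonpos by blast
 have "\<forall>\<^sub>F n::nat in sequentially. real n > \<bar>c\<bar>"
  using filterlim_real_sequentially unfolding filterlim_at_top_dense by blast
 with c eventually_real_nat[OF bd] eventually_ge_at_top[of "1::nat"] have "\<forall>\<^sub>F n::nat in sequentially. False"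
 proof eventually_elim
  case (elim n)
  have "real n <= real n ^ Suc m" using elim(3) by (intro self_le_power) auto
  also have "... <= K * real n ^ Suc m - C * real n ^ Suc m"
  proof -
   have "1 * real n ^ Suc m <= (K - C) * real n ^ Suc m" by (intro mult_right_mono) (auto simp: K_def)
   thus ?thesis by (simp add: algebra_simps)
  qed
  also have "... <= K * real n ^ Suc m - f (real n)" using elim(2) by linarith
  also have "... <= c" using elim(1) by (simp add: g_def)
  finally show ?case using elim(4) by simp
 qed
 thus False by simp
qed

lemma fdiff_growth:
 assumes f: "f \<in> real_span H" and bd: "\<forall>\<^sub>F x in at_top. \<bar>f x\<bar> <= C * x ^ Suc m"
 shows "\<exists>D. \<forall>\<^sub>F x in at_top. \<bar>fdiff f x\<bar> <= D * x ^ m"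
proof -
 obtain D1 where D1: "\<forall>\<^sub>F x in at_top. fdiff f x <= D1 * x ^ m" using fdiff_growth_upper[OF f bd] by blast
 have "\<exists>D. \<forall>\<^sub>F x in at_top. fdiff (\<lambda>x. - f x) x <= D * x ^ m"
  by (rule fdiff_growth_upper[OF span_minus[OF f], of C]) (use bd in simp)
 then obtain D2 where D2: "\<forall>\<^sub>F x in at_top. fdiff (\<lambda>x. - f x) x <= D2 * x ^ m" by blast
 have "\<forall>\<^sub>F x in at_top. \<bar>fdiff f x\<bar> <= (max D1 D2) * x ^ m"
  using D1 D2 eventually_ge_at_top[of 0]
 proof eventually_elim
  case (elim x)
  have "D1 * x ^ m <= max D1 D2 * x ^ m" "D2 * x ^ m <= max D1 D2 * x ^ m"
   using elim(3) by (intro mult_right_mono; simp)+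
  moreover have "fdiff (\<lambda>x. - f x) x = - fdiff f x" by (simp add: fdiff_def)
  ultimately show ?case using elim(1,2) by linarith
 qed
 thus ?thesis by blast
qed

lemma fdiff_pow_tendsto_0:
 assumes "f \<in> real_span H" "\<forall>\<^sub>F x in at_top. \<bar>f x\<bar> <= C * x ^ m"
 shows "((fdiff ^^ Suc m) f \<longlongrightarrow> 0) at_top"
 using assms
proof (induction m arbitrary: f C)
 case 0
 have nb: "\<not> filterlim h at_top at_top" if h: "\<forall>\<^sub>F x in at_top. \<bar>h x\<bar> <= C" for h :: "real => real"
 proof
  assume "filterlim h at_top at_top"
  hence "\<forall>\<^sub>F x in at_top. h x > C" by (simp add: filterlim_at_top_dense)
  with h have "\<forall>\<^sub>F x::real in at_top. False" by eventually_elim simp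
  thus False by simp
 qed
 have "\<not> filterlim f at_top at_top" using nb[of f] 0 by simp
 moreover have "\<not> filterlim f at_bot at_top" using nb[of "\<lambda>x. - f x"] 0 by (simp add: filterlim_uminus_at_bot)
 ultimately obtain L where "(f \<longlongrightarrow> L) at_top" using span_limit[OF 0(1)] by blast
 thus ?case using fdiff_tendsto_0 by simp
next
 case (Suc m)
 obtain D where "\<forall>\<^sub>F x in at_top. \<bar>fdiff f x\<bar> <= D * x ^ m" using fdiff_growth[OF Suc.prems] by blast
 from Suc.IH[OF span_fdiff[OF Suc.prems(1)] this] show ?case by (simp add: funpow_swap1)
qed

text \<open>
  Boshernitzan's theorem. Polynomial growth makes a sufficiently high difference tend to zero,
  where the induction starts.
\<close>

theorem equidistributing_away:
 assumes "f \<in> real_span H" "\<forall>\<^sub>F x in at_top. \<bar>f x\<bar> <= C * x ^ m" "away f"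
 shows "equidistributing f"
 using equidistributing_away_aux[OF assms(1,3) fdiff_pow_tendsto_0[OF assms(1,2)]] .

end

text \<open>Summing differences of size \<open>C / n\<close> gives a harmonic sum.\<close>

lemma log_growth_of_fdiff:
 assumes "\<forall>\<^sub>F x in at_top. \<bar>x * fdiff g x\<bar> <= C"
 shows "\<exists>D. \<forall>\<^sub>F n in sequentially. \<bar>g (real n)\<bar> <= D * ln (real n)"
proof -
 obtain N0 where N0: "\<And>n. n >= N0 ==> \<bar>real n * fdiff g (real n)\<bar> <= C"
  using eventually_real_nat[OF assms] by (auto simp: eventually_sequentially)
 define N where "N = max N0 3"
 have C: "C >= 0" using N0[of N0] by linarith
 have "\<bar>g (real n)\<bar> <= \<bar>g (real N)\<bar> + 2 * C * ln (real n)" if "n >= N" for n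
  using that
 proof (induction n rule: dec_induct)
  case base
  have "ln (real N) >= 0" by (rule ln_ge_zero) (simp add: N_def)
  thus ?case using C by simp
 next
  case (step n)
  have n: "real n > 0" "n >= N0" "real n >= 1" using step by (auto simp: N_def)
  have "\<bar>g (real (Suc n))\<bar> <= \<bar>g (real n)\<bar> + \<bar>fdiff g (real n)\<bar>"
   by (simp add: fdiff_def add.commute)
  also have "\<bar>fdiff g (real n)\<bar> <= C / real n" using N0[OF n(2)] n(1) by (simp add: pos_le_divide_eq abs_mult mult.commute)
  also have "... <= 2 * C * (ln (real (Suc n)) - ln (real n))"
  proof -
   have "ln (real n / real (Suc n)) <= real n / real (Suc n) - 1" by (rule ln_le_minus_one) (use n in auto)
   hence "1 / real (Suc n) <= ln (real (Suc n)) - ln (real n)"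
    using n by (simp add: ln_div field_simps)
   hence "2 * (1 / real (Suc n)) <= 2 * (ln (real (Suc n)) - ln (real n))" by (rule mult_left_mono) simp
   moreover have "1 / real n <= 2 * (1 / real (Suc n))" using n by (simp add: field_simps)
   ultimately have "C * (1 / real n) <= C * (2 * (ln (real (Suc n)) - ln (real n)))"
    by (intro mult_left_mono C) (rule order.trans)
   thus ?thesis by (simp only: mult.assoc mult.left_commute[of C 2] times_divide_eq_right mult_1_right)
  qed
  finally show ?case using step by (simp add: algebra_simps)
 qed
 moreover have "\<bar>g (real N)\<bar> <= \<bar>g (real N)\<bar> * ln (real n)" if "n >= N" for n
 proof -
  have "exp 1 <= real n" using exp_le that by (auto simp: N_def)
  hence "1 <= ln (real n)" using that by (subst ln_ge_iff) (auto simp: N_def)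
  hence "\<bar>g (real N)\<bar> * 1 <= \<bar>g (real N)\<bar> * ln (real n)" by (intro mult_left_mono) auto
  thus ?thesis by simp
 qed
 ultimately have "\<bar>g (real n)\<bar> <= (\<bar>g (real N)\<bar> + 2 * C) * ln (real n)" if "n >= N" for n
  using that by (fastforce simp: algebra_simps)
 thus ?thesis unfolding eventually_sequentially by blast
qed

lemma (in hardy_id) away_of_stays_log_away:
 assumes "stays_log_away f" shows "away f"
 unfolding away_def
proof (intro allI notI)
 fix p assume "\<exists>C. \<forall>\<^sub>F x in at_top. \<bar>x * fdiff (\<lambda>x. f x - rpoly p x) x\<bar> <= C"
 then obtain D where D: "\<forall>\<^sub>F n in sequentially. \<bar>f (real n) - rpoly p (real n)\<bar> <= D * ln (real n)"
  using log_growth_of_fdiff by blast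
 have "filterlim (\<lambda>x. \<bar>f x - rpoly p x\<bar> / ln x) at_top at_top" using assms unfolding stays_log_away_def by blast
 hence "\<forall>\<^sub>F x in at_top. \<bar>f x - rpoly p x\<bar> / ln x > D" by (simp add: filterlim_at_top_dense)
 hence "\<forall>\<^sub>F n in sequentially. \<bar>f (real n) - rpoly p (real n)\<bar> / ln (real n) > D" by (rule eventually_real_nat)
 with D eventually_gt_at_top[of 1] have "\<forall>\<^sub>F n::nat in sequentially. False"
 proof eventually_elim
  case (elim n)
  have "ln (real n) > 0" using elim by simp
  thus ?case using elim(1,3) by (simp add: pos_less_divide_eq)
 qed
 thus False by simp
qed

section \<open>Averages of exponentials of floors\<close>

definition trig_poly :: "(int \<times> complex) list => real => complex" where
 "trig_poly xs x = (\<Sum>p\<leftarrow>xs. snd p * ee (of_int (fst p) * x))"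

lemma trig_poly_append: "trig_poly (xs @ ys) x = trig_poly xs x + trig_poly ys x"
 by (simp add: trig_poly_def)

lemma trig_poly_mult: "\<exists>zs. \<forall>x. trig_poly xs x * trig_poly ys x = trig_poly zs x"
proof (induction xs)
 case Nil show ?case by (intro exI[of _ "[]"]) (simp add: trig_poly_def)
next
 case (Cons p xs)
 then obtain zs where zs: "\<And>x. trig_poly xs x * trig_poly ys x = trig_poly zs x" by blast
 have 1: "snd p * ee (of_int (fst p) * x) * trig_poly ys x = trig_poly (map (\<lambda>q. (fst p + fst q, snd p * snd q)) ys) x" for x
  by (induction ys) (auto simp: trig_poly_def algebra_simps ee_add)
 show ?case
 proof (intro exI[of _ "map (\<lambda>q. (fst p + fst q, snd p * snd q)) ys @ zs"] allI)
  fix x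
  have "trig_poly (p # xs) x * trig_poly ys x = snd p * ee (of_int (fst p) * x) * trig_poly ys x + trig_poly xs x * trig_poly ys x"
   by (simp add: trig_poly_def algebra_simps)
  thus "trig_poly (p # xs) x * trig_poly ys x = trig_poly (map (\<lambda>q. (fst p + fst q, snd p * snd q)) ys @ zs) x"
   by (simp add: 1 zs trig_poly_append)
 qed
qed

lemma ee_frac: "ee (frac x) = ee x"
 using ee_of_int[of "\<lfloor>x\<rfloor>"] by (simp add: frac_def ee_diff)

lemma Arg2pi_ee: "Arg2pi (ee x) / (2 * pi) = frac x"
proof -
 have "Arg2pi (ee x) = 2 * pi * frac x"
 proof (rule Arg2pi_unique[of 1])
  show "complex_of_real 1 * exp (\<i> * complex_of_real (2 * pi * frac x)) = ee x"
   unfolding ee_frac[of x, symmetric] by (simp add: ee_def cis_conv_exp)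
  show "2 * pi * frac x < 2 * pi" using frac_lt_1[of x] by simp
 qed (auto simp: frac_ge_0)
 thus ?thesis by simp
qed

text \<open>
  The function is a continuous function on the unit circle, so Stone-Weierstrass applies, with the
  argument normalised to \<open>[0, 1)\<close> as coordinate.
\<close>

lemma real_trig_approx:
 fixes G :: "real => real"
 assumes cont: "continuous_on {0..1} G" and per: "G 0 = G 1" and e: "e > 0"
 shows "\<exists>xs. \<forall>x. norm (of_real (G (frac x)) - trig_poly xs x) < e"
proof -
 define R where "R = {g :: complex => real. continuous_on (sphere 0 1) g \<and> (\<exists>xs. \<forall>x. of_real (g (ee x)) = trig_poly xs x)}"
 have const: "(\<lambda>_. c) \<in> R" for c :: real
  unfolding R_def by (auto intro!: exI[of _ "[(0, of_real c)]"] simp: trig_poly_def)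
 have Re: "Re \<in> R"
 proof -
  have "complex_of_real (Re (ee x)) = trig_poly [(1, 1/2), (-1, 1/2)] x" for x
   by (simp add: trig_poly_def ee_def complex_eq_iff)
  thus ?thesis unfolding R_def by (auto intro!: continuous_intros)
 qed
 have Im: "Im \<in> R"
 proof -
  have "complex_of_real (Im (ee x)) = trig_poly [(1, - \<i>/2), (-1, \<i>/2)] x" for x
   by (simp add: trig_poly_def ee_def complex_eq_iff)
  thus ?thesis unfolding R_def by (auto intro!: continuous_intros)
 qed
 interpret function_ring_on R "sphere 0 1"
 proof
  show "compact (sphere (0::complex) 1)" by simp
  show "continuous_on (sphere 0 1) f" if "f \<in> R" for f using that by (auto simp: R_def)
  fix f g assume "f \<in> R" "g \<in> R"
  then obtain xs ys where *: "continuous_on (sphere 0 1) f" "continuous_on (sphere 0 1) g"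
   "\<And>x. of_real (f (ee x)) = trig_poly xs x" "\<And>x. of_real (g (ee x)) = trig_poly ys x"
   unfolding R_def by blast
  show "(\<lambda>x. f x + g x) \<in> R" unfolding R_def
   using * by (auto intro!: continuous_intros exI[of _ "xs @ ys"] simp: trig_poly_append)
  show "(\<lambda>x. f x * g x) \<in> R" unfolding R_def
   using * trig_poly_mult[of xs ys] by (auto intro!: continuous_intros)
 next
  fix x y :: complex assume "x \<noteq> y"
  thus "\<exists>f\<in>R. f x \<noteq> f y" using Re Im by (meson complex_eqI)
 qed (rule const)
 define F where "F = G \<circ> (\<lambda>z. Arg2pi z / (2 * pi))"
 have "homotopic_loops (G ` {0..1}) G G"
  unfolding homotopic_loops_refl using cont per by (auto simp: path_def path_image_def pathfinish_def pathstart_def)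
 hence "continuous_on (sphere 0 1) F"
  unfolding F_def by (intro conjunct1[OF homotopic_with_imp_continuous[OF homotopic_loops_imp_homotopic_circlemaps]])
 from Stone_Weierstrass_basic[OF this e] obtain g where g: "g \<in> R" "\<And>z. z \<in> sphere 0 1 ==> \<bar>F z - g z\<bar> < e" by blast
 then obtain xs where xs: "\<And>x. of_real (g (ee x)) = trig_poly xs x" unfolding R_def by blast
 have "norm (of_real (G (frac x)) - trig_poly xs x) < e" for x
 proof -
  have "F (ee x) = G (frac x)" by (simp add: F_def Arg2pi_ee)
  hence "\<bar>G (frac x) - g (ee x)\<bar> < e" using g(2)[of "ee x"] by simp
  hence "norm (complex_of_real (G (frac x) - g (ee x))) < e" by (simp only: norm_of_real)
  thus ?thesis by (simp add: xs)
 qed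
 thus ?thesis by blast
qed

theorem trig_approx:
 fixes G :: "real => complex"
 assumes cont: "continuous_on {0..1} G" and per: "G 0 = G 1" and e: "e > 0"
 shows "\<exists>xs. \<forall>x. norm (G (frac x) - trig_poly xs x) < e"
proof -
 obtain xs where xs: "\<And>x. norm (of_real (Re (G (frac x))) - trig_poly xs x) < e/2"
  using real_trig_approx[of "\<lambda>x. Re (G x)" "e/2"] cont per e by (auto intro: continuous_intros)
 obtain ys where ys: "\<And>x. norm (of_real (Im (G (frac x))) - trig_poly ys x) < e/2"
  using real_trig_approx[of "\<lambda>x. Im (G x)" "e/2"] cont per e by (auto intro: continuous_intros)
 define zs where "zs = xs @ map (\<lambda>p. (fst p, \<i> * snd p)) ys"
 have zs: "trig_poly zs x = trig_poly xs x + \<i> * trig_poly ys x" for x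
 proof -
  have "trig_poly (map (\<lambda>p. (fst p, \<i> * snd p)) ys) x = \<i> * trig_poly ys x"
   by (induction ys) (auto simp: trig_poly_def algebra_simps)
  thus ?thesis by (simp add: zs_def trig_poly_append)
 qed
 have "norm (G (frac x) - trig_poly zs x) < e" for x
 proof -
  have "G (frac x) - trig_poly zs x = (of_real (Re (G (frac x))) - trig_poly xs x) + \<i> * (of_real (Im (G (frac x))) - trig_poly ys x)"
   unfolding zs by (subst complex_eq) (simp add: algebra_simps)
  also have "norm ... <= norm (of_real (Re (G (frac x))) - trig_poly xs x) + norm (of_real (Im (G (frac x))) - trig_poly ys x)"
   by (rule order.trans[OF norm_triangle_ineq]) (simp add: norm_mult)
  also have "... < e" using xs[of x] ys[of x] by linarith
  finally show ?thesis .
 qed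
 thus ?thesis by blast
qed

lemma average_divide: "average N (\<lambda>n. u n / c) = average N u / c"
 by (simp add: average_def sum_divide_distrib[symmetric])

text \<open>
  The average of a sequence depends continuously on the sequence in this distance, which tolerates
  errors on sets of small density.
\<close>

definition mean_dist :: "nat => (nat => complex) => (nat => complex) => real" where
 "mean_dist N u v = (\<Sum>n=1..N. norm (u n - v n)) / real N"

lemma norm_average_diff_le: "norm (average N u - average N v) <= mean_dist N u v"
proof -
 have "average N u - average N v = (\<Sum>n=1..N. u n - v n) / of_nat N"
  by (simp add: average_def sum_subtractf diff_divide_distrib)
 hence "norm (average N u - average N v) = norm (\<Sum>n=1..N. u n - v n) / real N"
  by (simp add: norm_divide)
 thus ?thesis by (simp add: mean_dist_def divide_right_mono norm_sum)
qed

lemma mean_dist_tendsto_0: assumes "(\<lambda>n. u n - v n) \<longlonglongrightarrow> 0" shows "(\<lambda>N. mean_dist N u v) \<longlonglongrightarrow> 0"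
proof -
 have "(\<lambda>n. complex_of_real (norm (u n - v n))) \<longlonglongrightarrow> of_real 0"
  by (intro tendsto_of_real tendsto_norm_zero assms)
 hence "(\<lambda>N. average N (\<lambda>n. complex_of_real (norm (u n - v n)))) \<longlonglongrightarrow> 0"
  by (intro average_tendsto_zero_of_null) simp
 hence "(\<lambda>N. norm (average N (\<lambda>n. complex_of_real (norm (u n - v n))))) \<longlonglongrightarrow> 0" by (rule tendsto_norm_zero)
 moreover have "norm (average N (\<lambda>n. complex_of_real (norm (u n - v n)))) = mean_dist N u v" for N
 proof -
  have "average N (\<lambda>n. complex_of_real (norm (u n - v n))) = of_real (mean_dist N u v)"
   by (simp add: average_def mean_dist_def)
  moreover have "mean_dist N u v >= 0" by (simp add: mean_dist_def sum_nonneg)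
  ultimately show ?thesis by (simp only: norm_of_real abs_of_nonneg)
 qed
 ultimately show ?thesis by simp
qed

lemma mean_dist_mult_le: assumes "\<And>n. norm (w n) <= C"
 shows "mean_dist N (\<lambda>n. w n * u n) (\<lambda>n. w n * v n) <= C * mean_dist N u v"
proof -
 have "(\<Sum>n=1..N. norm (w n * u n - w n * v n)) <= (\<Sum>n=1..N. C * norm (u n - v n))"
  unfolding right_diff_distrib[symmetric] norm_mult by (intro sum_mono mult_right_mono assms) auto
 hence "(\<Sum>n=1..N. norm (w n * u n - w n * v n)) / real N <= (C * (\<Sum>n=1..N. norm (u n - v n))) / real N"
  unfolding sum_distrib_left[symmetric] by (rule divide_right_mono) simp
 thus ?thesis by (simp add: mean_dist_def)
qed

lemma convergent_average_of_approx:
 assumes "\<And>e. e > 0 ==> \<exists>v. convergent (\<lambda>N. average N v) \<and> (\<forall>\<^sub>F N in sequentially. mean_dist N u v <= e)"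
 shows "convergent (\<lambda>N. average N u)"
proof (rule Cauchy_convergent, rule metric_CauchyI)
 fix e :: real assume e: "e > 0"
 then obtain v where v: "convergent (\<lambda>N. average N v)" "\<forall>\<^sub>F N in sequentially. mean_dist N u v <= e/4"
  using assms[of "e/4"] by auto
 from v(2) obtain N1 where N1: "\<And>N. N >= N1 ==> mean_dist N u v <= e/4" by (auto simp: eventually_sequentially)
 from v(1) have "Cauchy (\<lambda>N. average N v)" by (rule convergent_Cauchy)
 then obtain N2 where N2: "\<And>M N. M >= N2 ==> N >= N2 ==> dist (average M v) (average N v) < e/2"
  using e unfolding Cauchy_def by (meson half_gt_zero)
 have "dist (average M u) (average N u) < e" if "M >= max N1 N2" "N >= max N1 N2" for M N
 proof -
  have "dist (average K u) (average K v) <= e/4" if "K >= N1" for K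
   using norm_average_diff_le[of K u v] N1[OF that] by (simp add: dist_norm)
  from this[of M] this[of N] N2[of M N] that show ?thesis
   using dist_triangle[of "average M u" "average N u" "average M v"]
    dist_triangle[of "average M v" "average N u" "average N v"] dist_commute[of "average N v" "average N u"] by auto
 qed
 thus "\<exists>M. \<forall>m\<ge>M. \<forall>n\<ge>M. dist (average m u) (average n u) < e" by blast
qed

lemma average_ee_linear_tendsto_0:
 assumes "x \<notin> \<int>" shows "(\<lambda>N. average N (\<lambda>n. ee (x * real n))) \<longlonglongrightarrow> 0"
proof (rule average_tendsto_zero_of_ratio[where w="ee x" and C=1])
 have "ee (x * real (Suc n)) = ee x * ee (x * real n)" for n by (simp add: ee_add[symmetric] algebra_simps)
 thus "(\<lambda>n. ee (x * real (Suc n)) - ee x * ee (x * real n)) \<longlonglongrightarrow> 0" by simp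
qed (use assms in \<open>auto simp: ee_eq_1_iff\<close>)

lemma convergent_average_ee_linear: "convergent (\<lambda>N. average N (\<lambda>n. ee (x * real n)))"
proof (cases "x \<in> \<int>")
 case True
 then obtain k :: int where "x = of_int k" by (auto elim: Ints_cases)
 hence "ee (x * real n) = 1" for n using ee_of_int[of "k * int n"] by simp
 thus ?thesis using average_const_tendsto[of 1] by (auto simp: convergent_def)
next
 case False
 thus ?thesis using average_ee_linear_tendsto_0 by (auto simp: convergent_def)
qed

lemma convergent_average_sum_list:
 assumes "\<And>p. p \<in> set xs ==> convergent (\<lambda>N. average N (f p))"
 shows "convergent (\<lambda>N. average N (\<lambda>n. \<Sum>p\<leftarrow>xs. f p n))"
 using assms
proof (induction xs)
 case Nil show ?case by (simp add: average_def convergent_const)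
next
 case (Cons p xs)
 thus ?case by (simp add: average_add convergent_add)
qed

lemma convergent_average_periodic:
 assumes "Q > 0" "\<And>n. u (n + Q) = u n" shows "convergent (\<lambda>N. average N u)"
proof -
 have "convergent (\<lambda>N. average N (\<lambda>n. \<Sum>j<Q. (\<Sum>r<Q. u r * ee (- real j * real r / real Q)) / of_nat Q * ee (real j * real n / real Q)))"
  unfolding average_sum average_cmult
  using convergent_average_ee_linear[of "real _ / real Q"] by (intro convergent_sum convergent_mult convergent_const) simp
 moreover have "(\<lambda>n. \<Sum>j<Q. (\<Sum>r<Q. u r * ee (- real j * real r / real Q)) / of_nat Q * ee (real j * real n / real Q)) = u"
  by (rule ext, rule periodic_expand[of Q u, OF assms, symmetric])
 ultimately show ?thesis by simp
qed

text \<open>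
  The linear phases \<open>\<beta> n\<close>, for rational \<open>\<beta>\<close>, represent
  periodic factors.
\<close>

definition phase_comb :: "(nat => real) => (complex \<times> real \<times> real) list => nat => complex" where
 "phase_comb a xs n = (\<Sum>(z, c, \<beta>)\<leftarrow>xs. z * ee (c * a n + \<beta> * real n))"

text \<open>
  The factors \<open>e(t frac (a n))\<close> that arise from floors are approximated by
  exponentials in \<open>a n\<close> itself; \<open>tame\<close> says which sequences have
  convergent averages against such exponentials.
\<close>

definition approximable :: "(nat => real) => (nat => complex) => bool" where
 "approximable a w \<longleftrightarrow> (\<forall>e>0. \<exists>xs. (\<forall>(z, c, \<beta>)\<in>set xs. \<beta> \<in> \<rat>) \<and>
   (\<forall>\<^sub>F N in sequentially. mean_dist N w (phase_comb a xs) <= e))"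

definition tame :: "(nat => real) => (nat => real) => (nat => complex) => bool" where
 "tame a b u \<longleftrightarrow> (\<forall>c d. \<forall>\<beta>\<in>\<rat>. convergent (\<lambda>N. average N (\<lambda>n. u n * ee (c * a n + d * b n + \<beta> * real n))))"

lemma tame_commute: "tame a b u ==> tame b a u"
proof -
 assume t: "tame a b u"
 have "c * b n + d * a n + \<beta> * real n = d * a n + c * b n + \<beta> * real n" for c d \<beta> n by simp
 thus "tame b a u" using t unfolding tame_def by (simp only:) blast
qed

text \<open>
  Tameness is stable under multiplication by approximable factors, since the exponentials that
  approximate them only shift the frequencies. Floors are introduced by applying this twice.
\<close>

lemma tame_mult:
 assumes u: "tame a b u" and bd: "\<And>n. norm (u n) <= C" and w: "approximable a w"
 shows "tame a b (\<lambda>n. u n * w n)"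
 unfolding tame_def
proof (intro allI ballI)
 fix c d \<beta> :: real assume \<beta>: "\<beta> \<in> \<rat>"
 have C: "C >= 0" by (rule order.trans[OF norm_ge_zero bd[of 0]])
 show "convergent (\<lambda>N. average N (\<lambda>n. (u n * w n) * ee (c * a n + d * b n + \<beta> * real n)))"
 proof (rule convergent_average_of_approx)
  fix e :: real assume e: "e > 0"
  have "e / (C + 1) > 0" using e C by simp
  hence "\<exists>xs. (\<forall>(z, c, \<beta>)\<in>set xs. \<beta> \<in> \<rat>) \<and> (\<forall>\<^sub>F N in sequentially. mean_dist N w (phase_comb a xs) <= e / (C + 1))"
   using w unfolding approximable_def by (elim allE impE)
  then obtain xs where xs': "\<forall>(z, c, \<beta>)\<in>set xs. \<beta> \<in> \<rat>"
    and xs2: "\<forall>\<^sub>F N in sequentially. mean_dist N w (phase_comb a xs) <= e / (C + 1)"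
   by (elim exE conjE) (rule that)
  have xs: "snd (snd p) \<in> \<rat>" if "p \<in> set xs" for p using xs' that by (auto simp: case_prod_beta)
  define U where "U n = u n * ee (c * a n + d * b n + \<beta> * real n)" for n
  have U: "norm (U n) <= C" for n using bd[of n] by (simp add: U_def norm_mult)
  have eq: "U n * phase_comb a xs n = (\<Sum>p\<leftarrow>xs. fst p * (u n * ee ((c + fst (snd p)) * a n + d * b n + (\<beta> + snd (snd p)) * real n)))" for n
   unfolding phase_comb_def by (induction xs) (auto simp: U_def algebra_simps ee_add)
  show "\<exists>v. convergent (\<lambda>N. average N v) \<and> (\<forall>\<^sub>F N in sequentially. mean_dist N (\<lambda>n. (u n * w n) * ee (c * a n + d * b n + \<beta> * real n)) v <= e)"
  proof (intro exI conjI)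
   show "convergent (\<lambda>N. average N (\<lambda>n. U n * phase_comb a xs n))"
    unfolding eq
   proof (rule convergent_average_sum_list)
    fix p assume p: "p \<in> set xs"
    hence "\<beta> + snd (snd p) \<in> \<rat>" using xs \<beta> by (intro Rats_add) auto
    hence "convergent (\<lambda>N. average N (\<lambda>n. u n * ee ((c + fst (snd p)) * a n + d * b n + (\<beta> + snd (snd p)) * real n)))"
     using u unfolding tame_def by blast
    thus "convergent (\<lambda>N. average N (\<lambda>n. fst p * (u n * ee ((c + fst (snd p)) * a n + d * b n + (\<beta> + snd (snd p)) * real n))))"
     unfolding average_cmult by (intro convergent_mult convergent_const)
   qed
   have eqU: "(\<lambda>n. (u n * w n) * ee (c * a n + d * b n + \<beta> * real n)) = (\<lambda>n. U n * w n)" by (simp add: U_def mult_ac)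
   show "\<forall>\<^sub>F N in sequentially. mean_dist N (\<lambda>n. (u n * w n) * ee (c * a n + d * b n + \<beta> * real n)) (\<lambda>n. U n * phase_comb a xs n) <= e"
    unfolding eqU using xs2
   proof eventually_elim
    case (elim N)
    have "mean_dist N (\<lambda>n. U n * w n) (\<lambda>n. U n * phase_comb a xs n) <= C * mean_dist N w (phase_comb a xs)"
     by (rule mean_dist_mult_le[of U C, OF U])
    also have "... <= C * (e / (C + 1))" by (intro mult_left_mono elim C)
    also have "... <= e" using C e by (simp add: field_simps)
    finally show ?case .
   qed
  qed
 qed
qed

lemma approximable_of_periodic_limit:
 assumes Q: "Q > 0" and per: "\<And>n. v (n + Q) = v n" and lim: "(\<lambda>n. w n - v n) \<longlonglongrightarrow> 0"
 shows "approximable a w"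
 unfolding approximable_def
proof (intro allI impI)
 fix e :: real assume e: "e > 0"
 define c where "c j = (\<Sum>r<Q. v r * ee (- real j * real r / real Q)) / of_nat Q" for j
 define xs where "xs = map (\<lambda>j. (c j, 0::real, real j / real Q)) [0..<Q]"
 have "phase_comb a xs n = v n" for n
 proof -
  have "phase_comb a xs n = (\<Sum>j<Q. c j * ee (real j * real n / real Q))"
   by (simp add: phase_comb_def xs_def comp_def interv_sum_list_conv_sum_set_nat atLeast0LessThan)
  thus ?thesis using periodic_expand[of Q v n, OF Q per] by (simp add: c_def)
 qed
 hence "phase_comb a xs = v" by auto
 moreover have "\<forall>\<^sub>F N in sequentially. mean_dist N w v < e"
  by (rule order_tendstoD(2)[OF mean_dist_tendsto_0[OF lim] e])
 ultimately show "\<exists>xs. (\<forall>(z, c, \<beta>)\<in>set xs. \<beta> \<in> \<rat>) \<and> (\<forall>\<^sub>F N in sequentially. mean_dist N w (phase_comb a xs) <= e)"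
  by (intro exI[of _ xs] conjI) (auto simp: xs_def elim: eventually_mono)
qed

text \<open>
  Up to a factor 4, the Fejer kernel dominates the indicator of a neighbourhood of the integers of
  width \<open>1/m\<close>, while its average is \<open>1/m\<close>. This bounds how often a
  sequence comes close to an integer.
\<close>

lemma Fejer_kernel_ge:
 fixes x :: real
 assumes m: "m >= 1" and x: "\<bar>x - of_int j\<bar> <= 1 / (6 * real m)"
 shows "1 <= 4 * (norm ((\<Sum>k<m. ee (real k * x)) / of_nat m))\<^sup>2"
proof -
 define y where "y = x - of_int j"
 have e: "ee (real k * x) = ee (real k * y)" for k
 proof -
  have "ee (real k * x) = ee (real k * y + of_int (int k * j))" by (simp add: y_def algebra_simps)
  thus ?thesis by (simp only: ee_add ee_of_int mult_1_right)
 qed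
 have "real m / 2 = (\<Sum>k<m. 1/2)" by simp
 also have "... <= (\<Sum>k<m. Re (ee (real k * y)))"
 proof (rule sum_mono)
  fix k assume "k \<in> {..<m}"
  hence "real k * \<bar>y\<bar> <= real m * (1 / (6 * real m))" using x by (intro mult_mono) (auto simp: y_def)
  hence "\<bar>2 * pi * (real k * y)\<bar> <= pi / 3" using m by (simp add: abs_mult)
  hence "cos (pi / 3) <= cos \<bar>2 * pi * (real k * y)\<bar>" by (intro cos_monotone_0_pi_le) auto
  thus "1 / 2 <= Re (ee (real k * y))" by (simp add: ee_def cos_60)
 qed
 also have "... = Re (\<Sum>k<m. ee (real k * x))" by (simp add: e)
 also have "... <= norm (\<Sum>k<m. ee (real k * x))" by (rule complex_Re_le_cmod)
 finally have "1 / 2 <= norm ((\<Sum>k<m. ee (real k * x)) / of_nat m)" using m by (simp add: norm_divide field_simps)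
 hence "(1 / 2)\<^sup>2 <= (norm ((\<Sum>k<m. ee (real k * x)) / of_nat m))\<^sup>2" by (intro power_mono) auto
 thus ?thesis by (simp add: power2_eq_square)
qed

lemma average_Fejer_kernel:
 assumes ud: "\<And>k::int. k \<noteq> 0 ==> (\<lambda>N. average N (\<lambda>n. ee (of_int k * a n))) \<longlonglongrightarrow> 0" and m: "m >= 1"
 shows "(\<lambda>N. (\<Sum>n=1..N. (norm ((\<Sum>k<m. ee (real k * a n)) / of_nat m))\<^sup>2) / real N) \<longlonglongrightarrow> 1 / real m"
proof -
 define P where "P n = (\<Sum>k<m. ee (real k * a n)) / of_nat m" for n
 have "(\<lambda>N. \<Sum>k<m. \<Sum>l<m. average N (\<lambda>n. ee (of_int (int k - int l) * a n)) / (of_nat m * of_nat m)) \<longlonglongrightarrow>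
  (\<Sum>k<m. \<Sum>l<m. (if k = l then 1 else 0) / (of_nat m * of_nat m))"
 proof (intro tendsto_sum tendsto_divide tendsto_const)
  fix k l :: nat
  show "(\<lambda>N. average N (\<lambda>n. ee (of_int (int k - int l) * a n))) \<longlonglongrightarrow> (if k = l then 1 else 0)"
   using ud[of "int k - int l"] average_const_tendsto[of 1] by auto
 qed (use m in auto)
 moreover have "(\<Sum>k<m. \<Sum>l<m. (if k = l then 1 else 0) / (of_nat m * of_nat m)) = (1 / of_nat m :: complex)"
  using m by (simp add: sum_divide_distrib[symmetric])
 moreover have "(\<Sum>k<m. \<Sum>l<m. average N (\<lambda>n. ee (of_int (int k - int l) * a n)) / (of_nat m * of_nat m)) = average N (\<lambda>n. P n * cnj (P n))" for N
 proof -
  have "P n * cnj (P n) = (\<Sum>k<m. \<Sum>l<m. ee (of_int (int k - int l) * a n)) / (of_nat m * of_nat m)" for n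
   by (simp add: P_def sum_product left_diff_distrib ee_diff)
  thus ?thesis by (simp only: average_divide average_sum sum_divide_distrib)
 qed
 moreover have "average N (\<lambda>n. P n * cnj (P n)) = of_real ((\<Sum>n=1..N. (norm (P n))\<^sup>2) / real N)" for N
  by (simp only: average_def of_real_divide of_real_sum complex_norm_square of_real_of_nat_eq)
 ultimately have "(\<lambda>N. complex_of_real ((\<Sum>n=1..N. (norm (P n))\<^sup>2) / real N)) \<longlonglongrightarrow> of_real (1 / real m)" by simp
 thus ?thesis unfolding tendsto_of_real_iff P_def .
qed

text \<open>
  The function \<open>e(t frac x)\<close> jumps at the integers. Cut off near them it is
  continuous and periodic, hence approximated by trigonometric polynomials; for an equidistributed
  sequence the cutoff is felt only on a set of density \<open>O(1/m)\<close>.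
\<close>

lemma approximable_fractional_part:
 assumes ud: "\<And>k::int. k \<noteq> 0 ==> (\<lambda>N. average N (\<lambda>n. ee (of_int k * a n))) \<longlonglongrightarrow> 0"
 shows "approximable a (\<lambda>n. ee (t * frac (a n)))"
 unfolding approximable_def
proof (intro allI impI)
 fix e :: real assume e: "e > 0"
 define m where "m = Suc (nat \<lceil>8 / e\<rceil>)"
 have m: "m >= 1" "4 / real m <= e / 2"
 proof -
  have "8 / e <= real m" unfolding m_def of_nat_Suc by linarith
  moreover have "real m > 0" by (simp add: m_def)
  ultimately show "4 / real m <= e / 2" using e by (simp add: field_simps)
 qed (simp add: m_def)
 \<comment> \<open>the tent-shaped factor vanishes at the integers and is one outside distance \<open>1/(6m)\<close> of them\<close>
 define G where "G y = ee (t * y) * of_real (min 1 (min y (1 - y) * (6 * real m)))" for y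
 have "continuous_on {0..1} G" unfolding G_def by (intro continuous_intros)
 moreover have "G 0 = G 1" by (simp add: G_def)
 moreover have "e / 4 > 0" using e by simp
 ultimately obtain xs where xs: "\<And>x. norm (G (frac x) - trig_poly xs x) < e/4" using trig_approx by blast
 define K where "K n = (norm ((\<Sum>k<m. ee (real k * a n)) / of_nat m))\<^sup>2" for n
 have GK: "norm (ee (t * frac x) - G (frac x)) <= 4 * (norm ((\<Sum>k<m. ee (real k * x)) / of_nat m))\<^sup>2" for x
 proof -
  have fr: "0 <= frac x" "frac x < 1" by (auto simp: frac_ge_0 frac_lt_1)
  define r where "r = min (frac x) (1 - frac x)"
  have "norm (ee (t * frac x) - G (frac x)) = \<bar>1 - min 1 (r * (6 * real m))\<bar>"
  proof -
   have "ee (t * frac x) - G (frac x) = ee (t * frac x) * of_real (1 - min 1 (r * (6 * real m)))"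
    by (simp only: G_def r_def of_real_diff of_real_1 right_diff_distrib mult_1_right)
   thus ?thesis by (simp only: norm_mult norm_ee norm_of_real mult_1_left)
  qed
  also have "... <= 4 * (norm ((\<Sum>k<m. ee (real k * x)) / of_nat m))\<^sup>2"
  proof (cases "r * (6 * real m) >= 1")
   case True thus ?thesis by simp
  next
   case False
   hence r: "r <= 1 / (6 * real m)" using m by (simp add: field_simps)
   have "1 <= 4 * (norm ((\<Sum>k<m. ee (real k * x)) / of_nat m))\<^sup>2"
   proof (cases "frac x <= 1 - frac x")
    case True
    show ?thesis by (rule Fejer_kernel_ge[of m x "\<lfloor>x\<rfloor>"]) (use True r fr m in \<open>auto simp: r_def frac_def\<close>)
   next
    case f: False
    show ?thesis by (rule Fejer_kernel_ge[of m x "\<lfloor>x\<rfloor> + 1"]) (use f r fr m in \<open>auto simp: r_def frac_def\<close>)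
   qed
   moreover have "r * (6 * real m) >= 0" using fr by (simp add: r_def)
   hence "\<bar>1 - min 1 (r * (6 * real m))\<bar> <= 1" by (simp add: min_def)
   ultimately show ?thesis by linarith
  qed
  finally show ?thesis .
 qed
 define ys where "ys = map (\<lambda>p. (snd p, real_of_int (fst p), 0::real)) xs"
 have ys: "phase_comb a ys n = trig_poly xs (a n)" for n
  by (simp add: phase_comb_def ys_def trig_poly_def comp_def case_prod_beta)
 have "\<forall>\<^sub>F N in sequentially. (\<Sum>n=1..N. K n) / real N < 1 / real m + e / 16"
  unfolding K_def
 proof (rule order_tendstoD(2)[OF average_Fejer_kernel[of a, OF ud m(1)]])
  have "0 < e / 16" using e by simp
  thus "1 / real m < 1 / real m + e / 16" by (rule less_add_same_cancel1[THEN iffD2])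
 qed
 hence "\<forall>\<^sub>F N in sequentially. mean_dist N (\<lambda>n. ee (t * frac (a n))) (phase_comb a ys) <= e"
  using eventually_gt_at_top[of 0]
 proof eventually_elim
  case (elim N)
  have "(\<Sum>n=1..N. norm (ee (t * frac (a n)) - phase_comb a ys n)) <= (\<Sum>n=1..N. 4 * K n + e/4)"
  proof (rule sum_mono)
   fix n
   show "norm (ee (t * frac (a n)) - phase_comb a ys n) <= 4 * K n + e/4"
    using norm_triangle_ineq[of "ee (t * frac (a n)) - G (frac (a n))" "G (frac (a n)) - trig_poly xs (a n)"]
     GK[of "a n"] xs[of "a n"] unfolding ys K_def by simp
  qed
  also have "... = 4 * (\<Sum>n=1..N. K n) + e/4 * real N" by (simp add: sum.distrib sum_distrib_left)
  finally have "mean_dist N (\<lambda>n. ee (t * frac (a n))) (phase_comb a ys) <= (4 * (\<Sum>n=1..N. K n) + e/4 * real N) / real N"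
   unfolding mean_dist_def by (rule divide_right_mono) simp
  also have "... = 4 * ((\<Sum>n=1..N. K n) / real N) + e/4" using elim(2) by (simp add: field_simps)
  also have "... <= 4 * (1 / real m + e / 16) + e/4" using elim(1) by simp
  also have "... <= e" using m(2) by simp
  finally show ?case .
 qed
 moreover have "\<forall>(z, c, \<beta>)\<in>set ys. \<beta> \<in> \<rat>" by (auto simp: ys_def)
 ultimately show "\<exists>xs. (\<forall>(z, c, \<beta>)\<in>set xs. \<beta> \<in> \<rat>) \<and>
  (\<forall>\<^sub>F N in sequentially. mean_dist N (\<lambda>n. ee (t * frac (a n))) (phase_comb a xs) <= e)" by blast
qed

lemma frac_add_small:
 assumes "0 <= frac x + r" "frac x + r < 1" shows "frac (x + r) = frac x + r"
proof -
 have "x + r = of_int \<lfloor>x\<rfloor> + (frac x + r)" by (simp add: frac_def)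
 hence "\<lfloor>x + r\<rfloor> = \<lfloor>x\<rfloor>" using assms by (simp add: floor_unique)
 thus ?thesis by (simp add: frac_def)
qed

text \<open>
  If \<open>a\<close> approaches a sequence \<open>b\<close> that is periodic modulo one, then
  \<open>frac (a n)\<close> approaches \<open>frac (b n)\<close>, except where \<open>b n\<close>
  is an integer: there it tends to 0 or 1 according to the side from which \<open>b\<close> is
  approached. Eventual constancy of sign makes this side the same for all \<open>n\<close>.
\<close>

lemma approximable_fractional_part_almost_periodic:
 assumes Q: "Q > 0" and per: "\<And>n. ee (b (n + Q)) = ee (b n)"
  and lim: "(\<lambda>n. a n - b n) \<longlonglongrightarrow> 0"
  and sgn: "(\<forall>\<^sub>F n in sequentially. a n >= b n) \<or> (\<forall>\<^sub>F n in sequentially. a n < b n)"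
 shows "approximable a (\<lambda>n. ee (t * frac (a n)))"
proof -
 define neg where "neg \<longleftrightarrow> \<not> (\<forall>\<^sub>F n in sequentially. a n >= b n)"
 define \<phi> where "\<phi> n = (if neg \<and> frac (b n) = 0 then 1 else frac (b n))" for n
 have fper: "frac (b (n + Q)) = frac (b n)" for n
 proof -
  have "ee (b (n + Q) - b n) = ee (b n) * ee (- b n)" using per[of n] by (simp add: ee_diff cnj_ee)
  also have "... = 1" by (simp add: ee_add[symmetric])
  finally have "ee (b (n + Q) - b n) = 1" .
  hence "b (n + Q) - b n \<in> \<int>" by (simp only: ee_eq_1_iff)
  then obtain k :: int where "b (n + Q) = b n + of_int k" by (auto elim!: Ints_cases simp: algebra_simps)
  thus ?thesis by (simp add: frac_def)
 qed
 hence pper: "\<phi> (n + Q) = \<phi> n" for n by (simp add: \<phi>_def)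
 have per': "frac (b (n mod Q)) = frac (b n)" for n
 proof -
  have "frac (b (n mod Q + k * Q)) = frac (b (n mod Q))" for k
  proof (induction k)
   case (Suc k)
   thus ?case using fper[of "n mod Q + k * Q"] by (simp add: algebra_simps)
  qed simp
  from this[of "n div Q"] show ?thesis by (simp add: mod_mult_div_eq mult.commute)
 qed
 define S where "S = insert 1 ((\<lambda>r. 1 - frac (b r)) ` {..<Q} \<union> ((\<lambda>r. frac (b r)) ` {..<Q} - {0}))"
 \<comment> \<open>the distance to the nearest jump, positive since \<open>frac (b n)\<close> has finitely many values\<close>
 define \<eta> where "\<eta> = Min S"
 have S: "finite S" "S \<noteq> {}" by (auto simp: S_def)
 have "0 < z" if "z \<in> S" for z
  using that frac_lt_1[of "b _"] frac_ge_0[of "b _"] by (auto simp: S_def less_le)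
 hence \<eta>: "\<eta> > 0" unfolding \<eta>_def using S by (subst Min_gr_iff) auto
 have up: "frac (b n) <= 1 - \<eta>" for n
 proof -
  have "1 - frac (b n) \<in> S" unfolding S_def using per'[of n] Q by (auto intro!: image_eqI[of _ _ "n mod Q"])
  thus ?thesis using Min_le[OF S(1)] unfolding \<eta>_def by fastforce
 qed
 have low: "frac (b n) >= \<eta>" if "frac (b n) \<noteq> 0" for n
 proof -
  have "frac (b n) \<in> S" unfolding S_def using per'[of n] Q that by (auto intro!: image_eqI[of _ _ "n mod Q"])
  thus ?thesis using Min_le[OF S(1)] unfolding \<eta>_def by fastforce
 qed
 have "\<forall>\<^sub>F n in sequentially. norm (a n - b n) < \<eta>"
  by (rule order_tendstoD(2)[OF tendsto_norm_zero[OF lim] \<eta>])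
 moreover have "\<forall>\<^sub>F n in sequentially. (if neg then a n < b n else a n >= b n)"
 proof (cases neg)
  case True
  hence "\<forall>\<^sub>F n in sequentially. a n < b n" using sgn by (simp add: neg_def)
  thus ?thesis using True by simp
 next
  case False
  hence "\<forall>\<^sub>F n in sequentially. a n >= b n" by (simp add: neg_def)
  thus ?thesis using False by simp
 qed
 ultimately have ev: "\<forall>\<^sub>F n in sequentially. frac (a n) = \<phi> n + (a n - b n)"
 proof eventually_elim
  case (elim n)
  have r: "\<bar>a n - b n\<bar> < \<eta>" using elim(1) by simp
  show ?case
  proof (cases "neg \<and> frac (b n) = 0")
   case True
   hence ab: "a n - b n < 0" "b n = of_int \<lfloor>b n\<rfloor>" using elim(2) by (auto simp: frac_def)
   have "\<eta> <= 1" unfolding \<eta>_def using S by (intro Min_le) (auto simp: S_def)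
   have "\<lfloor>a n\<rfloor> = \<lfloor>b n\<rfloor> - 1" using ab r \<open>\<eta> <= 1\<close> by (intro floor_unique) auto
   hence "frac (a n) = 1 + (a n - b n)" using ab(2) by (simp add: frac_def)
   thus ?thesis using True by (simp add: \<phi>_def)
  next
   case False
   have "0 <= frac (b n) + (a n - b n)"
   proof (cases "frac (b n) = 0")
    case True
    hence "a n >= b n" using False elim(2) by auto
    thus ?thesis using True by simp
   next
    case f: False
    show ?thesis using low[OF f] r by linarith
   qed
   moreover have "frac (b n) + (a n - b n) < 1" using up[of n] r by linarith
   ultimately have "frac (b n + (a n - b n)) = frac (b n) + (a n - b n)" by (rule frac_add_small)
   thus ?thesis using False by (auto simp: \<phi>_def)
  qed
 qed
 show ?thesis
 proof (rule approximable_of_periodic_limit[OF Q, where v="\<lambda>n. ee (t * \<phi> n)"])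
  show "ee (t * \<phi> (n + Q)) = ee (t * \<phi> n)" for n by (simp add: pper)
  have "(\<lambda>n. ee (t * \<phi> n) * (ee (t * (a n - b n)) - 1)) \<longlonglongrightarrow> 0"
  proof (rule tendsto_norm_zero_cancel)
   have "(\<lambda>n. ee (t * (a n - b n)) - 1) \<longlonglongrightarrow> ee (t * 0) - 1" by (intro tendsto_intros lim)
   thus "(\<lambda>n. norm (ee (t * \<phi> n) * (ee (t * (a n - b n)) - 1))) \<longlonglongrightarrow> 0"
    using tendsto_norm_zero by (force simp: norm_mult)
  qed
  thus "(\<lambda>n. ee (t * frac (a n)) - ee (t * \<phi> n)) \<longlonglongrightarrow> 0"
  proof (rule Lim_transform_eventually)
   show "\<forall>\<^sub>F n in sequentially. ee (t * \<phi> n) * (ee (t * (a n - b n)) - 1) = ee (t * frac (a n)) - ee (t * \<phi> n)"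
    using ev
   proof eventually_elim
    case (elim n)
    have "t * frac (a n) = t * \<phi> n + t * (a n - b n)" by (simp add: elim distrib_left)
    hence "ee (t * frac (a n)) = ee (t * \<phi> n) * ee (t * (a n - b n))" by (simp only: ee_add)
    thus ?case by (simp add: algebra_simps)
   qed
  qed
 qed
qed

text \<open>
  \<open>e(t [a n]) = e(t a n) e(-t frac (a n))\<close>, and likewise for \<open>b\<close>.
\<close>

lemma convergent_average_floor:
 assumes one: "tame a b (\<lambda>_. 1)"
  and a: "\<And>t. approximable a (\<lambda>n. ee (t * frac (a n)))" and b: "\<And>t. approximable b (\<lambda>n. ee (t * frac (b n)))"
 shows "convergent (\<lambda>N. average N (\<lambda>n. ee (t * of_int \<lfloor>a n\<rfloor> + s * of_int \<lfloor>b n\<rfloor>)))"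
proof -
 have "tame a b (\<lambda>n. 1 * ee (- t * frac (a n)))"
  by (rule tame_mult[where u="\<lambda>_. 1" and C=1, OF one _ a]) simp
 hence t1: "tame b a (\<lambda>n. ee (- t * frac (a n)))" unfolding mult_1_left by (rule tame_commute)
 have tm: "tame b a (\<lambda>n. ee (- t * frac (a n)) * ee (- s * frac (b n)))"
  by (rule tame_mult[where u="\<lambda>n. ee (- t * frac (a n))" and C=1, OF t1 _ b]) simp
 have "convergent (\<lambda>N. average N (\<lambda>n. ee (- t * frac (a n)) * ee (- s * frac (b n)) * ee (s * b n + t * a n + 0 * real n)))"
  using tm unfolding tame_def using Rats_0 by blast
 moreover have "ee (- t * frac (a n)) * ee (- s * frac (b n)) * ee (s * b n + t * a n + 0 * real n) = ee (t * of_int \<lfloor>a n\<rfloor> + s * of_int \<lfloor>b n\<rfloor>)" for n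
  unfolding ee_add[symmetric] by (rule arg_cong[of _ _ ee]) (simp add: frac_def algebra_simps)
 ultimately show ?thesis by simp
qed

section \<open>Application to Hardy functions\<close>

text \<open>Monomials in place of real powers, for the induction on the order of differences.\<close>

definition poly_growth :: "(real => real) => bool" where
 "poly_growth f \<longleftrightarrow> (\<exists>C m. \<forall>\<^sub>F x in at_top. \<bar>f x\<bar> <= C * x ^ m)"

lemma poly_growth_add: assumes "poly_growth f" "poly_growth g" shows "poly_growth (\<lambda>x. f x + g x)"
proof -
 obtain C m D k where *: "\<forall>\<^sub>F x in at_top. \<bar>f x\<bar> <= C * x ^ m" "\<forall>\<^sub>F x in at_top. \<bar>g x\<bar> <= D * x ^ k"
  using assms unfolding poly_growth_def by blast
 have "\<forall>\<^sub>F x in at_top. \<bar>f x + g x\<bar> <= (\<bar>C\<bar> + \<bar>D\<bar>) * x ^ (max m k)"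
  using * eventually_ge_at_top[of 1]
 proof eventually_elim
  case (elim x)
  have "C * x ^ m <= \<bar>C\<bar> * x ^ (max m k)" "D * x ^ k <= \<bar>D\<bar> * x ^ (max m k)"
   using elim(3) by (intro mult_mono power_increasing; simp)+
  thus ?case using elim(1,2) abs_triangle_ineq[of "f x" "g x"] unfolding distrib_right by linarith
 qed
 thus ?thesis unfolding poly_growth_def by blast
qed

lemma poly_growth_cmult: assumes "poly_growth f" shows "poly_growth (\<lambda>x. c * f x)"
proof -
 obtain C m where *: "\<forall>\<^sub>F x in at_top. \<bar>f x\<bar> <= C * x ^ m"
  using assms unfolding poly_growth_def by blast
 hence "\<forall>\<^sub>F x in at_top. \<bar>c * f x\<bar> <= (\<bar>c\<bar> * C) * x ^ m"
  by eventually_elim (simp add: abs_mult mult.assoc mult_left_mono)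
 thus ?thesis unfolding poly_growth_def by blast
qed

lemma poly_growth_linear: "poly_growth (\<lambda>x. c * x)"
 unfolding poly_growth_def
 by (rule exI[of _ "\<bar>c\<bar>"], rule exI[of _ 1], rule eventually_mono[OF eventually_ge_at_top[of 0]]) (simp add: abs_mult)

lemma poly_growth_of_polynomial_growth_part:
 assumes "a \<in> polynomial_growth_part H" shows "poly_growth a"
proof -
 obtain d where d: "d > 0" "a \<in> O[at_top](\<lambda>x. x powr d)" using assms unfolding polynomial_growth_part_def by blast
 then obtain C where C: "C > 0" "\<forall>\<^sub>F x in at_top. norm (a x) <= C * norm (x powr d)" by (elim landau_o.bigE)
 define m where "m = nat \<lceil>d\<rceil>"
 have "d <= real m" unfolding m_def by linarith
 have "\<forall>\<^sub>F x in at_top. \<bar>a x\<bar> <= C * x ^ m"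
  using C(2) eventually_ge_at_top[of 1]
 proof eventually_elim
  case (elim x)
  have "x powr d <= x powr real m" using \<open>d <= real m\<close> elim(2) by (rule powr_mono)
  also have "... = x ^ m" using elim(2) by (simp add: powr_realpow)
  finally have "C * x powr d <= C * x ^ m" using C(1) by simp
  thus ?case using elim(1) by simp
 qed
 thus ?thesis unfolding poly_growth_def by blast
qed

context hardy_id
begin

lemma equidistributing_away':
 "f \<in> real_span H ==> poly_growth f ==> away f ==> equidistributing f"
 unfolding poly_growth_def using equidistributing_away by blast

lemma away_cmult_int:
 assumes "away f" "k \<noteq> 0" shows "away (\<lambda>x. of_int k * f x)"
 unfolding away_def
proof (intro allI notI)
 fix p assume "\<exists>C. \<forall>\<^sub>F x in at_top. \<bar>x * fdiff (\<lambda>x. of_int k * f x - rpoly p x) x\<bar> <= C"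
 then obtain C where C: "\<forall>\<^sub>F x in at_top. \<bar>x * fdiff (\<lambda>x. of_int k * f x - rpoly p x) x\<bar> <= C" by blast
 define q where "q = smult (1 / of_int k) p"
 have q: "rpoly p x = of_int k * rpoly q x" for x
  using assms(2) unfolding q_def rpoly_smult by (simp add: of_rat_divide)
 have "x * fdiff (\<lambda>x. of_int k * f x - rpoly p x) x = of_int k * (x * fdiff (\<lambda>x. f x - rpoly q x) x)" for x
  unfolding q by (simp add: fdiff_def algebra_simps)
 with C have "\<forall>\<^sub>F x in at_top. \<bar>of_int k\<bar> * \<bar>x * fdiff (\<lambda>x. f x - rpoly q x) x\<bar> <= C" by (simp add: abs_mult)
 hence "\<forall>\<^sub>F x in at_top. \<bar>x * fdiff (\<lambda>x. f x - rpoly q x) x\<bar> <= C / \<bar>of_int k\<bar>"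
  by eventually_elim (use assms(2) in \<open>simp add: field_simps\<close>)
 thus False using assms(1) unfolding away_def by blast
qed

text \<open>The two alternatives of the dichotomy match the two approximation lemmas.\<close>

lemma approximable_floor:
 assumes a: "a \<in> real_span H" "poly_growth a" and d: "almost_rational_polynomial a \<or> stays_log_away a"
 shows "approximable (\<lambda>n. a (real n)) (\<lambda>n. ee (t * frac (a (real n))))"
 using d
proof
 assume "stays_log_away a"
 hence "away a" by (rule away_of_stays_log_away)
 show ?thesis
 proof (rule approximable_fractional_part)
  fix k :: int assume "k \<noteq> 0"
  have "equidistributing (\<lambda>x. of_int k * a x)"
   by (intro equidistributing_away' away_cmult_int span_cmult poly_growth_cmult a \<open>k \<noteq> 0\<close> \<open>away a\<close>)
  thus "(\<lambda>N. average N (\<lambda>n. ee (of_int k * a (real n)))) \<longlonglongrightarrow> 0" by (simp add: equidistributing_def)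
 qed
next
 assume "almost_rational_polynomial a"
 then obtain p L where pL: "((\<lambda>x. a x - rpoly p x) \<longlongrightarrow> L) at_top" unfolding almost_rational_polynomial_def by blast
 obtain Q where Q: "Q > 0" "\<And>n. ee (rpoly p (real (n + Q))) = ee (rpoly p (real n))"
  using ee_rpoly_periodic[of p] by blast
 show ?thesis
 proof (rule approximable_fractional_part_almost_periodic[OF Q(1), where b="\<lambda>n. rpoly p (real n) + L"])
  show "ee (rpoly p (real (n + Q)) + L) = ee (rpoly p (real n) + L)" for n using Q(2) by (simp only: ee_add)
  have l0: "((\<lambda>x. a x - (rpoly p x + L)) \<longlongrightarrow> 0) at_top" using LIM_zero[OF pL] by (simp add: algebra_simps)
  thus "(\<lambda>n. a (real n) - (rpoly p (real n) + L)) \<longlonglongrightarrow> 0" by (rule filterlim_real_nat)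
  have "(\<lambda>x. a x - (rpoly p x + L)) \<in> real_span H" by (intro span_diff span_add span_rpoly span_const a)
  from span_ge_or_lt[OF this, of 0]
  show "(\<forall>\<^sub>F n in sequentially. a (real n) >= rpoly p (real n) + L) \<or> (\<forall>\<^sub>F n in sequentially. a (real n) < rpoly p (real n) + L)"
  proof
   assume "\<forall>\<^sub>F x in at_top. a x - (rpoly p x + L) >= 0"
   from eventually_real_nat[OF this] show ?thesis by (intro disjI1) (auto elim: eventually_mono)
  next
   assume "\<forall>\<^sub>F x in at_top. a x - (rpoly p x + L) < 0"
   from eventually_real_nat[OF this] show ?thesis by (intro disjI2) (auto elim: eventually_mono)
  qed
 qed
qed

text \<open>
  A rational polynomial does not change whether a function is almost a rational polynomial or
  logarithmically away, so the linear phase \<open>\<beta> n\<close> can be absorbed. In the first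
  case the exponentials are asymptotically periodic, in the second their averages vanish.
\<close>

lemma tame_one:
 assumes a: "a \<in> real_span H" "poly_growth a" and b: "b \<in> real_span H" "poly_growth b"
  and d: "\<And>c d. almost_rational_polynomial (\<lambda>x. c * a x - d * b x) \<or> stays_log_away (\<lambda>x. c * a x - d * b x)"
 shows "tame (\<lambda>n. a (real n)) (\<lambda>n. b (real n)) (\<lambda>_. 1)"
 unfolding tame_def
proof (intro allI ballI)
 fix c d \<beta> :: real assume "\<beta> \<in> \<rat>"
 then obtain r where r: "\<beta> = of_rat r" unfolding Rats_def by blast
 define p0 where "p0 = [:0, r:]"
 have p0: "rpoly p0 x = \<beta> * x" for x by (simp add: p0_def r)
 define f where "f x = c * a x + d * b x" for x
 have fs: "f \<in> real_span H" "poly_growth f" unfolding f_def[abs_def]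
  by (intro span_add span_cmult poly_growth_add poly_growth_cmult a b)+
 have fd: "almost_rational_polynomial f \<or> stays_log_away f" using d[of c "-d"] by (simp add: f_def[abs_def])
 show "convergent (\<lambda>N. average N (\<lambda>n. 1 * ee (c * a (real n) + d * b (real n) + \<beta> * real n)))"
  using fd
 proof
  assume "stays_log_away f"
  hence "away f" by (rule away_of_stays_log_away)
  have "equidistributing (\<lambda>x. f x + rpoly p0 x)"
  proof (rule equidistributing_away')
   show "poly_growth (\<lambda>x. f x + rpoly p0 x)" unfolding p0 by (intro poly_growth_add poly_growth_linear fs)
  qed (intro span_add span_rpoly away_add_rpoly fs \<open>away f\<close>)+
  thus ?thesis unfolding equidistributing_def convergent_def p0 f_def by (auto simp: mult.commute)
 next
  assume "almost_rational_polynomial f"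
  then obtain p L where pL: "((\<lambda>x. f x - rpoly p x) \<longlongrightarrow> L) at_top" unfolding almost_rational_polynomial_def by blast
  obtain Q where Q: "Q > 0" "\<And>n. ee (rpoly (p + p0) (real (n + Q))) = ee (rpoly (p + p0) (real n))"
   using ee_rpoly_periodic[of "p + p0"] by blast
  define v where "v n = ee (rpoly (p + p0) (real n)) * ee L" for n
  have "convergent (\<lambda>N. average N v)"
   by (rule convergent_average_periodic[OF Q(1)]) (simp only: v_def Q(2))
  have lim: "(\<lambda>n. ee (c * a (real n) + d * b (real n) + \<beta> * real n) - v n) \<longlonglongrightarrow> 0"
  proof (rule tendsto_norm_zero_cancel)
   have eq: "norm (ee (c * a (real n) + d * b (real n) + \<beta> * real n) - v n) = norm (ee (f (real n) - rpoly p (real n)) - ee L)" for n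
   proof -
    have "c * a (real n) + d * b (real n) + \<beta> * real n = rpoly (p + p0) (real n) + (f (real n) - rpoly p (real n))"
     unfolding rpoly_add p0 by (simp add: f_def)
    hence "ee (c * a (real n) + d * b (real n) + \<beta> * real n) - v n = ee (rpoly (p + p0) (real n)) * (ee (f (real n) - rpoly p (real n)) - ee L)"
     by (simp only: ee_add v_def right_diff_distrib)
    thus ?thesis by (simp only: norm_mult norm_ee mult_1_left)
   qed
   have "(\<lambda>n. ee (f (real n) - rpoly p (real n)) - ee L) \<longlonglongrightarrow> 0"
    by (intro LIM_zero tendsto_ee filterlim_real_nat[OF pL])
   thus "(\<lambda>n. norm (ee (c * a (real n) + d * b (real n) + \<beta> * real n) - v n)) \<longlonglongrightarrow> 0"
    unfolding eq by (rule tendsto_norm_zero)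
  qed
  show ?thesis
  proof (rule convergent_average_of_approx)
   fix e :: real assume "e > 0"
   have "\<forall>\<^sub>F N in sequentially. mean_dist N (\<lambda>n. 1 * ee (c * a (real n) + d * b (real n) + \<beta> * real n)) v < e"
    using order_tendstoD(2)[OF mean_dist_tendsto_0[OF lim] \<open>e > 0\<close>] by simp
   thus "\<exists>v. convergent (\<lambda>N. average N v) \<and> (\<forall>\<^sub>F N in sequentially. mean_dist N (\<lambda>n. 1 * ee (c * a (real n) + d * b (real n) + \<beta> * real n)) v <= e)"
    using \<open>convergent (\<lambda>N. average N v)\<close> by (intro exI[of _ v] conjI) (auto elim: eventually_mono)
  qed
 qed
qed

theorem convergent_average_floor_pair:
 assumes a: "a \<in> real_span H" "poly_growth a" and b: "b \<in> real_span H" "poly_growth b"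
  and d: "\<And>c d. almost_rational_polynomial (\<lambda>x. c * a x - d * b x) \<or> stays_log_away (\<lambda>x. c * a x - d * b x)"
 shows "convergent (\<lambda>N. average N (\<lambda>n. ee (t * of_int \<lfloor>a (real n)\<rfloor> + s * of_int \<lfloor>b (real n)\<rfloor>)))"
proof (rule convergent_average_floor)
 show "tame (\<lambda>n. a (real n)) (\<lambda>n. b (real n)) (\<lambda>_. 1)" by (rule tame_one[OF a b d])
 show "approximable (\<lambda>n. a (real n)) (\<lambda>n. ee (t * frac (a (real n))))" for t
  using d[of 1 0] by (intro approximable_floor a) simp
 have "\<And>c d. almost_rational_polynomial (\<lambda>x. - c * a x - - d * b x) \<or> stays_log_away (\<lambda>x. - c * a x - - d * b x)"
  by (rule d)
 thus "approximable (\<lambda>n. b (real n)) (\<lambda>n. ee (t * frac (b (real n))))" for t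
  using d[of 0 "-1"] by (intro approximable_floor b) simp
qed

lemma countable_rat_poly: "countable (UNIV :: rat poly set)"
proof (rule countableI')
 show "inj (\<lambda>p :: rat poly. to_nat (coeffs p))" by (intro injI) (simp add: coeffs_eq_iff)
qed

text \<open>
  An exceptional \<open>s\<close> comes with a rational polynomial \<open>p\<close> for which
  \<open>x (s a - p)'\<close> is bounded. Two different \<open>s\<close> cannot share the same
  \<open>p\<close>, since their difference would bound \<open>x a'\<close>; and there are
  countably many \<open>p\<close>.
\<close>

theorem countable_not_equidistributing:
 assumes a: "a \<in> real_span H" "poly_growth a" and fast: "\<not> (\<exists>C. \<forall>\<^sub>F x in at_top. \<bar>x * fdiff a x\<bar> <= C)"
 shows "countable {s. \<not> equidistributing (\<lambda>x. s * a x)}"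
proof -
 define B where "B p = {s. \<exists>C. \<forall>\<^sub>F x in at_top. \<bar>x * fdiff (\<lambda>x. s * a x - rpoly p x) x\<bar> <= C}" for p
 have sub: "{s. \<not> equidistributing (\<lambda>x. s * a x)} \<subseteq> (\<Union>p. B p)"
 proof
  fix s assume "s \<in> {s. \<not> equidistributing (\<lambda>x. s * a x)}"
  hence "\<not> away (\<lambda>x. s * a x)" using equidistributing_away'[OF span_cmult[OF a(1)] poly_growth_cmult[OF a(2)]] by blast
  thus "s \<in> (\<Union>p. B p)" unfolding away_def B_def by blast
 qed
 have cB: "countable (B p)" for p
 proof -
  have "s1 = s2" if s: "s1 \<in> B p" "s2 \<in> B p" for s1 s2
  proof (rule ccontr)
   assume ne: "s1 \<noteq> s2"
   obtain C1 C2 where C: "\<forall>\<^sub>F x in at_top. \<bar>x * fdiff (\<lambda>x. s1 * a x - rpoly p x) x\<bar> <= C1"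
    "\<forall>\<^sub>F x in at_top. \<bar>x * fdiff (\<lambda>x. s2 * a x - rpoly p x) x\<bar> <= C2" using s unfolding B_def by blast
   hence "\<forall>\<^sub>F x in at_top. \<bar>x * fdiff a x\<bar> <= (C1 + C2) / \<bar>s1 - s2\<bar>"
   proof eventually_elim
    case (elim x)
    have "(s1 - s2) * (x * fdiff a x) = x * fdiff (\<lambda>x. s1 * a x - rpoly p x) x - x * fdiff (\<lambda>x. s2 * a x - rpoly p x) x"
     by (simp add: fdiff_def algebra_simps)
    hence "\<bar>s1 - s2\<bar> * \<bar>x * fdiff a x\<bar> <= C1 + C2" unfolding abs_mult[symmetric] using elim by linarith
    thus ?case using ne by (simp add: field_simps)
   qed
   thus False using fast by blast
  qed
  hence "B p = {} \<or> (\<exists>s. B p = {s})" by blast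
  thus ?thesis by auto
 qed
 have "countable (\<Union>p. B p)" by (intro countable_UN countable_rat_poly cB)
 thus ?thesis by (rule countable_subset[OF sub])
qed

end

section \<open>Bounded convergence for positive functionals\<close>

text \<open>
  Dyadic convex combinations of the tail of the sequence. Closure under midpoints is all that the
  parallelogram identity needs.
\<close>

inductive_set midpoint_hull :: "(nat => 'a => real) => nat => ('a => real) set" for f n where
 base: "m >= n ==> f m \<in> midpoint_hull f n"
| mid: "g \<in> midpoint_hull f n ==> h \<in> midpoint_hull f n ==> (\<lambda>x. (g x + h x) * (1/2)) \<in> midpoint_hull f n"

lemma midpoint_hull_mono: assumes "n <= m" shows "midpoint_hull f m \<subseteq> midpoint_hull f n"
proof
 fix g assume "g \<in> midpoint_hull f m"
 thus "g \<in> midpoint_hull f n"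
 proof induction
  case (mid g h) show ?case by (rule midpoint_hull.mid[OF mid(3,4)])
 qed (use assms in \<open>auto intro: midpoint_hull.base\<close>)
qed

lemma midpoint_hull_le:
 assumes "g \<in> midpoint_hull f n" "\<And>m. m >= n ==> f m x <= e" shows "g x <= e"
 using assms(1) by induction (use assms(2) in auto)

locale positive_functional =
 fixes K :: "'a :: metric_space set" and P :: "('a => real) set" and L :: "('a => real) => real"
 assumes K: "compact K" and cont: "p \<in> P ==> continuous_on K p"
  and const: "(\<lambda>_. c) \<in> P" and add: "p \<in> P ==> q \<in> P ==> (\<lambda>x. p x + q x) \<in> P"
  and mult: "p \<in> P ==> q \<in> P ==> (\<lambda>x. p x * q x) \<in> P"
  and L_add: "p \<in> P ==> q \<in> P ==> L (\<lambda>x. p x + q x) = L p + L q"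
  and L_cmult: "p \<in> P ==> L (\<lambda>x. p x * c) = L p * c"
  and L_nonneg: "p \<in> P ==> (\<And>x. x \<in> K ==> p x >= 0) ==> L p >= 0"
begin

lemma cmult: "p \<in> P ==> (\<lambda>x. p x * c) \<in> P"
 by (rule mult[OF _ const])
lemma diff: assumes "p \<in> P" "q \<in> P" shows "(\<lambda>x. p x - q x) \<in> P"
 using add[OF assms(1) cmult[OF assms(2), of "-1"]] by simp
lemma L_diff: assumes "p \<in> P" "q \<in> P" shows "L (\<lambda>x. p x - q x) = L p - L q"
 using L_add[OF assms(1) cmult[OF assms(2), of "-1"]] L_cmult[OF assms(2), of "-1"] by simp
lemma L_mono: assumes "p \<in> P" "q \<in> P" "\<And>x. x \<in> K ==> p x <= q x" shows "L p <= L q"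
 using L_nonneg[OF diff[OF assms(2,1)]] L_diff[OF assms(2,1)] assms(3) by simp
lemma sum_in: "finite I ==> (\<And>i. i \<in> I ==> p i \<in> P) ==> (\<lambda>x. \<Sum>i\<in>I. p i x) \<in> P"
 by (induction I rule: finite_induct) (auto intro: add const)
lemma L_zero: "L (\<lambda>_. 0) = 0" using L_cmult[OF const[of 1], of 0] by simp
lemma L_sum: "finite I ==> (\<And>i. i \<in> I ==> p i \<in> P) ==> L (\<lambda>x. \<Sum>i\<in>I. p i x) = (\<Sum>i\<in>I. L (p i))"
 by (induction I rule: finite_induct) (auto simp: L_zero L_add sum_in)
lemma L_const: "L (\<lambda>_. c) = L (\<lambda>_. 1) * c"
 using L_cmult[OF const[of 1], of c] by simp

text \<open>
  Consider the quadratic form \<open>Q g = L(g^2)\<close> on the hull of the \<open>n\<close>-th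
  tail. Nearly minimal elements \<open>g_k\<close> of the hulls are close to one another by the
  parallelogram identity, so \<open>L |g_k - g_(k+1)|\<close> is summable. Since
  \<open>g_k \<rightarrow> 0\<close> pointwise, \<open>g_0\<close> is bounded by the sum of these
  differences, and by Dini's argument on the compact space already by a finite partial sum plus
  \<open>\<eta>\<close>. Hence \<open>L g_0\<close> is small, although \<open>L \<ge> e\<close> on
  the whole hull.
\<close>

lemma not_bounded_below:
 fixes f :: "nat => 'a => real"
 assumes f: "\<And>n. f n \<in> P" "\<And>n x. x \<in> K ==> 0 <= f n x" "\<And>n x. x \<in> K ==> f n x <= 1"
  and lim: "\<And>x. x \<in> K ==> (\<lambda>n. f n x) \<longlonglongrightarrow> 0" and e: "e > 0" "\<And>n. L (f n) >= e"
 shows False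
proof -
 let ?C = "midpoint_hull f"
 have CP: "g \<in> P" if "g \<in> ?C n" for g n
  using that
 proof induction
  case (mid g h) show ?case by (rule cmult[OF add[OF mid(3,4)]])
 qed (rule f)
 have Ce: "L g >= e" if "g \<in> ?C n" for g n
  using that
 proof induction
  case (mid g h)
  thus ?case using L_cmult[OF add[OF CP[OF mid(1)] CP[OF mid(2)]], of "1/2"] L_add[OF CP[OF mid(1)] CP[OF mid(2)]] by simp
 qed (rule e)
 have L1: "L (\<lambda>_. 1) >= 0" by (rule L_nonneg[OF const]) auto
 define Q where "Q g = L (\<lambda>x. g x * g x)" for g :: "'a => real"
 have Q0: "Q g >= 0" if "g \<in> P" for g unfolding Q_def by (rule L_nonneg[OF mult[OF that that]]) auto
 define d where "d n = Inf (Q ` ?C n)" for n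
 have bdd: "bdd_below (Q ` ?C n)" for n using Q0 CP by (intro bdd_belowI[of _ 0]) auto
 have ne: "Q ` ?C n \<noteq> {}" for n using midpoint_hull.base[of n n f] by blast
 have d_le: "d n <= Q g" if "g \<in> ?C n" for n g unfolding d_def using that bdd by (intro cInf_lower) auto
 have d_mono: "d n <= d m" if "n <= m" for n m
  unfolding d_def by (rule cInf_superset_mono[OF ne bdd]) (use midpoint_hull_mono[OF that] in blast)
 have d_bd: "d n <= L (\<lambda>_. 1)" for n
 proof -
  have "d n <= Q (f n)" by (rule d_le) (rule midpoint_hull.base, simp)
  also have "... <= L (\<lambda>_. 1)" unfolding Q_def
   by (rule L_mono[OF mult[OF f(1) f(1)] const]) (use f in \<open>simp add: mult_le_one\<close>)
  finally show ?thesis .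
 qed
 define D where "D = (SUP n. d n)"
 have bddD: "bdd_above (range d)" using d_bd by (intro bdd_aboveI[of _ "L (\<lambda>_. 1)"]) auto
 have dD: "d n <= D" for n unfolding D_def by (rule cSUP_upper[OF _ bddD]) simp
 define \<eta> where "\<eta> = e / (2 * (9 + 2 * L (\<lambda>_. 1)))"
 have \<eta>: "\<eta> > 0" using e L1 by (simp add: \<eta>_def)
 define \<epsilon> where "\<epsilon> k = \<eta>\<^sup>2 / 4 ^ k" for k :: nat
 have \<epsilon>: "\<epsilon> k > 0" "\<epsilon> (Suc k) <= \<epsilon> k" for k using \<eta> by (auto simp: \<epsilon>_def field_simps)
 have "\<exists>n. d n > D - \<epsilon> k" for k
  using less_cSUP_iff[OF UNIV_not_empty bddD, of "D - \<epsilon> k"] \<epsilon>(1)[of k] by (auto simp: D_def)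
 then obtain n0 where n0: "\<And>k. d (n0 k) > D - \<epsilon> k" by metis
 define N where "N k = (\<Sum>j\<le>k. n0 j) + k" for k
 have N: "k <= N k" "N k <= N (Suc k)" for k by (auto simp: N_def)
 have "n0 k <= (\<Sum>j\<le>k. n0 j)" for k by (rule member_le_sum) auto
 hence Nd: "d (N k) > D - \<epsilon> k" for k
  using n0[of k] d_mono[of "n0 k" "N k"] by (force simp: N_def intro: le_add1 order.trans)
 have "\<exists>g \<in> ?C (N k). Q g < d (N k) + \<epsilon> k" for k
  using cInf_lessD[OF ne, of "N k" "d (N k) + \<epsilon> k"] \<epsilon>(1)[of k] by (auto simp: d_def)
 then obtain g where g: "\<And>k. g k \<in> ?C (N k)" "\<And>k. Q (g k) < d (N k) + \<epsilon> k" by metis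
 have gP: "g k \<in> P" for k by (rule CP[OF g(1)])
 have gap: "L (\<lambda>x. (g k x - g (Suc k) x) * (g k x - g (Suc k) x)) <= 8 * \<epsilon> k" for k
 proof -
  let ?h = "\<lambda>x. (g k x + g (Suc k) x) * (1/2)"
  have "?h \<in> ?C (N k)" using g(1)[of k] g(1)[of "Suc k"] midpoint_hull_mono[OF N(2)[of k]] by (intro midpoint_hull.mid) auto
  hence h: "d (N k) <= Q ?h" by (rule d_le)
  have sq: "(\<lambda>x. g k x * g k x) \<in> P" "(\<lambda>x. g (Suc k) x * g (Suc k) x) \<in> P" "(\<lambda>x. ?h x * ?h x) \<in> P"
   by (intro mult gP cmult add)+
  have "(\<lambda>x. (g k x - g (Suc k) x) * (g k x - g (Suc k) x)) =
    (\<lambda>x. (g k x * g k x * 2 + g (Suc k) x * g (Suc k) x * 2) - (?h x * ?h x) * 4)"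
   by (auto simp: algebra_simps)
  hence "L (\<lambda>x. (g k x - g (Suc k) x) * (g k x - g (Suc k) x)) = Q (g k) * 2 + Q (g (Suc k)) * 2 - Q ?h * 4"
   unfolding Q_def by (simp only: L_diff[OF add[OF cmult[OF sq(1)] cmult[OF sq(2)]] cmult[OF sq(3)]]
     L_add[OF cmult[OF sq(1)] cmult[OF sq(2)]] L_cmult[OF sq(1)] L_cmult[OF sq(2)] L_cmult[OF sq(3)])
  also have "... <= (D + \<epsilon> k) * 2 + (D + \<epsilon> k) * 2 - (D - \<epsilon> k) * 4"
  proof (intro diff_mono add_mono mult_right_mono)
   show "Q (g k) <= D + \<epsilon> k" using g(2)[of k] dD[of "N k"] by linarith
   show "Q (g (Suc k)) <= D + \<epsilon> k" using g(2)[of "Suc k"] dD[of "N (Suc k)"] \<epsilon>(2)[of k] by linarith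
   show "D - \<epsilon> k <= Q ?h" using h Nd[of k] by (meson less_imp_le order.trans)
  qed auto
  finally show ?thesis by simp
 qed
 \<comment> \<open>the inequality of the means replaces \<open>\<bar>g_k - g_(k+1)\<bar>\<close>, which is not in the algebra, by the element \<open>v k\<close> of the algebra\<close>
 define \<eta>k where "\<eta>k k = \<eta> / 2 ^ k" for k :: nat
 have \<eta>k: "\<eta>k k > 0" for k using \<eta> by (simp add: \<eta>k_def)
 define v where "v k x = (g k x - g (Suc k) x) * (g k x - g (Suc k) x) * (1 / (2 * \<eta>k k)) + \<eta>k k / 2" for k x
 have vP: "v k \<in> P" for k unfolding v_def[abs_def] by (intro add cmult mult diff gP const)
 have v0: "v k x >= 0" for k x
 proof -
  have "(g k x - g (Suc k) x) * (g k x - g (Suc k) x) * (1 / (2 * \<eta>k k)) >= 0"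
   by (rule mult_nonneg_nonneg[OF zero_le_square]) (use \<eta>k[of k] in simp)
  thus ?thesis unfolding v_def using \<eta>k[of k] by simp
 qed
 have amgm: "g k x - g (Suc k) x <= v k x" for k x
 proof -
  have "0 <= (g k x - g (Suc k) x - \<eta>k k)\<^sup>2" by simp
  hence "(g k x - g (Suc k) x) * (2 * \<eta>k k) <= (g k x - g (Suc k) x) * (g k x - g (Suc k) x) + \<eta>k k * \<eta>k k"
   by (simp add: power2_eq_square algebra_simps)
  hence "g k x - g (Suc k) x <= ((g k x - g (Suc k) x) * (g k x - g (Suc k) x) + \<eta>k k * \<eta>k k) / (2 * \<eta>k k)"
   using \<eta>k[of k] by (subst pos_le_divide_eq) auto
  also have "... = v k x" using \<eta>k[of k] by (simp add: v_def field_simps)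
  finally show ?thesis .
 qed
 have tele: "g 0 x <= (\<Sum>k<m. v k x) + g m x" for m x
 proof (induction m)
  case (Suc m)
  thus ?case using amgm[of m x] by simp
 qed simp
 \<comment> \<open>Dini: otherwise points where the inequality fails for every \<open>m\<close> accumulate at a point \<open>y\<close> at which \<open>g m y\<close> does not tend to zero\<close>
 have "\<exists>m. \<forall>x\<in>K. g 0 x <= (\<Sum>k<m. v k x) + \<eta>"
 proof (rule ccontr)
  assume "\<not> ?thesis"
  hence "\<forall>m. \<exists>x\<in>K. g 0 x > (\<Sum>k<m. v k x) + \<eta>" by (auto simp: not_le)
  then obtain X where X: "\<And>m. X m \<in> K" "\<And>m. g 0 (X m) > (\<Sum>k<m. v k (X m)) + \<eta>" by metis
  obtain y r where yr: "y \<in> K" "strict_mono r" "(X \<circ> r) \<longlonglongrightarrow> y"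
   using K X(1) unfolding compact_def by blast
  have clim: "(\<lambda>n. p (X (r n))) \<longlonglongrightarrow> p y" if "p \<in> P" for p
   using continuous_on_tendsto_compose[OF cont[OF that] yr(3) yr(1)] X(1) by (simp add: comp_def)
  have "(\<Sum>k<m. v k y) + \<eta> <= g 0 y" for m
  proof (rule tendsto_le[OF sequentially_bot clim[OF gP[of 0]]])
   show "(\<lambda>n. (\<Sum>k<m. v k (X (r n))) + \<eta>) \<longlonglongrightarrow> (\<Sum>k<m. v k y) + \<eta>"
    by (intro tendsto_intros clim vP)
   show "\<forall>\<^sub>F n in sequentially. (\<Sum>k<m. v k (X (r n))) + \<eta> <= g 0 (X (r n))"
    using eventually_ge_at_top[of m]
   proof eventually_elim
    case (elim n)
    hence "m <= r n" using seq_suble[OF yr(2), of n] by linarith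
    hence "(\<Sum>k<m. v k (X (r n))) <= (\<Sum>k<r n. v k (X (r n)))" by (intro sum_mono2) (auto simp: v0)
    thus ?case using X(2)[of "r n"] by linarith
   qed
  qed
  moreover have "\<exists>m. g m y < \<eta>"
  proof -
   have "\<forall>\<^sub>F n in sequentially. f n y < \<eta> / 2" by (rule order_tendstoD(2)[OF lim[OF yr(1)]]) (use \<eta> in simp)
   then obtain m where m: "\<And>n. n >= m ==> f n y < \<eta> / 2" by (auto simp: eventually_sequentially)
   have "g m y <= \<eta> / 2"
    by (rule midpoint_hull_le[OF g(1)[of m]]) (use m N(1)[of m] in \<open>auto intro: less_imp_le\<close>)
   thus ?thesis using \<eta> by (intro exI[of _ m]) simp
  qed
  ultimately show False using tele[of y] by (metis add.commute add_le_cancel_left linorder_not_less order_trans)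
 qed
 then obtain m where m: "\<And>x. x \<in> K ==> g 0 x <= (\<Sum>k<m. v k x) + \<eta>" by blast
 have "e <= L (g 0)" by (rule Ce[OF g(1)])
 also have "... <= L (\<lambda>x. (\<Sum>k<m. v k x) + \<eta>)" by (intro L_mono gP add sum_in vP const m) auto
 also have "... = (\<Sum>k<m. L (v k)) + L (\<lambda>_. 1) * \<eta>"
  by (subst L_add) (auto intro: sum_in vP const simp: L_sum vP L_const[of \<eta>])
 also have "(\<Sum>k<m. L (v k)) <= (\<Sum>k<m. (4 * \<eta> + L (\<lambda>_. 1) * \<eta> / 2) * (1/2) ^ k)"
 proof (rule sum_mono)
  fix k
  have "L (v k) = L (\<lambda>x. (g k x - g (Suc k) x) * (g k x - g (Suc k) x)) * (1 / (2 * \<eta>k k)) + L (\<lambda>_. 1) * (\<eta>k k / 2)"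
   unfolding v_def[abs_def]
   by (simp only: L_add[OF cmult[OF mult[OF diff[OF gP gP] diff[OF gP gP]]] const]
     L_cmult[OF mult[OF diff[OF gP gP] diff[OF gP gP]]] L_const[of "\<eta>k k / 2"])
  also have "... <= 8 * \<epsilon> k * (1 / (2 * \<eta>k k)) + L (\<lambda>_. 1) * (\<eta>k k / 2)"
   using \<eta>k[of k] by (intro add_mono mult_right_mono gap) auto
  also have "8 * \<epsilon> k * (1 / (2 * \<eta>k k)) = 4 * \<eta> * (1/2) ^ k"
  proof -
   have "(4::real) ^ k = 2 ^ k * 2 ^ k" by (simp flip: power_mult_distrib)
   thus ?thesis using \<eta> by (simp add: \<epsilon>_def \<eta>k_def power2_eq_square field_simps power_one_over)
  qed
  also have "4 * \<eta> * (1/2) ^ k + L (\<lambda>_. 1) * (\<eta>k k / 2) = (4 * \<eta> + L (\<lambda>_. 1) * \<eta> / 2) * (1/2) ^ k"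
   by (simp add: \<eta>k_def power_one_over field_simps)
  finally show "L (v k) <= (4 * \<eta> + L (\<lambda>_. 1) * \<eta> / 2) * (1/2) ^ k" .
 qed
 also have "... = (4 * \<eta> + L (\<lambda>_. 1) * \<eta> / 2) * (\<Sum>k<m. (1/2) ^ k)" by (simp add: sum_distrib_left)
 also have "(\<Sum>k<m. (1/2::real) ^ k) <= 2"
  using sum_gp_strict[of "1/2::real" m] by simp
 also have "(4 * \<eta> + L (\<lambda>_. 1) * \<eta> / 2) * 2 + L (\<lambda>_. 1) * \<eta> = \<eta> * (8 + 2 * L (\<lambda>_. 1))"
  by (simp add: algebra_simps)
 also have "... < e"
 proof -
  have "\<eta> * (8 + 2 * L (\<lambda>_. 1)) <= \<eta> * (9 + 2 * L (\<lambda>_. 1))" using \<eta> by (intro mult_left_mono) auto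
  also have "... = e / 2" using L1 by (simp add: \<eta>_def field_simps)
  also have "... < e" using e by simp
  finally show ?thesis .
 qed
 finally show False using \<eta> L1 by (simp add: mult_left_mono)
qed

theorem bounded_convergence:
 fixes f :: "nat => 'a => real"
 assumes f: "\<And>n. f n \<in> P" "\<And>n x. x \<in> K ==> 0 <= f n x" "\<And>n x. x \<in> K ==> f n x <= 1"
  and lim: "\<And>x. x \<in> K ==> (\<lambda>n. f n x) \<longlonglongrightarrow> 0"
 shows "(\<lambda>n. L (f n)) \<longlonglongrightarrow> 0"
proof (rule ccontr)
 assume "\<not> ?thesis"
 then obtain e where e: "e > 0" "\<And>n. \<exists>m\<ge>n. e <= \<bar>L (f m)\<bar>"
  unfolding LIMSEQ_iff by (auto simp: not_less)
 have L0: "L (f m) >= 0" for m by (rule L_nonneg[OF f(1)]) (use f in auto)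
 obtain r where r: "\<And>n. r n >= n" "\<And>n. e <= L (f (r n))" using e(2) L0 by (metis abs_of_nonneg)
 have rt: "filterlim r at_top sequentially"
  by (rule filterlim_at_top_mono[OF filterlim_ident]) (use r in auto)
 show False
 proof (rule not_bounded_below[of "\<lambda>n. f (r n)" e])
  show "(\<lambda>n. f (r n) x) \<longlonglongrightarrow> 0" if "x \<in> K" for x
   using filterlim_compose[OF lim[OF that] rt] .
 qed (use f r e in auto)
qed

end

section \<open>Positive definite functions on the integer lattice\<close>

definition positive_definite2 :: "(int => int => complex) => bool" where
 "positive_definite2 c \<longleftrightarrow> (\<forall>(I :: (nat \<times> nat) set) z. finite I \<longrightarrow> (\<exists>r\<ge>0. (\<Sum>i\<in>I. \<Sum>j\<in>I. z i * cnj (z j) *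
   c (int (fst i) - int (fst j)) (int (snd i) - int (snd j))) = complex_of_real r))"

text \<open>
  A trigonometric polynomial on the torus is a list of triples of two frequencies and a
  coefficient; \<open>trig2_value c\<close> plays the role of its integral against a measure with
  Fourier transform \<open>c\<close>.
\<close>

definition trig2 :: "(int \<times> int \<times> complex) list => real \<times> real => complex" where
 "trig2 xs y = (\<Sum>(m, n, z)\<leftarrow>xs. z * ee (of_int m * fst y + of_int n * snd y))"

definition trig2_value :: "(int => int => complex) => (int \<times> int \<times> complex) list => complex" where
 "trig2_value c xs = (\<Sum>(m, n, z)\<leftarrow>xs. z * c m n)"

definition grid :: "nat => (nat \<times> nat) set" where
 "grid R = {..<2 * R} \<times> {..<2 * R}"
definition grid_point :: "nat => nat \<times> nat => real \<times> real" where
 "grid_point R g = (real (fst g) / real (2 * R), real (snd g) / real (2 * R))"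

text \<open>
  The Fejer sum of \<open>c\<close> of order \<open>R\<close> at a point of the grid of mesh
  \<open>1 / (2R)\<close>. As discrete measures these weights have Fourier coefficients that tend
  to \<open>c\<close>, and positive definiteness makes them nonnegative.
\<close>

definition Fejer_weight :: "(int => int => complex) => nat => nat \<times> nat => complex" where
 "Fejer_weight c R g = (\<Sum>i\<in>{..<R} \<times> {..<R}. \<Sum>j\<in>{..<R} \<times> {..<R}.
   ee (- (real (fst i) * fst (grid_point R g) + real (snd i) * snd (grid_point R g))) *
   cnj (ee (- (real (fst j) * fst (grid_point R g) + real (snd j) * snd (grid_point R g)))) *
   c (int (fst i) - int (fst j)) (int (snd i) - int (snd j))) / of_nat ((2 * R)\<^sup>2 * R\<^sup>2)"

lemma Fejer_weight_nonneg:
 assumes "positive_definite2 c" shows "\<exists>r\<ge>0. Fejer_weight c R g = complex_of_real r"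
proof -
 obtain r where "r >= 0" "(\<Sum>i\<in>{..<R} \<times> {..<R}. \<Sum>j\<in>{..<R} \<times> {..<R}.
   ee (- (real (fst i) * fst (grid_point R g) + real (snd i) * snd (grid_point R g))) *
   cnj (ee (- (real (fst j) * fst (grid_point R g) + real (snd j) * snd (grid_point R g)))) *
   c (int (fst i) - int (fst j)) (int (snd i) - int (snd j))) = complex_of_real r"
  using assms[unfolded positive_definite2_def, rule_format, of "{..<R} \<times> {..<R}"
    "\<lambda>i. ee (- (real (fst i) * fst (grid_point R g) + real (snd i) * snd (grid_point R g)))"] by auto
 thus ?thesis unfolding Fejer_weight_def
  by (intro exI[of _ "r / real ((2 * R)\<^sup>2 * R\<^sup>2)"]) simp
qed

lemma sum_roots_of_unity:
 assumes "Q > 0"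
 shows "(\<Sum>p<Q. ee (of_int j * (real p / real Q))) = (if int Q dvd j then of_nat Q else 0)"
proof -
 define w where "w = ee (of_int j / real Q)"
 have e: "ee (of_int j * (real p / real Q)) = w ^ p" for p
  unfolding w_def ee_mult_of_nat[symmetric] by (simp add: mult.commute)
 have "w ^ Q = 1" unfolding w_def ee_mult_of_nat[symmetric] using assms by simp
 moreover have "w = 1 \<longleftrightarrow> int Q dvd j"
 proof -
  have "w = 1 \<longleftrightarrow> of_int j / real Q \<in> \<int>" by (simp add: w_def ee_eq_1_iff)
  also have "... \<longleftrightarrow> int Q dvd j"
   using of_int_div_of_int_in_Ints_iff[of j "int Q", where 'a=real] assms by simp
  finally show ?thesis .
 qed
 ultimately show ?thesis unfolding e using sum_gp_strict[of w Q] by auto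
qed

text \<open>The triangular weights of the Fejer kernel.\<close>

lemma card_diff_eq:
 assumes "\<bar>m\<bar> <= int R"
 shows "(\<Sum>k<R. \<Sum>k'<R. if int k - int k' = m then 1 else 0) = (of_int (int R - \<bar>m\<bar>) :: complex)"
proof -
 have "(\<Sum>k<R. \<Sum>k'<R. if int k - int k' = m then 1 else 0) = (\<Sum>k<R. if 0 <= int k - m \<and> int k - m < int R then 1 else (0::complex))"
 proof (rule sum.cong[OF refl])
  fix k assume "k \<in> {..<R}"
  have "(\<Sum>k'<R. if int k - int k' = m then 1 else 0) = (\<Sum>k'<R. if k' = nat (int k - m) \<and> 0 <= int k - m then 1 else (0::complex))"
   by (intro sum.cong) auto
  also have "... = (if 0 <= int k - m \<and> int k - m < int R then 1 else 0)"
   by (auto simp: if_distrib sum.delta zless_nat_eq_int_zless nat_less_iff)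
  finally show "(\<Sum>k'<R. if int k - int k' = m then 1 else 0) = (if 0 <= int k - m \<and> int k - m < int R then 1 else (0::complex))" .
 qed
 also have "... = of_nat (card {k. k < R \<and> 0 <= int k - m \<and> int k - m < int R})"
  by (simp add: sum.If_cases Int_def lessThan_def)
 also have "{k. k < R \<and> 0 <= int k - m \<and> int k - m < int R} = {nat (max 0 m)..<nat (min (int R) (int R + m))}"
  by auto
 also have "of_nat (card ...) = (of_int (int R - \<bar>m\<bar>) :: complex)"
  using assms by (auto simp: of_nat_diff max_def min_def of_nat_nat)
 finally show ?thesis .
qed

lemma sum_factor: "(\<Sum>i\<in>A \<times> B. f (fst i) * h (snd i)) = sum f A * (sum h B :: complex)"
 by (simp add: sum_product sum.cartesian_product case_prod_unfold)

lemma sum_rotate: "(\<Sum>g\<in>G. \<Sum>i\<in>I. \<Sum>j\<in>J. X g i j) = (\<Sum>i\<in>I. \<Sum>j\<in>J. \<Sum>g\<in>G. X g i j)"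
proof -
 have "(\<Sum>g\<in>G. \<Sum>i\<in>I. \<Sum>j\<in>J. X g i j) = (\<Sum>i\<in>I. \<Sum>g\<in>G. \<Sum>j\<in>J. X g i j)" by (rule sum.swap)
 also have "... = (\<Sum>i\<in>I. \<Sum>j\<in>J. \<Sum>g\<in>G. X g i j)" by (intro sum.cong refl sum.swap)
 finally show ?thesis .
qed

text \<open>
  Orthogonality of the characters of the grid picks the terms with index difference
  \<open>(m, n)\<close>. As all index differences are less than \<open>R\<close> in absolute value
  and the grid has \<open>2R\<close> points per side, no aliasing occurs.
\<close>

lemma Fejer_weight_exponential:
 assumes R: "R > 0" and m: "\<bar>m\<bar> < int R" and n: "\<bar>n\<bar> < int R"
 shows "(\<Sum>g\<in>grid R. Fejer_weight c R g * ee (of_int m * fst (grid_point R g) + of_int n * snd (grid_point R g)))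
  = c m n * of_int (int R - \<bar>m\<bar>) / of_nat R * (of_int (int R - \<bar>n\<bar>) / of_nat R)"
proof -
 define Q where "Q = 2 * R"
 have Q: "Q > 0" using R by (simp add: Q_def)
 define I where "I = {..<R} \<times> {..<R}"
 define C where "C i j = c (int (fst i) - int (fst j)) (int (snd i) - int (snd j))" for i j :: "nat \<times> nat"
 have inner: "(\<Sum>g\<in>grid R. ee (- (real (fst i) * fst (grid_point R g) + real (snd i) * snd (grid_point R g))) *
   cnj (ee (- (real (fst j) * fst (grid_point R g) + real (snd j) * snd (grid_point R g)))) *
   ee (of_int m * fst (grid_point R g) + of_int n * snd (grid_point R g))) =
   of_nat (Q\<^sup>2) * ((if int (fst i) - int (fst j) = m then 1 else 0) * (if int (snd i) - int (snd j) = n then 1 else 0))"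
  if "i \<in> I" "j \<in> I" for i j
 proof -
  define a where "a = m - (int (fst i) - int (fst j))"
  define b where "b = n - (int (snd i) - int (snd j))"
  have "(\<Sum>g\<in>grid R. ee (- (real (fst i) * fst (grid_point R g) + real (snd i) * snd (grid_point R g))) *
    cnj (ee (- (real (fst j) * fst (grid_point R g) + real (snd j) * snd (grid_point R g)))) *
    ee (of_int m * fst (grid_point R g) + of_int n * snd (grid_point R g))) =
    (\<Sum>g\<in>grid R. ee (of_int a * (real (fst g) / real Q)) * ee (of_int b * (real (snd g) / real Q)))"
   unfolding cnj_ee ee_add[symmetric]
   by (intro sum.cong refl arg_cong[of _ _ ee]) (simp add: a_def b_def grid_point_def Q_def algebra_simps add_divide_distrib diff_divide_distrib)
  also have "... = (\<Sum>p<Q. ee (of_int a * (real p / real Q))) * (\<Sum>q<Q. ee (of_int b * (real q / real Q)))"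
   unfolding grid_def Q_def[symmetric] sum_product sum.cartesian_product by (simp add: case_prod_beta)
  also have "... = (if int Q dvd a then of_nat Q else 0) * (if int Q dvd b then of_nat Q else 0)"
   by (simp only: sum_roots_of_unity[OF Q])
  also have "int Q dvd a \<longleftrightarrow> int (fst i) - int (fst j) = m"
  proof -
   have "\<bar>a\<bar> < int Q" using that m by (auto simp: a_def I_def Q_def)
   hence "int Q dvd a \<longleftrightarrow> a = 0" using dvd_imp_le_int[of a "int Q"] by auto
   thus ?thesis by (auto simp: a_def)
  qed
  also have "int Q dvd b \<longleftrightarrow> int (snd i) - int (snd j) = n"
  proof -
   have "\<bar>b\<bar> < int Q" using that n by (auto simp: b_def I_def Q_def)
   hence "int Q dvd b \<longleftrightarrow> b = 0" using dvd_imp_le_int[of b "int Q"] by auto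
   thus ?thesis by (auto simp: b_def)
  qed
  finally show ?thesis by (simp add: power2_eq_square)
 qed
 have "(\<Sum>g\<in>grid R. Fejer_weight c R g * ee (of_int m * fst (grid_point R g) + of_int n * snd (grid_point R g)))
  = (\<Sum>g\<in>grid R. (\<Sum>i\<in>I. \<Sum>j\<in>I. C i j * (ee (- (real (fst i) * fst (grid_point R g) + real (snd i) * snd (grid_point R g))) *
   cnj (ee (- (real (fst j) * fst (grid_point R g) + real (snd j) * snd (grid_point R g)))) *
   ee (of_int m * fst (grid_point R g) + of_int n * snd (grid_point R g)))) / of_nat (Q\<^sup>2 * R\<^sup>2))"
  unfolding Fejer_weight_def I_def[symmetric] C_def[symmetric] Q_def[symmetric]
  by (simp only: times_divide_eq_left sum_distrib_right) (simp only: mult_ac)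
 also have "... = (\<Sum>i\<in>I. \<Sum>j\<in>I. C i j * (\<Sum>g\<in>grid R. ee (- (real (fst i) * fst (grid_point R g) + real (snd i) * snd (grid_point R g))) *
   cnj (ee (- (real (fst j) * fst (grid_point R g) + real (snd j) * snd (grid_point R g)))) *
   ee (of_int m * fst (grid_point R g) + of_int n * snd (grid_point R g)))) / of_nat (Q\<^sup>2 * R\<^sup>2)"
  unfolding sum_divide_distrib[symmetric] sum_distrib_left
  by (intro arg_cong2[of _ _ _ _ "(/)"] refl sum_rotate)
 also have "... = (\<Sum>i\<in>I. \<Sum>j\<in>I. C i j * (of_nat (Q\<^sup>2) * ((if int (fst i) - int (fst j) = m then 1 else 0) * (if int (snd i) - int (snd j) = n then 1 else 0)))) / of_nat (Q\<^sup>2 * R\<^sup>2)"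
  by (intro arg_cong2[of _ _ _ _ "(/)"] sum.cong refl arg_cong2[of _ _ _ _ "(*)"] inner)
 also have "... = (\<Sum>i\<in>I. \<Sum>j\<in>I. of_nat (Q\<^sup>2) * c m n * ((if int (fst i) - int (fst j) = m then 1 else 0) * (if int (snd i) - int (snd j) = n then 1 else 0))) / of_nat (Q\<^sup>2 * R\<^sup>2)"
  by (intro arg_cong2[of _ _ _ _ "(/)"] sum.cong refl) (auto simp: C_def)
 also have "... = of_nat (Q\<^sup>2) * c m n * (\<Sum>i\<in>I. \<Sum>j\<in>I. ((if int (fst i) - int (fst j) = m then 1 else 0) * (if int (snd i) - int (snd j) = n then 1 else 0))) / of_nat (Q\<^sup>2 * R\<^sup>2)"
  by (simp only: sum_distrib_left)
 also have "(\<Sum>i\<in>I. \<Sum>j\<in>I. ((if int (fst i) - int (fst j) = m then 1 else 0) * (if int (snd i) - int (snd j) = n then 1 else (0::complex))))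
  = (\<Sum>k<R. \<Sum>k'<R. if int k - int k' = m then 1 else 0) * (\<Sum>l<R. \<Sum>l'<R. if int l - int l' = n then 1 else 0)"
 proof -
  have "(\<Sum>i\<in>I. \<Sum>j\<in>I. ((if int (fst i) - int (fst j) = m then 1 else 0) * (if int (snd i) - int (snd j) = n then 1 else (0::complex))))
   = (\<Sum>i\<in>I. (\<Sum>k'<R. if int (fst i) - int k' = m then 1 else 0) * (\<Sum>l'<R. if int (snd i) - int l' = n then 1 else 0))"
   by (intro sum.cong refl) (simp only: I_def sum_product sum.cartesian_product case_prod_unfold)
  also have "... = (\<Sum>k<R. \<Sum>k'<R. if int k - int k' = m then 1 else 0) * (\<Sum>l<R. \<Sum>l'<R. if int l - int l' = n then 1 else 0)"
   unfolding I_def by (rule sum_factor[of "\<lambda>k. \<Sum>k'<R. if int k - int k' = m then 1 else 0" "\<lambda>l. \<Sum>l'<R. if int l - int l' = n then 1 else 0"])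
  finally show ?thesis .
 qed
 also have "... = of_int (int R - \<bar>m\<bar>) * of_int (int R - \<bar>n\<bar>)"
  using m n by (simp only: card_diff_eq less_imp_le)
 finally show ?thesis using Q R by (simp add: power2_eq_square)
qed

lemma Fejer_weight_tendsto:
 "(\<lambda>R. \<Sum>g\<in>grid R. Fejer_weight c R g * ee (of_int m * fst (grid_point R g) + of_int n * snd (grid_point R g))) \<longlonglongrightarrow> c m n"
proof (rule Lim_transform_eventually)
 have r: "(\<lambda>R. of_int (int R - \<bar>k\<bar>) / of_nat R :: complex) \<longlonglongrightarrow> 1" for k :: int
 proof -
  have "(\<lambda>R. 1 - of_int \<bar>k\<bar> / of_nat R :: complex) \<longlonglongrightarrow> 1 - 0" by (intro tendsto_diff tendsto_const lim_const_over_n)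
  hence "(\<lambda>R. 1 - of_int \<bar>k\<bar> / of_nat R :: complex) \<longlonglongrightarrow> 1" by simp
  thus ?thesis
  proof (rule Lim_transform_eventually)
   show "\<forall>\<^sub>F R in sequentially. 1 - of_int \<bar>k\<bar> / of_nat R = (of_int (int R - \<bar>k\<bar>) / of_nat R :: complex)"
    using eventually_gt_at_top[of 0] by eventually_elim (simp add: diff_divide_distrib)
  qed
 qed
 show "(\<lambda>R. c m n * (of_int (int R - \<bar>m\<bar>) / of_nat R) * (of_int (int R - \<bar>n\<bar>) / of_nat R)) \<longlonglongrightarrow> c m n"
  using tendsto_mult[OF tendsto_mult[OF tendsto_const[of "c m n"] r[of m]] r[of n]] by simp
 show "\<forall>\<^sub>F R in sequentially. c m n * (of_int (int R - \<bar>m\<bar>) / of_nat R) * (of_int (int R - \<bar>n\<bar>) / of_nat R) =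
  (\<Sum>g\<in>grid R. Fejer_weight c R g * ee (of_int m * fst (grid_point R g) + of_int n * snd (grid_point R g)))"
  using eventually_gt_at_top[of "nat \<bar>m\<bar> + nat \<bar>n\<bar>"]
 proof eventually_elim
  case (elim R)
  show ?case by (subst Fejer_weight_exponential) (use elim in auto)
 qed
qed

lemma Fejer_weight_tendsto_trig2:
 "(\<lambda>R. \<Sum>g\<in>grid R. Fejer_weight c R g * trig2 xs (grid_point R g)) \<longlonglongrightarrow> trig2_value c xs"
proof (induction xs)
 case Nil show ?case by (simp add: trig2_def trig2_value_def)
next
 case (Cons p xs)
 obtain m n z where p: "p = (m, n, z)" by (cases p)
 have "(\<lambda>R. z * (\<Sum>g\<in>grid R. Fejer_weight c R g * ee (of_int m * fst (grid_point R g) + of_int n * snd (grid_point R g)))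
   + (\<Sum>g\<in>grid R. Fejer_weight c R g * trig2 xs (grid_point R g))) \<longlonglongrightarrow> z * c m n + trig2_value c xs"
  by (intro tendsto_add tendsto_mult_left Fejer_weight_tendsto Cons)
 moreover have "z * (\<Sum>g\<in>grid R. Fejer_weight c R g * ee (of_int m * fst (grid_point R g) + of_int n * snd (grid_point R g)))
   + (\<Sum>g\<in>grid R. Fejer_weight c R g * trig2 xs (grid_point R g)) = (\<Sum>g\<in>grid R. Fejer_weight c R g * trig2 (p # xs) (grid_point R g))" for R
  by (simp add: p trig2_def sum_distrib_left sum.distrib[symmetric] algebra_simps)
 ultimately show ?case by (simp add: p trig2_value_def)
qed

definition trig2_prod :: "(int \<times> int \<times> complex) list => (int \<times> int \<times> complex) list => (int \<times> int \<times> complex) list" where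
 "trig2_prod xs ys = concat (map (\<lambda>(m, n, z). map (\<lambda>(m', n', z'). (m + m', n + n', z * z')) ys) xs)"

definition trig2_cnj :: "(int \<times> int \<times> complex) list => (int \<times> int \<times> complex) list" where
 "trig2_cnj xs = map (\<lambda>(m, n, z). (- m, - n, cnj z)) xs"

lemma trig2_append: "trig2 (xs @ ys) y = trig2 xs y + trig2 ys y"
 by (simp add: trig2_def)

lemma trig2_prod: "trig2 (trig2_prod xs ys) y = trig2 xs y * trig2 ys y"
proof (induction xs)
 case Nil show ?case by (simp add: trig2_def trig2_prod_def)
next
 case (Cons p xs)
 obtain m n z where p: "p = (m, n, z)" by (cases p)
 have 1: "trig2 (map (\<lambda>(m', n', z'). (m + m', n + n', z * z')) ys) y = z * ee (of_int m * fst y + of_int n * snd y) * trig2 ys y"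
 proof (induction ys)
  case Nil show ?case by (simp add: trig2_def)
 next
  case (Cons q ys)
  obtain m' n' z' where q: "q = (m', n', z')" by (cases q)
  have "ee (of_int (m + m') * fst y + of_int (n + n') * snd y) = ee (of_int m * fst y + of_int n * snd y) * ee (of_int m' * fst y + of_int n' * snd y)"
   unfolding ee_add[symmetric] by (rule arg_cong[of _ _ ee]) (simp add: algebra_simps)
  thus ?case using Cons by (simp add: trig2_def q algebra_simps)
 qed
 have "trig2 (trig2_prod (p # xs) ys) y = trig2 (map (\<lambda>(m', n', z'). (m + m', n + n', z * z')) ys) y + trig2 (trig2_prod xs ys) y"
  by (simp add: trig2_prod_def p trig2_append)
 thus ?case unfolding 1 Cons by (simp add: p trig2_def algebra_simps)
qed

lemma trig2_cnj: "trig2 (trig2_cnj xs) y = cnj (trig2 xs y)"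
proof (induction xs)
 case (Cons p xs)
 obtain m n z where p: "p = (m, n, z)" by (cases p)
 have e: "ee (of_int (-m) * fst y + of_int (-n) * snd y) = cnj (ee (of_int m * fst y + of_int n * snd y))"
  unfolding cnj_ee by (rule arg_cong[of _ _ ee]) simp
 have "trig2 (trig2_cnj (p # xs)) y = cnj z * ee (of_int (-m) * fst y + of_int (-n) * snd y) + trig2 (trig2_cnj xs) y"
  by (simp only: p trig2_def trig2_cnj_def list.map case_prod_conv sum_list.Cons)
 also have "... = cnj (trig2 (p # xs) y)" unfolding e Cons by (simp add: p trig2_def)
 finally show ?case .
qed (simp add: trig2_def trig2_cnj_def)

lemma continuous_on_trig2: "continuous_on S (trig2 xs)"
proof (induction xs)
 case Nil
 have "trig2 [] = (\<lambda>_. 0)" by (auto simp: trig2_def)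
 thus ?case by simp
next
 case (Cons p xs)
 obtain m n z where p: "p = (m, n, z)" by (cases p)
 have "trig2 (p # xs) = (\<lambda>y. z * ee (of_int m * fst y + of_int n * snd y) + trig2 xs y)"
  by (auto simp: trig2_def p)
 thus ?case using Cons by (auto intro!: continuous_intros)
qed

lemma trig2_value_append: "trig2_value c (xs @ ys) = trig2_value c xs + trig2_value c ys"
 by (simp add: trig2_value_def)

lemma trig2_value_prod_cnj:
 "trig2_value c (trig2_prod xs (trig2_cnj ys)) = (\<Sum>(m, n, z)\<leftarrow>xs. \<Sum>(m', n', z')\<leftarrow>ys. z * cnj z' * c (m - m') (n - n'))"
proof (induction xs)
 case Nil show ?case by (simp add: trig2_value_def trig2_prod_def)
next
 case (Cons p xs)
 obtain m n z where p: "p = (m, n, z)" by (cases p)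
 have 1: "trig2_value c (map (\<lambda>(m', n', z'). (m + m', n + n', z * z')) (trig2_cnj ys)) = (\<Sum>(m', n', z')\<leftarrow>ys. z * cnj z' * c (m - m') (n - n'))"
  by (induction ys) (auto simp: trig2_value_def trig2_cnj_def)
 have "trig2_value c (trig2_prod (p # xs) (trig2_cnj ys)) = trig2_value c (map (\<lambda>(m', n', z'). (m + m', n + n', z * z')) (trig2_cnj ys)) + trig2_value c (trig2_prod xs (trig2_cnj ys))"
  by (simp add: trig2_prod_def p trig2_value_append)
 thus ?case unfolding 1 Cons by (simp add: p)
qed

definition real_trig2 :: "(real \<times> real => real) set" where
 "real_trig2 = {p. \<exists>xs. \<forall>y. complex_of_real (p y) = trig2 xs y}"

text \<open>
  The limit of the discrete measures. Taking a limit, rather than defining the functional by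
  coefficients, makes positivity obvious and does not require coefficients to be unique.
\<close>

definition state :: "(int => int => complex) => (real \<times> real => real) => real" where
 "state c p = Re (lim (\<lambda>R. \<Sum>g\<in>grid R. Fejer_weight c R g * complex_of_real (p (grid_point R g))))"

lemma state_eq: assumes "\<And>y. complex_of_real (p y) = trig2 xs y" shows "state c p = Re (trig2_value c xs)"
 unfolding state_def assms using limI[OF Fejer_weight_tendsto_trig2] by metis

lemma positive_functional_state:
 assumes c: "positive_definite2 c"
 shows "positive_functional ({0..1} \<times> {0..1}) real_trig2 (state c)"
proof
 show "compact ({0..1::real} \<times> {0..1::real})" by (intro compact_Times compact_Icc)
next
 fix p assume "p \<in> real_trig2"
 then obtain xs where xs: "\<And>y. complex_of_real (p y) = trig2 xs y" unfolding real_trig2_def by blast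
 have "p = (\<lambda>y. Re (trig2 xs y))" unfolding xs[symmetric] by simp
 thus "continuous_on ({0..1} \<times> {0..1}) p" using continuous_on_trig2 by (auto intro: continuous_on_Re)
next
 fix a :: real
 have "\<forall>y. complex_of_real a = trig2 [(0, 0, of_real a)] y" by (simp add: trig2_def)
 thus "(\<lambda>_. a) \<in> real_trig2" unfolding real_trig2_def by blast
next
 fix p q assume "p \<in> real_trig2" "q \<in> real_trig2"
 then obtain xs ys where xy: "\<And>y. complex_of_real (p y) = trig2 xs y" "\<And>y. complex_of_real (q y) = trig2 ys y"
  unfolding real_trig2_def by blast
 have a: "complex_of_real (p y + q y) = trig2 (xs @ ys) y" for y by (simp add: trig2_append xy)
 thus "(\<lambda>x. p x + q x) \<in> real_trig2" unfolding real_trig2_def by blast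
 show "(\<lambda>x. p x * q x) \<in> real_trig2" unfolding real_trig2_def
  by (rule CollectI, rule exI[of _ "trig2_prod xs ys"]) (simp add: trig2_prod xy)
 show "state c (\<lambda>x. p x + q x) = state c p + state c q"
  by (simp only: state_eq[OF a] state_eq[OF xy(1)] state_eq[OF xy(2)] trig2_value_append plus_complex.sel)
next
 fix p :: "real \<times> real => real" and a :: real assume "p \<in> real_trig2"
 then obtain xs where xs: "\<And>y. complex_of_real (p y) = trig2 xs y" unfolding real_trig2_def by blast
 have a: "trig2 (map (\<lambda>(m, n, z). (m, n, z * of_real a)) xs) y = trig2 xs y * of_real a" for y
  by (induction xs) (auto simp: trig2_def algebra_simps)
 have v: "trig2_value c (map (\<lambda>(m, n, z). (m, n, z * of_real a)) xs) = trig2_value c xs * of_real a"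
  by (induction xs) (auto simp: trig2_value_def algebra_simps)
 have "complex_of_real (p y * a) = trig2 (map (\<lambda>(m, n, z). (m, n, z * of_real a)) xs) y" for y
  by (simp add: a xs)
 from state_eq[OF this, of c] show "state c (\<lambda>x. p x * a) = state c p * a"
  by (simp only: state_eq[OF xs] v) simp
next
 fix p :: "real \<times> real => real" assume p: "p \<in> real_trig2" and nn: "\<And>y. y \<in> {0..1} \<times> {0..1} ==> p y >= 0"
 then obtain xs where xs: "\<And>y. complex_of_real (p y) = trig2 xs y" unfolding real_trig2_def by blast
 have "(\<lambda>R. Re (\<Sum>g\<in>grid R. Fejer_weight c R g * trig2 xs (grid_point R g))) \<longlonglongrightarrow> Re (trig2_value c xs)"
  by (intro tendsto_Re Fejer_weight_tendsto_trig2)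
 moreover have "Re (\<Sum>g\<in>grid R. Fejer_weight c R g * trig2 xs (grid_point R g)) >= 0" for R
  unfolding Re_sum
 proof (rule sum_nonneg)
  fix g assume "g \<in> grid R"
  hence "grid_point R g \<in> {0..1} \<times> {0..1}" by (auto simp: grid_def grid_point_def)
  hence "p (grid_point R g) >= 0" by (rule nn)
  moreover obtain r where "r >= 0" "Fejer_weight c R g = complex_of_real r" using Fejer_weight_nonneg[OF c] by blast
  ultimately show "Re (Fejer_weight c R g * trig2 xs (grid_point R g)) >= 0" by (simp add: xs[symmetric])
 qed
 ultimately have "Re (trig2_value c xs) >= 0" by (intro LIMSEQ_le_const) auto
 thus "state c p >= 0" by (simp add: state_eq[OF xs])
qed

text \<open>
  For a correlation function \<open>c\<close> the left-hand side is the squared \<open>L2\<close>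
  norm of a combination of translates, so pointwise convergence of multipliers gives convergence
  in norm.
\<close>

theorem spectral_null_sequence:
 assumes c: "positive_definite2 c" and bd: "\<And>i y. norm (trig2 (X i) y) <= 1"
  and lim: "\<And>y. (\<lambda>i. trig2 (X i) y) \<longlonglongrightarrow> 0"
 shows "(\<lambda>i. Re (trig2_value c (trig2_prod (X i) (trig2_cnj (X i))))) \<longlonglongrightarrow> 0"
proof -
 interpret positive_functional "{0..1} \<times> {0..1}" real_trig2 "state c" by (rule positive_functional_state[OF c])
 define p where "p i y = (norm (trig2 (X i) y))\<^sup>2" for i y
 have pe: "complex_of_real (p i y) = trig2 (trig2_prod (X i) (trig2_cnj (X i))) y" for i y
  unfolding p_def complex_norm_square trig2_prod trig2_cnj ..
 have "(\<lambda>i. state c (p i)) \<longlonglongrightarrow> 0"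
 proof (rule bounded_convergence)
  show "p i \<in> real_trig2" for i unfolding real_trig2_def using pe by blast
  show "0 <= p i y" for i y by (simp add: p_def)
  show "p i y <= 1" for i y unfolding p_def using bd by (simp add: power_le_one)
  show "(\<lambda>i. p i y) \<longlonglongrightarrow> 0" for y
   using tendsto_power[OF tendsto_norm_zero[OF lim[of y]], of 2] by (simp add: p_def)
 qed
 thus ?thesis by (simp add: state_eq[OF pe])
qed

text \<open>
  The Fejer weights, projected to the first coordinate, are probability measures on
  \<open>[0, 1)\<close>, hence tight. A weak limit has the right Fourier coefficients; reducing it
  modulo one moves a possible atom from 1 to 0.
\<close>

theorem Herglotz:
 assumes c: "positive_definite2 (\<lambda>m n. c m)" and c0: "c 0 = 1"
 shows "\<exists>\<sigma>. real_distribution \<sigma> \<and> (AE x in \<sigma>. 0 <= x \<and> x < 1) \<and> (\<forall>k. (\<integral>x. ee (of_int k * x) \<partial>\<sigma>) = c k)"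
proof -
 define W where "W R p = (if p < 2 * R then \<Sum>q<2 * R. Re (Fejer_weight (\<lambda>m n. c m) R (p, q)) else 0)" for R p
 have re: "complex_of_real (Re (Fejer_weight (\<lambda>m n. c m) R g)) = Fejer_weight (\<lambda>m n. c m) R g"
  and W0': "Re (Fejer_weight (\<lambda>m n. c m) R g) >= 0" for R g
  using Fejer_weight_nonneg[OF c, of R g] by auto
 have W0: "W R p >= 0" for R p unfolding W_def using W0' by (auto intro: sum_nonneg)
 have Wsum: "(\<Sum>p<2 * R. complex_of_real (W R p) * f (real p / real (2 * R))) = (\<Sum>g\<in>grid R. Fejer_weight (\<lambda>m n. c m) R g * f (fst (grid_point R g)))" for R f
  by (simp add: W_def grid_def grid_point_def sum.cartesian_product[symmetric] re sum_distrib_right case_prod_unfold)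
    (simp add: sum.cartesian_product re case_prod_unfold)
 have W1: "(\<Sum>p<2 * R. W R p) = 1" if "R > 0" for R
 proof -
  have "(\<Sum>g\<in>grid R. Fejer_weight (\<lambda>m n. c m) R g * ee (of_int 0 * fst (grid_point R g) + of_int 0 * snd (grid_point R g))) = 1"
   using that by (subst Fejer_weight_exponential) (auto simp: c0)
  hence "complex_of_real (\<Sum>p<2 * R. W R p) = of_real 1" using Wsum[of R "\<lambda>_. 1"] by simp
  thus ?thesis by (simp only: of_real_eq_iff)
 qed
 define \<mu> where "\<mu> R = distr (measure_pmf (embed_pmf (W (Suc R)))) borel (\<lambda>p. real p / real (2 * Suc R))" for R
 have pm: "pmf (embed_pmf (W (Suc R))) p = W (Suc R) p" for R p
 proof (rule pmf_embed_pmf[OF W0])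
  have "(\<integral>\<^sup>+ x. ennreal (W (Suc R) x) \<partial>count_space UNIV) = (\<Sum>p<2 * Suc R. ennreal (W (Suc R) p))"
   by (rule nn_integral_count_space') (auto simp: W_def)
  also have "... = ennreal 1" unfolding sum_ennreal[OF W0] using W1[of "Suc R"] by simp
  finally show "(\<integral>\<^sup>+ x. ennreal (W (Suc R) x) \<partial>count_space UNIV) = 1" by simp
 qed
 have setp: "set_pmf (embed_pmf (W (Suc R))) \<subseteq> {..<2 * Suc R}" for R
  by (auto simp: set_pmf_iff pm W_def split: if_splits)
 have rd: "real_distribution (\<mu> R)" for R
  unfolding \<mu>_def by (intro prob_space.real_distribution_distr[OF prob_space_measure_pmf]) simp
 have int: "(\<integral>x. ee (of_int k * x) \<partial>\<mu> R) = (\<Sum>g\<in>grid (Suc R). Fejer_weight (\<lambda>m n. c m) (Suc R) g * ee (of_int k * fst (grid_point (Suc R) g) + of_int 0 * snd (grid_point (Suc R) g)))" for k R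
 proof -
  have "(\<integral>x. ee (of_int k * x) \<partial>\<mu> R) = (\<integral>p. ee (of_int k * (real p / real (2 * Suc R))) \<partial>measure_pmf (embed_pmf (W (Suc R))))"
   unfolding \<mu>_def by (rule integral_distr) auto
  also have "... = (\<Sum>p<2 * Suc R. pmf (embed_pmf (W (Suc R))) p *\<^sub>R ee (of_int k * (real p / real (2 * Suc R))))"
   by (rule integral_measure_pmf) (use setp[of R] in auto)
  also have "... = (\<Sum>p<2 * Suc R. complex_of_real (W (Suc R) p) * ee (of_int k * (real p / real (2 * Suc R))))"
   by (simp only: pm scaleR_conv_of_real)
  also note Wsum[of "Suc R" "\<lambda>x. ee (of_int k * x)"]
  finally show ?thesis by simp
 qed
 have tight: "tight \<mu>" unfolding tight_def
 proof (intro conjI allI impI rd)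
  fix e :: real assume "e > 0"
  have "measure (\<mu> R) {-1<..1} = 1" for R
  proof -

   have "measure (\<mu> R) {-1<..1} = measure (measure_pmf (embed_pmf (W (Suc R)))) ((\<lambda>p. real p / real (2 * Suc R)) -` {-1<..1})"
    unfolding \<mu>_def by (subst measure_distr) auto
   also have "... = 1"
   proof (rule measure_pmf.prob_eq_1[THEN iffD2])
    show "AE p in measure_pmf (embed_pmf (W (Suc R))). p \<in> (\<lambda>p. real p / real (2 * Suc R)) -` {-1<..1}"
    proof (rule AE_pmfI)
     fix p assume "p \<in> set_pmf (embed_pmf (W (Suc R)))"
     hence "p < 2 * Suc R" using setp[of R] by auto
     hence "real p / real (2 * Suc R) <= 1" by simp
     moreover have "real p / real (2 * Suc R) > -1" by (rule less_le_trans[of _ 0]) auto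
     ultimately show "p \<in> (\<lambda>p. real p / real (2 * Suc R)) -` {-1<..1}" by simp
    qed
   qed simp
   finally show ?thesis .
  qed
  thus "\<exists>a b. a < b \<and> (\<forall>n. 1 - e < measure (\<mu> n) {a<..b})" using \<open>e > 0\<close> by (intro exI[of _ "-1"] exI[of _ 1]) auto
 qed
 obtain r M where M: "strict_mono (r :: nat => nat)" "real_distribution M" "weak_conv_m (\<mu> \<circ> id \<circ> r) M"
  using tight_imp_convergent_subsubsequence[OF tight strict_mono_id] by blast
 interpret M: real_distribution M by fact
 have lim: "(\<integral>x. ee (of_int k * x) \<partial>M) = c k" for k
 proof -
  have "(\<lambda>n. \<integral>x. ee (of_int k * x) \<partial>(\<mu> \<circ> id \<circ> r) n) \<longlonglongrightarrow> (\<integral>x. ee (of_int k * x) \<partial>M)"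
  proof (rule weak_conv_imp_integral_bdd_continuous_conv[where B=1])
   show "isCont (\<lambda>x. ee (of_int k * x)) x" for x
    using isCont_o2[OF _ isCont_ee, of x "\<lambda>x. of_int k * x"] by simp
  qed (use M rd in \<open>auto simp: comp_def\<close>)
  moreover have "(\<lambda>n. \<integral>x. ee (of_int k * x) \<partial>\<mu> n) \<longlonglongrightarrow> c k"
   unfolding int by (rule LIMSEQ_Suc[OF Fejer_weight_tendsto[where c="\<lambda>m n. c m"]])
  from LIMSEQ_subseq_LIMSEQ[OF this M(1)] have "(\<lambda>n. \<integral>x. ee (of_int k * x) \<partial>(\<mu> \<circ> id \<circ> r) n) \<longlonglongrightarrow> c k" by (simp add: comp_def)
  ultimately show ?thesis by (rule LIMSEQ_unique)
 qed
 have fM [measurable]: "frac \<in> M \<rightarrow>\<^sub>M borel" unfolding frac_def[abs_def] by measurable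
 define \<sigma> where "\<sigma> = distr M borel frac"
 show ?thesis
 proof (intro exI[of _ \<sigma>] conjI allI)
  show "real_distribution \<sigma>" unfolding \<sigma>_def by (rule M.real_distribution_distr) simp
  show "AE x in \<sigma>. 0 <= x \<and> x < 1" unfolding \<sigma>_def by (subst AE_distr_iff) (auto simp: frac_ge_0 frac_lt_1)
  fix k
  have "(\<integral>x. ee (of_int k * x) \<partial>\<sigma>) = (\<integral>x. ee (of_int k * frac x) \<partial>M)" unfolding \<sigma>_def by (rule integral_distr) auto
  also have "ee (of_int k * frac x) = ee (of_int k * x)" for x
  proof -
   have "of_int k * frac x = of_int k * x - of_int (k * \<lfloor>x\<rfloor>)" by (simp add: frac_def algebra_simps)
   thus ?thesis by (simp only: ee_diff ee_of_int complex_cnj_one mult_1_right)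
  qed
  hence "(\<integral>x. ee (of_int k * frac x) \<partial>M) = (\<integral>x. ee (of_int k * x) \<partial>M)" by simp
  finally show "(\<integral>x. ee (of_int k * x) \<partial>\<sigma>) = c k" using lim by simp
 qed
qed

section \<open>Ergodic averages of commuting transformations\<close>

definition mp_map :: "'a measure => ('a => 'a) => bool" where
 "mp_map M S \<longleftrightarrow> S \<in> M \<rightarrow>\<^sub>M M \<and> distr M M S = M"

lemma mp_map_measurable: "mp_map M S ==> S \<in> M \<rightarrow>\<^sub>M M" by (simp add: mp_map_def)
lemma mp_map_space: "mp_map M S ==> x \<in> space M ==> S x \<in> space M"
 using measurable_space[of S M M] by (auto simp: mp_map_def)

lemma mp_map_comp: assumes "mp_map M S" "mp_map M U" shows "mp_map M (S \<circ> U)"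
 unfolding mp_map_def
proof
 show "S \<circ> U \<in> M \<rightarrow>\<^sub>M M" using assms by (auto simp: mp_map_def intro: measurable_comp)
 have "distr M M (S \<circ> U) = distr (distr M M U) M S" using assms by (subst distr_distr) (auto simp: mp_map_def)
 thus "distr M M (S \<circ> U) = M" using assms by (simp add: mp_map_def)
qed

lemma mp_map_id: "mp_map M id"
 by (simp add: mp_map_def id_def distr_id)
lemma mp_map_funpow: "mp_map M S ==> mp_map M (S ^^ n)"
 by (induction n) (auto intro: mp_map_comp mp_map_id simp: id_def[symmetric])

lemma mp_map_integral:
 fixes f :: "'a => 'b :: {banach, second_countable_topology}"
 assumes "mp_map M S" "f \<in> borel_measurable M"
 shows "(\<integral>x. f (S x) \<partial>M) = (\<integral>x. f x \<partial>M)"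
 using integral_distr[of S M M f] assms by (simp add: mp_map_def)

lemma mp_map_AE: assumes "mp_map M S" "AE x in M. P x" shows "AE x in M. P (S x)"
proof (rule AE_distrD[of S M M P])
 have d: "distr M M S = M" using assms(1) by (simp add: mp_map_def)
 show "AE x in distr M M S. P x" unfolding d by (rule assms(2))
qed (use assms in \<open>simp add: mp_map_def\<close>)

lemma measurable_cnj [measurable]: "cnj \<in> borel_measurable borel"
 by (intro borel_measurable_continuous_onI continuous_on_cnj continuous_on_id)

locale invertible_system = prob_space M for M :: "'a measure" +
 fixes T :: "'a => 'a"
 assumes imp: "invertible_measure_preserving M T"
begin

abbreviation "iter k \<equiv> int_iterate M T k"
abbreviation "Tinv \<equiv> inv_into (space M) T"

lemma bij: "bij_betw T (space M) (space M)" using imp by (simp add: invertible_measure_preserving_def)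
lemma Tinv_T [simp]: "x \<in> space M ==> Tinv (T x) = x"
 using bij by (simp add: bij_betw_def)
lemma T_Tinv [simp]: "x \<in> space M ==> T (Tinv x) = x"
 using bij by (simp add: bij_betw_def f_inv_into_f)
lemma mp_T: "mp_map M T" using imp by (simp add: invertible_measure_preserving_def mp_map_def)
lemma mp_Tinv: "mp_map M Tinv"
proof -
 have m: "Tinv \<in> M \<rightarrow>\<^sub>M M" using imp by (simp add: invertible_measure_preserving_def)
 have "distr M M Tinv = distr (distr M M T) M Tinv" using mp_T by (simp add: mp_map_def)
 also have "... = distr M M (Tinv \<circ> T)" using m mp_T by (intro distr_distr) (auto simp: mp_map_def)
 also have "... = distr M M (\<lambda>x. x)" by (intro distr_cong) auto
 finally show ?thesis using m by (simp add: mp_map_def distr_id)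
qed
lemma mp_iter: "mp_map M (iter k)"
 unfolding int_iterate_def by (auto intro: mp_map_funpow mp_T mp_Tinv)
lemma iter_space [simp]: "x \<in> space M ==> iter k x \<in> space M"
 by (rule mp_map_space[OF mp_iter])
lemma iter_0 [simp]: "iter 0 x = x" by (simp add: int_iterate_def)

lemma iter_Suc: assumes x: "x \<in> space M" shows "iter (k + 1) x = T (iter k x)"
proof (cases "k >= 0")
 case True thus ?thesis by (simp add: int_iterate_def nat_add_distrib)
next
 case False
 obtain n where n: "nat (- k) = Suc n" using False by (cases "nat (-k)") auto
 hence k: "k = - int (Suc n)" using False by linarith
 have s: "(Tinv ^^ n) x \<in> space M" using mp_map_space[OF mp_map_funpow[OF mp_Tinv] x] .
 have "iter k x = Tinv ((Tinv ^^ n) x)" using False n by (simp add: int_iterate_def)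
 hence "T (iter k x) = (Tinv ^^ n) x" using s by simp
 also have "... = iter (k + 1) x" unfolding k by (cases n) (auto simp: int_iterate_def nat_add_distrib)
 finally show ?thesis ..
qed

lemma T_inj: "x \<in> space M ==> y \<in> space M ==> T x = T y ==> x = y"
 using bij by (auto simp: bij_betw_def inj_on_def)

lemma iter_add: assumes x: "x \<in> space M" shows "iter (k + m) x = iter k (iter m x)"
proof (induction k rule: int_induct[where k=0])
 case (step1 k)
 thus ?case using iter_Suc[of x "k + m"] iter_Suc[of "iter m x" k] x by (simp add: algebra_simps)
next
 case (step2 k)
 have "T (iter (k - 1 + m) x) = T (iter (k - 1) (iter m x))"
  using step2 iter_Suc[of x "k - 1 + m"] iter_Suc[of "iter m x" "k - 1"] x by (simp add: algebra_simps)
 thus ?case by (rule T_inj[rotated 2]) (use x in auto)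
qed (use x in simp)

end

lemma iter_commute:
 assumes S: "invertible_system M S" and U: "invertible_system M U"
  and comm: "\<And>x. x \<in> space M ==> S (U x) = U (S x)" and x: "x \<in> space M"
 shows "int_iterate M S k (int_iterate M U m x) = int_iterate M U m (int_iterate M S k x)"
proof -
 interpret S: invertible_system M S by fact
 interpret U: invertible_system M U by fact
 have Ss: "S y \<in> space M" "U y \<in> space M" if "y \<in> space M" for y
  using mp_map_space[OF S.mp_T that] mp_map_space[OF U.mp_T that] by auto
 have one: "S (U.iter m y) = U.iter m (S y)" if y: "y \<in> space M" for y m
 proof (induction m rule: int_induct[where k=0])
  case (step1 m)
  have "S (U.iter (m + 1) y) = S (U (U.iter m y))" by (simp only: U.iter_Suc[OF y])
  also have "... = U (S (U.iter m y))" by (rule comm) (use y in simp)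
  also have "... = U (U.iter m (S y))" by (simp only: step1)
  also have "... = U.iter (m + 1) (S y)" by (simp only: U.iter_Suc[OF Ss(1)[OF y]])
  finally show ?case .
 next
  case (step2 m)
  have "U (S (U.iter (m - 1) y)) = S (U (U.iter (m - 1) y))" by (rule comm[symmetric]) (use y in simp)
  also have "... = S (U.iter m y)" using U.iter_Suc[OF y, of "m - 1"] by (simp only: diff_add_cancel)
  also have "... = U.iter m (S y)" by (simp only: step2)
  also have "... = U (U.iter (m - 1) (S y))" using U.iter_Suc[OF Ss(1)[OF y], of "m - 1"] by (simp only: diff_add_cancel)
  finally show ?case by (rule U.T_inj[rotated 2]) (use y Ss in auto)
 qed simp
 show ?thesis
 proof (induction k rule: int_induct[where k=0])
  case (step1 k)
  have "S.iter (k + 1) (U.iter m x) = S (S.iter k (U.iter m x))" by (rule S.iter_Suc) (use x in simp)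
  also have "... = S (U.iter m (S.iter k x))" by (simp only: step1)
  also have "... = U.iter m (S (S.iter k x))" by (rule one) (use x in simp)
  also have "... = U.iter m (S.iter (k + 1) x)" by (simp only: S.iter_Suc[OF x])
  finally show ?case .
 next
  case (step2 k)
  have "S (S.iter (k - 1) (U.iter m x)) = S.iter k (U.iter m x)"
   using S.iter_Suc[OF U.iter_space[OF x], of "k - 1" m] by (simp only: diff_add_cancel)
  also have "... = U.iter m (S.iter k x)" by (simp only: step2)
  also have "... = U.iter m (S (S.iter (k - 1) x))" using S.iter_Suc[OF x, of "k - 1"] by (simp only: diff_add_cancel)
  also have "... = S (U.iter m (S.iter (k - 1) x))" by (rule one[symmetric]) (use x in simp)
  finally show ?case by (rule S.T_inj[rotated 2]) (use x in auto)
 qed simp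
qed

lemma (in finite_measure) integrable_bounded:
 fixes f :: "'a => 'b :: {banach, second_countable_topology}"
 assumes "f \<in> borel_measurable M" "\<And>x. norm (f x) <= C" shows "integrable M f"
 by (rule integrable_const_bound[of _ C]) (use assms in auto)

context prob_space
begin

lemma integral_norm_le_L2:
 fixes v :: "'a => complex"
 assumes m: "v \<in> borel_measurable M" and C: "\<And>x. norm (v x) <= C"
 shows "(\<integral>x. norm (v x) \<partial>M) <= sqrt (\<integral>x. (norm (v x))\<^sup>2 \<partial>M)"
proof (rule real_le_rsqrt)
 have 1: "integrable M (\<lambda>x. norm (v x))" by (rule integrable_bounded[of _ C]) (use m C in auto)
 have 2: "integrable M (\<lambda>x. (norm (v x))\<^sup>2)"
  by (rule integrable_bounded[of _ "C\<^sup>2"]) (use m C in \<open>auto intro!: power_mono\<close>)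
 have "0 <= variance (\<lambda>x. norm (v x))" by (rule variance_positive)
 thus "(\<integral>x. norm (v x) \<partial>M)\<^sup>2 <= (\<integral>x. (norm (v x))\<^sup>2 \<partial>M)" using variance_eq[OF 1 2] by simp
qed

lemma norm_integral_le_L2norm:
 fixes v :: "'a => complex"
 assumes m: "v \<in> borel_measurable M" and C: "\<And>x. norm (v x) <= C"
 shows "norm (\<integral>x. v x \<partial>M) <= L2norm M v"
 unfolding L2norm_def using integral_norm_bound[of M v] integral_norm_le_L2[OF assms] by linarith

text \<open>
  A function in \<open>Linfty\<close> agrees almost everywhere with a bounded function, and
  subtracting its integral makes the mean zero.
\<close>

lemma ergodic_sequenceI:
 assumes S: "\<And>n. mp_map M (S n)"
  and main: "\<And>(f :: 'a => complex) C. f \<in> borel_measurable M ==> (\<And>x. norm (f x) <= C) ==> (\<integral>x. f x \<partial>M) = 0 ==>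
    (\<lambda>N. \<integral>x. (norm (average N (\<lambda>n. f (S n x))))\<^sup>2 \<partial>M) \<longlonglongrightarrow> 0"
 shows "ergodic_sequence M S"
 unfolding ergodic_sequence_def
proof
 fix f assume "f \<in> Linfty M"
 then obtain C where f: "f \<in> borel_measurable M" "AE x in M. norm (f x) <= C" unfolding Linfty_def by blast
 define f' where "f' x = (if norm (f x) <= C then f x else 0)" for x
 have f'm [measurable]: "f' \<in> borel_measurable M" unfolding f'_def using f(1) by measurable
 have f'b: "norm (f' x) <= \<bar>C\<bar>" for x by (auto simp: f'_def)
 have ff': "AE x in M. f x = f' x" using f(2) by eventually_elim (simp add: f'_def)
 have int: "(\<integral>x. f x \<partial>M) = (\<integral>x. f' x \<partial>M)" by (rule integral_cong_AE) (use f f'm ff' in auto)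
 define c where "c = (\<integral>x. f' x \<partial>M)"
 define g where "g x = f' x - c" for x
 have gm: "g \<in> borel_measurable M" unfolding g_def by measurable
 have gb: "norm (g x) <= \<bar>C\<bar> + norm c" for x
  unfolding g_def using f'b[of x] norm_triangle_ineq4[of "f' x" c] by linarith
 have "(\<integral>x. g x \<partial>M) = 0"
  unfolding g_def by (subst Bochner_Integration.integral_diff) (use integrable_bounded[OF f'm f'b] in \<open>auto simp: c_def prob_space\<close>)
 from main[OF gm gb this] have lim: "(\<lambda>N. \<integral>x. (norm (average N (\<lambda>n. g (S n x))))\<^sup>2 \<partial>M) \<longlonglongrightarrow> 0" .
 have "AE x in M. \<forall>n. f (S n x) = f' (S n x)"
  unfolding AE_all_countable by (intro allI mp_map_AE[OF S ff'])
 hence eq: "L2norm M (\<lambda>x. average N (\<lambda>n. f (S n x)) - (\<integral>x. f x \<partial>M)) = sqrt (\<integral>x. (norm (average N (\<lambda>n. g (S n x))))\<^sup>2 \<partial>M)" if "N > 0" for N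
  unfolding L2norm_def
 proof (intro arg_cong[of _ _ sqrt] integral_cong_AE)
  note [measurable] = mp_map_measurable[OF S] f(1) gm
  show "(\<lambda>x. (norm (average N (\<lambda>n. f (S n x)) - (\<integral>x. f x \<partial>M)))\<^sup>2) \<in> borel_measurable M" unfolding average_def by measurable
  show "(\<lambda>x. (norm (average N (\<lambda>n. g (S n x))))\<^sup>2) \<in> borel_measurable M" unfolding average_def by measurable
  assume "AE x in M. \<forall>n. f (S n x) = f' (S n x)"
  thus "AE x in M. (norm (average N (\<lambda>n. f (S n x)) - (\<integral>x. f x \<partial>M)))\<^sup>2 = (norm (average N (\<lambda>n. g (S n x))))\<^sup>2"
   by eventually_elim (simp add: g_def average_diff average_const[OF that] int c_def)
 qed
 have "(\<lambda>N. sqrt (\<integral>x. (norm (average N (\<lambda>n. g (S n x))))\<^sup>2 \<partial>M)) \<longlonglongrightarrow> 0"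
  using tendsto_real_sqrt[OF lim] by simp
 thus "(\<lambda>N. L2norm M (\<lambda>x. average N (\<lambda>n. f (S n x)) - (\<integral>x. f x \<partial>M))) \<longlonglongrightarrow> 0"
  by (rule Lim_transform_eventually) (rule eventually_mono[OF eventually_gt_at_top[of 0]], rule eq[symmetric])
qed

end

locale commuting_pair = S: invertible_system M S + U: invertible_system M U for M :: "'a measure" and S U +
 assumes comm: "x \<in> space M ==> S (U x) = U (S x)"
begin

definition W :: "int => int => 'a => 'a" where
 "W m n = int_iterate M S m \<circ> int_iterate M U n"

lemma mp_W: "mp_map M (W m n)" unfolding W_def by (intro mp_map_comp S.mp_iter U.mp_iter)

lemma W_add: assumes x: "x \<in> space M" shows "W (m + m') (n + n') x = W m n (W m' n' x)"
 unfolding W_def comp_def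
 using S.iter_add[of "U.iter (n + n') x" m m'] U.iter_add[OF x, of n n']
  iter_commute[OF S.invertible_system_axioms U.invertible_system_axioms comm, of "U.iter n' x" m' n] x by simp

definition corr :: "('a => complex) => int => int => complex" where
 "corr f m n = (\<integral>x. f (W m n x) * cnj (f x) \<partial>M)"

lemma corr_eq:
 assumes [measurable]: "f \<in> borel_measurable M"
 shows "(\<integral>x. f (W m n x) * cnj (f (W m' n' x)) \<partial>M) = corr f (m - m') (n - n')"
proof -
 note [measurable] = mp_map_measurable[OF mp_W]
 have "corr f (m - m') (n - n') = (\<integral>x. f (W (m - m') (n - n') (W m' n' x)) * cnj (f (W m' n' x)) \<partial>M)"
  unfolding corr_def by (rule mp_map_integral[OF mp_W, symmetric]) measurable
 also have "... = (\<integral>x. f (W m n x) * cnj (f (W m' n' x)) \<partial>M)"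
  using W_add[of _ "m - m'" m' "n - n'" n'] by (intro Bochner_Integration.integral_cong) auto
 finally show ?thesis ..
qed

lemma integrable_corr:
 assumes [measurable]: "f \<in> borel_measurable M" and C: "\<And>x. norm (f x) <= C"
 shows "integrable M (\<lambda>x. f (W m n x) * cnj (f (W m' n' x)))"
proof (rule S.integrable_bounded[of _ "C * C"])
 note [measurable] = mp_map_measurable[OF mp_W]
 show "(\<lambda>x. f (W m n x) * cnj (f (W m' n' x))) \<in> borel_measurable M" by measurable
 show "norm (f (W m n x) * cnj (f (W m' n' x))) <= C * C" for x
  using mult_mono[OF C[of "W m n x"] C[of "W m' n' x"]] order.trans[OF norm_ge_zero C] by (simp add: norm_mult)
qed

lemma positive_definite2_corr:
 assumes f: "f \<in> borel_measurable M" and C: "\<And>x. norm (f x) <= C"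
 shows "positive_definite2 (corr f)"
 unfolding positive_definite2_def
proof (intro allI impI)
 fix I :: "(nat \<times> nat) set" and z :: "nat \<times> nat => complex" assume I: "finite I"
 define F where "F x = (\<Sum>i\<in>I. z i * f (W (int (fst i)) (int (snd i)) x))" for x
 have "(\<Sum>i\<in>I. \<Sum>j\<in>I. z i * cnj (z j) * corr f (int (fst i) - int (fst j)) (int (snd i) - int (snd j)))
   = (\<Sum>i\<in>I. \<Sum>j\<in>I. \<integral>x. z i * cnj (z j) * (f (W (int (fst i)) (int (snd i)) x) * cnj (f (W (int (fst j)) (int (snd j)) x))) \<partial>M)"
  by (simp add: corr_eq[OF f])
 also have "... = (\<integral>x. (\<Sum>i\<in>I. \<Sum>j\<in>I. z i * cnj (z j) * (f (W (int (fst i)) (int (snd i)) x) * cnj (f (W (int (fst j)) (int (snd j)) x)))) \<partial>M)"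
  by (subst Bochner_Integration.integral_sum | intro sum.cong refl integrable_mult_right Bochner_Integration.integrable_sum integrable_corr[OF f C] | simp)+
 also have "... = (\<integral>x. complex_of_real ((norm (F x))\<^sup>2) \<partial>M)"
  by (simp add: F_def complex_norm_square cnj_sum sum_product mult_ac del: of_real_power)
 also have "... = complex_of_real (\<integral>x. (norm (F x))\<^sup>2 \<partial>M)" by (rule integral_complex_of_real)
 finally show "\<exists>r\<ge>0. (\<Sum>i\<in>I. \<Sum>j\<in>I. z i * cnj (z j) * corr f (int (fst i) - int (fst j)) (int (snd i) - int (snd j))) = complex_of_real r"
  by (intro exI[of _ "\<integral>x. (norm (F x))\<^sup>2 \<partial>M"]) auto
qed

text \<open>
  The element of \<open>L2\<close> that a trigonometric polynomial \<open>xs\<close> produces when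
  its characters act as translations on \<open>f\<close>.
\<close>

definition comb :: "('a => complex) => (int \<times> int \<times> complex) list => 'a => complex" where
 "comb f xs x = (\<Sum>(m, n, z)\<leftarrow>xs. z * f (W m n x))"

lemma comb_inner:
 assumes f: "f \<in> borel_measurable M" and C: "\<And>x. norm (f x) <= C"
 shows "integrable M (\<lambda>x. comb f xs x * cnj (comb f ys x))" (is "?A xs")
  and "(\<integral>x. comb f xs x * cnj (comb f ys x) \<partial>M) = trig2_value (corr f) (trig2_prod xs (trig2_cnj ys))" (is "?B xs")
proof -
 have one: "integrable M (\<lambda>x. z * f (W m n x) * cnj (comb f ys x)) \<and>
  (\<integral>x. z * f (W m n x) * cnj (comb f ys x) \<partial>M) = (\<Sum>(m', n', z')\<leftarrow>ys. z * cnj z' * corr f (m - m') (n - n'))" for z m n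
 proof (induction ys)
  case Nil show ?case by (simp add: comb_def)
 next
  case (Cons q ys)
  obtain m' n' z' where q: "q = (m', n', z')" by (cases q)
  have e: "z * f (W m n x) * cnj (comb f (q # ys) x) = z * cnj z' * (f (W m n x) * cnj (f (W m' n' x))) + z * f (W m n x) * cnj (comb f ys x)" for x
   by (simp add: comb_def q algebra_simps)
  show ?case unfolding e
   using Cons integrable_corr[OF f C, of m n m' n'] by (simp add: q corr_eq[OF f])
 qed
 have "?A xs \<and> ?B xs"
 proof (induction xs)
  case Nil show ?case by (simp add: comb_def trig2_value_prod_cnj)
 next
  case (Cons p xs)
  obtain m n z where p: "p = (m, n, z)" by (cases p)
  have e: "comb f (p # xs) x * cnj (comb f ys x) = z * f (W m n x) * cnj (comb f ys x) + comb f xs x * cnj (comb f ys x)" for x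
   by (simp add: comb_def p algebra_simps)
  show ?case unfolding e using Cons one[of z m n] by (simp add: p trig2_value_prod_cnj)
 qed
 thus "?A xs" "?B xs" by auto
qed

text \<open>
  The spectral isometry: norms of combinations of translates are computed by the functional of the
  correlation function.
\<close>

lemma comb_norm_square:
 assumes f: "f \<in> borel_measurable M" and C: "\<And>x. norm (f x) <= C"
 shows "(\<integral>x. (norm (comb f xs x))\<^sup>2 \<partial>M) = Re (trig2_value (corr f) (trig2_prod xs (trig2_cnj xs)))"
proof -
 have "complex_of_real (\<integral>x. (norm (comb f xs x))\<^sup>2 \<partial>M) = (\<integral>x. comb f xs x * cnj (comb f xs x) \<partial>M)"
  unfolding integral_complex_of_real[symmetric] complex_norm_square ..
 thus ?thesis using comb_inner(2)[OF f C, of xs xs] by (metis Re_complex_of_real)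
qed

text \<open>
  The difference of two averages is a combination of translates whose trigonometric polynomial is
  the difference of two multipliers. If the averages were not Cauchy, a sequence of such
  differences would tend to zero pointwise but not in norm.
\<close>

lemma Cauchy_averages:
 assumes f: "f \<in> borel_measurable M" and C: "\<And>x. norm (f x) <= C"
  and conv: "\<And>t s. convergent (\<lambda>N. average N (\<lambda>n. ee (of_int (p n) * t + of_int (q n) * s)))"
  and e: "e > 0"
 shows "\<exists>N0. \<forall>N\<ge>N0. \<forall>K\<ge>N0. (\<integral>x. (norm (average N (\<lambda>n. f (W (p n) (q n) x)) - average K (\<lambda>n. f (W (p n) (q n) x))))\<^sup>2 \<partial>M) < e"
proof (rule ccontr)
 define J where "J N K = (\<integral>x. (norm (average N (\<lambda>n. f (W (p n) (q n) x)) - average K (\<lambda>n. f (W (p n) (q n) x))))\<^sup>2 \<partial>M)" for N K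
 assume "\<not> ?thesis"
 hence "\<forall>i. \<exists>N K. N >= i \<and> K >= i \<and> J N K >= e" unfolding J_def[symmetric] by (meson not_less)
 then obtain N K where NK': "\<And>i. N i >= i" "\<And>i. K i >= i" "\<And>i. J (N i) (K i) >= e" by metis
 note NK = NK'(1,2) NK'(3)[unfolded J_def]
 define Y where "Y c L = map (\<lambda>n. (p n, q n, c / of_nat L :: complex)) [1..<Suc L]" for c L
 \<comment> \<open>the factor 1/2 makes the polynomial bounded by one\<close>
 define X where "X i = Y (1/2) (N i) @ Y (-1/2) (K i)" for i :: nat
 have sl: "(\<Sum>n\<leftarrow>[1..<Suc L]. g n) = (\<Sum>n=1..L. g n)" for g :: "nat => complex" and L
  by (simp add: interv_sum_list_conv_sum_set_nat atLeastLessThanSuc_atLeastAtMost del: upt_Suc)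
 have tY: "trig2 (Y c L) y = c * average L (\<lambda>n. ee (of_int (p n) * fst y + of_int (q n) * snd y))" for c L y
  unfolding trig2_def Y_def map_map comp_def case_prod_conv sl average_def
  by (simp add: sum_distrib_left sum_divide_distrib)
 have cY: "comb f (Y c L) x = c * average L (\<lambda>n. f (W (p n) (q n) x))" for c L x
  unfolding comb_def Y_def map_map comp_def case_prod_conv sl average_def
  by (simp add: sum_distrib_left sum_divide_distrib)
 have "(\<lambda>i. Re (trig2_value (corr f) (trig2_prod (X i) (trig2_cnj (X i))))) \<longlonglongrightarrow> 0"
 proof (rule spectral_null_sequence[OF positive_definite2_corr[OF f C]])
  fix i y
  have a: "norm (average L (\<lambda>n. ee (of_int (p n) * fst y + of_int (q n) * snd y))) <= 1" for L
   by (rule norm_average_le) auto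
  show "norm (trig2 (X i) y) <= 1"
   unfolding X_def trig2_append tY
   by (rule order.trans[OF norm_triangle_ineq]) (use a[of "N i"] a[of "K i"] in \<open>simp add: norm_mult\<close>)
 next
  fix y
  obtain l where l: "(\<lambda>N. average N (\<lambda>n. ee (of_int (p n) * fst y + of_int (q n) * snd y))) \<longlonglongrightarrow> l"
   using conv[of "fst y" "snd y"] unfolding convergent_def by blast
  have Nt: "filterlim N at_top sequentially" by (rule filterlim_at_top_mono[OF filterlim_ident]) (use NK in auto)
  have Kt: "filterlim K at_top sequentially" by (rule filterlim_at_top_mono[OF filterlim_ident]) (use NK in auto)
  have "(\<lambda>i. trig2 (X i) y) \<longlonglongrightarrow> 1/2 * l + (-1/2) * l"
   unfolding X_def trig2_append tY
   by (intro tendsto_intros filterlim_compose[OF l Nt] filterlim_compose[OF l Kt])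
  thus "(\<lambda>i. trig2 (X i) y) \<longlonglongrightarrow> 0" by simp
 qed
 moreover have "Re (trig2_value (corr f) (trig2_prod (X i) (trig2_cnj (X i)))) >= e / 4" for i
 proof -
  have "comb f (X i) x = (1/2) * (average (N i) (\<lambda>n. f (W (p n) (q n) x)) - average (K i) (\<lambda>n. f (W (p n) (q n) x)))" for x
  proof -
   have "comb f (X i) x = comb f (Y (1/2) (N i)) x + comb f (Y (-1/2) (K i)) x" by (simp add: comb_def X_def)
   thus ?thesis unfolding cY by (simp add: algebra_simps)
  qed
  hence "(norm (comb f (X i) x))\<^sup>2 = 1/4 * (norm (average (N i) (\<lambda>n. f (W (p n) (q n) x)) - average (K i) (\<lambda>n. f (W (p n) (q n) x))))\<^sup>2" for x
   by (simp only: norm_mult power_mult_distrib) (simp add: power2_eq_square)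
  hence "(\<integral>x. (norm (comb f (X i) x))\<^sup>2 \<partial>M) = 1/4 * (\<integral>x. (norm (average (N i) (\<lambda>n. f (W (p n) (q n) x)) - average (K i) (\<lambda>n. f (W (p n) (q n) x))))\<^sup>2 \<partial>M)"
   by (simp only: integral_mult_right_zero)
  thus ?thesis using NK(3)[of i] unfolding comb_norm_square[OF f C] by simp
 qed
 ultimately have "e / 4 <= 0" by (intro LIMSEQ_le_const[where X="\<lambda>i. Re (trig2_value (corr f) (trig2_prod (X i) (trig2_cnj (X i))))"]) auto
 thus False using e by simp
qed

text \<open>
  Let \<open>A_N\<close> be the averages of a function with integral zero. Then \<open>A_N\<close>
  is Cauchy by convergence of the multipliers, and
  \<open>\<integral> A_N g \<rightarrow> 0\<close> for bounded \<open>g\<close>. Testing with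
  \<open>g = cnj A_K\<close> for a large fixed \<open>K\<close> shows that \<open>A_N\<close>
  tends to zero in norm.
\<close>

theorem ergodic_sequence_of_weak:
 assumes conv: "\<And>t s. convergent (\<lambda>N. average N (\<lambda>n. ee (of_int (p n) * t + of_int (q n) * s)))"
  and weak: "\<And>(f :: 'a => complex) (g :: 'a => complex) C. f \<in> borel_measurable M ==> g \<in> borel_measurable M ==> (\<And>x. norm (f x) <= C) ==> (\<And>x. norm (g x) <= C) ==>
    (\<lambda>N. average N (\<lambda>n. \<integral>x. f (W (p n) (q n) x) * g x \<partial>M)) \<longlonglongrightarrow> (\<integral>x. f x \<partial>M) * (\<integral>x. g x \<partial>M)"
 shows "ergodic_sequence M (\<lambda>n. W (p n) (q n))"
proof (rule S.ergodic_sequenceI[OF mp_W])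
 fix f :: "'a => complex" and C assume f [measurable]: "f \<in> borel_measurable M" and C: "\<And>x. norm (f x) <= C" and f0: "(\<integral>x. f x \<partial>M) = 0"
 note [measurable] = mp_map_measurable[OF mp_W]
 define B where "B N x = average N (\<lambda>n. f (W (p n) (q n) x))" for N x
 have C0: "C >= 0" by (rule order.trans[OF norm_ge_zero C])
 have Bm [measurable]: "B N \<in> borel_measurable M" for N unfolding B_def average_def by measurable
 have Bb: "norm (B N x) <= C" for N x unfolding B_def by (rule norm_average_le) (use C C0 in auto)
 have w0: "(\<lambda>N. \<integral>x. B N x * cnj (B K x) \<partial>M) \<longlonglongrightarrow> 0" for K
 proof -
  have "(\<lambda>N. average N (\<lambda>n. \<integral>x. f (W (p n) (q n) x) * cnj (B K x) \<partial>M)) \<longlonglongrightarrow> (\<integral>x. f x \<partial>M) * (\<integral>x. cnj (B K x) \<partial>M)"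
   by (rule weak[of f "\<lambda>x. cnj (B K x)" C]) (use C Bb in auto)
  moreover have "average N (\<lambda>n. \<integral>x. f (W (p n) (q n) x) * cnj (B K x) \<partial>M) = (\<integral>x. B N x * cnj (B K x) \<partial>M)" for N
  proof -
   have i: "integrable M (\<lambda>x. f (W (p n) (q n) x) * cnj (B K x))" for n
    by (rule S.integrable_bounded[of _ "C * C"]) (use C Bb C0 in \<open>auto simp: norm_mult intro!: mult_mono\<close>)
   show ?thesis
    unfolding B_def[of N] average_def by (simp add: sum_distrib_right Bochner_Integration.integral_sum[OF i])
  qed
  ultimately show ?thesis by (simp add: f0)
 qed
 show "(\<lambda>N. \<integral>x. (norm (average N (\<lambda>n. f (W (p n) (q n) x))))\<^sup>2 \<partial>M) \<longlonglongrightarrow> 0"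
  unfolding B_def[symmetric]
 proof (rule tendstoI)
  fix e :: real assume e: "e > 0"
  define d where "d = (e / (2 * (C + 1)))\<^sup>2"
  have d: "d > 0" using e C0 by (simp add: d_def)
  obtain K where K: "\<And>N. N >= K ==> (\<integral>x. (norm (B N x - B K x))\<^sup>2 \<partial>M) < d"
   using Cauchy_averages[OF f C conv d] unfolding B_def by blast
  have "\<forall>\<^sub>F N in sequentially. norm (\<integral>x. B N x * cnj (B K x) \<partial>M) < e / 2"
   by (rule order_tendstoD(2)[OF tendsto_norm_zero[OF w0]]) (use e in simp)
  thus "\<forall>\<^sub>F N in sequentially. dist (\<integral>x. (norm (B N x))\<^sup>2 \<partial>M) 0 < e"
   using eventually_ge_at_top[of K]
  proof eventually_elim
   case (elim N)
   have i1: "integrable M (\<lambda>x. B N x * cnj (B K x))"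
    by (rule S.integrable_bounded[of _ "C * C"]) (use Bb C0 in \<open>auto simp: norm_mult intro!: mult_mono\<close>)
   have i2: "integrable M (\<lambda>x. B N x * cnj (B N x - B K x))"
   proof (rule S.integrable_bounded[of _ "C * (C + C)"])
    show "norm (B N x * cnj (B N x - B K x)) <= C * (C + C)" for x
     unfolding norm_mult complex_mod_cnj
     by (intro mult_mono Bb norm_triangle_le_diff add_mono) (use C0 in auto)
   qed measurable
   have "complex_of_real (\<integral>x. (norm (B N x))\<^sup>2 \<partial>M) = (\<integral>x. B N x * cnj (B K x) + B N x * cnj (B N x - B K x) \<partial>M)"
    unfolding integral_complex_of_real[symmetric] complex_norm_square by (simp add: algebra_simps)
   also have "... = (\<integral>x. B N x * cnj (B K x) \<partial>M) + (\<integral>x. B N x * cnj (B N x - B K x) \<partial>M)"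
    by (rule Bochner_Integration.integral_add[OF i1 i2])
   finally have "norm (complex_of_real (\<integral>x. (norm (B N x))\<^sup>2 \<partial>M)) <= norm (\<integral>x. B N x * cnj (B K x) \<partial>M) + norm (\<integral>x. B N x * cnj (B N x - B K x) \<partial>M)"
    by (simp only: norm_triangle_ineq)
   also have "norm (\<integral>x. B N x * cnj (B N x - B K x) \<partial>M) <= e / 2"
   proof -
    have vb: "norm (B N x - B K x) <= C + C" for x by (intro norm_triangle_le_diff add_mono Bb)
    have iv: "integrable M (\<lambda>x. norm (B N x - B K x))"
     by (rule S.integrable_bounded[of _ "C + C"]) (use vb in auto)
    have "norm (\<integral>x. B N x * cnj (B N x - B K x) \<partial>M) <= (\<integral>x. norm (B N x * cnj (B N x - B K x)) \<partial>M)" by (rule integral_norm_bound)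
    also have "... <= (\<integral>x. C * norm (B N x - B K x) \<partial>M)"
    proof (rule integral_mono)
     show "integrable M (\<lambda>x. norm (B N x * cnj (B N x - B K x)))" by (rule integrable_norm[OF i2])
     show "integrable M (\<lambda>x. C * norm (B N x - B K x))" using iv by simp
     show "norm (B N x * cnj (B N x - B K x)) <= C * norm (B N x - B K x)" for x
      unfolding norm_mult complex_mod_cnj by (intro mult_right_mono Bb) auto
    qed
    also have "... = C * (\<integral>x. norm (B N x - B K x) \<partial>M)" by simp
    also have "... <= C * sqrt (\<integral>x. (norm (B N x - B K x))\<^sup>2 \<partial>M)"
     by (intro mult_left_mono S.integral_norm_le_L2[OF _ vb] C0) measurable
    also have "... <= C * sqrt d" using K[OF elim(2)] C0 by (intro mult_left_mono) auto
    also have "... = C * (e / (2 * (C + 1)))" using e C0 by (simp add: d_def)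
    also have "... <= e / 2" using e C0 by (simp add: field_simps)
    finally show ?thesis .
   qed
   finally have "norm (complex_of_real (\<integral>x. (norm (B N x))\<^sup>2 \<partial>M)) < e" using elim(1) by linarith
   thus ?case by (simp add: dist_real_def)
  qed
 qed
qed

end

section \<open>Wiener's lemma along a sequence\<close>

definition average2 :: "nat => (nat => nat => complex) => complex" where
 "average2 N F = average N (\<lambda>n. average N (F n))"

lemma norm_average2_le: "(\<And>n m. norm (F n m) <= C) ==> C >= 0 ==> norm (average2 N F) <= C"
 unfolding average2_def by (intro norm_average_le)
lemma average2_add: "average2 N (\<lambda>n m. F n m + G n m) = average2 N F + average2 N G"
 by (simp add: average2_def average_add)
lemma average2_diff: "average2 N (\<lambda>n m. F n m - G n m) = average2 N F - average2 N G"
 by (simp add: average2_def average_diff)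
lemma average2_cmult: "average2 N (\<lambda>n m. c * F n m) = c * average2 N F"
 by (simp add: average2_def average_cmult)
lemma average2_prod: "average2 N (\<lambda>n m. u n * v m) = average N u * average N v"
 by (simp add: average2_def average_cmult average_cmult_right)
definition real_average2 :: "nat => (nat => nat => real) => real" where
 "real_average2 N F = (\<Sum>n=1..N. (\<Sum>m=1..N. F n m) / real N) / real N"

lemma average2_of_real: "average2 N (\<lambda>n m. of_real (F n m)) = of_real (real_average2 N F)"
 by (simp add: average2_def average_def real_average2_def)
lemma real_average2_mono: "(\<And>n m. F n m <= G n m) ==> real_average2 N F <= real_average2 N G"
 unfolding real_average2_def by (intro divide_right_mono sum_mono) auto
lemma real_average2_nonneg: "(\<And>n m. F n m >= 0) ==> real_average2 N F >= 0"
 unfolding real_average2_def by (intro divide_nonneg_nonneg sum_nonneg) auto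
lemma real_average2_add: "real_average2 N (\<lambda>n m. F n m + G n m) = real_average2 N F + real_average2 N G"
 by (simp add: real_average2_def sum.distrib add_divide_distrib)
lemma real_average2_const_le: "c >= 0 ==> real_average2 N (\<lambda>n m. c) <= c"
 by (cases "N = 0") (simp_all add: real_average2_def)

lemma norm_average2_le_real_average2: "norm (average2 N F) <= real_average2 N (\<lambda>n m. norm (F n m))"
proof -
 have "norm (average2 N F) = norm (\<Sum>n=1..N. (\<Sum>m=1..N. F n m) / of_nat N) / real N"
  by (simp add: average2_def average_def norm_divide)
 also have "... <= (\<Sum>n=1..N. norm ((\<Sum>m=1..N. F n m) / of_nat N)) / real N"
  by (intro divide_right_mono norm_sum) auto
 also have "... <= real_average2 N (\<lambda>n m. norm (F n m))"
  unfolding real_average2_def norm_divide norm_of_nat by (intro divide_right_mono sum_mono norm_sum) auto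
 finally show ?thesis .
qed

lemma real_average2_power2:
 "(real_average2 N F)\<^sup>2 <= real_average2 N (\<lambda>n m. (F n m)\<^sup>2)"
proof (cases "N = 0")
 case False
 have j: "((\<Sum>n=1..N. f n) / real N)\<^sup>2 <= (\<Sum>n=1..N. (f n)\<^sup>2) / real N" for f :: "nat => real"
 proof -
  have "(\<Sum>n=1..N. f n)\<^sup>2 <= (\<Sum>n=1..N. (f n)\<^sup>2) * real N"
   using sum_squared_le_sum_of_squares[of f "{1..N}"] by simp
  hence "(\<Sum>n=1..N. f n)\<^sup>2 / (real N * real N) <= ((\<Sum>n=1..N. (f n)\<^sup>2) * real N) / (real N * real N)"
   by (rule divide_right_mono) simp
  thus ?thesis using False by (simp add: power2_eq_square)
 qed
 have "(real_average2 N F)\<^sup>2 <= (\<Sum>n=1..N. ((\<Sum>m=1..N. F n m) / real N)\<^sup>2) / real N"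
  unfolding real_average2_def by (rule j)
 also have "... <= real_average2 N (\<lambda>n m. (F n m)\<^sup>2)"
  unfolding real_average2_def by (intro divide_right_mono sum_mono j) auto
 finally show ?thesis .
qed (simp add: real_average2_def)

text \<open>
  Piecewise linear interpolation of \<open>k \<mapsto> e(k \<theta>)\<close>. Unlike the function
  of the floor it is continuous in \<open>u\<close>, so that it can be expanded into exponentials.
\<close>

definition interp :: "real => real => complex" where
 "interp \<theta> u = of_real (1 - frac u) * ee (of_int \<lfloor>u\<rfloor> * \<theta>) + of_real (frac u) * ee (of_int (\<lfloor>u\<rfloor> + 1) * \<theta>)"

lemma norm_interp_le: "norm (interp \<theta> u) <= 1"
proof -
 have "norm (interp \<theta> u) <= \<bar>1 - frac u\<bar> + \<bar>frac u\<bar>"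
  unfolding interp_def by (rule order.trans[OF norm_triangle_ineq]) (simp only: norm_mult norm_of_real norm_ee mult_1_right order_refl)
 also have "... = 1" using frac_ge_0[of u] frac_lt_1[of u] by simp
 finally show ?thesis .
qed

text \<open>
  The second factor depends only on \<open>frac u\<close> and agrees at both ends of the unit
  interval.
\<close>

lemma interp_eq: "interp \<theta> u = ee (u * \<theta>) * (ee (- frac u * \<theta>) * (of_real (1 - frac u) + of_real (frac u) * ee \<theta>))"
proof -
 have "ee (of_int \<lfloor>u\<rfloor> * \<theta>) = ee (u * \<theta>) * ee (- frac u * \<theta>)"
  unfolding ee_add[symmetric] by (rule arg_cong[of _ _ ee]) (simp add: frac_def algebra_simps)
 moreover have "ee (of_int (\<lfloor>u\<rfloor> + 1) * \<theta>) = ee (u * \<theta>) * ee (- frac u * \<theta>) * ee \<theta>"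
  unfolding ee_add[symmetric] by (rule arg_cong[of _ _ ee]) (simp add: frac_def algebra_simps)
 ultimately show ?thesis by (simp add: interp_def algebra_simps)
qed

lemma average2_interp_tendsto_0:
 assumes good: "\<And>k :: int. (\<lambda>N. average N (\<lambda>n. ee ((of_int k + \<theta>) * \<alpha> n))) \<longlonglongrightarrow> 0"
 shows "(\<lambda>N. average2 N (\<lambda>n m. interp \<theta> (\<alpha> n - \<alpha> m))) \<longlonglongrightarrow> 0"
proof (rule tendstoI)
 fix e :: real assume e: "e > 0"
 define G where "G v = ee (- v * \<theta>) * (of_real (1 - v) + of_real v * ee \<theta>)" for v
 have "continuous_on {0..1} G" unfolding G_def by (intro continuous_intros)
 moreover have "G 0 = G 1" by (simp add: G_def flip: ee_add)
 ultimately obtain xs where xs: "\<And>u. norm (G (frac u) - trig_poly xs u) < e / 2"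
  using trig_approx[of G "e/2"] e by auto
 have approx: "norm (interp \<theta> u - (\<Sum>p\<leftarrow>xs. snd p * ee ((of_int (fst p) + \<theta>) * u))) <= e / 2" for u
 proof -
  have "(\<Sum>p\<leftarrow>xs. snd p * ee ((of_int (fst p) + \<theta>) * u)) = ee (u * \<theta>) * trig_poly xs u"
   unfolding trig_poly_def by (induction xs) (auto simp: ee_add algebra_simps)
  hence "interp \<theta> u - (\<Sum>p\<leftarrow>xs. snd p * ee ((of_int (fst p) + \<theta>) * u)) = ee (u * \<theta>) * (G (frac u) - trig_poly xs u)"
   by (simp add: interp_eq G_def algebra_simps)
  thus ?thesis using xs[of u] by (simp add: norm_mult)
 qed
 have "(\<lambda>N. average2 N (\<lambda>n m. ee ((of_int k + \<theta>) * (\<alpha> n - \<alpha> m)))) \<longlonglongrightarrow> 0 * cnj 0" for k :: int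
 proof -
  have "average2 N (\<lambda>n m. ee ((of_int k + \<theta>) * (\<alpha> n - \<alpha> m))) = average N (\<lambda>n. ee ((of_int k + \<theta>) * \<alpha> n)) * cnj (average N (\<lambda>n. ee ((of_int k + \<theta>) * \<alpha> n)))" for N
   unfolding cnj_average average2_prod[symmetric] by (simp only: right_diff_distrib ee_diff)
  thus ?thesis by (simp only:) (intro tendsto_mult tendsto_cnj good)
 qed
 hence l0: "(\<lambda>N. average2 N (\<lambda>n m. ee ((of_int k + \<theta>) * (\<alpha> n - \<alpha> m)))) \<longlonglongrightarrow> 0" for k :: int by simp
 have "(\<lambda>N. average2 N (\<lambda>n m. \<Sum>p\<leftarrow>xs. snd p * ee ((of_int (fst p) + \<theta>) * (\<alpha> n - \<alpha> m)))) \<longlonglongrightarrow> 0"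
 proof (induction xs)
  case Nil show ?case by (simp add: average2_def average_def)
 next
  case (Cons p xs)
  from tendsto_add[OF tendsto_mult_left[OF l0[of "fst p"], of "snd p"] Cons]
  show ?case by (simp add: average2_add average2_cmult)
 qed
 hence "\<forall>\<^sub>F N in sequentially. norm (average2 N (\<lambda>n m. \<Sum>p\<leftarrow>xs. snd p * ee ((of_int (fst p) + \<theta>) * (\<alpha> n - \<alpha> m)))) < e / 2"
  by (rule order_tendstoD(2)[OF tendsto_norm_zero]) (use e in simp)
 thus "\<forall>\<^sub>F N in sequentially. dist (average2 N (\<lambda>n m. interp \<theta> (\<alpha> n - \<alpha> m))) 0 < e"
 proof eventually_elim
  case (elim N)
  have "norm (average2 N (\<lambda>n m. interp \<theta> (\<alpha> n - \<alpha> m)) - average2 N (\<lambda>n m. \<Sum>p\<leftarrow>xs. snd p * ee ((of_int (fst p) + \<theta>) * (\<alpha> n - \<alpha> m)))) <= e / 2"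
   unfolding average2_diff[symmetric] by (rule norm_average2_le) (use approx e in auto)
  thus ?case using elim
   norm_triangle_sub[of "average2 N (\<lambda>n m. interp \<theta> (\<alpha> n - \<alpha> m))" "average2 N (\<lambda>n m. \<Sum>p\<leftarrow>xs. snd p * ee ((of_int (fst p) + \<theta>) * (\<alpha> n - \<alpha> m)))"]
   by (simp add: dist_norm)
 qed
qed

lemma interp_shift: "interp \<theta> (u + of_int j) = ee (of_int j * \<theta>) * interp \<theta> u"
proof -
 have "frac (u + of_int j) = frac u" by (simp add: frac_def)
 moreover have "ee (of_int (\<lfloor>u\<rfloor> + j) * \<theta>) = ee (of_int j * \<theta>) * ee (of_int \<lfloor>u\<rfloor> * \<theta>)"
  "ee (of_int (\<lfloor>u\<rfloor> + j + 1) * \<theta>) = ee (of_int j * \<theta>) * ee (of_int (\<lfloor>u\<rfloor> + 1) * \<theta>)"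
  unfolding ee_add[symmetric] by (rule arg_cong[of _ _ ee], simp add: algebra_simps)+
 ultimately show ?thesis unfolding interp_def by (simp only: floor_add_int) (simp add: algebra_simps)
qed

text \<open>
  Let \<open>b k = |r k|^2\<close> for the Fourier coefficients \<open>r\<close> of the measure.
  The floors are removed by positivity: \<open>[\<alpha> n] - [\<alpha> m]\<close> differs from
  \<open>u = \<alpha> n - \<alpha> m\<close> by less than one, so \<open>b\<close> there is at
  most the sum of the linear interpolation \<open>bt\<close> of \<open>b\<close> at
  \<open>u - 1\<close>, \<open>u\<close>, \<open>u + 1\<close>. Now \<open>bt u\<close> is the
  double integral of \<open>interp (x - y) u\<close>, whose averages vanish unless
  \<open>x - y\<close> lies in a countable set, which is a null event as there are no atoms.
\<close>

theorem Wiener_along_sequence: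
 fixes \<nu> :: "real measure" and \<alpha> :: "nat => real"
 assumes fin: "finite_measure \<nu>" and sets [measurable_cong]: "sets \<nu> = sets borel"
  and atomless: "\<And>x. emeasure \<nu> {x} = 0"
  and ctbl: "countable {s. \<not> (\<lambda>N. average N (\<lambda>n. ee (s * \<alpha> n))) \<longlonglongrightarrow> 0}"
 shows "(\<lambda>N. real_average2 N (\<lambda>n m. (norm (\<integral>x. ee (of_int (\<lfloor>\<alpha> n\<rfloor> - \<lfloor>\<alpha> m\<rfloor>) * x) \<partial>\<nu>))\<^sup>2)) \<longlonglongrightarrow> 0"
proof -
 interpret finite_measure \<nu> by fact
 define r where "r k = (\<integral>x. ee (of_int k * x) \<partial>\<nu>)" for k
 define b where "b k = (norm (r k))\<^sup>2" for k
 define bt where "bt u = (1 - frac u) * b \<lfloor>u\<rfloor> + frac u * b (\<lfloor>u\<rfloor> + 1)" for u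
 have b0: "b k >= 0" for k by (simp add: b_def)
 have major: "b k <= bt (u - 1) + bt u + bt (u + 1)" if "\<bar>u - of_int k\<bar> < 1" for u k
 proof -
  have f: "\<lfloor>u - 1\<rfloor> = \<lfloor>u\<rfloor> - 1" "frac (u - 1) = frac u" "\<lfloor>u + 1\<rfloor> = \<lfloor>u\<rfloor> + 1" "frac (u + 1) = frac u"
   by (simp_all add: frac_def)
  have fr: "0 <= frac u" "frac u < 1" by (auto simp: frac_ge_0 frac_lt_1)
  have nn: "(1 - frac u) * b j >= 0" "frac u * b j >= 0" for j using fr b0[of j] by auto
  have "\<lfloor>u\<rfloor> = k \<or> \<lfloor>u\<rfloor> = k - 1"
  proof (cases "u >= of_int k")
   case True
   hence "\<lfloor>u\<rfloor> = k" using that by (intro floor_unique) auto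
   thus ?thesis ..
  next
   case False
   hence "\<lfloor>u\<rfloor> = k - 1" using that by (intro floor_unique) auto
   thus ?thesis ..
  qed
  thus ?thesis
  proof
   assume k: "\<lfloor>u\<rfloor> = k"
   have "b k = (1 - frac u) * b k + frac u * b k" by (simp add: algebra_simps)
   thus ?thesis unfolding bt_def f k using nn[of "k-1"] nn[of "k+1"] nn[of "k+2"] nn[of k] by (simp add: add.commute)
  next
   assume k: "\<lfloor>u\<rfloor> = k - 1"
   have "b k = (1 - frac u) * b k + frac u * b k" by (simp add: algebra_simps)
   thus ?thesis unfolding bt_def f k using nn[of "k-1"] nn[of "k-2"] nn[of "k+1"] nn[of k] by (simp add: add.commute)
  qed
 qed
 have ie: "integrable \<nu> (\<lambda>x. ee (of_int k * (x - y)))" for k y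
  by (rule integrable_bounded[of _ 1]) (auto intro: measurable_compose[OF _ measurable_ee])
 have rb: "(\<integral>x. ee (of_int k * (x - y)) \<partial>\<nu>) = ee (- of_int k * y) * r k" for k y
 proof -
  have "ee (of_int k * (x - y)) = ee (- of_int k * y) * ee (of_int k * x)" for x
   unfolding ee_add[symmetric] by (rule arg_cong[of _ _ ee]) (simp add: algebra_simps)
  thus ?thesis by (simp add: r_def)
 qed
 have cr: "(\<integral>y. ee (- of_int k * y) \<partial>\<nu>) = cnj (r k)" for k
 proof -
  have "cnj (r k) = (\<integral>x. cnj (ee (of_int k * x)) \<partial>\<nu>)" unfolding r_def by (rule Bochner_Integration.integral_cnj[symmetric])
  thus ?thesis by (simp add: cnj_ee)
 qed
 have bb: "(\<integral>y. ee (- of_int k * y) * r k \<partial>\<nu>) = of_real (b k)" for k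
  unfolding integral_mult_left_zero cr b_def complex_norm_square by (rule mult.commute)
 have inn: "(\<integral>x. interp (x - y) u \<partial>\<nu>) = of_real (1 - frac u) * (ee (- of_int \<lfloor>u\<rfloor> * y) * r \<lfloor>u\<rfloor>) + of_real (frac u) * (ee (- of_int (\<lfloor>u\<rfloor> + 1) * y) * r (\<lfloor>u\<rfloor> + 1))" for u y
  unfolding interp_def by (subst Bochner_Integration.integral_add) (auto intro!: ie simp del: of_int_add of_real_diff simp: rb)
 have i2: "integrable \<nu> (\<lambda>y. ee (- of_int k * y) * r k)" for k
  by (rule integrable_bounded[of _ "norm (r k)"]) (auto intro!: measurable_compose[OF _ measurable_ee] simp: norm_mult)
 have btI: "of_real (bt u) = (\<integral>y. (\<integral>x. interp (x - y) u \<partial>\<nu>) \<partial>\<nu>)" for u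
  unfolding inn by (subst Bochner_Integration.integral_add[OF integrable_mult_right[OF i2] integrable_mult_right[OF i2]])
   (simp only: integral_mult_right_zero bb bt_def of_real_add of_real_mult)
 have mi: "(\<lambda>x. interp (x - y) u) \<in> borel_measurable \<nu>" for y u
  unfolding interp_def by measurable
 have iin: "integrable \<nu> (\<lambda>x. interp (x - y) u)" for y u
  by (rule integrable_bounded[of _ 1]) (auto intro: mi norm_interp_le)
 have iin2: "integrable \<nu> (\<lambda>y. \<integral>x. interp (x - y) u \<partial>\<nu>)" for u
  unfolding inn by (intro Bochner_Integration.integrable_add integrable_mult_right i2)
 \<comment> \<open>translates of the exceptional set by integers, since \<open>interp\<close> contains the frequencies \<open>k + \<theta>\<close>\<close>
 define C' where "C' = (\<Union>k::int. (\<lambda>s. s - of_int k) ` {s. \<not> (\<lambda>N. average N (\<lambda>n. ee (s * \<alpha> n))) \<longlonglongrightarrow> 0})"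
 have C': "countable C'" unfolding C'_def by (intro countable_UN countable_image ctbl) auto
 have good: "(\<lambda>N. average2 N (\<lambda>n m. interp \<theta> (\<alpha> n - \<alpha> m))) \<longlonglongrightarrow> 0" if "\<theta> \<notin> C'" for \<theta>
 proof (rule average2_interp_tendsto_0, rule ccontr)
  fix k :: int
  assume "\<not> (\<lambda>N. average N (\<lambda>n. ee ((of_int k + \<theta>) * \<alpha> n))) \<longlonglongrightarrow> 0"
  hence "of_int k + \<theta> - of_int k \<in> C'" unfolding C'_def by blast
  thus False using that by simp
 qed
 have AEgood: "AE x in \<nu>. x - y \<notin> C'" for y
 proof (rule AE_I')
  have "countable ((\<lambda>c. c + y) ` C')" using C' by (rule countable_image)
  hence "(\<Union>z\<in>(\<lambda>c. c + y) ` C'. {z}) \<in> null_sets \<nu>"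
   by (rule null_sets_UN') (simp add: null_sets_def atomless sets)
  thus "(\<lambda>c. c + y) ` C' \<in> null_sets \<nu>" by (simp only: UN_singleton)
  show "{x \<in> space \<nu>. \<not> x - y \<notin> C'} \<subseteq> (\<lambda>c. c + y) ` C'" by (auto intro: image_eqI[of _ _ "_ - y"])
 qed
 have L: "(\<lambda>N. real_average2 N (\<lambda>n m. bt (\<alpha> n - \<alpha> m + of_int j))) \<longlonglongrightarrow> 0" for j :: int
 proof -
  define X where "X N x y = average2 N (\<lambda>n m. interp (x - y) (\<alpha> n - \<alpha> m + of_int j))" for N x y
  have mX [measurable]: "(\<lambda>x. X N x y) \<in> borel_measurable \<nu>" for N y
   unfolding X_def average2_def average_def interp_def by measurable
  have mX2 [measurable]: "(\<lambda>y. \<integral>x. X N x y \<partial>\<nu>) \<in> borel_measurable \<nu>" for N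
   unfolding X_def average2_def average_def interp_def by measurable
  have bX: "norm (X N x y) <= 1" for N x y unfolding X_def by (rule norm_average2_le) (auto simp: norm_interp_le)
  have lX: "(\<lambda>N. X N x y) \<longlonglongrightarrow> 0" if "x - y \<notin> C'" for x y
  proof -
   have "X N x y = ee (of_int j * (x - y)) * average2 N (\<lambda>n m. interp (x - y) (\<alpha> n - \<alpha> m))" for N
    unfolding X_def interp_shift average2_cmult ..
   thus ?thesis using tendsto_mult_left[OF good[OF that], of "ee (of_int j * (x - y))"] by simp
  qed
  have inner: "(\<lambda>N. \<integral>x. X N x y \<partial>\<nu>) \<longlonglongrightarrow> (\<integral>x. 0 \<partial>\<nu>)" for y
  proof (rule integral_dominated_convergence[where w="\<lambda>_. 1"])
   show "AE x in \<nu>. (\<lambda>N. X N x y) \<longlonglongrightarrow> 0" using AEgood[of y] by eventually_elim (rule lX)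
  qed (auto simp: bX)
  have bI: "norm (\<integral>x. X N x y \<partial>\<nu>) <= measure \<nu> (space \<nu>)" for N y
  proof -
   have "norm (\<integral>x. X N x y \<partial>\<nu>) <= (\<integral>x. norm (X N x y) \<partial>\<nu>)" by (rule integral_norm_bound)
   also have "... <= (\<integral>x. 1 \<partial>\<nu>)"
    by (rule integral_mono) (auto intro!: integrable_bounded[of _ 1] simp: bX)
   finally show ?thesis by simp
  qed
  have outer: "(\<lambda>N. \<integral>y. (\<integral>x. X N x y \<partial>\<nu>) \<partial>\<nu>) \<longlonglongrightarrow> (\<integral>y. 0 \<partial>\<nu>)"
  proof (rule integral_dominated_convergence[where w="\<lambda>_. measure \<nu> (space \<nu>)"])
   show "AE y in \<nu>. (\<lambda>N. \<integral>x. X N x y \<partial>\<nu>) \<longlonglongrightarrow> 0" using inner by simp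
  qed (auto simp: bI)
  have sw: "(\<integral>y. (\<integral>x. X N x y \<partial>\<nu>) \<partial>\<nu>) = of_real (real_average2 N (\<lambda>n m. bt (\<alpha> n - \<alpha> m + of_int j)))" for N
  proof -
   have 1: "(\<integral>x. X N x y \<partial>\<nu>) = average2 N (\<lambda>n m. \<integral>x. interp (x - y) (\<alpha> n - \<alpha> m + of_int j) \<partial>\<nu>)" for y
    unfolding X_def average2_def average_def
    by (simp add: Bochner_Integration.integral_sum integrable_divide Bochner_Integration.integrable_sum iin del: sum_divide_distrib)
   show ?thesis
    unfolding 1 average2_of_real[symmetric] btI
    unfolding average2_def average_def
    by (simp add: Bochner_Integration.integral_sum integrable_divide Bochner_Integration.integrable_sum iin2 del: sum_divide_distrib)
  qed
  have "(\<lambda>N. complex_of_real (real_average2 N (\<lambda>n m. bt (\<alpha> n - \<alpha> m + of_int j)))) \<longlonglongrightarrow> of_real 0"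
   using outer unfolding sw by simp
  thus ?thesis by (simp only: tendsto_of_real_iff)
 qed
 have le: "real_average2 N (\<lambda>n m. b (\<lfloor>\<alpha> n\<rfloor> - \<lfloor>\<alpha> m\<rfloor>)) <= real_average2 N (\<lambda>n m. bt (\<alpha> n - \<alpha> m + of_int (-1)))
   + real_average2 N (\<lambda>n m. bt (\<alpha> n - \<alpha> m + of_int 0)) + real_average2 N (\<lambda>n m. bt (\<alpha> n - \<alpha> m + of_int 1))" for N
  unfolding real_average2_add[symmetric]
 proof (rule real_average2_mono)
  fix n m
  have "\<bar>(\<alpha> n - \<alpha> m) - of_int (\<lfloor>\<alpha> n\<rfloor> - \<lfloor>\<alpha> m\<rfloor>)\<bar> < 1"
   unfolding of_int_diff by linarith
  from major[OF this] show "b (\<lfloor>\<alpha> n\<rfloor> - \<lfloor>\<alpha> m\<rfloor>) <= bt (\<alpha> n - \<alpha> m + of_int (-1)) + bt (\<alpha> n - \<alpha> m + of_int 0) + bt (\<alpha> n - \<alpha> m + of_int 1)"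
   by simp
 qed
 have "(\<lambda>N. real_average2 N (\<lambda>n m. b (\<lfloor>\<alpha> n\<rfloor> - \<lfloor>\<alpha> m\<rfloor>))) \<longlonglongrightarrow> 0"
 proof (rule tendsto_sandwich[OF _ _ tendsto_const])
  show "(\<lambda>N. real_average2 N (\<lambda>n m. bt (\<alpha> n - \<alpha> m + of_int (-1)))
   + real_average2 N (\<lambda>n m. bt (\<alpha> n - \<alpha> m + of_int 0)) + real_average2 N (\<lambda>n m. bt (\<alpha> n - \<alpha> m + of_int 1))) \<longlonglongrightarrow> 0"
   using tendsto_add[OF tendsto_add[OF L[of "-1"] L[of 0]] L[of 1]] by (simp only: add_0_right)
 qed (use le b0 in \<open>auto intro!: always_eventually real_average2_nonneg\<close>)
 thus ?thesis by (simp only: b_def r_def)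
qed

section \<open>Eigenfunctions and atoms of the spectral measure\<close>

text \<open>The averages that project a measure onto its atom at \<open>y\<close>.\<close>

lemma average_ee_atom:
 assumes "0 <= x" "x < 1" "0 <= y" "y < 1"
 shows "(\<lambda>N. average N (\<lambda>n. ee ((x - y) * real n))) \<longlonglongrightarrow> (if x = y then 1 else 0)"
proof (cases "x = y")
 case True thus ?thesis using average_const_tendsto[of 1] by simp
next
 case False
 have "x - y \<notin> \<int>"
 proof
  assume "x - y \<in> \<int>"
  then obtain k :: int where k: "x - y = of_int k" by (auto elim: Ints_cases)
  hence "\<bar>of_int k :: real\<bar> < 1" using assms by linarith
  hence "k = 0" by linarith
  thus False using k False by simp
 qed
 thus ?thesis using False average_ee_linear_tendsto_0 by simp
qed

context invertible_system
begin

lemma invertible_id: "invertible_system M (\<lambda>x. x)"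
proof
 have "inv_into (space M) (\<lambda>x. x) x = x" if "x \<in> space M" for x
  using inv_into_f_f[of "\<lambda>x. x" "space M" x] that by (simp add: inj_on_def)
 hence "inv_into (space M) (\<lambda>x. x) \<in> M \<rightarrow>\<^sub>M M \<longleftrightarrow> (\<lambda>x. x) \<in> M \<rightarrow>\<^sub>M M" by (intro measurable_cong) auto
 thus "invertible_measure_preserving M (\<lambda>x. x)"
  by (simp add: invertible_measure_preserving_def bij_betw_def distr_id)
qed

definition autocorr :: "('a => complex) => int => complex" where
 "autocorr f m = (\<integral>x. f (iter m x) * cnj (f x) \<partial>M)"

definition eigenfunction :: "real => ('a => complex) => bool" where
 "eigenfunction lam g \<longleftrightarrow> g \<in> Linfty M \<and> (AE x in M. g (T x) = ee lam * g x) \<and> \<not> (AE x in M. g x = 0)"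

lemma eigenfunction_iter:
 assumes "AE x in M. g (T x) = ee lam * g x"
 shows "AE x in M. g (iter k x) = ee (of_int k * lam) * g x"
proof (induction k rule: int_induct[where k=0])
 case (step1 k)
 have "AE x in M. g (T (iter k x)) = ee lam * g (iter k x)" by (rule mp_map_AE[OF mp_iter assms])
 with step1(2) AE_space show ?case
 proof eventually_elim
  case (elim x)
  thus ?case by (simp only: iter_Suc) (simp add: ee_add distrib_right)
 qed
next
 case (step2 k)
 have "AE x in M. g (T (iter (k - 1) x)) = ee lam * g (iter (k - 1) x)" by (rule mp_map_AE[OF mp_iter assms])
 with step2(2) AE_space show ?case
 proof eventually_elim
  case (elim x)
  have "g (T (iter (k - 1) x)) = g (iter k x)" using iter_Suc[of x "k - 1"] elim by simp
  hence "ee lam * g (iter (k - 1) x) = ee (of_int k * lam) * g x" using elim by simp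
  also have "ee (of_int k * lam) = ee lam * ee (of_int (k - 1) * lam)"
   unfolding ee_add[symmetric] by (rule arg_cong[of _ _ ee]) (simp add: algebra_simps)
  finally show ?case by (simp only: mult.assoc mult_cancel_left ee_nonzero simp_thms)
 qed
qed simp

text \<open>
  Ergodicity along any sequence of powers makes invariant functions constant, as averaging does
  not change them.
\<close>

lemma invariant_const:
 assumes erg: "ergodic_sequence M (\<lambda>n. iter (p n))" and g: "g \<in> Linfty M" and inv: "AE x in M. g (T x) = g x"
 shows "AE x in M. g x = (\<integral>y. g y \<partial>M)"
proof -
 obtain C where [measurable]: "g \<in> borel_measurable M" and C: "AE x in M. norm (g x) <= C" using g unfolding Linfty_def by blast
 note [measurable] = mp_map_measurable[OF mp_iter]
 have "AE x in M. g (iter k x) = g x" for k using eigenfunction_iter[of g 0 k] inv by simp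
 hence AE: "AE x in M. \<forall>n. g (iter (p n) x) = g x" unfolding AE_all_countable by blast
 define c where "c = (\<integral>y. g y \<partial>M)"
 have eq: "L2norm M (\<lambda>x. average N (\<lambda>n. g (iter (p n) x)) - c) = L2norm M (\<lambda>x. g x - c)" if "N > 0" for N
  unfolding L2norm_def
 proof (intro arg_cong[of _ _ sqrt] integral_cong_AE)
  show "AE x in M. (norm (average N (\<lambda>n. g (iter (p n) x)) - c))\<^sup>2 = (norm (g x - c))\<^sup>2"
   using AE by eventually_elim (simp add: average_const[OF that])
  show "(\<lambda>x. (norm (average N (\<lambda>n. g (iter (p n) x)) - c))\<^sup>2) \<in> borel_measurable M" unfolding average_def by measurable
 qed measurable
 have "(\<lambda>N. L2norm M (\<lambda>x. average N (\<lambda>n. g (iter (p n) x)) - c)) \<longlonglongrightarrow> 0"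
  using erg g unfolding ergodic_sequence_def c_def by blast
 hence "(\<lambda>N::nat. L2norm M (\<lambda>x. g x - c)) \<longlonglongrightarrow> 0"
  by (rule Lim_transform_eventually) (rule eventually_mono[OF eventually_gt_at_top[of 0]], rule eq)
 hence "L2norm M (\<lambda>x. g x - c) = 0" by (simp add: LIMSEQ_const_iff)
 hence 0: "(\<integral>x. (norm (g x - c))\<^sup>2 \<partial>M) = 0" by (simp add: L2norm_def)
 have "integrable M (\<lambda>x. (norm (g x - c))\<^sup>2)"
 proof (rule integrable_const_bound[where B="(\<bar>C\<bar> + norm c)\<^sup>2"])
  show "AE x in M. norm ((norm (g x - c))\<^sup>2) <= (\<bar>C\<bar> + norm c)\<^sup>2" using C
  proof eventually_elim
   case (elim x)
   have "norm (g x - c) <= \<bar>C\<bar> + norm c" using elim norm_triangle_ineq4[of "g x" c] by linarith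
   thus ?case by (simp add: power_mono)
  qed
 qed measurable
 hence "AE x in M. (norm (g x - c))\<^sup>2 = 0" using integral_nonneg_eq_0_iff_AE[of M "\<lambda>x. (norm (g x - c))\<^sup>2"] 0 by simp
 thus ?thesis unfolding c_def by eventually_elim simp
qed

text \<open>The modulus of an eigenfunction is invariant.\<close>

lemma eigenfunction_norm_const:
 assumes erg: "ergodic_sequence M (\<lambda>n. iter (p n))" and g: "eigenfunction lam g"
 shows "\<exists>c>0. AE x in M. norm (g x) = c"
proof -
 obtain C where gm [measurable]: "g \<in> borel_measurable M" and C: "AE x in M. norm (g x) <= C" using g unfolding eigenfunction_def Linfty_def by blast
 define h where "h x = complex_of_real (norm (g x))" for x
 have "h \<in> Linfty M" unfolding Linfty_def h_def using C by auto
 moreover have "AE x in M. h (T x) = h x"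
  using g unfolding eigenfunction_def by (auto elim!: eventually_mono simp: h_def norm_mult)
 ultimately have "AE x in M. h x = (\<integral>y. h y \<partial>M)" by (rule invariant_const[OF erg])
 moreover have "(\<integral>y. h y \<partial>M) = of_real (\<integral>y. norm (g y) \<partial>M)" unfolding h_def by (rule integral_complex_of_real)
 ultimately have c: "AE x in M. norm (g x) = (\<integral>y. norm (g y) \<partial>M)"
  by (simp add: h_def)
 moreover have "(\<integral>y. norm (g y) \<partial>M) \<noteq> 0"
 proof
  assume "(\<integral>y. norm (g y) \<partial>M) = 0"
  hence "AE x in M. g x = 0" using c by simp
  thus False using g by (simp add: eigenfunction_def)
 qed
 moreover have "(\<integral>y. norm (g y) \<partial>M) >= 0" by simp
 ultimately have "(\<integral>y. norm (g y) \<partial>M) > 0" by linarith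
 thus ?thesis using c by blast
qed

lemma eigenfunction_integral_0:
 assumes "eigenfunction lam g" "lam \<notin> \<int>" shows "(\<integral>x. g x \<partial>M) = 0"
proof -
 have gm [measurable]: "g \<in> borel_measurable M" and AE: "AE x in M. g (T x) = ee lam * g x" using assms unfolding eigenfunction_def Linfty_def by auto
 note [measurable] = mp_map_measurable[OF mp_T]
 have "(\<integral>x. g x \<partial>M) = (\<integral>x. g (T x) \<partial>M)" by (rule mp_map_integral[OF mp_T gm, symmetric])
 also have "... = (\<integral>x. ee lam * g x \<partial>M)" by (rule integral_cong_AE) (use AE in auto)
 finally have "(1 - ee lam) * (\<integral>x. g x \<partial>M) = 0" by (simp add: algebra_simps)
 thus ?thesis using assms(2) by (simp add: ee_eq_1_iff)
qed

lemma commuting_pair_id: "commuting_pair M T (\<lambda>x. x)"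
 using invertible_id by (intro commuting_pair.intro commuting_pair_axioms.intro invertible_system_axioms) auto

lemma W_id: assumes x: "x \<in> space M" shows "commuting_pair.W M T (\<lambda>x. x) m n x = iter m x"
proof -
 interpret P: commuting_pair M T "\<lambda>x. x" by (rule commuting_pair_id)
 have "int_iterate M (\<lambda>x. x) n x = x"
 proof (induction n rule: int_induct[where k=0])
  case (step1 n) thus ?case using invertible_system.iter_Suc[OF invertible_id x, of n] by simp
 next
  case (step2 n) thus ?case using invertible_system.iter_Suc[OF invertible_id x, of "n - 1"] by simp
 qed simp
 thus ?thesis by (simp add: P.W_def)
qed

lemma corr_id: "commuting_pair.corr M T (\<lambda>x. x) f m n = autocorr f m"
proof -
 interpret P: commuting_pair M T "\<lambda>x. x" by (rule commuting_pair_id)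
 show ?thesis unfolding P.corr_def autocorr_def by (rule Bochner_Integration.integral_cong) (auto simp: W_id)
qed

lemma positive_definite2_autocorr:
 assumes "f \<in> borel_measurable M" "\<And>x. norm (f x) <= C"
 shows "positive_definite2 (\<lambda>m n. autocorr f m)"
 using commuting_pair.positive_definite2_corr[OF commuting_pair_id assms] corr_id[of f]
 by (simp add: positive_definite2_def)

lemma spectral_isometry:
 assumes f: "f \<in> borel_measurable M" and C: "\<And>x. norm (f x) <= C" and \<sigma>: "real_distribution \<sigma>"
  and spec: "\<And>m. autocorr f m = of_real p * (\<integral>y. ee (of_int m * y) \<partial>\<sigma>)"
 shows "(\<integral>x. (norm (\<Sum>n=1..N. z n * f (iter (int n) x)))\<^sup>2 \<partial>M) = p * (\<integral>y. (norm (\<Sum>n=1..N. z n * ee (real n * y)))\<^sup>2 \<partial>\<sigma>)"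
proof -
 interpret P: commuting_pair M T "\<lambda>x. x" by (rule commuting_pair_id)
 interpret \<sigma>: real_distribution \<sigma> by fact
 note W = W_id and corr = corr_id
 have it: "integrable \<sigma> (\<lambda>y. trig2 xs (y, 0))" for xs
 proof (induction xs)
  case Nil show ?case by (simp add: trig2_def)
 next
  case (Cons q xs)
  obtain m n c where q: "q = (m, n, c)" by (cases q)
  have "integrable \<sigma> (\<lambda>y. ee (of_int m * y))" by (rule \<sigma>.integrable_bounded[of _ 1]) auto
  hence "integrable \<sigma> (\<lambda>y. c * ee (of_int m * y) + trig2 xs (y, 0))" using Cons by simp
  thus ?case by (simp add: trig2_def q)
 qed
 have tv: "trig2_value (P.corr f) xs = of_real p * (\<integral>y. trig2 xs (y, 0) \<partial>\<sigma>)" for xs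
 proof (induction xs)
  case Nil show ?case by (simp add: trig2_def trig2_value_def)
 next
  case (Cons q xs)
  obtain m n c where q: "q = (m, n, c)" by (cases q)
  have "integrable \<sigma> (\<lambda>y. c * ee (of_int m * y))" by (intro integrable_mult_right \<sigma>.integrable_bounded[of _ 1]) auto
  from Bochner_Integration.integral_add[OF this it[of xs]]
  have "(\<integral>y. trig2 (q # xs) (y, 0) \<partial>\<sigma>) = c * (\<integral>y. ee (of_int m * y) \<partial>\<sigma>) + (\<integral>y. trig2 xs (y, 0) \<partial>\<sigma>)"
   by (simp add: trig2_def q)
  thus ?case using Cons by (simp add: q trig2_value_def corr spec algebra_simps)
 qed
 define xs where "xs = map (\<lambda>n. (int n, 0::int, z n)) [1..<Suc N]"
 have sl: "(\<Sum>n\<leftarrow>[1..<Suc N]. g n) = (\<Sum>n=1..N. g n)" for g :: "nat => complex"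
  by (simp add: interv_sum_list_conv_sum_set_nat atLeastLessThanSuc_atLeastAtMost del: upt_Suc)
 have t: "trig2 xs (y, 0) = (\<Sum>n=1..N. z n * ee (real n * y))" for y
  unfolding trig2_def xs_def map_map comp_def case_prod_conv sl by simp
 have cb: "P.comb f xs x = (\<Sum>n=1..N. z n * f (iter (int n) x))" if "x \<in> space M" for x
  unfolding P.comb_def xs_def map_map comp_def case_prod_conv sl by (simp add: W[OF that])
 have "(\<integral>x. (norm (\<Sum>n=1..N. z n * f (iter (int n) x)))\<^sup>2 \<partial>M) = (\<integral>x. (norm (P.comb f xs x))\<^sup>2 \<partial>M)"
  by (rule Bochner_Integration.integral_cong) (auto simp: cb)
 also have "... = Re (of_real p * (\<integral>y. trig2 (trig2_prod xs (trig2_cnj xs)) (y, 0) \<partial>\<sigma>))"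
  unfolding P.comb_norm_square[OF f C] tv ..
 also have "(\<lambda>y. trig2 (trig2_prod xs (trig2_cnj xs)) (y, 0)) = (\<lambda>y. complex_of_real ((norm (trig2 xs (y, 0)))\<^sup>2))"
  unfolding trig2_prod trig2_cnj complex_norm_square ..
 finally show ?thesis by (simp add: t del: of_real_power)
qed

text \<open>
  The eigenfunction is the limit of \<open>G_N = E_n e(-n lam) f(T^n x)\<close>, the projection of
  \<open>f\<close>. Under the spectral isometry these averages correspond to kernels that tend to
  the indicator of \<open>lam\<close>, which makes them Cauchy in \<open>L2\<close> and gives the
  norm of the limit. A subsequence converges almost everywhere, so that the limit is bounded like
  \<open>f\<close>.
\<close>

lemma eigenfunction_of_atom:
 assumes f [measurable]: "f \<in> borel_measurable M" and C: "\<And>x. norm (f x) <= C" and \<sigma>: "real_distribution \<sigma>" "AE y in \<sigma>. 0 <= y \<and> y < 1"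
  and spec: "\<And>m. autocorr f m = of_real p * (\<integral>y. ee (of_int m * y) \<partial>\<sigma>)"
  and p: "p >= 0" and lam: "0 <= lam" "lam < 1"
 shows "\<exists>g. g \<in> Linfty M \<and> (AE x in M. g (T x) = ee lam * g x) \<and> (\<integral>x. (norm (g x))\<^sup>2 \<partial>M) = p * measure \<sigma> {lam}
   \<and> (lam = 0 \<longrightarrow> (\<integral>x. g x \<partial>M) = (\<integral>x. f x \<partial>M))"
proof -
 interpret \<sigma>: real_distribution \<sigma> by fact
 note [measurable] = mp_map_measurable[OF mp_iter] mp_map_measurable[OF mp_T]
 have C0: "C >= 0" by (rule order.trans[OF norm_ge_zero C])
 define u where "u x n = ee (- real n * lam) * f (iter (int n) x)" for x n
 define G where "G N x = average N (u x)" for N x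
 define D where "D N y = average N (\<lambda>n. ee ((y - lam) * real n))" for N y
 have Gm [measurable]: "G N \<in> borel_measurable M" for N unfolding G_def u_def average_def by measurable
 have Dm [measurable]: "D N \<in> borel_measurable \<sigma>" for N unfolding D_def average_def by measurable
 have ub: "norm (u x n) <= C" for x n using C by (simp add: u_def norm_mult)
 have Gb: "norm (G N x) <= C" for N x unfolding G_def by (rule norm_average_le) (use ub C0 in auto)
 have Db: "norm (D N y) <= 1" for N y unfolding D_def by (rule norm_average_le) auto
 have Dl: "AE y in \<sigma>. (\<lambda>N. D N y) \<longlonglongrightarrow> indicator {lam} y"
  using \<sigma>(2)
 proof eventually_elim
  case (elim y)
  have e: "indicator {lam} y = (if y = lam then 1 else (0::complex))" by simp
  show ?case unfolding D_def e by (rule average_ee_atom) (use elim lam in auto)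
 qed
 have De: "D N y = (\<Sum>n=1..N. (ee (- real n * lam) / of_nat N) * ee (real n * y))" for N y
  unfolding D_def average_def sum_divide_distrib
  by (intro sum.cong refl) (simp add: ee_add[symmetric] algebra_simps)
 have iso1: "(\<integral>x. (norm (G N x))\<^sup>2 \<partial>M) = p * (\<integral>y. (norm (D N y))\<^sup>2 \<partial>\<sigma>)" for N
 proof -
  have "G N x = (\<Sum>n=1..N. (ee (- real n * lam) / of_nat N) * f (iter (int n) x))" for x
   by (simp add: G_def average_def u_def sum_divide_distrib)
  thus ?thesis unfolding De by (simp only: spectral_isometry[OF f C \<sigma>(1) spec])
 qed
 have iso2: "(\<integral>x. (norm (G N x - G K x))\<^sup>2 \<partial>M) = p * (\<integral>y. (norm (D N y - D K y))\<^sup>2 \<partial>\<sigma>)" for N K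
 proof -
  define z where "z n = (if n <= N then ee (- real n * lam) / of_nat N else 0) - (if n <= K then ee (- real n * lam) / of_nat K else 0)" for n
  have e: "(\<Sum>n=1..max N K. z n * h n) = (\<Sum>n=1..N. ee (- real n * lam) * h n) / of_nat N - (\<Sum>n=1..K. ee (- real n * lam) * h n) / of_nat K" for h
  proof -
   have r: "(\<Sum>n=1..max N K. (if n <= L then ee (- real n * lam) / of_nat L else 0) * h n) = (\<Sum>n=1..L. ee (- real n * lam) * h n) / of_nat L"
    if "L <= max N K" for L
   proof -
    have "(\<Sum>n=1..L. ee (- real n * lam) * h n) / of_nat L = (\<Sum>n=1..L. (if n <= L then ee (- real n * lam) / of_nat L else 0) * h n)"
     by (simp add: sum_divide_distrib)
    also have "... = (\<Sum>n=1..max N K. (if n <= L then ee (- real n * lam) / of_nat L else 0) * h n)"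
     by (rule sum.mono_neutral_left) (use that in auto)
    finally show ?thesis ..
   qed
   show ?thesis unfolding z_def left_diff_distrib sum_subtractf using r[of N] r[of K] by simp
  qed
  have "G N x - G K x = (\<Sum>n=1..max N K. z n * f (iter (int n) x))" for x
   unfolding e by (simp add: G_def average_def u_def)
  moreover have "D N y - D K y = (\<Sum>n=1..max N K. z n * ee (real n * y))" for y
  proof -
   have "D L y = (\<Sum>n=1..L. ee (- real n * lam) * ee (real n * y)) / of_nat L" for L
    by (simp add: De sum_divide_distrib)
   thus ?thesis unfolding e by simp
  qed
  ultimately show ?thesis by (simp only: spectral_isometry[OF f C \<sigma>(1) spec])
 qed
 have Dlim: "(\<lambda>N. \<integral>y. (norm (D N y - indicator {lam} y))\<^sup>2 \<partial>\<sigma>) \<longlonglongrightarrow> (\<integral>y. 0 \<partial>\<sigma>)"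
 proof (rule integral_dominated_convergence[where w="\<lambda>_. 4"])
  show "AE y in \<sigma>. (\<lambda>N. (norm (D N y - indicator {lam} y))\<^sup>2) \<longlonglongrightarrow> 0"
   using Dl
  proof eventually_elim
   case (elim y)
   from tendsto_power[OF tendsto_norm_zero[OF LIM_zero[OF elim]], of 2] show ?case by simp
  qed
  show "AE y in \<sigma>. norm ((norm (D N y - indicator {lam} y))\<^sup>2) <= 4" for N
  proof (rule AE_I2)
   fix y
   have "norm (D N y - indicator {lam} y) <= 1 + 1" by (intro norm_triangle_le_diff add_mono Db) (auto simp: indicator_def)
   from power_mono[OF this, of 2] show "norm ((norm (D N y - indicator {lam} y))\<^sup>2) <= 4" by simp
  qed
 qed auto
 have Dint: "integrable \<sigma> (\<lambda>y. (norm (D N y - indicator {lam} y))\<^sup>2)" for N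
 proof (rule \<sigma>.integrable_bounded[of _ 4])
  fix y
  have "norm (D N y - indicator {lam} y) <= 1 + 1" by (intro norm_triangle_le_diff add_mono Db) (auto simp: indicator_def)
  from power_mono[OF this, of 2] show "norm ((norm (D N y - indicator {lam} y))\<^sup>2) <= 4" by simp
 qed auto
 have Cau: "\<exists>N0. \<forall>i\<ge>N0. \<forall>j\<ge>N0. (\<integral>x. norm (G i x - G j x) \<partial>M) < e" if e: "e > 0" for e
 proof -
  \<comment> \<open>the bound \<open>4 d\<close> below, times \<open>p\<close>, stays under \<open>e^2\<close>; adding 1 allows \<open>p = 0\<close>\<close>
  define d where "d = e\<^sup>2 / (4 * (p + 1))"
  have d: "d > 0" using e p by (simp add: d_def)
  have "\<forall>\<^sub>F N in sequentially. (\<integral>y. (norm (D N y - indicator {lam} y))\<^sup>2 \<partial>\<sigma>) < d"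
   by (rule order_tendstoD(2)[OF Dlim]) (use d in simp)
  then obtain N0 where N0: "\<And>N. N >= N0 ==> (\<integral>y. (norm (D N y - indicator {lam} y))\<^sup>2 \<partial>\<sigma>) < d"
   by (auto simp: eventually_sequentially)
  have "(\<integral>x. norm (G i x - G j x) \<partial>M) < e" if ij: "i >= N0" "j >= N0" for i j
  proof -
   have "(\<integral>y. (norm (D i y - D j y))\<^sup>2 \<partial>\<sigma>) <= (\<integral>y. 2 * (norm (D i y - indicator {lam} y))\<^sup>2 + 2 * (norm (D j y - indicator {lam} y))\<^sup>2 \<partial>\<sigma>)"
   proof (rule integral_mono)
    show "integrable \<sigma> (\<lambda>y. (norm (D i y - D j y))\<^sup>2)"
    proof (rule \<sigma>.integrable_bounded[of _ 4])
     fix y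
     have "norm (D i y - D j y) <= 1 + 1" by (intro norm_triangle_le_diff add_mono Db)
     from power_mono[OF this, of 2] show "norm ((norm (D i y - D j y))\<^sup>2) <= 4" by simp
    qed auto
    show "integrable \<sigma> (\<lambda>y. 2 * (norm (D i y - indicator {lam} y))\<^sup>2 + 2 * (norm (D j y - indicator {lam} y))\<^sup>2)"
     using Dint by auto
    fix y
    define a where "a = norm (D i y - indicator {lam} y)"
    define b where "b = norm (D j y - indicator {lam} y)"
    have "norm (D i y - D j y) <= a + b" unfolding a_def b_def
     using norm_triangle_ineq4[of "D i y - indicator {lam} y" "D j y - indicator {lam} y"] by simp
    hence "(norm (D i y - D j y))\<^sup>2 <= (a + b)\<^sup>2" by (intro power_mono) auto
    also have "... <= 2 * a\<^sup>2 + 2 * b\<^sup>2" using zero_le_power2[of "a - b"] by (simp add: power2_eq_square algebra_simps)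
    finally show "(norm (D i y - D j y))\<^sup>2 <= 2 * (norm (D i y - indicator {lam} y))\<^sup>2 + 2 * (norm (D j y - indicator {lam} y))\<^sup>2"
     by (simp only: a_def b_def)
   qed
   also have "... = 2 * (\<integral>y. (norm (D i y - indicator {lam} y))\<^sup>2 \<partial>\<sigma>) + 2 * (\<integral>y. (norm (D j y - indicator {lam} y))\<^sup>2 \<partial>\<sigma>)"
    using Dint by simp
   also have "... < 4 * d" using N0[OF ij(1)] N0[OF ij(2)] by linarith
   finally have dd: "(\<integral>y. (norm (D i y - D j y))\<^sup>2 \<partial>\<sigma>) < 4 * d" .
   have "(\<integral>x. norm (G i x - G j x) \<partial>M) <= sqrt (\<integral>x. (norm (G i x - G j x))\<^sup>2 \<partial>M)"
   proof (rule integral_norm_le_L2[of _ "C + C"])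
    show "norm (G i x - G j x) <= C + C" for x by (intro norm_triangle_le_diff add_mono Gb)
   qed measurable
   also have "... < sqrt (e\<^sup>2)"
   proof (rule real_sqrt_less_mono)
    have "p * (\<integral>y. (norm (D i y - D j y))\<^sup>2 \<partial>\<sigma>) <= p * (4 * d)" using dd p by (intro mult_left_mono) auto
    also have "... < (p + 1) * (4 * d)" using d by simp
    also have "... = e\<^sup>2" using p by (simp add: d_def field_simps)
    finally show "(\<integral>x. (norm (G i x - G j x))\<^sup>2 \<partial>M) < e\<^sup>2" unfolding iso2 .
   qed
   finally show ?thesis using e by simp
  qed
  thus ?thesis by blast
 qed
 have Gi: "integrable M (G N)" for N by (rule integrable_bounded[of _ C]) (use Gb in auto)
 obtain r where r: "strict_mono r" "AE x in M. Cauchy (\<lambda>i. G (r i) x)"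
  using cauchy_L1_AE_cauchy_subseq[of M G, OF Gi Cau] by blast
 define g where "g x = lim (\<lambda>i. G (r i) x)" for x
 have gm [measurable]: "g \<in> borel_measurable M" unfolding g_def by (rule borel_measurable_lim_metric) simp
 have gl: "AE x in M. (\<lambda>i. G (r i) x) \<longlonglongrightarrow> g x"
  using r(2) by eventually_elim (simp add: g_def Cauchy_convergent_iff convergent_LIMSEQ_iff)
 have gb: "AE x in M. norm (g x) <= C"
  using gl by eventually_elim (rule LIMSEQ_le_const2[OF tendsto_norm], assumption, use Gb in blast)
 have rt: "filterlim r at_top sequentially" by (rule filterlim_subseq[OF r(1)])
 show ?thesis
 proof (intro exI[of _ g] conjI impI)
  show "g \<in> Linfty M" unfolding Linfty_def using gb gm by blast
  have "AE x in M. (\<lambda>i. G (r i) (T x)) \<longlonglongrightarrow> g (T x)" by (rule mp_map_AE[OF mp_T gl])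
  with gl AE_space show "AE x in M. g (T x) = ee lam * g x"
  proof eventually_elim
   case (elim x)
   have Gs: "G N (T x) = ee lam * average N (\<lambda>n. u x (n + 1))" for N
   proof -
    have "u (T x) n = ee lam * u x (n + 1)" for n
    proof -
     have "iter (int n) (T x) = iter (int n + 1) x" using iter_add[of x "int n" 1] iter_Suc[of x 0] elim(2) by simp
     hence "u (T x) n = ee (- real n * lam) * f (iter (int n + 1) x)" by (simp add: u_def)
     also have "ee (- real n * lam) = ee lam * ee (- real (n + 1) * lam)"
      unfolding ee_add[symmetric] by (rule arg_cong[of _ _ ee]) (simp add: algebra_simps)
     finally show ?thesis by (simp add: u_def add.commute)
    qed
    hence "u (T x) = (\<lambda>n. ee lam * u x (n + 1))" by auto
    thus ?thesis by (simp add: G_def average_cmult)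
   qed
   have "(\<lambda>N. average N (\<lambda>n. u x (n + 1)) - average N (u x)) \<longlonglongrightarrow> 0" by (rule average_shift[of "u x" C, OF ub])
   from filterlim_compose[OF this rt] have "(\<lambda>i. average (r i) (\<lambda>n. u x (n + 1)) - G (r i) x) \<longlonglongrightarrow> 0" by (simp add: G_def)
   from tendsto_mult_left[OF tendsto_add[OF this elim(1)], of "ee lam"] have "(\<lambda>i. G (r i) (T x)) \<longlonglongrightarrow> ee lam * g x" by (simp add: Gs)
   thus ?case using elim(3) by (rule LIMSEQ_unique[symmetric])
  qed
  have l1: "(\<lambda>i. \<integral>x. (norm (G (r i) x))\<^sup>2 \<partial>M) \<longlonglongrightarrow> (\<integral>x. (norm (g x))\<^sup>2 \<partial>M)"
  proof (rule integral_dominated_convergence[where w="\<lambda>_. C\<^sup>2"])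
   show "AE x in M. (\<lambda>i. (norm (G (r i) x))\<^sup>2) \<longlonglongrightarrow> (norm (g x))\<^sup>2" using gl by eventually_elim (intro tendsto_power tendsto_norm)
  qed (use Gb in \<open>auto intro!: power_mono\<close>)
  have l2: "(\<lambda>N. p * (\<integral>y. (norm (D N y))\<^sup>2 \<partial>\<sigma>)) \<longlonglongrightarrow> p * (\<integral>y. (norm (indicator {lam} y :: complex))\<^sup>2 \<partial>\<sigma>)"
  proof (intro tendsto_mult_left integral_dominated_convergence[where w="\<lambda>_. 1"])
   show "AE y in \<sigma>. (\<lambda>N. (norm (D N y))\<^sup>2) \<longlonglongrightarrow> (norm (indicator {lam} y :: complex))\<^sup>2" using Dl by eventually_elim (intro tendsto_power tendsto_norm)
   show "AE y in \<sigma>. norm ((norm (D N y))\<^sup>2) <= 1" for N using power_mono[OF Db, of _ _ 2] by simp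
  qed auto
  have "(\<lambda>y. (norm (indicator {lam} y :: complex))\<^sup>2) = indicat_real {lam}" by (auto simp: indicator_def)
  hence "(\<integral>y. (norm (indicator {lam} y :: complex))\<^sup>2 \<partial>\<sigma>) = measure \<sigma> {lam}" by simp
  with filterlim_compose[OF l2 rt] have "(\<lambda>i. \<integral>x. (norm (G (r i) x))\<^sup>2 \<partial>M) \<longlonglongrightarrow> p * measure \<sigma> {lam}" by (simp add: iso1)
  thus "(\<integral>x. (norm (g x))\<^sup>2 \<partial>M) = p * measure \<sigma> {lam}" using l1 by (rule LIMSEQ_unique[symmetric])
  assume lam0: "lam = 0"
  have "(\<lambda>i. \<integral>x. G (r i) x \<partial>M) \<longlonglongrightarrow> (\<integral>x. g x \<partial>M)"
   by (rule integral_dominated_convergence[where w="\<lambda>_. C"]) (use gl Gb in auto)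
  moreover have "(\<integral>x. G N x \<partial>M) = average N (\<lambda>n. \<integral>x. f x \<partial>M)" for N
  proof -
   have i: "integrable M (\<lambda>x. f (iter (int n) x))" for n by (rule integrable_bounded[of _ C]) (use C in auto)
   have "(\<integral>x. G N x \<partial>M) = average N (\<lambda>n. \<integral>x. f (iter (int n) x) \<partial>M)"
    unfolding G_def u_def average_def using i by (simp add: lam0 Bochner_Integration.integral_sum)
   thus ?thesis by (simp add: mp_map_integral[OF mp_iter f])
  qed
  ultimately have "(\<lambda>i. average (r i) (\<lambda>n. \<integral>x. f x \<partial>M)) \<longlonglongrightarrow> (\<integral>x. g x \<partial>M)" by simp
  moreover have "(\<lambda>i. average (r i) (\<lambda>n. \<integral>x. f x \<partial>M)) \<longlonglongrightarrow> (\<integral>x. f x \<partial>M)"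
   by (rule filterlim_compose[OF average_const_tendsto rt])
  ultimately show "(\<integral>x. g x \<partial>M) = (\<integral>x. f x \<partial>M)" by (rule LIMSEQ_unique)
 qed
qed

end

section \<open>Decomposition of correlation sequences\<close>

lemma finite_subset_approx:
 assumes "finite_measure \<sigma>" "\<And>x. {x} \<in> sets \<sigma>" "countable D" "e > 0"
 shows "\<exists>L. finite L \<and> L \<subseteq> D \<and> measure \<sigma> (D - L) < e"
proof (cases "D = {}")
 case True thus ?thesis using assms(4) by (intro exI[of _ "{}"]) auto
next
 case False
 interpret finite_measure \<sigma> by fact
 define A where "A n = D - from_nat_into D ` {..<n}" for n
 have "A n \<in> sets \<sigma>" for n unfolding A_def
  by (rule sets.countable) (use assms in \<open>auto intro: countable_subset[of _ D]\<close>)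
 moreover have "decseq A" unfolding A_def by (intro decseq_SucI) auto
 ultimately have "(\<lambda>n. measure \<sigma> (A n)) \<longlonglongrightarrow> measure \<sigma> (\<Inter>n. A n)"
  by (intro finite_Lim_measure_decseq) auto
 moreover have "(\<Inter>n. A n) = {}"
 proof -
  have "x \<notin> (\<Inter>n. A n)" for x
  proof
   assume x: "x \<in> (\<Inter>n. A n)"
   hence "x \<in> D" by (auto simp: A_def)
   then obtain n where "from_nat_into D n = x" using from_nat_into_surj[OF assms(3)] by blast
   hence "x \<notin> A (Suc n)" by (auto simp: A_def)
   thus False using x by blast
  qed
  thus ?thesis by blast
 qed
 ultimately have "(\<lambda>n. measure \<sigma> (A n)) \<longlonglongrightarrow> 0" by simp
 from order_tendstoD(2)[OF this assms(4)] obtain n where "measure \<sigma> (A n) < e" by (auto simp: eventually_sequentially)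
 thus ?thesis using from_nat_into[OF False] by (intro exI[of _ "from_nat_into D ` {..<n}"]) (auto simp: A_def)
qed

lemma increasing_from:
 fixes a :: "nat => real"
 assumes m: "\<forall>n\<ge>N. a n <= a (Suc n)" and "N <= i" "i <= j"
 shows "a i <= a j"
 using assms(3)
proof (induction j rule: dec_induct)
 case (step j)
 have "a j <= a (Suc j)" using m step assms(2) by simp
 thus ?case using step by linarith
qed simp

lemma decreasing_from:
 fixes a :: "nat => real"
 assumes m: "\<forall>n\<ge>N. a (Suc n) <= a n" and "N <= i" "i <= j"
 shows "a j <= a i"
 using increasing_from[of N "\<lambda>n. - a n" i j] assms by simp

text \<open>
  Over a block of length \<open>2M\<close> the sequence varies by less than one, and it is
  monotone. So its floor changes at most once in the block and is constant on one of the halves.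
\<close>

lemma floor_constant_on_half_block:
 fixes a :: "nat => real"
 assumes mono: "(\<forall>n\<ge>N. a n <= a (Suc n)) \<or> (\<forall>n\<ge>N. a (Suc n) <= a n)"
  and var: "\<And>n. n >= N ==> \<bar>a (Suc n) - a n\<bar> <= d" and d: "2 * real M * d < 1" and "M >= 1"
 shows "\<exists>b\<in>{N, N + M}. \<exists>k. \<forall>n\<in>{b+1..b+M}. \<lfloor>a n\<rfloor> = k"
proof -
 have d0: "d >= 0" using var[of N] by linarith
 have close: "\<bar>a (N + 1 + j) - a (N + 1)\<bar> <= real j * d" for j
 proof (induction j)
  case (Suc j)
  have "\<bar>a (N + 1 + Suc j) - a (N + 1 + j)\<bar> <= d" using var[of "N + 1 + j"] by simp
  thus ?case using Suc by (simp add: algebra_simps)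
 qed simp
 have near: "\<bar>a n - a (N + 1)\<bar> < 1" if "n \<in> {N+1..N+2*M}" for n
 proof -
  have "\<bar>a n - a (N + 1)\<bar> <= real (n - (N + 1)) * d" using close[of "n - (N + 1)"] that by simp
  also have "... <= (2 * real M) * d" using that d0 by (intro mult_right_mono) auto
  finally show ?thesis using d by linarith
 qed
 define F where "F n = \<lfloor>a n\<rfloor>" for n
 have nearF: "\<bar>F n - F (N + 1)\<bar> <= 1" if "n \<in> {N+1..N+2*M}" for n
  using near[OF that] unfolding F_def by linarith
 show ?thesis
 proof (cases "F (N + M) = F (N + 1)")
  case True
  have "F n = F (N + 1)" if n: "n \<in> {N+1..N+M}" for n
   using mono
  proof
   assume m: "\<forall>n\<ge>N. a n <= a (Suc n)"
   note inc = increasing_from[OF m]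
   have "F (N + 1) <= F n" "F n <= F (N + M)" using inc[of "N+1" n] inc[of n "N+M"] n unfolding F_def by (simp_all add: floor_mono)
   thus ?thesis using True by simp
  next
   assume m: "\<forall>n\<ge>N. a (Suc n) <= a n"
   note dec = decreasing_from[OF m]
   have "F n <= F (N + 1)" "F (N + M) <= F n" using dec[of "N+1" n] dec[of n "N+M"] n unfolding F_def by (simp_all add: floor_mono)
   thus ?thesis using True by simp
  qed
  hence "\<forall>n\<in>{N+1..N+M}. \<lfloor>a n\<rfloor> = F (N + 1)" by (simp only: F_def) blast
  thus ?thesis by blast
 next
  case False
  have "F n = F (N + M)" if n: "n \<in> {N+M+1..N+M+M}" for n
   using mono
  proof
   assume m: "\<forall>n\<ge>N. a n <= a (Suc n)"
   note inc = increasing_from[OF m]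
   have "F (N + 1) <= F (N + M)" "F (N + M) <= F n" using inc[of "N+1" "N+M"] inc[of "N+M" n] n \<open>M >= 1\<close> unfolding F_def by (simp_all add: floor_mono)
   thus ?thesis using False nearF[of n] n by auto
  next
   assume m: "\<forall>n\<ge>N. a (Suc n) <= a n"
   note dec = decreasing_from[OF m]
   have "F (N + M) <= F (N + 1)" "F n <= F (N + M)" using dec[of "N+1" "N+M"] dec[of "N+M" n] n \<open>M >= 1\<close> unfolding F_def by (simp_all add: floor_mono)
   thus ?thesis using False nearF[of n] n by auto
  qed
  hence "\<forall>n\<in>{N+M+1..N+M+M}. \<lfloor>a n\<rfloor> = F (N + M)" by (simp only: F_def) blast
  thus ?thesis by blast
 qed
qed

context invertible_system
begin

text \<open>
  For \<open>f = 1_A - \<mu>(A)\<close> the partial sums at the ends of a block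
  \<open>(b, b + K]\<close> with \<open>K\<close> comparable to \<open>b\<close> are both
  \<open>o(b)\<close> in norm. If the floor is constant on the block, their difference is
  \<open>K f\<close> composed with a power of \<open>T\<close>, of norm \<open>K |f|\<close>.
  Hence \<open>f\<close> vanishes.
\<close>

lemma trivial_of_slow_ergodic:
 fixes \<alpha> :: "nat => real"
 assumes erg: "ergodic_sequence M (\<lambda>n. iter \<lfloor>\<alpha> n\<rfloor>)"
  and slow: "\<forall>\<^sub>F n in sequentially. real n * \<bar>\<alpha> (Suc n) - \<alpha> n\<bar> <= C"
  and mono: "(\<forall>\<^sub>F n in sequentially. \<alpha> n <= \<alpha> (Suc n)) \<or> (\<forall>\<^sub>F n in sequentially. \<alpha> (Suc n) <= \<alpha> n)"
  and A: "A \<in> sets M"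
 shows "AE x in M. indicat_real A x = prob A"
proof -
 define f where "f x = complex_of_real (indicat_real A x - prob A)" for x
 note [measurable] = A mp_map_measurable[OF mp_iter]
 have fm [measurable]: "f \<in> borel_measurable M" unfolding f_def by measurable
 have fb: "norm (f x) <= 1" for x using prob_le_1[of A] measure_nonneg[of M A] unfolding f_def norm_of_real by (auto simp: indicator_def)
 have f0: "(\<integral>x. f x \<partial>M) = 0"
 proof -
  have "(\<integral>x. f x \<partial>M) = of_real (\<integral>x. indicat_real A x - prob A \<partial>M)" unfolding f_def by (rule integral_complex_of_real)
  also have "(\<integral>x. indicat_real A x - prob A \<partial>M) = 0" using A by (subst Bochner_Integration.integral_diff) (auto simp: prob_space emeasure_eq_measure)
  finally show ?thesis by simp
 qed
 define S where "S N x = (\<Sum>n=1..N. f (iter \<lfloor>\<alpha> n\<rfloor> x))" for N x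
 have Sm [measurable]: "S N \<in> borel_measurable M" for N unfolding S_def by measurable
 have Sb: "norm (S N x) <= real N" for N x
 proof -
  have "norm (S N x) <= (\<Sum>n=1..N. 1)" unfolding S_def by (rule sum_norm_le) (use fb in auto)
  thus ?thesis by simp
 qed
 have iS: "integrable M (\<lambda>x. (norm (S N x))\<^sup>2)" for N
  by (rule integrable_bounded[of _ "(real N)\<^sup>2"]) (use Sb in \<open>auto intro!: power_mono\<close>)
 define \<Phi> where "\<Phi> = (\<integral>x. (norm (f x))\<^sup>2 \<partial>M)"
 have \<Phi>k: "(\<integral>x. (norm (f (iter k x)))\<^sup>2 \<partial>M) = \<Phi>" for k unfolding \<Phi>_def by (rule mp_map_integral[OF mp_iter]) measurable
 have lim: "(\<lambda>N. L2norm M (\<lambda>x. average N (\<lambda>n. f (iter \<lfloor>\<alpha> n\<rfloor> x)))) \<longlonglongrightarrow> 0"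
 proof -
  have "f \<in> Linfty M" unfolding Linfty_def using fb by auto
  thus ?thesis using erg f0 unfolding ergodic_sequence_def by fastforce
 qed
 have SL: "(\<integral>x. (norm (S N x))\<^sup>2 \<partial>M) = (real N)\<^sup>2 * (L2norm M (\<lambda>x. average N (\<lambda>n. f (iter \<lfloor>\<alpha> n\<rfloor> x))))\<^sup>2" if "N > 0" for N
 proof -
  have "norm (average N (\<lambda>n. f (iter \<lfloor>\<alpha> n\<rfloor> x))) = norm (S N x) / real N" for x by (simp add: average_def S_def norm_divide)
  hence "(L2norm M (\<lambda>x. average N (\<lambda>n. f (iter \<lfloor>\<alpha> n\<rfloor> x))))\<^sup>2 = (\<integral>x. (norm (S N x))\<^sup>2 / (real N)\<^sup>2 \<partial>M)"
   by (simp add: L2norm_def power_divide)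
  also have "... = (\<integral>x. (norm (S N x))\<^sup>2 \<partial>M) / (real N)\<^sup>2" by simp
  finally show ?thesis using that by simp
 qed
 have "\<Phi> = 0"
 proof (rule ccontr)
  assume "\<Phi> \<noteq> 0"
  moreover have "\<Phi> >= 0" unfolding \<Phi>_def by simp
  ultimately have \<Phi>: "\<Phi> > 0" by simp
  define m where "m = Suc (nat \<lceil>2 * \<bar>C\<bar>\<rceil>)"
  have m: "m >= 1" "2 * \<bar>C\<bar> < real m" unfolding m_def of_nat_Suc by (simp, linarith)
  \<comment> \<open>makes the final bound \<open>36 e (2 m K)^2\<close> equal to half of \<open>K^2 \<Phi>\<close>\<close>
  define e where "e = \<Phi> / (288 * (real m)\<^sup>2)"
  have e: "e > 0" using \<Phi> m by (simp add: e_def)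
  have "\<forall>\<^sub>F N in sequentially. L2norm M (\<lambda>x. average N (\<lambda>n. f (iter \<lfloor>\<alpha> n\<rfloor> x))) < sqrt e"
   by (rule order_tendstoD(2)[OF lim]) (use e in simp)
  moreover have "\<exists>up. (\<forall>\<^sub>F n in sequentially. if up then \<alpha> n <= \<alpha> (Suc n) else \<alpha> (Suc n) <= \<alpha> n)"
   using mono by (auto intro: exI[of _ True] exI[of _ False])
  then obtain up where "\<forall>\<^sub>F n in sequentially. if up then \<alpha> n <= \<alpha> (Suc n) else \<alpha> (Suc n) <= \<alpha> n" by blast
  ultimately have "\<forall>\<^sub>F n in sequentially. L2norm M (\<lambda>x. average n (\<lambda>n. f (iter \<lfloor>\<alpha> n\<rfloor> x))) < sqrt e \<and> real n * \<bar>\<alpha> (Suc n) - \<alpha> n\<bar> <= C \<and>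
    (if up then \<alpha> n <= \<alpha> (Suc n) else \<alpha> (Suc n) <= \<alpha> n)"
   using slow by eventually_elim blast
  then obtain N0 where N0: "\<And>n. n >= N0 ==> L2norm M (\<lambda>x. average n (\<lambda>n. f (iter \<lfloor>\<alpha> n\<rfloor> x))) < sqrt e \<and> real n * \<bar>\<alpha> (Suc n) - \<alpha> n\<bar> <= C \<and>
    (if up then \<alpha> n <= \<alpha> (Suc n) else \<alpha> (Suc n) <= \<alpha> n)"
   by (auto simp: eventually_sequentially)
  define N where "N = max (Suc N0) m"
  have N: "N >= N0" "N >= m" "N > 0" by (auto simp: N_def)
  define K where "K = N div m"
  have mK: "m * K <= N" "N < m * K + m" using mult_div_mod_eq[of m N] mod_less_divisor[of m N] m(1) unfolding K_def by linarith+
  have K1: "K >= 1" unfolding K_def using div_le_mono[OF N(2), of m] m(1) by simp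
  have KN: "K <= N" using mK(1) m(1) by (metis le_trans mult_le_mono1 nat_mult_1)
  have "\<exists>b\<in>{N, N + K}. \<exists>k. \<forall>n\<in>{b+1..b+K}. \<lfloor>\<alpha> n\<rfloor> = k"
  proof (rule floor_constant_on_half_block[where d="\<bar>C\<bar> / real N"])
   show "(\<forall>n\<ge>N. \<alpha> n <= \<alpha> (Suc n)) \<or> (\<forall>n\<ge>N. \<alpha> (Suc n) <= \<alpha> n)"
   proof (cases up)
    case True hence "\<forall>n\<ge>N. \<alpha> n <= \<alpha> (Suc n)" using N0 N(1) by (meson le_trans)
    thus ?thesis ..
   next
    case False hence "\<forall>n\<ge>N. \<alpha> (Suc n) <= \<alpha> n" using N0 N(1) by (meson le_trans)
    thus ?thesis ..
   qed
   fix n assume n: "n >= N"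
   have "real N * \<bar>\<alpha> (Suc n) - \<alpha> n\<bar> <= real n * \<bar>\<alpha> (Suc n) - \<alpha> n\<bar>" using n by (intro mult_right_mono) auto
   also have "... <= \<bar>C\<bar>" using N0[of n] n N(1) by linarith
   finally show "\<bar>\<alpha> (Suc n) - \<alpha> n\<bar> <= \<bar>C\<bar> / real N" using N(3) by (simp add: pos_le_divide_eq mult.commute)
  next
   have "real m * real K <= real N" using mK(1) by (metis of_nat_le_iff of_nat_mult)
   moreover have "2 * \<bar>C\<bar> * real K < real m * real K" using m(2) K1 by (intro mult_strict_right_mono) auto
   ultimately show "2 * real K * (\<bar>C\<bar> / real N) < 1" using N(3) by (simp add: pos_divide_less_eq mult_ac)
  qed (rule K1)
  then obtain b k where b0: "b \<in> {N, N + K}" "\<forall>n\<in>{b+1..b+K}. \<lfloor>\<alpha> n\<rfloor> = k" by blast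
  have b: "b = N \<or> b = N + K" "\<And>n. n \<in> {b+1..b+K} ==> \<lfloor>\<alpha> n\<rfloor> = k" using b0 by blast+
  have diff: "S (b + K) x - S b x = of_nat K * f (iter k x)" for x
  proof -
   have "{1..b + K} = {1..b} \<union> {b+1..b+K}" by auto
   hence "S (b + K) x = S b x + (\<Sum>n=b+1..b+K. f (iter \<lfloor>\<alpha> n\<rfloor> x))"
    unfolding S_def by (simp only:) (rule sum.union_disjoint, auto)
   also have "(\<Sum>n=b+1..b+K. f (iter \<lfloor>\<alpha> n\<rfloor> x)) = (\<Sum>n=b+1..b+K. f (iter k x))" by (rule sum.cong) (use b(2) in auto)
   finally show ?thesis by simp
  qed
  have bound: "(\<integral>x. (norm (S L x))\<^sup>2 \<partial>M) <= 9 * (real N)\<^sup>2 * e" if L: "L >= N" "L <= 3 * N" for L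
  proof -
   have L0: "L > 0" using L N by simp
   have "L2norm M (\<lambda>x. average L (\<lambda>n. f (iter \<lfloor>\<alpha> n\<rfloor> x))) < sqrt e" using N0[of L] L N(1) by auto
   moreover have "0 <= L2norm M (\<lambda>x. average L (\<lambda>n. f (iter \<lfloor>\<alpha> n\<rfloor> x)))" by (simp add: L2norm_def)
   ultimately have "(L2norm M (\<lambda>x. average L (\<lambda>n. f (iter \<lfloor>\<alpha> n\<rfloor> x))))\<^sup>2 <= (sqrt e)\<^sup>2" by (intro power_mono) auto
   hence "(L2norm M (\<lambda>x. average L (\<lambda>n. f (iter \<lfloor>\<alpha> n\<rfloor> x))))\<^sup>2 <= e" using e by simp
   hence "(real L)\<^sup>2 * (L2norm M (\<lambda>x. average L (\<lambda>n. f (iter \<lfloor>\<alpha> n\<rfloor> x))))\<^sup>2 <= (3 * real N)\<^sup>2 * e"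
    using L by (intro mult_mono power_mono) auto
   thus ?thesis unfolding SL[OF L0] by (simp add: power_mult_distrib)
  qed
  have "(real K)\<^sup>2 * \<Phi> = (\<integral>x. (norm (S (b + K) x - S b x))\<^sup>2 \<partial>M)"
   unfolding diff norm_mult power_mult_distrib norm_of_nat by (simp add: \<Phi>k)
  also have "... <= (\<integral>x. 2 * (norm (S (b + K) x))\<^sup>2 + 2 * (norm (S b x))\<^sup>2 \<partial>M)"
  proof (rule integral_mono)
   show "integrable M (\<lambda>x. (norm (S (b + K) x - S b x))\<^sup>2)"
   proof (rule integrable_bounded[of _ "(real (b + K) + real b)\<^sup>2"])
    fix x
    have "norm (S (b + K) x - S b x) <= real (b + K) + real b" by (intro norm_triangle_le_diff add_mono Sb)
    from power_mono[OF this, of 2] show "norm ((norm (S (b + K) x - S b x))\<^sup>2) <= (real (b + K) + real b)\<^sup>2" by simp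
   qed measurable
   show "integrable M (\<lambda>x. 2 * (norm (S (b + K) x))\<^sup>2 + 2 * (norm (S b x))\<^sup>2)" using iS by simp
   fix x
   have "(norm (S (b + K) x - S b x))\<^sup>2 <= (norm (S (b + K) x) + norm (S b x))\<^sup>2"
    by (intro power_mono norm_triangle_ineq4) auto
   also have "... <= 2 * (norm (S (b + K) x))\<^sup>2 + 2 * (norm (S b x))\<^sup>2"
    using zero_le_power2[of "norm (S (b + K) x) - norm (S b x)"] by (simp add: power2_eq_square algebra_simps)
   finally show "(norm (S (b + K) x - S b x))\<^sup>2 <= 2 * (norm (S (b + K) x))\<^sup>2 + 2 * (norm (S b x))\<^sup>2" .
  qed
  also have "... = 2 * (\<integral>x. (norm (S (b + K) x))\<^sup>2 \<partial>M) + 2 * (\<integral>x. (norm (S b x))\<^sup>2 \<partial>M)" using iS by simp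
  also have "... <= 2 * (9 * (real N)\<^sup>2 * e) + 2 * (9 * (real N)\<^sup>2 * e)"
   using b(1) KN by (intro add_mono mult_left_mono bound) auto
  also have "... = 36 * e * (real N)\<^sup>2" by simp
  also have "... <= 36 * e * (2 * real m * real K)\<^sup>2"
  proof (intro mult_left_mono power_mono)
   have "m <= m * K" using K1 by simp
   hence "N <= 2 * m * K" using mK(2) by linarith
   thus "real N <= 2 * real m * real K" by (metis of_nat_le_iff of_nat_mult of_nat_numeral)
  qed (use e in auto)
  also have "... = (real K)\<^sup>2 * \<Phi> / 2" using m by (simp add: e_def power_mult_distrib field_simps)
  finally show False using \<Phi> K1 by simp
 qed
 hence "AE x in M. (norm (f x))\<^sup>2 = 0"
  unfolding \<Phi>_def by (subst (asm) integral_nonneg_eq_0_iff_AE) (auto intro!: integrable_bounded[of _ 1] simp: fb power_le_one)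
 thus ?thesis by eventually_elim (simp add: f_def)
qed

text \<open>
  The correlations of \<open>A\<close> are a finite sum over eigenvalues \<open>lam\<close>, with
  masses \<open>\<kappa> lam\<close>, plus a remainder that is small on average along
  \<open>p\<close>. The mass at zero is that of the constants. Only this information on the
  sequence enters the proof of product ergodicity.
\<close>

definition atomic_decomposition ::
 "(nat => int) => 'a set => real => real set => (real => real) => (int => complex) => bool" where
 "atomic_decomposition p A e L \<kappa> r \<longleftrightarrow> finite L \<and> 0 \<in> L \<and> L \<subseteq> {0..<1} \<and> (\<forall>lam\<in>L. \<exists>g. eigenfunction lam g) \<and>
   \<kappa> 0 = (prob A)\<^sup>2 \<and> (\<forall>lam. \<kappa> lam >= 0) \<and> sum \<kappa> L <= 1 \<and>
   (\<forall>k. autocorr (indicator A) k = (\<Sum>lam\<in>L. of_real (\<kappa> lam) * ee (of_int k * lam)) + r k) \<and>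
   (\<forall>\<^sub>F N in sequentially. real_average2 N (\<lambda>n m. norm (r (p n - p m))) <= e)"

definition almost_atomic :: "(nat => int) => 'a set => bool" where
 "almost_atomic p A \<longleftrightarrow> (\<forall>e>0. \<exists>L \<kappa> r. atomic_decomposition p A e L \<kappa> r)"

lemma eigenfunction_one: "eigenfunction 0 (\<lambda>_. 1)"
 unfolding eigenfunction_def Linfty_def by (auto simp: AE_const prob_space intro!: exI[of _ 1])

lemma almost_atomic_trivial:
 assumes A: "A \<in> sets M" and triv: "AE x in M. indicat_real A x = prob A"
 shows "almost_atomic p A"
 unfolding almost_atomic_def
proof (intro allI impI)
 fix e :: real assume e: "e > 0"
 note [measurable] = A mp_map_measurable[OF mp_iter]
 have ind: "indicator A x = complex_of_real (indicat_real A x)" for x by (simp add: indicator_def)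
 have "autocorr (indicator A) k = of_real ((prob A)\<^sup>2)" for k
 proof -
  have "AE x in M. indicat_real A (iter k x) = prob A" by (rule mp_map_AE[OF mp_iter triv])
  with triv have "AE x in M. (indicator A (iter k x) :: complex) * cnj (indicator A x) = of_real ((prob A)\<^sup>2)"
   unfolding ind by eventually_elim (simp add: power2_eq_square)
  hence "autocorr (indicator A) k = (\<integral>x. of_real ((prob A)\<^sup>2) \<partial>M)"
   unfolding autocorr_def by (intro integral_cong_AE) auto
  thus ?thesis by (simp add: prob_space)
 qed
 moreover have "\<forall>\<^sub>F N in sequentially. real_average2 N (\<lambda>n m. norm (0::complex)) <= e"
  using e by (simp add: real_average2_def)
 ultimately show "\<exists>L \<kappa> r. atomic_decomposition p A e L \<kappa> r"
  using eigenfunction_one unfolding atomic_decomposition_def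
  by (intro exI[of _ "{0}"] exI[of _ "\<lambda>_. (prob A)\<^sup>2"] exI[of _ "\<lambda>_. 0"]) (auto simp: power_le_one)
qed

text \<open>
  The spectral measure of the indicator of \<open>A\<close> is split into finitely many atoms, the
  remaining atoms of total mass below \<open>e/2\<close>, and the continuous part, to which
  Wiener's lemma applies.
\<close>

lemma almost_atomic_of_Wiener:
 fixes \<alpha> :: "nat => real"
 assumes erg: "ergodic_sequence M (\<lambda>n. iter \<lfloor>\<alpha> n\<rfloor>)" and A: "A \<in> sets M"
  and ctbl: "countable {s. \<not> (\<lambda>N. average N (\<lambda>n. ee (s * \<alpha> n))) \<longlonglongrightarrow> 0}"
 shows "almost_atomic (\<lambda>n. \<lfloor>\<alpha> n\<rfloor>) A"
proof (cases "prob A = 0")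
 case True
 hence "AE x in M. x \<notin> A" using A by (simp add: prob_eq_0)
 hence "AE x in M. indicat_real A x = prob A" by eventually_elim (simp add: True)
 thus ?thesis by (rule almost_atomic_trivial[OF A])
next
 case False
 define p where "p = prob A"
 have p: "p > 0" "p <= 1" using False measure_nonneg[of M A] by (auto simp: p_def less_le)
 define f :: "'a => complex" where "f = indicator A"
 have fm: "f \<in> borel_measurable M" unfolding f_def using A by measurable
 have fb: "norm (f x) <= 1" for x by (simp add: f_def indicator_def)
 have f_int: "(\<integral>x. f x \<partial>M) = of_real p"
 proof -
  have "(\<integral>x. f x \<partial>M) = (\<integral>x. complex_of_real (indicat_real A x) \<partial>M)" by (intro Bochner_Integration.integral_cong) (auto simp: f_def indicator_def)
  thus ?thesis using A by (simp add: p_def)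
 qed
 have c0: "autocorr f 0 = of_real p"
 proof -
  have "autocorr f 0 = (\<integral>x. f x \<partial>M)" unfolding autocorr_def by (intro Bochner_Integration.integral_cong) (auto simp: f_def indicator_def)
  thus ?thesis by (simp add: f_int)
 qed
 define c where "c m = autocorr f m / of_real p" for m
 have pd: "positive_definite2 (\<lambda>m n. c m)"
  unfolding positive_definite2_def
 proof (intro allI impI)
  fix I :: "(nat \<times> nat) set" and z :: "nat \<times> nat => complex" assume "finite I"
  then obtain r where r: "r >= 0" "(\<Sum>i\<in>I. \<Sum>j\<in>I. z i * cnj (z j) * autocorr f (int (fst i) - int (fst j))) = complex_of_real r"
   using positive_definite2_autocorr[OF fm fb] unfolding positive_definite2_def by blast
  have "(\<Sum>i\<in>I. \<Sum>j\<in>I. z i * cnj (z j) * c (int (fst i) - int (fst j))) = of_real (r / p)"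
   unfolding c_def times_divide_eq_right sum_divide_distrib[symmetric] r(2) by simp
  thus "\<exists>r\<ge>0. (\<Sum>i\<in>I. \<Sum>j\<in>I. z i * cnj (z j) * c (int (fst i) - int (fst j))) = complex_of_real r"
   using r(1) p by (intro exI[of _ "r / p"]) auto
 qed
 have "c 0 = 1" using c0 p by (simp add: c_def)
 from Herglotz[OF pd this] obtain \<sigma> where \<sigma>: "real_distribution \<sigma>" "AE x in \<sigma>. 0 <= x \<and> x < 1"
  and ck: "\<And>k. (\<integral>x. ee (of_int k * x) \<partial>\<sigma>) = c k" by blast
 interpret \<sigma>: real_distribution \<sigma> by fact
 have spec: "autocorr f m = of_real p * (\<integral>y. ee (of_int m * y) \<partial>\<sigma>)" for m
  unfolding ck c_def using p by simp
 have atom: "\<exists>g. g \<in> Linfty M \<and> (AE x in M. g (T x) = ee lam * g x) \<and> (\<integral>x. (norm (g x))\<^sup>2 \<partial>M) = p * measure \<sigma> {lam}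
   \<and> (lam = 0 \<longrightarrow> (\<integral>x. g x \<partial>M) = (\<integral>x. f x \<partial>M))" if "0 <= lam" "lam < 1" for lam
  by (rule eigenfunction_of_atom[OF fm fb \<sigma> spec]) (use p that in auto)
 define \<kappa> where "\<kappa> lam = p * measure \<sigma> {lam}" for lam
 define D where "D = {x. measure \<sigma> {x} \<noteq> 0}"
 have Dc: "countable D" unfolding D_def by (rule \<sigma>.countable_support)
 have D01: "D \<subseteq> {0..<1}"
 proof
  fix x assume x: "x \<in> D"
  show "x \<in> {0..<1}"
  proof (rule ccontr)
   assume "x \<notin> {0..<1}"
   from \<sigma>(2) have "AE y in \<sigma>. y \<notin> {x}"
   proof eventually_elim
    case (elim y) thus ?case using \<open>x \<notin> {0..<1}\<close> by auto
   qed
   hence "measure \<sigma> {x} = 0" by (subst \<sigma>.prob_eq_0) auto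
   thus False using x by (simp add: D_def)
  qed
 qed
 have eig: "\<exists>g. eigenfunction lam g" if "lam \<in> insert 0 D" for lam
 proof (cases "lam \<in> D")
  case True
  have lam: "0 <= lam" "lam < 1" using subsetD[OF D01 True] by auto
  obtain g where g: "g \<in> Linfty M" "AE x in M. g (T x) = ee lam * g x" "(\<integral>x. (norm (g x))\<^sup>2 \<partial>M) = p * measure \<sigma> {lam}"
   using atom[OF lam] by blast
  have "\<not> (AE x in M. g x = 0)"
  proof
   assume "AE x in M. g x = 0"
   hence "AE x in M. (norm (g x))\<^sup>2 = 0" by eventually_elim simp
   hence "(\<integral>x. (norm (g x))\<^sup>2 \<partial>M) = (\<integral>x. 0 \<partial>M)" using g(1) by (intro integral_cong_AE) (auto simp: Linfty_def)
   thus False using g(3) True p by (simp add: D_def)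
  qed
  thus ?thesis using g unfolding eigenfunction_def by blast
 next
  case False thus ?thesis using that eigenfunction_one by auto
 qed
 have \<kappa>0: "\<kappa> 0 = (prob A)\<^sup>2"
 proof -
  obtain g where g: "g \<in> Linfty M" "AE x in M. g (T x) = ee 0 * g x" "(\<integral>x. (norm (g x))\<^sup>2 \<partial>M) = p * measure \<sigma> {0}"
   "(\<integral>x. g x \<partial>M) = (\<integral>x. f x \<partial>M)" using atom[of 0] by auto
  have "AE x in M. g x = (\<integral>y. g y \<partial>M)" by (rule invariant_const[OF erg g(1)]) (use g(2) in simp)
  hence "AE x in M. (norm (g x))\<^sup>2 = p\<^sup>2" unfolding g(4) f_int by eventually_elim simp
  hence "(\<integral>x. (norm (g x))\<^sup>2 \<partial>M) = (\<integral>x. p\<^sup>2 \<partial>M)" using g(1) by (intro integral_cong_AE) (auto simp: Linfty_def)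
  thus ?thesis using g(3) by (simp add: \<kappa>_def p_def prob_space)
 qed
 show ?thesis unfolding almost_atomic_def
 proof (intro allI impI)
  fix e :: real assume e: "e > 0"
  obtain L0 where L0: "finite L0" "L0 \<subseteq> D" "measure \<sigma> (D - L0) < e / 2"
   using finite_subset_approx[of \<sigma> D "e/2"] Dc e \<sigma>.finite_measure_axioms by auto
  define L where "L = insert 0 L0"
  have L: "finite L" "0 \<in> L" "L \<subseteq> {0..<1}" using L0 D01 by (auto simp: L_def)
  define E where "E = D - L"
  define F where "F = - (D \<union> L)"
  have Db [measurable]: "D \<in> sets borel" "L \<in> sets borel" using Dc L(1) by (auto intro: sets.countable countable_finite)
  have Em [measurable]: "E \<in> sets borel" "F \<in> sets borel" unfolding E_def F_def by measurable
  have Ee: "measure \<sigma> E < e / 2"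
  proof -
   have "measure \<sigma> E <= measure \<sigma> (D - L0)" by (rule \<sigma>.finite_measure_mono) (use Db(1) borel_closed[OF finite_imp_closed[OF L0(1)]] in \<open>auto simp: E_def L_def\<close>)
   thus ?thesis using L0(3) by linarith
  qed
  define \<nu> where "\<nu> = density \<sigma> (\<lambda>x. ennreal (indicat_real F x))"
  define r1 where "r1 k = (\<integral>x. indicat_real E x *\<^sub>R ee (of_int k * x) \<partial>\<sigma>)" for k
  define r2 where "r2 k = (\<integral>x. ee (of_int k * x) \<partial>\<nu>)" for k
  have \<nu>fin: "finite_measure \<nu>"
  proof (rule finite_measureI)
   have "emeasure \<nu> (space \<nu>) = (\<integral>\<^sup>+x. ennreal (indicat_real F x) * indicator UNIV x \<partial>\<sigma>)"
    unfolding \<nu>_def by (subst emeasure_density) auto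
   also have "... <= (\<integral>\<^sup>+x. 1 \<partial>\<sigma>)" by (rule nn_integral_mono) (simp add: indicator_def)
   also have "... = 1" using \<sigma>.emeasure_space_1 by simp
   finally show "emeasure \<nu> (space \<nu>) \<noteq> \<infinity>" by (auto simp: top_unique)
  qed
  have \<nu>at: "emeasure \<nu> {x} = 0" for x
  proof -
   have "emeasure \<nu> {x} = (\<integral>\<^sup>+y. ennreal (indicat_real F y) * indicator {x} y \<partial>\<sigma>)" unfolding \<nu>_def by (rule emeasure_density) auto
   also have "... = (\<integral>\<^sup>+y. indicator (F \<inter> {x}) y \<partial>\<sigma>)" by (intro nn_integral_cong) (auto simp: indicator_def)
   also have "... = emeasure \<sigma> (F \<inter> {x})" by (rule nn_integral_indicator) auto
   also have "... = 0"
   proof (cases "x \<in> F")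
    case True
    hence "measure \<sigma> {x} = 0" by (auto simp: F_def D_def)
    thus ?thesis using True by (simp add: \<sigma>.emeasure_eq_measure)
   qed simp
   finally show ?thesis .
  qed
  have ib: "integrable \<sigma> (\<lambda>x. indicat_real B x *\<^sub>R ee (of_int k * x))" if "B \<in> sets borel" for B k
   by (rule \<sigma>.integrable_bounded[of _ 1]) (use that in \<open>auto simp: indicator_def\<close>)
  have r2: "r2 k = (\<integral>x. indicat_real F x *\<^sub>R ee (of_int k * x) \<partial>\<sigma>)" for k
   unfolding r2_def \<nu>_def by (rule integral_density) auto
  have dec: "c k = (\<Sum>lam\<in>L. of_real (measure \<sigma> {lam}) * ee (of_int k * lam)) + r1 k + r2 k" for k
  proof -
   have pt: "ee (of_int k * x) = (\<Sum>lam\<in>L. indicat_real {lam} x *\<^sub>R ee (of_int k * lam)) + indicat_real E x *\<^sub>R ee (of_int k * x) + indicat_real F x *\<^sub>R ee (of_int k * x)" for x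
   proof -
    have "(\<Sum>lam\<in>L. indicat_real {lam} x *\<^sub>R ee (of_int k * lam)) = (\<Sum>lam\<in>L. if lam = x then ee (of_int k * x) else 0)"
     by (intro sum.cong) (auto simp: indicator_def)
    also have "... = (if x \<in> L then ee (of_int k * x) else 0)" using L(1) by (simp add: sum.delta')
    finally show ?thesis by (auto simp: E_def F_def indicator_def)
   qed
   have i1: "integrable \<sigma> (\<lambda>x. indicat_real {lam} x *\<^sub>R ee (of_int k * lam))" for lam
    by (rule \<sigma>.integrable_bounded[of _ 1]) (auto simp: indicator_def)
   have "c k = (\<integral>x. (\<Sum>lam\<in>L. indicat_real {lam} x *\<^sub>R ee (of_int k * lam)) + indicat_real E x *\<^sub>R ee (of_int k * x) + indicat_real F x *\<^sub>R ee (of_int k * x) \<partial>\<sigma>)"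
    unfolding ck[symmetric] by (intro Bochner_Integration.integral_cong refl pt)
   also have "... = (\<integral>x. (\<Sum>lam\<in>L. indicat_real {lam} x *\<^sub>R ee (of_int k * lam)) \<partial>\<sigma>) + r1 k + r2 k"
    unfolding r1_def r2 using i1 ib[OF Em(1)] ib[OF Em(2)]
    by (simp add: Bochner_Integration.integral_add Bochner_Integration.integrable_add Bochner_Integration.integrable_sum)
   also have "(\<integral>x. (\<Sum>lam\<in>L. indicat_real {lam} x *\<^sub>R ee (of_int k * lam)) \<partial>\<sigma>) = (\<Sum>lam\<in>L. \<integral>x. indicat_real {lam} x *\<^sub>R ee (of_int k * lam) \<partial>\<sigma>)"
    by (rule Bochner_Integration.integral_sum) (rule i1)
   also have "... = (\<Sum>lam\<in>L. of_real (measure \<sigma> {lam}) * ee (of_int k * lam))"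
   proof (intro sum.cong refl)
    fix lam
    have "(\<integral>x. indicat_real {lam} x *\<^sub>R ee (of_int k * lam) \<partial>\<sigma>) = (\<integral>x. indicat_real {lam} x \<partial>\<sigma>) *\<^sub>R ee (of_int k * lam)"
     by (rule integral_scaleR_left) (auto simp: \<sigma>.emeasure_eq_measure)
    thus "(\<integral>x. indicat_real {lam} x *\<^sub>R ee (of_int k * lam) \<partial>\<sigma>) = of_real (measure \<sigma> {lam}) * ee (of_int k * lam)"
     by (simp add: scaleR_conv_of_real)
   qed
   finally show ?thesis .
  qed
  have r1b: "norm (r1 k) <= e / 2" for k
  proof -
   have "norm (r1 k) <= (\<integral>x. norm (indicat_real E x *\<^sub>R ee (of_int k * x)) \<partial>\<sigma>)" unfolding r1_def by (rule integral_norm_bound)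
   also have "... = (\<integral>x. indicat_real E x \<partial>\<sigma>)" by (intro Bochner_Integration.integral_cong) auto
   also have "... = measure \<sigma> E" by simp
   finally show ?thesis using Ee by linarith
  qed
  define r where "r k = of_real p * (r1 k + r2 k)" for k
  have W: "(\<lambda>N. real_average2 N (\<lambda>n m. (norm (r2 (\<lfloor>\<alpha> n\<rfloor> - \<lfloor>\<alpha> m\<rfloor>)))\<^sup>2)) \<longlonglongrightarrow> 0"
   unfolding r2_def by (rule Wiener_along_sequence[OF \<nu>fin _ \<nu>at ctbl]) (simp add: \<nu>_def)
  have "\<forall>\<^sub>F N in sequentially. real_average2 N (\<lambda>n m. (norm (r2 (\<lfloor>\<alpha> n\<rfloor> - \<lfloor>\<alpha> m\<rfloor>)))\<^sup>2) < (e / 2)\<^sup>2"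
   by (rule order_tendstoD(2)[OF W]) (use e in simp)
  hence fin: "\<forall>\<^sub>F N in sequentially. real_average2 N (\<lambda>n m. norm (r (\<lfloor>\<alpha> n\<rfloor> - \<lfloor>\<alpha> m\<rfloor>))) <= e"
  proof eventually_elim
   case (elim N)
   have "(real_average2 N (\<lambda>n m. norm (r2 (\<lfloor>\<alpha> n\<rfloor> - \<lfloor>\<alpha> m\<rfloor>))))\<^sup>2 <= (e / 2)\<^sup>2"
    using real_average2_power2[of N "\<lambda>n m. norm (r2 (\<lfloor>\<alpha> n\<rfloor> - \<lfloor>\<alpha> m\<rfloor>))"] elim by linarith
   hence a: "real_average2 N (\<lambda>n m. norm (r2 (\<lfloor>\<alpha> n\<rfloor> - \<lfloor>\<alpha> m\<rfloor>))) <= e / 2" by (rule power2_le_imp_le) (use e in simp)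
   have "real_average2 N (\<lambda>n m. norm (r (\<lfloor>\<alpha> n\<rfloor> - \<lfloor>\<alpha> m\<rfloor>))) <= real_average2 N (\<lambda>n m. e / 2 + norm (r2 (\<lfloor>\<alpha> n\<rfloor> - \<lfloor>\<alpha> m\<rfloor>)))"
   proof (rule real_average2_mono)
    fix n m
    define k where "k = \<lfloor>\<alpha> n\<rfloor> - \<lfloor>\<alpha> m\<rfloor>"
    have "norm (r k) = p * norm (r1 k + r2 k)" using p by (simp add: r_def norm_mult)
    also have "... <= 1 * norm (r1 k + r2 k)" using p by (intro mult_right_mono) auto
    also have "... <= e / 2 + norm (r2 k)" using norm_triangle_ineq[of "r1 k" "r2 k"] r1b[of k] by simp
    finally show "norm (r (\<lfloor>\<alpha> n\<rfloor> - \<lfloor>\<alpha> m\<rfloor>)) <= e / 2 + norm (r2 (\<lfloor>\<alpha> n\<rfloor> - \<lfloor>\<alpha> m\<rfloor>))" by (simp add: k_def)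
   qed
   also have "... <= e / 2 + e / 2"
    unfolding real_average2_add by (intro add_mono real_average2_const_le a) (use e in simp)
   finally show ?case by simp
  qed
  have "sum \<kappa> L <= 1"
  proof -
   have "sum \<kappa> L = p * (\<Sum>lam\<in>L. measure \<sigma> {lam})" by (simp add: \<kappa>_def sum_distrib_left)
   also have "(\<Sum>lam\<in>L. measure \<sigma> {lam}) = measure \<sigma> L"
    using \<sigma>.finite_measure_eq_sum_singleton[OF L(1)] by simp
   also have "p * measure \<sigma> L <= 1 * 1" using p by (intro mult_mono) auto
   finally show ?thesis by simp
  qed
  moreover have "\<forall>k. autocorr (indicator A) k = (\<Sum>lam\<in>L. of_real (\<kappa> lam) * ee (of_int k * lam)) + r k"
  proof
   fix k
   have "autocorr f k = of_real p * c k" using p by (simp add: c_def)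
   thus "autocorr (indicator A) k = (\<Sum>lam\<in>L. of_real (\<kappa> lam) * ee (of_int k * lam)) + r k"
    unfolding dec f_def[symmetric] by (simp add: \<kappa>_def r_def sum_distrib_left algebra_simps)
  qed
  moreover have "\<forall>lam\<in>L. \<exists>g. eigenfunction lam g" using eig L0(2) by (auto simp: L_def)
  moreover have "\<forall>lam. \<kappa> lam >= 0" using p by (simp add: \<kappa>_def)
  ultimately show "\<exists>L \<kappa> r. atomic_decomposition (\<lambda>n. \<lfloor>\<alpha> n\<rfloor>) A e L \<kappa> r"
   unfolding atomic_decomposition_def
   using L \<kappa>0 fin by (intro exI[of _ L] exI[of _ \<kappa>] exI[of _ r] conjI) auto
 qed
qed

end

section \<open>Mean ergodicity from a generating family\<close>

lemma mp_map_integrable: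
 fixes f :: "'a => 'b :: {banach, second_countable_topology}"
 assumes "mp_map M S" "integrable M f"
 shows "integrable M (\<lambda>x. f (S x))"
 using integrable_distr[of S M M f] assms by (simp add: mp_map_def)

context prob_space
begin

text \<open>
  The \<open>L1\<close> distance is used since averaging contracts it, so that the functions with
  vanishing deviation form a closed set; for bounded functions it controls the \<open>L2\<close>
  distance.
\<close>

definition mean_deviation :: "(nat => 'a => 'a) => ('a => complex) => nat => real" where
 "mean_deviation S f N = (\<integral>x. norm (average N (\<lambda>n. f (S n x)) - (\<integral>y. f y \<partial>M)) \<partial>M)"

lemma mean_deviation_nonneg: "0 <= mean_deviation S f N"
 by (simp add: mean_deviation_def)

lemma integrable_average:
 assumes "\<And>n. mp_map M (S n)" "integrable M (f :: 'a => complex)"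
 shows "integrable M (\<lambda>x. average N (\<lambda>n. f (S n x)))"
 unfolding average_def
 by (rule integrable_divide, rule Bochner_Integration.integrable_sum, rule mp_map_integrable[OF assms])

lemma mean_deviation_add:
 assumes S: "\<And>n. mp_map M (S n)" and f: "integrable M f" and g: "integrable M g"
 shows "mean_deviation S (\<lambda>x. f x + g x) N <= mean_deviation S f N + mean_deviation S g N"
proof -
 note i = integrable_average[of S, OF S f] integrable_average[of S, OF S g]
 have "mean_deviation S (\<lambda>x. f x + g x) N
   = (\<integral>x. norm ((average N (\<lambda>n. f (S n x)) - (\<integral>y. f y \<partial>M)) + (average N (\<lambda>n. g (S n x)) - (\<integral>y. g y \<partial>M))) \<partial>M)"
  unfolding mean_deviation_def average_add Bochner_Integration.integral_add[OF f g] by (simp add: algebra_simps)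
 also have "... <= (\<integral>x. norm (average N (\<lambda>n. f (S n x)) - (\<integral>y. f y \<partial>M)) + norm (average N (\<lambda>n. g (S n x)) - (\<integral>y. g y \<partial>M)) \<partial>M)"
  using i by (intro integral_mono norm_triangle_ineq) auto
 also have "... = mean_deviation S f N + mean_deviation S g N"
  unfolding mean_deviation_def using i by (intro Bochner_Integration.integral_add) auto
 finally show ?thesis .
qed

lemma mean_deviation_le:
 assumes S: "\<And>n. mp_map M (S n)" and f: "integrable M f"
 shows "mean_deviation S f N <= 2 * (\<integral>x. norm (f x) \<partial>M)"
proof -
 define c where "c = (\<integral>x. norm (f x) \<partial>M)"
 note i = integrable_average[of S, OF S f]
 have if': "integrable M (\<lambda>x. norm (f (S n x)))" for n
  using mp_map_integrable[OF S f] by auto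
 have c: "(\<integral>x. norm (f (S n x)) \<partial>M) = c" for n
  unfolding c_def by (rule mp_map_integral[OF S]) (use f in auto)
 have c0: "c >= 0" by (simp add: c_def)
 have "(\<integral>x. norm (average N (\<lambda>n. f (S n x))) \<partial>M) <= (\<integral>x. (\<Sum>n=1..N. norm (f (S n x))) / real N \<partial>M)"
 proof (rule integral_mono)
  fix x
  show "norm (average N (\<lambda>n. f (S n x))) <= (\<Sum>n=1..N. norm (f (S n x))) / real N"
   unfolding average_def norm_divide norm_of_nat by (intro divide_right_mono norm_sum) auto
 qed (use i if' in auto)
 also have "... = (\<Sum>n=1..N. c) / real N" using if' by (simp add: c)
 also have "... <= c" using c0 by (cases "N = 0") auto
 finally have 1: "(\<integral>x. norm (average N (\<lambda>n. f (S n x))) \<partial>M) <= c" .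
 have "mean_deviation S f N <= (\<integral>x. norm (average N (\<lambda>n. f (S n x))) + norm (\<integral>y. f y \<partial>M) \<partial>M)"
  unfolding mean_deviation_def using i by (intro integral_mono norm_triangle_ineq4) auto
 also have "... = (\<integral>x. norm (average N (\<lambda>n. f (S n x))) \<partial>M) + norm (\<integral>y. f y \<partial>M)"
  using i by (subst Bochner_Integration.integral_add) (auto simp: prob_space)
 also have "... <= c + c" by (intro add_mono 1) (simp add: c_def integral_norm_bound)
 finally show ?thesis by (simp add: c_def)
qed

lemma mean_deviation_limit:
 assumes S: "\<And>n. mp_map M (S n)" and f: "integrable M f" and s: "\<And>i :: nat. integrable M (s i)"
  and lim: "(\<lambda>i. \<integral>x. norm (f x - s i x) \<partial>M) \<longlonglongrightarrow> 0"
  and dev: "\<And>i. mean_deviation S (s i) \<longlonglongrightarrow> 0"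
 shows "mean_deviation S f \<longlonglongrightarrow> 0"
proof (rule LIMSEQ_I)
 fix e :: real assume e: "e > 0"
 have "\<forall>\<^sub>F i in sequentially. (\<integral>x. norm (f x - s i x) \<partial>M) < e / 4"
  by (rule order_tendstoD(2)[OF lim]) (use e in simp)
 then obtain i where i: "(\<integral>x. norm (f x - s i x) \<partial>M) < e / 4" by (auto simp: eventually_sequentially)
 have "\<forall>\<^sub>F N in sequentially. mean_deviation S (s i) N < e / 2"
  by (rule order_tendstoD(2)[OF dev]) (use e in simp)
 then obtain N0 where N0: "\<And>N. N >= N0 ==> mean_deviation S (s i) N < e / 2" by (auto simp: eventually_sequentially)
 have "norm (mean_deviation S f N - 0) < e" if "N >= N0" for N
 proof -
  have d: "integrable M (\<lambda>x. f x - s i x)" using f s by simp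
  have "mean_deviation S (\<lambda>x. s i x + (f x - s i x)) N <= mean_deviation S (s i) N + mean_deviation S (\<lambda>x. f x - s i x) N"
   by (rule mean_deviation_add[of S, OF S s d])
  also have "... <= mean_deviation S (s i) N + 2 * (\<integral>x. norm (f x - s i x) \<partial>M)"
   using mean_deviation_le[of S, OF S d] by simp
  also have "... < e" using N0[OF that] i by linarith
  finally show ?thesis using mean_deviation_nonneg[of S f N] by simp
 qed
 thus "\<exists>N0. \<forall>N\<ge>N0. norm (mean_deviation S f N - 0) < e" by blast
qed

lemma integrable_ind [simp]: "A \<in> sets M ==> integrable M (indicator A :: 'a => complex)"
 by (rule integrable_bounded[of _ 1]) (auto simp: indicator_def)

lemma integral_ind: "A \<in> sets M ==> (\<integral>x. indicator A x \<partial>M) = complex_of_real (prob A)"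
proof -
 assume A: "A \<in> sets M"
 have "(\<integral>x. (indicator A x :: complex) \<partial>M) = (\<integral>x. complex_of_real (indicat_real A x) \<partial>M)"
  by (intro Bochner_Integration.integral_cong) (auto simp: indicator_def)
 thus ?thesis using A by simp
qed

text \<open>
  The functions with vanishing deviation form a closed subspace of \<open>L1\<close> that contains
  the constants. So the sets with this property form a Dynkin system, and integrable functions
  follow from their indicators.
\<close>

theorem ergodic_sequence_of_generator:
 assumes S: "\<And>n. mp_map M (S n)" and G: "Int_stable G" "G \<subseteq> Pow (space M)" "sets M = sigma_sets (space M) G"
  and gen: "\<And>A. A \<in> G ==> mean_deviation S (indicator A) \<longlonglongrightarrow> 0"
 shows "ergodic_sequence M S"
proof -
 have add: "mean_deviation S (\<lambda>x. f x + g x) \<longlonglongrightarrow> 0"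
  if "integrable M f" "integrable M g" "mean_deviation S f \<longlonglongrightarrow> 0" "mean_deviation S g \<longlonglongrightarrow> 0" for f g
 proof (rule tendsto_sandwich[OF _ _ tendsto_const])
  show "(\<lambda>N. mean_deviation S f N + mean_deviation S g N) \<longlonglongrightarrow> 0" using tendsto_add[OF that(3,4)] by simp
 qed (use mean_deviation_nonneg mean_deviation_add[of S, OF S that(1,2)] in auto)
 have cmult: "mean_deviation S (\<lambda>x. c * f x) \<longlonglongrightarrow> 0" if "mean_deviation S f \<longlonglongrightarrow> 0" for f c
 proof -
  have "mean_deviation S (\<lambda>x. c * f x) N = norm c * mean_deviation S f N" for N
   by (simp add: mean_deviation_def average_cmult right_diff_distrib[symmetric] norm_mult)
  hence "mean_deviation S (\<lambda>x. c * f x) = (\<lambda>N. norm c * mean_deviation S f N)" by (rule ext)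
  thus ?thesis using tendsto_mult_left[OF that, of "norm c"] by simp
 qed
 have const: "mean_deviation S (\<lambda>x. c) \<longlonglongrightarrow> 0" for c
  by (rule tendsto_eventually, rule eventually_mono[OF eventually_gt_at_top[of 0]])
   (simp add: mean_deviation_def average_const prob_space)
 have event': "mean_deviation S (indicator A) \<longlonglongrightarrow> 0" if "A \<in> sigma_sets (space M) G" for A
  using that
 proof (induction rule: sigma_sets_induct_disjoint[OF G(1,2), consumes 1, case_names basic empty compl union])
  case (basic A) thus ?case by (rule gen)
 next
  case empty thus ?case using const[of 0] by (simp add: indicator_def[abs_def])
 next
  case (compl A)
  hence A: "A \<in> sets M" by (simp add: G(3))
  have dev: "mean_deviation S (\<lambda>x. 1 + (-1) * indicator A x) \<longlonglongrightarrow> 0"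
   by (rule add[of "\<lambda>_. 1", OF _ _ const cmult[OF compl(2)]]) (use A in auto)
  show ?case
  proof (rule mean_deviation_limit[of S, OF S _ _ _ dev])
   have "(\<integral>x. norm ((indicator (space M - A) x :: complex) - (1 + - 1 * indicator A x)) \<partial>M) = (\<integral>x. 0 \<partial>M)"
    by (rule Bochner_Integration.integral_cong) (auto simp: indicator_def)
   thus "(\<lambda>i. \<integral>x. norm ((indicator (space M - A) x :: complex) - (1 + - 1 * indicator A x)) \<partial>M) \<longlonglongrightarrow> 0" by simp
  qed (use A in auto)
 next
  case (union A)
  hence A: "A i \<in> sets M" for i unfolding G(3) by auto
  define B where "B n = (\<Union>i<n. A i)" for n
  have B [simp]: "B n \<in> sets M" "(\<Union>i. A i) \<in> sets M" for n using A unfolding B_def by auto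
  have dev: "mean_deviation S (indicator (B n)) \<longlonglongrightarrow> 0" for n
  proof (induction n)
   case 0 thus ?case using const[of 0] by (simp add: indicator_def[abs_def] B_def)
  next
   case (Suc n)
   have "x \<notin> A n" if xB: "x \<in> B n" for x
   proof -
    obtain i where i: "i < n" "x \<in> A i" using xB by (auto simp: B_def)
    have "A i \<inter> A n = {}" by (rule disjoint_family_onD[OF union(1)]) (use i in auto)
    thus ?thesis using i by blast
   qed
   hence "indicator (B (Suc n)) = (\<lambda>x. indicator (B n) x + indicator (A n) x :: complex)"
    by (intro ext) (auto simp: indicator_def B_def lessThan_Suc)
   thus ?case using add[of "indicator (B n)" "indicator (A n)", OF _ _ Suc union(3)] A by simp
  qed
  show ?case
  proof (rule mean_deviation_limit[of S, OF S _ _ _ dev])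
   have e: "(\<integral>x. norm ((indicator (\<Union>i. A i) x :: complex) - indicator (B n) x) \<partial>M) = prob (\<Union>i. A i) - prob (B n)" for n
   proof -
    have "(\<integral>x. norm ((indicator (\<Union>i. A i) x :: complex) - indicator (B n) x) \<partial>M) = (\<integral>x. indicator (\<Union>i. A i) x - indicator (B n) x \<partial>M)"
     by (rule Bochner_Integration.integral_cong) (auto simp: indicator_def B_def)
    also have "... = prob (\<Union>i. A i) - prob (B n)"
     by (subst Bochner_Integration.integral_diff) (auto simp: emeasure_eq_measure)
    finally show ?thesis .
   qed
   have "(\<lambda>n. prob (B n)) \<longlonglongrightarrow> prob (\<Union>n. B n)"
   proof (rule finite_Lim_measure_incseq)
    show "incseq B" unfolding B_def by (intro incseq_SucI UN_mono) auto
   qed auto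
   moreover have "(\<Union>n. B n) = (\<Union>i. A i)" by (auto simp: B_def)
   ultimately have "(\<lambda>n. prob (\<Union>i. A i) - prob (B n)) \<longlonglongrightarrow> prob (\<Union>i. A i) - prob (\<Union>i. A i)"
    by (intro tendsto_diff tendsto_const) simp
   thus "(\<lambda>n. \<integral>x. norm ((indicator (\<Union>i. A i) x :: complex) - indicator (B n) x) \<partial>M) \<longlonglongrightarrow> 0" by (simp add: e)
  qed auto
 qed
 have event: "mean_deviation S (indicator A) \<longlonglongrightarrow> 0" if "A \<in> sets M" for A
  using event'[of A] that G(3) by simp
 note add_closed = add
 have all: "mean_deviation S f \<longlonglongrightarrow> 0" if "integrable M f" for f
  using that
 proof (induction rule: integrable_induct)
  case (base A c)
  have "(\<lambda>x. indicator A x *\<^sub>R c) = (\<lambda>x. c * indicator A x)" by (auto simp: indicator_def)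
  thus ?case using cmult[OF event[OF base(1)], of c] by simp
 next
  case (add f g) show ?case by (rule add_closed[OF add(1-4)])
 next
  case (lim f s)
  show ?case
  proof (rule mean_deviation_limit[of S, OF S lim(4) lim(1) _ lim(5)])
   have "(\<lambda>i. \<integral>x. norm (f x - s i x) \<partial>M) \<longlonglongrightarrow> (\<integral>x. 0 \<partial>M)"
   proof (rule integral_dominated_convergence[where w="\<lambda>x. 3 * norm (f x)"])
    show "AE x in M. (\<lambda>i. norm (f x - s i x)) \<longlonglongrightarrow> 0"
    proof (rule AE_I2)
     fix x assume "x \<in> space M"
     from tendsto_diff[OF tendsto_const lim(2)[OF this], of "f x"]
     show "(\<lambda>i. norm (f x - s i x)) \<longlonglongrightarrow> 0" by (intro tendsto_norm_zero) simp
    qed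
    fix i show "AE x in M. norm (norm (f x - s i x)) <= 3 * norm (f x)"
    proof (rule AE_I2)
     fix x assume "x \<in> space M"
     thus "norm (norm (f x - s i x)) <= 3 * norm (f x)"
      using lim(3)[of x i] norm_triangle_ineq4[of "f x" "s i x"] by simp
    qed
   qed (use lim(1,4) in auto)
   thus "(\<lambda>i. \<integral>x. norm (f x - s i x) \<partial>M) \<longlonglongrightarrow> 0" by simp
  qed
 qed
 show ?thesis
 proof (rule ergodic_sequenceI[OF S])
  fix f :: "'a => complex" and C
  assume f [measurable]: "f \<in> borel_measurable M" and C: "\<And>x. norm (f x) <= C" and f0: "(\<integral>x. f x \<partial>M) = 0"
  note [measurable] = mp_map_measurable[OF S]
  have C0: "C >= 0" using C[of undefined] norm_ge_zero[of "f undefined"] by linarith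
  have av: "norm (average N (\<lambda>n. f (S n x))) <= C" for N x by (rule norm_average_le) (use C C0 in auto)
  have m: "(\<lambda>x. average N (\<lambda>n. f (S n x))) \<in> borel_measurable M" for N unfolding average_def by measurable
  show "(\<lambda>N. \<integral>x. (norm (average N (\<lambda>n. f (S n x))))\<^sup>2 \<partial>M) \<longlonglongrightarrow> 0"
  proof (rule tendsto_sandwich[OF _ _ tendsto_const])
   have "mean_deviation S f \<longlonglongrightarrow> 0" by (rule all, rule integrable_bounded[of _ C]) (use C in auto)
   from tendsto_mult_left[OF this, of C]
   show "(\<lambda>N. C * mean_deviation S f N) \<longlonglongrightarrow> 0" by simp
   have "(\<integral>x. (norm (average N (\<lambda>n. f (S n x))))\<^sup>2 \<partial>M) <= (\<integral>x. C * norm (average N (\<lambda>n. f (S n x))) \<partial>M)" for N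
   proof (rule integral_mono)
    show "integrable M (\<lambda>x. (norm (average N (\<lambda>n. f (S n x))))\<^sup>2)"
     by (rule integrable_bounded[of _ "C\<^sup>2"]) (use m av in \<open>auto intro!: power_mono\<close>)
    show "integrable M (\<lambda>x. C * norm (average N (\<lambda>n. f (S n x))))"
     using integrable_bounded[OF m, of N C] av by simp
    show "(norm (average N (\<lambda>n. f (S n x))))\<^sup>2 <= C * norm (average N (\<lambda>n. f (S n x)))" for x
     unfolding power2_eq_square by (intro mult_right_mono av) auto
   qed
   thus "\<forall>\<^sub>F N in sequentially. (\<integral>x. (norm (average N (\<lambda>n. f (S n x))))\<^sup>2 \<partial>M) <= C * mean_deviation S f N"
    by (intro always_eventually allI) (simp add: mean_deviation_def f0)
  qed simp
 qed
qed

lemma integral_norm_average_square: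
 assumes v: "\<And>n. v n \<in> borel_measurable M" and C: "\<And>n x. norm (v n x) <= C"
 shows "complex_of_real (\<integral>x. (norm (average N (\<lambda>n. v n x)))\<^sup>2 \<partial>M) = average2 N (\<lambda>n m. \<integral>x. v n x * cnj (v m x) \<partial>M)"
proof -
 note [measurable] = v
 have C0: "C >= 0" using C[of undefined undefined] norm_ge_zero[of "v undefined undefined"] by linarith
 have i: "integrable M (\<lambda>x. v n x * cnj (v m x))" for n m
  by (rule integrable_bounded[of _ "C * C"]) (use C C0 in \<open>auto simp: norm_mult intro!: mult_mono\<close>)
 have "complex_of_real (\<integral>x. (norm (average N (\<lambda>n. v n x)))\<^sup>2 \<partial>M) = (\<integral>x. complex_of_real ((norm (average N (\<lambda>n. v n x)))\<^sup>2) \<partial>M)"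
  by (rule integral_complex_of_real[symmetric])
 also have "... = (\<integral>x. average2 N (\<lambda>n m. v n x * cnj (v m x)) \<partial>M)"
  by (simp only: complex_norm_square average2_prod cnj_average)
 also have "... = average2 N (\<lambda>n m. \<integral>x. v n x * cnj (v m x) \<partial>M)"
  unfolding average2_def average_def using i by simp
 finally show ?thesis .
qed

end

text \<open>Preimages of rectangles are rectangles of the same measure.\<close>

lemma mp_map_PiM:
 assumes "finite I" "prob_space M" and U: "\<And>j. j \<in> I ==> mp_map M (U j)"
 shows "mp_map (\<Pi>\<^sub>M j\<in>I. M) (\<lambda>x. \<lambda>j\<in>I. U j (x j))"
proof -
 interpret M: prob_space M by fact
 interpret product_prob_space "\<lambda>_. M" I by standard
 let ?P = "\<Pi>\<^sub>M j\<in>I. M" and ?S = "\<lambda>x. \<lambda>j\<in>I. U j (x j)"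
 have Um: "U j \<in> M \<rightarrow>\<^sub>M M" if "j \<in> I" for j using U[OF that] by (rule mp_map_measurable)
 have meas: "?S \<in> ?P \<rightarrow>\<^sub>M ?P"
 proof (rule measurable_restrict)
  fix j assume j: "j \<in> I"
  show "(\<lambda>x. U j (x j)) \<in> ?P \<rightarrow>\<^sub>M M"
   by (rule measurable_compose[OF _ Um[OF j]]) (rule measurable_component_singleton[OF j])
 qed
 have "distr ?P ?P ?S = ?P"
 proof (rule PiM_eqI[OF assms(1)])
  fix A assume A: "\<And>i. i \<in> I ==> A i \<in> sets M"
  define B where "B i = U i -` A i \<inter> space M" for i
  have B: "B i \<in> sets M" if "i \<in> I" for i unfolding B_def using Um A that by (auto intro: measurable_sets)
  have "emeasure (distr ?P ?P ?S) (Pi\<^sub>E I A) = emeasure ?P (?S -` Pi\<^sub>E I A \<inter> space ?P)"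
   by (rule emeasure_distr[OF meas]) (use A assms(1) in \<open>auto intro: sets_PiM_I_finite\<close>)
  also have "?S -` Pi\<^sub>E I A \<inter> space ?P = Pi\<^sub>E I B"
   by (auto simp: space_PiM B_def PiE_iff)
  also have "emeasure ?P (Pi\<^sub>E I B) = (\<Prod>i\<in>I. emeasure M (B i))" by (rule emeasure_PiM[OF assms(1)]) (rule B)
  also have "... = (\<Prod>i\<in>I. emeasure M (A i))"
  proof (rule prod.cong[OF refl])
   fix i assume i: "i \<in> I"
   have "emeasure M (B i) = emeasure (distr M M (U i)) (A i)"
    unfolding B_def by (rule emeasure_distr[symmetric]) (use Um A i in auto)
   thus "emeasure M (B i) = emeasure M (A i)" using U[OF i] by (simp add: mp_map_def)
  qed
  finally show "emeasure (distr ?P ?P ?S) (Pi\<^sub>E I A) = (\<Prod>i\<in>I. emeasure M (A i))" .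
 qed simp
 thus ?thesis using meas by (simp add: mp_map_def)
qed

section \<open>Joint ergodicity implies product ergodicity\<close>

text \<open>
  The floors of the Hardy functions enter only as integer sequences \<open>p j\<close>.
\<close>

locale joint_system = prob_space M for M :: "'a measure" +
 fixes l :: nat and T :: "nat => 'a => 'a" and p :: "nat => nat => int"
 assumes invertible: "j \<in> {1..l} ==> invertible_measure_preserving M (T j)"
  and joint: "(\<And>j. j \<in> {1..l} ==> f j \<in> Linfty M) ==>
    (\<lambda>N. L2norm M (\<lambda>x. average N (\<lambda>n. \<Prod>j=1..l. f j (int_iterate M (T j) (p j n) x)) - (\<Prod>j=1..l. \<integral>y. f j y \<partial>M)))
    \<longlonglongrightarrow> 0"
begin

lemma system: "j \<in> {1..l} ==> invertible_system M (T j)"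
 by (rule invertible_system.intro[OF prob_space_axioms]) (simp add: invertible_system_axioms_def invertible)

lemma mp_iterate: "j \<in> {1..l} ==> mp_map M (int_iterate M (T j) k)"
 by (rule invertible_system.mp_iter[OF system])

lemma one_Linfty: "(\<lambda>_. 1) \<in> Linfty M"
 by (auto simp: Linfty_def intro: exI[of _ 1])

text \<open>All other functions are taken to be one.\<close>

lemma ergodic_coordinate:
 assumes j: "j \<in> {1..l}"
 shows "ergodic_sequence M (\<lambda>n. int_iterate M (T j) (p j n))"
 unfolding ergodic_sequence_def
proof
 fix f assume f: "f \<in> Linfty M"
 define F where "F = (\<lambda>k. if k = j then f else (\<lambda>_. 1))"
 have "(\<Prod>k=1..l. F k (y k)) = f (y j)" for y
 proof -
  have "(\<Prod>k=1..l. F k (y k)) = (\<Prod>k=1..l. if k = j then f (y k) else 1)" by (rule prod.cong) (auto simp: F_def)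
  thus ?thesis using j by (simp add: prod.delta)
 qed
 moreover have "(\<Prod>k=1..l. \<integral>y. F k y \<partial>M) = (\<integral>y. f y \<partial>M)"
 proof -
  have "(\<Prod>k=1..l. \<integral>y. F k y \<partial>M) = (\<Prod>k=1..l. if k = j then (\<integral>y. f y \<partial>M) else 1)"
   by (rule prod.cong) (auto simp: F_def prob_space)
  thus ?thesis using j by (simp add: prod.delta)
 qed
 moreover have "F k \<in> Linfty M" for k using f one_Linfty by (simp add: F_def)
 ultimately show "(\<lambda>N. L2norm M (\<lambda>x. average N (\<lambda>n. f (int_iterate M (T j) (p j n) x)) - (\<integral>y. f y \<partial>M))) \<longlonglongrightarrow> 0"
  using joint[of F] by simp
qed

text \<open>
  Along the orbit the product of the eigenfunctions is multiplied by
  \<open>e(\<Sum>j lam_j p_j(n))\<close>, and its modulus is a positive constant. So the norm of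
  its joint average is a constant times the exponential average, whereas the product of the
  integrals vanishes since an eigenfunction for a nontrivial eigenvalue has mean zero.
\<close>

lemma eigenvalues_average:
 assumes lam: "\<And>j. j \<in> {1..l} ==> 0 <= lam j \<and> lam j < 1"
  and eig: "\<And>j. j \<in> {1..l} ==> invertible_system.eigenfunction M (T j) (lam j) (g j)"
  and k: "k \<in> {1..l}" "lam k \<noteq> 0"
 shows "(\<lambda>N. average N (\<lambda>n. ee (\<Sum>j=1..l. of_int (p j n) * lam j))) \<longlonglongrightarrow> 0"
proof -
 have gL: "g j \<in> Linfty M" if "j \<in> {1..l}" for j
  using eig[OF that] by (simp add: invertible_system.eigenfunction_def[OF system[OF that]])
 have "\<forall>j\<in>{1..l}. \<exists>c>0. AE x in M. norm (g j x) = c"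
  using invertible_system.eigenfunction_norm_const[OF system ergodic_coordinate eig] by blast
 then obtain c where c: "\<And>j. j \<in> {1..l} ==> c j > 0" "\<And>j. j \<in> {1..l} ==> AE x in M. norm (g j x) = c j"
  unfolding bchoice_iff by blast
 have it: "AE x in M. g j (int_iterate M (T j) m x) = ee (of_int m * lam j) * g j x" if "j \<in> {1..l}" for j m
  using eig[OF that] unfolding invertible_system.eigenfunction_def[OF system[OF that]]
  by (intro invertible_system.eigenfunction_iter[OF system[OF that]]) blast
 define C where "C = (\<Prod>j=1..l. c j)"
 define E where "E N = average N (\<lambda>n. ee (\<Sum>j=1..l. of_int (p j n) * lam j))" for N
 have C: "C > 0" unfolding C_def by (rule prod_pos) (use c in auto)
 have "(\<integral>x. g k x \<partial>M) = 0"
 proof (rule invertible_system.eigenfunction_integral_0[OF system[OF k(1)] eig[OF k(1)]])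
  show "lam k \<notin> \<int>"
  proof
   assume "lam k \<in> \<int>"
   then obtain i :: int where "lam k = of_int i" by (auto elim: Ints_cases)
   thus False using lam[OF k(1)] k(2) by auto
  qed
 qed
 hence int0: "(\<Prod>j=1..l. \<integral>x. g j x \<partial>M) = 0" using k(1) by (auto simp: prod_zero_iff)
 have norm: "AE x in M. norm (average N (\<lambda>n. \<Prod>j=1..l. g j (int_iterate M (T j) (p j n) x))) = norm (E N) * C" for N
 proof -
  have "AE x in M. \<forall>j\<in>{1..l}. norm (g j x) = c j"
   by (rule AE_finite_allI) (use c(2) in auto)
  moreover have "AE x in M. \<forall>j\<in>{1..l}. \<forall>m. g j (int_iterate M (T j) m x) = ee (of_int m * lam j) * g j x"
   by (rule AE_finite_allI) (use it in \<open>auto simp: AE_all_countable\<close>)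
  ultimately show ?thesis
  proof eventually_elim
   case (elim x)
   have "(\<Prod>j=1..l. g j (int_iterate M (T j) (p j n) x)) = ee (\<Sum>j=1..l. of_int (p j n) * lam j) * (\<Prod>j=1..l. g j x)" for n
    unfolding ee_sum[OF finite_atLeastAtMost] prod.distrib[symmetric] by (rule prod.cong) (use elim(2) in auto)
   hence "average N (\<lambda>n. \<Prod>j=1..l. g j (int_iterate M (T j) (p j n) x)) = E N * (\<Prod>j=1..l. g j x)"
    by (simp only: average_cmult_right E_def)
   moreover have "norm (\<Prod>j=1..l. g j x) = C"
    unfolding C_def prod_norm[symmetric] by (rule prod.cong) (use elim(1) in auto)
   ultimately show ?case by (simp add: norm_mult)
  qed
 qed
 have "L2norm M (\<lambda>x. average N (\<lambda>n. \<Prod>j=1..l. g j (int_iterate M (T j) (p j n) x)) - (\<Prod>j=1..l. \<integral>x. g j x \<partial>M)) = norm (E N) * C" for N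
 proof -
  have m: "(\<lambda>x. g j (int_iterate M (T j) i x)) \<in> borel_measurable M" if "j \<in> {1..l}" for i j
   using measurable_compose[OF mp_map_measurable[OF mp_iterate[OF that]]] gL[OF that] unfolding Linfty_def by blast
  have "(\<integral>x. (norm (average N (\<lambda>n. \<Prod>j=1..l. g j (int_iterate M (T j) (p j n) x))))\<^sup>2 \<partial>M) = (\<integral>x. (norm (E N) * C)\<^sup>2 \<partial>M)"
  proof (rule integral_cong_AE)
   show "(\<lambda>x. (norm (average N (\<lambda>n. \<Prod>j=1..l. g j (int_iterate M (T j) (p j n) x))))\<^sup>2) \<in> borel_measurable M"
   proof -
    have [measurable]: "(\<lambda>x. \<Prod>j=1..l. g j (int_iterate M (T j) (p j n) x)) \<in> borel_measurable M" for n
     by (rule borel_measurable_prod) (rule m)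
    show ?thesis unfolding average_def by measurable
   qed
   show "AE x in M. (norm (average N (\<lambda>n. \<Prod>j=1..l. g j (int_iterate M (T j) (p j n) x))))\<^sup>2 = (norm (E N) * C)\<^sup>2"
    using norm[of N] by eventually_elim simp
  qed simp
  thus ?thesis using C unfolding L2norm_def int0 by (simp add: prob_space)
 qed
 hence "(\<lambda>N. norm (E N) * C) \<longlonglongrightarrow> 0" using joint[of g, OF gL] by simp
 from tendsto_mult_right[OF this, of "1 / C"] have "(\<lambda>N. norm (E N)) \<longlonglongrightarrow> 0" using C by simp
 thus ?thesis unfolding E_def by (rule tendsto_norm_zero_cancel)
qed

abbreviation "acorr j \<equiv> invertible_system.autocorr M (T j)"

text \<open>
  All factors are bounded by one, so replacing each correlation sequence by its atomic part costs
  the sum of the remainders. The product of the atomic parts expands into exponentials, one for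
  each choice \<open>g\<close> of eigenvalues, and all of them average to zero except the choice
  \<open>z\<close> of only zeros.
\<close>

lemma rectangle_correlations:
 assumes A: "\<And>j. j \<in> {1..l} ==> A j \<in> sets M"
  and aa: "\<And>j. j \<in> {1..l} ==> invertible_system.almost_atomic M (T j) (p j) (A j)"
 shows "(\<lambda>N. average2 N (\<lambda>n m. \<Prod>j=1..l. acorr j (indicator (A j)) (p j n - p j m)))
   \<longlonglongrightarrow> of_real (\<Prod>j=1..l. (prob (A j))\<^sup>2)"
proof (rule LIMSEQ_I)
 fix e0 :: real assume e0: "e0 > 0"
 \<comment> \<open>\<open>l\<close> remainders contribute at most half of \<open>e0\<close>\<close>
 define e where "e = e0 / (2 * (real l + 1))"
 have e: "e > 0" "real l * e <= e0 / 2" using e0 by (auto simp: e_def field_simps)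
 define I where "I = {1..l}"
 have I: "finite I" by (simp add: I_def)
 have "\<forall>j\<in>I. \<exists>L \<kappa> r. invertible_system.atomic_decomposition M (T j) (p j) (A j) e L \<kappa> r"
  using aa e(1) by (simp add: I_def invertible_system.almost_atomic_def[OF system])
 then obtain L \<kappa> r where all:
  "\<And>j. j \<in> I ==> invertible_system.atomic_decomposition M (T j) (p j) (A j) e (L j) (\<kappa> j) (r j)"
  by metis
 have L: "finite (L j)" "0 \<in> L j" "L j \<subseteq> {0..<1}" "\<And>lam. lam \<in> L j ==> \<exists>g. invertible_system.eigenfunction M (T j) lam g"
  and \<kappa>: "\<kappa> j 0 = (prob (A j))\<^sup>2" "\<And>lam. \<kappa> j lam >= 0" "sum (\<kappa> j) (L j) <= 1"
  and dec: "\<And>k. acorr j (indicator (A j)) k = (\<Sum>lam\<in>L j. of_real (\<kappa> j lam) * ee (of_int k * lam)) + r j k"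
  and small: "\<forall>\<^sub>F N in sequentially. real_average2 N (\<lambda>n m. norm (r j (p j n - p j m))) <= e"
  if "j \<in> I" for j
  using all[OF that] that by (auto simp: I_def invertible_system.atomic_decomposition_def[OF system])
 define d where "d j k = (\<Sum>lam\<in>L j. of_real (\<kappa> j lam) * ee (of_int k * lam))" for j and k :: int
 have d1: "norm (d j k) <= 1" if "j \<in> I" for j k
 proof -
  have "norm (d j k) <= (\<Sum>lam\<in>L j. norm (of_real (\<kappa> j lam) * ee (of_int k * lam)))" unfolding d_def by (rule norm_sum)
  also have "... = sum (\<kappa> j) (L j)" using \<kappa>(2)[OF that] by (simp add: norm_mult)
  finally show ?thesis using \<kappa>(3)[OF that] by linarith
 qed
 have c1: "norm (acorr j (indicator (A j)) k) <= 1" if "j \<in> I" for j k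
 proof -
  have j: "j \<in> {1..l}" using that by (simp add: I_def)
  have "norm (acorr j (indicator (A j)) k) <= (\<integral>x. norm (indicator (A j) (int_iterate M (T j) k x) * cnj (indicator (A j) x :: complex)) \<partial>M)"
   unfolding invertible_system.autocorr_def[OF system[OF j]] by (rule integral_norm_bound)
  also have "... <= (\<integral>x. 1 \<partial>M)"
  proof (rule integral_mono)
   note [measurable] = A[OF j] mp_map_measurable[OF mp_iterate[OF j]]
   show "integrable M (\<lambda>x. norm (indicator (A j) (int_iterate M (T j) k x) * cnj (indicator (A j) x :: complex)))"
    by (rule integrable_bounded[of _ 1]) (auto simp: indicator_def)
  qed (auto simp: indicator_def)
  finally show ?thesis by (simp add: prob_space)
 qed
 have main: "(\<lambda>N. average2 N (\<lambda>n m. \<Prod>j\<in>I. d j (p j n - p j m))) \<longlonglongrightarrow> of_real (\<Prod>j\<in>I. (prob (A j))\<^sup>2)"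
 proof -
  define w where "w g n = ee (\<Sum>j\<in>I. of_int (p j n) * g j)" for g :: "nat => real" and n
  define K where "K g = complex_of_real (\<Prod>j\<in>I. \<kappa> j (g j))" for g
  define z where "z = (\<lambda>j\<in>I. 0 :: real)"
  have "(\<Prod>j\<in>I. d j (p j n - p j m)) = (\<Sum>g\<in>Pi\<^sub>E I L. K g * (w g n * cnj (w g m)))" for n m
  proof -
   have "(\<Prod>j\<in>I. d j (p j n - p j m)) = (\<Sum>g\<in>Pi\<^sub>E I L. \<Prod>j\<in>I. of_real (\<kappa> j (g j)) * ee (of_int (p j n - p j m) * g j))"
    unfolding d_def by (rule prod_sum_PiE) (use I L in auto)
   also have "... = (\<Sum>g\<in>Pi\<^sub>E I L. K g * (w g n * cnj (w g m)))"
    by (rule sum.cong[OF refl]) (simp add: K_def w_def ee_sum[OF I] prod.distrib[symmetric] cnj_ee ee_add[symmetric] left_diff_distrib)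
   finally show ?thesis .
  qed
  hence eq: "average2 N (\<lambda>n m. \<Prod>j\<in>I. d j (p j n - p j m)) = (\<Sum>g\<in>Pi\<^sub>E I L. K g * (average N (w g) * cnj (average N (w g))))" for N
   by (simp only: cnj_average average2_prod[symmetric] average2_cmult[symmetric]) (simp only: average2_def average_sum)
  have each: "(\<lambda>N. K g * (average N (w g) * cnj (average N (w g)))) \<longlonglongrightarrow> (if g = z then K z else 0)" if g: "g \<in> Pi\<^sub>E I L" for g
  proof (cases "g = z")
   case True
   have "w g = (\<lambda>_. 1)" by (auto simp: w_def True z_def)
   hence "(\<lambda>N. average N (w g)) \<longlonglongrightarrow> 1" using average_const_tendsto[of 1] by simp
   from tendsto_mult[OF tendsto_const tendsto_mult[OF this tendsto_cnj[OF this]], of "K g"] True show ?thesis by simp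
  next
   case False
   have "\<exists>k\<in>I. g k \<noteq> 0"
   proof (rule ccontr)
    assume "\<not> (\<exists>k\<in>I. g k \<noteq> 0)"
    hence "g = z" using g by (auto simp: z_def fun_eq_iff PiE_iff extensional_def)
    thus False using False by simp
   qed
   then obtain k where k: "k \<in> I" "g k \<noteq> 0" by blast
   have "\<forall>j\<in>I. \<exists>h. invertible_system.eigenfunction M (T j) (g j) h" using L(4) g by (auto simp: PiE_iff)
   then obtain h where h: "\<And>j. j \<in> I ==> invertible_system.eigenfunction M (T j) (g j) (h j)"
    unfolding bchoice_iff by blast
   have "g j \<in> {0..<1}" if "j \<in> I" for j using L(3)[OF that] g that by (auto simp: PiE_iff)
   hence "(\<lambda>N. average N (w g)) \<longlonglongrightarrow> 0" unfolding w_def I_def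
    by (intro eigenvalues_average[of g h k]) (use h k in \<open>auto simp: I_def\<close>)
   from tendsto_mult[OF tendsto_const tendsto_mult[OF this tendsto_cnj[OF this]], of "K g"] False show ?thesis by simp
  qed
  have "z \<in> Pi\<^sub>E I L" using L(2) by (auto simp: z_def)
  moreover have "finite (Pi\<^sub>E I L)" by (rule finite_PiE) (use I L in auto)
  ultimately have "(\<Sum>g\<in>Pi\<^sub>E I L. if g = z then K z else 0) = K z" by (simp add: sum.delta)
  also have "K z = of_real (\<Prod>j\<in>I. (prob (A j))\<^sup>2)" unfolding K_def by (intro arg_cong[of _ _ of_real] prod.cong) (auto simp: z_def \<kappa>(1))
  finally have val: "(\<Sum>g\<in>Pi\<^sub>E I L. if g = z then K z else 0) = of_real (\<Prod>j\<in>I. (prob (A j))\<^sup>2)" .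
  show ?thesis unfolding eq val[symmetric] by (rule tendsto_sum) (rule each)
 qed
 have bound: "norm (average2 N (\<lambda>n m. \<Prod>j\<in>I. acorr j (indicator (A j)) (p j n - p j m)) - average2 N (\<lambda>n m. \<Prod>j\<in>I. d j (p j n - p j m)))
   <= (\<Sum>j\<in>I. real_average2 N (\<lambda>n m. norm (r j (p j n - p j m))))" for N
 proof -
  have "norm (average2 N (\<lambda>n m. (\<Prod>j\<in>I. acorr j (indicator (A j)) (p j n - p j m)) - (\<Prod>j\<in>I. d j (p j n - p j m))))
    <= real_average2 N (\<lambda>n m. norm ((\<Prod>j\<in>I. acorr j (indicator (A j)) (p j n - p j m)) - (\<Prod>j\<in>I. d j (p j n - p j m))))"
   by (rule norm_average2_le_real_average2)
  also have "... <= real_average2 N (\<lambda>n m. \<Sum>j\<in>I. norm (r j (p j n - p j m)))"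
  proof (rule real_average2_mono)
   fix n m
   have "norm ((\<Prod>j\<in>I. acorr j (indicator (A j)) (p j n - p j m)) - (\<Prod>j\<in>I. d j (p j n - p j m)))
     <= (\<Sum>j\<in>I. norm (acorr j (indicator (A j)) (p j n - p j m) - d j (p j n - p j m)))"
    by (rule norm_prod_diff) (use c1 d1 in auto)
   also have "... = (\<Sum>j\<in>I. norm (r j (p j n - p j m)))" by (rule sum.cong) (simp_all add: dec d_def)
   finally show "norm ((\<Prod>j\<in>I. acorr j (indicator (A j)) (p j n - p j m)) - (\<Prod>j\<in>I. d j (p j n - p j m))) <= (\<Sum>j\<in>I. norm (r j (p j n - p j m)))" .
  qed
  also have "... = (\<Sum>j\<in>I. real_average2 N (\<lambda>n m. norm (r j (p j n - p j m))))"
   using I by (induction I rule: finite_induct) (simp_all add: real_average2_add, simp add: real_average2_def)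
  finally show ?thesis by (simp only: average2_diff)
 qed
 have "\<forall>\<^sub>F N in sequentially. \<forall>j\<in>I. real_average2 N (\<lambda>n m. norm (r j (p j n - p j m))) <= e"
  by (rule eventually_ball_finite[OF I]) (use small in blast)
 moreover have "\<forall>\<^sub>F N in sequentially. norm (average2 N (\<lambda>n m. \<Prod>j\<in>I. d j (p j n - p j m)) - of_real (\<Prod>j\<in>I. (prob (A j))\<^sup>2)) < e0 / 2"
  using tendstoD[OF main, of "e0/2"] e0 by (simp add: dist_norm)
 ultimately have "\<forall>\<^sub>F N in sequentially. norm (average2 N (\<lambda>n m. \<Prod>j\<in>I. acorr j (indicator (A j)) (p j n - p j m)) - of_real (\<Prod>j\<in>I. (prob (A j))\<^sup>2)) < e0"
 proof eventually_elim
  case (elim N)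
  have "(\<Sum>j\<in>I. real_average2 N (\<lambda>n m. norm (r j (p j n - p j m)))) <= (\<Sum>j\<in>I. e)" by (rule sum_mono) (use elim(1) in auto)
  hence s: "(\<Sum>j\<in>I. real_average2 N (\<lambda>n m. norm (r j (p j n - p j m)))) <= e0 / 2" using e(2) by (simp add: I_def)
  have tri: "norm (x - z) <= norm (x - y) + norm (y - z)" for x y z :: complex
   using norm_triangle_ineq[of "x - y" "y - z"] by simp
  show ?case
   using tri[of "average2 N (\<lambda>n m. \<Prod>j\<in>I. acorr j (indicator (A j)) (p j n - p j m))"
     "of_real (\<Prod>j\<in>I. (prob (A j))\<^sup>2)" "average2 N (\<lambda>n m. \<Prod>j\<in>I. d j (p j n - p j m))"] s bound[of N] elim(2) by linarith
 qed
 thus "\<exists>N0. \<forall>N\<ge>N0. norm (average2 N (\<lambda>n m. \<Prod>j=1..l. acorr j (indicator (A j)) (p j n - p j m)) - of_real (\<Prod>j=1..l. (prob (A j))\<^sup>2)) < e0"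
  by (simp add: eventually_sequentially I_def)
qed

text \<open>
  By independence of the coordinates the inner products of translates of a rectangle are products
  of correlations, so \<open>rectangle_correlations\<close> computes the limit of the norm.
\<close>

theorem product_ergodic:
 assumes aa: "\<And>j A. j \<in> {1..l} ==> A \<in> sets M ==> invertible_system.almost_atomic M (T j) (p j) A"
 shows "ergodic_sequence (\<Pi>\<^sub>M i\<in>{1..l}. M) (\<lambda>n x. \<lambda>j\<in>{1..l}. int_iterate M (T j) (p j n) (x j))"
proof -
 define I where "I = {1..l}"
 have I: "finite I" by (simp add: I_def)
 define P where "P = (\<Pi>\<^sub>M i\<in>I. M)"
 define S where "S = (\<lambda>n x. \<lambda>j\<in>I. int_iterate M (T j) (p j n) (x j))"
 interpret pp: product_prob_space "\<lambda>_. M" I by standard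
 interpret P: prob_space P unfolding P_def by (rule prob_space_PiM) (rule prob_space_axioms)
 have S: "mp_map P (S n)" for n unfolding P_def S_def
  by (rule mp_map_PiM[OF I prob_space_axioms]) (simp add: mp_iterate I_def)
 have alg: "prod_algebra I (\<lambda>_. M) = {(\<Pi>\<^sub>E i\<in>I. X i) |X. X \<in> (\<Pi> j\<in>I. sets M)}" by (rule prod_algebra_eq_finite[OF I])
 have "ergodic_sequence P S"
 proof (rule P.ergodic_sequence_of_generator[OF S, of "prod_algebra I (\<lambda>_. M)"])
  show "Int_stable (prod_algebra I (\<lambda>_. M))" by (rule Int_stable_prod_algebra)
  show "prod_algebra I (\<lambda>_. M) \<subseteq> Pow (space P)" using prod_algebra_sets_into_space[of I "\<lambda>_. M"] by (simp add: P_def space_PiM)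
  show "sets P = sigma_sets (space P) (prod_algebra I (\<lambda>_. M))" by (simp add: P_def space_PiM sets_PiM)
  fix R assume "R \<in> prod_algebra I (\<lambda>_. M)"
  then obtain A where A: "\<And>j. j \<in> I ==> A j \<in> sets M" and R: "R = (\<Pi>\<^sub>E i\<in>I. A i)" unfolding alg by auto
  have Rm [measurable]: "R \<in> sets P" unfolding R P_def by (rule sets_PiM_I_finite[OF I]) (rule A)
  define m where "m = (\<Prod>j\<in>I. prob (A j))"
  have mR: "P.prob R = m"
  proof -
   have "ennreal (P.prob R) = (\<Prod>j\<in>I. emeasure M (A j))"
    unfolding P.emeasure_eq_measure[symmetric] R unfolding P_def by (rule pp.emeasure_PiM[OF I]) (rule A)
   also have "... = ennreal m" unfolding m_def emeasure_eq_measure by (rule prod_ennreal) simp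
   finally show ?thesis by (simp add: m_def prod_nonneg)
  qed
  have ind: "indicator R x = (\<Prod>j\<in>I. indicator (A j) (x j) :: complex)" if "x \<in> space P" for x
  proof -
   have "x \<in> R \<longleftrightarrow> (\<forall>j\<in>I. x j \<in> A j)" using that by (auto simp: R P_def space_PiM PiE_iff)
   thus ?thesis using I by (auto simp: indicator_def prod_zero_iff)
  qed
  define v where "v n x = indicator R (S n x) - complex_of_real m" for n x
  note [measurable] = mp_map_measurable[OF S]
  have vm [measurable]: "v n \<in> borel_measurable P" for n unfolding v_def by measurable
  have vb: "norm (v n x) <= 1 + norm m" for n x
   unfolding v_def by (rule order.trans[OF norm_triangle_ineq4]) (auto simp: indicator_def)
  have inner: "(\<integral>x. v n x * cnj (v k x) \<partial>P) = (\<Prod>j\<in>I. acorr j (indicator (A j)) (p j n - p j k)) - of_real (m\<^sup>2)" for n k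
  proof -
   have i: "integrable P (\<lambda>x. indicator R (S n x) :: complex)" for n
    by (rule P.integrable_bounded[of _ 1]) (auto simp: indicator_def)
   have i2: "integrable P (\<lambda>x. indicator R (S n x) * cnj (indicator R (S k x)) :: complex)"
    by (rule P.integrable_bounded[of _ 1]) (auto simp: indicator_def)
   have ei: "(\<integral>x. indicator R (S n x) \<partial>P) = complex_of_real m" for n
    using mp_map_integral[OF S, of "indicator R :: _ => complex" n] P.integral_ind[OF Rm] by (simp add: mR)
   have cn: "cnj (indicator R y) = (indicator R y :: complex)" for y by (simp add: indicator_def)
   have "(\<integral>x. v n x * cnj (v k x) \<partial>P) = (\<integral>x. indicator R (S n x) * cnj (indicator R (S k x)) - of_real m * indicator R (S n x)
     - of_real m * indicator R (S k x) + of_real (m\<^sup>2) \<partial>P)"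
    by (rule Bochner_Integration.integral_cong) (simp_all add: v_def cn algebra_simps power2_eq_square)
   also have "... = (\<integral>x. indicator R (S n x) * cnj (indicator R (S k x)) \<partial>P) - of_real (m\<^sup>2)"
    using i[of n] i[of k] i2 by (simp add: ei P.prob_space power2_eq_square)
   also have "(\<integral>x. indicator R (S n x) * cnj (indicator R (S k x)) \<partial>P) = (\<integral>x. (\<Prod>j\<in>I. indicator (A j) (int_iterate M (T j) (p j n) (x j)) *
      cnj (indicator (A j) (int_iterate M (T j) (p j k) (x j)) :: complex)) \<partial>P)"
   proof (rule Bochner_Integration.integral_cong[OF refl])
    fix x assume x: "x \<in> space P"
    show "indicator R (S n x) * cnj (indicator R (S k x)) = (\<Prod>j\<in>I. indicator (A j) (int_iterate M (T j) (p j n) (x j)) *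
      cnj (indicator (A j) (int_iterate M (T j) (p j k) (x j)) :: complex))"
     unfolding ind[OF mp_map_space[OF S x]] prod.distrib cnj_prod by (simp add: S_def)
   qed
   also have "... = (\<Prod>j\<in>I. \<integral>y. indicator (A j) (int_iterate M (T j) (p j n) y) * cnj (indicator (A j) (int_iterate M (T j) (p j k) y) :: complex) \<partial>M)"
    unfolding P_def
   proof (rule pp.product_integral_prod[OF I])
    fix j assume j: "j \<in> I"
    note [measurable] = A[OF j] mp_map_measurable[OF mp_iterate[of j]]
    show "integrable M (\<lambda>y. indicator (A j) (int_iterate M (T j) (p j n) y) * cnj (indicator (A j) (int_iterate M (T j) (p j k) y) :: complex))"
     by (rule integrable_bounded[of _ 1]) (use j in \<open>auto simp: indicator_def I_def\<close>)
   qed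
   also have "... = (\<Prod>j\<in>I. acorr j (indicator (A j)) (p j n - p j k))"
   proof (rule prod.cong[OF refl])
    fix j assume j: "j \<in> I"
    hence jl: "j \<in> {1..l}" by (simp add: I_def)
    interpret Tj: invertible_system M "T j" by (rule system[OF jl])
    note [measurable] = A[OF j] mp_map_measurable[OF Tj.mp_iter]
    define h where "h y = indicator (A j) (Tj.iter (p j n - p j k) y) * cnj (indicator (A j) y :: complex)" for y
    have "(\<integral>y. indicator (A j) (Tj.iter (p j n) y) * cnj (indicator (A j) (Tj.iter (p j k) y) :: complex) \<partial>M) = (\<integral>y. h (Tj.iter (p j k) y) \<partial>M)"
    proof (rule Bochner_Integration.integral_cong[OF refl])
     fix y assume y: "y \<in> space M"
     show "indicator (A j) (Tj.iter (p j n) y) * cnj (indicator (A j) (Tj.iter (p j k) y) :: complex) = h (Tj.iter (p j k) y)"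
      using Tj.iter_add[OF y, of "p j n - p j k" "p j k"] by (simp add: h_def)
    qed
    also have "... = (\<integral>y. h y \<partial>M)" by (rule mp_map_integral[OF Tj.mp_iter]) (unfold h_def, measurable)
    finally show "(\<integral>y. indicator (A j) (Tj.iter (p j n) y) * cnj (indicator (A j) (Tj.iter (p j k) y) :: complex) \<partial>M) = acorr j (indicator (A j)) (p j n - p j k)"
     by (simp add: Tj.autocorr_def h_def)
   qed
   finally show ?thesis .
  qed
  have "(\<lambda>N. average2 N (\<lambda>n k. \<Prod>j\<in>I. acorr j (indicator (A j)) (p j n - p j k))) \<longlonglongrightarrow> of_real (m\<^sup>2)"
   unfolding m_def prod_power_distrib I_def by (rule rectangle_correlations) (use A aa in \<open>auto simp: I_def\<close>)
  from tendsto_diff[OF this average_const_tendsto[of "complex_of_real (m\<^sup>2)"]]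
  have "(\<lambda>N. average2 N (\<lambda>n k. \<Prod>j\<in>I. acorr j (indicator (A j)) (p j n - p j k)) - average N (\<lambda>_. of_real (m\<^sup>2))) \<longlonglongrightarrow> 0" by simp
  hence "(\<lambda>N. average2 N (\<lambda>n k. \<integral>x. v n x * cnj (v k x) \<partial>P)) \<longlonglongrightarrow> 0"
  proof (rule Lim_transform_eventually)
   show "\<forall>\<^sub>F N in sequentially. average2 N (\<lambda>n k. \<Prod>j\<in>I. acorr j (indicator (A j)) (p j n - p j k)) - average N (\<lambda>_. of_real (m\<^sup>2))
     = average2 N (\<lambda>n k. \<integral>x. v n x * cnj (v k x) \<partial>P)"
    by (rule eventually_mono[OF eventually_gt_at_top[of 0]]) (simp only: inner average2_diff, simp add: average2_def average_const)
  qed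
  hence "(\<lambda>N. complex_of_real (\<integral>x. (norm (average N (\<lambda>n. v n x)))\<^sup>2 \<partial>P)) \<longlonglongrightarrow> complex_of_real 0"
   using P.integral_norm_average_square[of v, OF vm vb] by simp
  hence sq: "(\<lambda>N. \<integral>x. (norm (average N (\<lambda>n. v n x)))\<^sup>2 \<partial>P) \<longlonglongrightarrow> 0" unfolding tendsto_of_real_iff .
  show "P.mean_deviation S (indicator R) \<longlonglongrightarrow> 0"
  proof (rule tendsto_sandwich[OF _ _ tendsto_const])
   show "(\<lambda>N. sqrt (\<integral>x. (norm (average N (\<lambda>n. v n x)))\<^sup>2 \<partial>P)) \<longlonglongrightarrow> 0" using tendsto_real_sqrt[OF sq] by simp
   show "\<forall>\<^sub>F N in sequentially. P.mean_deviation S (indicator R) N <= sqrt (\<integral>x. (norm (average N (\<lambda>n. v n x)))\<^sup>2 \<partial>P)"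
   proof (rule eventually_mono[OF eventually_gt_at_top[of 0]])
    fix N :: nat assume N: "N > 0"
    have "P.mean_deviation S (indicator R) N = (\<integral>x. norm (average N (\<lambda>n. v n x)) \<partial>P)"
     using N by (simp add: P.mean_deviation_def P.integral_ind mR v_def average_diff average_const)
    also have "... <= sqrt (\<integral>x. (norm (average N (\<lambda>n. v n x)))\<^sup>2 \<partial>P)"
    proof (rule P.integral_norm_le_L2)
     show "(\<lambda>x. average N (\<lambda>n. v n x)) \<in> borel_measurable P" unfolding average_def by measurable
     show "norm (average N (\<lambda>n. v n x)) <= 1 + norm m" for x by (rule norm_average_le) (use vb in auto)
    qed
    finally show "P.mean_deviation S (indicator R) N <= sqrt (\<integral>x. (norm (average N (\<lambda>n. v n x)))\<^sup>2 \<partial>P)" .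
   qed
  qed (simp add: P.mean_deviation_nonneg)
 qed
 thus ?thesis by (simp add: P_def S_def I_def)
qed

end

section \<open>Joint ergodicity and differences\<close>

lemma prod_two_coordinates:
 fixes x y :: "'a :: comm_monoid_mult"
 assumes "finite I" "i \<in> I" "j \<in> I" "i \<noteq> j"
 shows "(\<Prod>k\<in>I. if k = i then x else if k = j then y else 1) = x * y"
proof -
 have "(\<Prod>k\<in>I. if k = i then x else if k = j then y else 1) = (\<Prod>k\<in>I. (if k = i then x else 1) * (if k = j then y else 1))"
  by (rule prod.cong) (use assms(4) in auto)
 thus ?thesis using assms by (simp add: prod.distrib prod.delta)
qed

context joint_system
begin

text \<open>Joint ergodicity with all functions but two equal to one, integrated.\<close>

lemma joint_weak:
 assumes ij: "i \<in> {1..l}" "j \<in> {1..l}" "i \<noteq> j"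
  and f: "f \<in> borel_measurable M" "\<And>x. norm (f x) <= C" and g: "g \<in> borel_measurable M" "\<And>x. norm (g x) <= C"
 shows "(\<lambda>N. average N (\<lambda>n. \<integral>x. f (int_iterate M (T i) (p i n) x) * g (int_iterate M (T j) (p j n) x) \<partial>M))
   \<longlonglongrightarrow> (\<integral>x. f x \<partial>M) * (\<integral>x. g x \<partial>M)"
proof -
 define F where "F = (\<lambda>k. if k = i then f else if k = j then g else (\<lambda>_. 1))"
 define u where "u n x = f (int_iterate M (T i) (p i n) x) * g (int_iterate M (T j) (p j n) x)" for n x
 define c where "c = (\<integral>x. f x \<partial>M) * (\<integral>x. g x \<partial>M)"
 note [measurable] = f(1) g(1) mp_map_measurable[OF mp_iterate[OF ij(1)]] mp_map_measurable[OF mp_iterate[OF ij(2)]]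
 have C0: "C >= 0" using f(2)[of undefined] norm_ge_zero[of "f undefined"] by linarith
 have um [measurable]: "u n \<in> borel_measurable M" for n unfolding u_def by measurable
 have ub: "norm (u n x) <= C * C" for n x unfolding u_def norm_mult by (intro mult_mono f g C0) auto
 have ui: "integrable M (u n)" for n by (rule integrable_bounded[OF um ub])
 have FL: "F k \<in> Linfty M" for k
  using f g by (auto simp: F_def Linfty_def intro: exI[of _ C] exI[of _ 1])
 have "(\<Prod>k=1..l. F k (int_iterate M (T k) (p k n) x)) = u n x" for n x
 proof -
  have "(\<Prod>k=1..l. F k (int_iterate M (T k) (p k n) x)) = (\<Prod>k=1..l. if k = i then f (int_iterate M (T i) (p i n) x)
    else if k = j then g (int_iterate M (T j) (p j n) x) else 1)"
   by (rule prod.cong) (auto simp: F_def)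
  thus ?thesis unfolding u_def using prod_two_coordinates[OF _ ij] by simp
 qed
 moreover have "(\<Prod>k=1..l. \<integral>x. F k x \<partial>M) = c"
 proof -
  have "(\<Prod>k=1..l. \<integral>x. F k x \<partial>M) = (\<Prod>k=1..l. if k = i then (\<integral>x. f x \<partial>M) else if k = j then (\<integral>x. g x \<partial>M) else 1)"
   by (rule prod.cong) (auto simp: F_def prob_space)
  thus ?thesis unfolding c_def using prod_two_coordinates[OF _ ij] by simp
 qed
 ultimately have lim: "(\<lambda>N. L2norm M (\<lambda>x. average N (\<lambda>n. u n x) - c)) \<longlonglongrightarrow> 0" using joint[of F, OF FL] by simp
 have "norm (average N (\<lambda>n. \<integral>x. u n x \<partial>M) - c) <= L2norm M (\<lambda>x. average N (\<lambda>n. u n x) - c)" for N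
 proof -
  have i: "integrable M (\<lambda>x. average N (\<lambda>n. u n x))" unfolding average_def using ui by simp
  have "(\<integral>x. average N (\<lambda>n. u n x) - c \<partial>M) = average N (\<lambda>n. \<integral>x. u n x \<partial>M) - c"
   using i ui by (subst Bochner_Integration.integral_diff) (simp_all add: prob_space average_def)
  moreover have "norm (\<integral>x. average N (\<lambda>n. u n x) - c \<partial>M) <= L2norm M (\<lambda>x. average N (\<lambda>n. u n x) - c)"
  proof (rule norm_integral_le_L2norm)
   show "(\<lambda>x. average N (\<lambda>n. u n x) - c) \<in> borel_measurable M" unfolding average_def by measurable
   show "norm (average N (\<lambda>n. u n x) - c) <= C * C + norm c" for x
    by (rule order.trans[OF norm_triangle_ineq4]) (intro add_mono norm_average_le ub order.refl mult_nonneg_nonneg C0)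
  qed
  ultimately show ?thesis by simp
 qed
 hence "(\<lambda>N. average N (\<lambda>n. \<integral>x. u n x \<partial>M) - c) \<longlonglongrightarrow> 0"
  by (intro Lim_null_comparison[OF _ lim] always_eventually allI)
 thus ?thesis unfolding u_def c_def by (rule LIM_zero_cancel)
qed

text \<open>
  The invariance of the measure under \<open>T j\<close> to the power \<open>p j n\<close> moves
  the inverse power from one function to the other.
\<close>

theorem difference_ergodic:
 assumes ij: "i \<in> {1..l}" "j \<in> {1..l}" "i \<noteq> j"
  and comm: "\<And>x. x \<in> space M ==> T i (T j x) = T j (T i x)"
  and conv: "\<And>t s. convergent (\<lambda>N. average N (\<lambda>n. ee (t * of_int (p i n) + s * of_int (p j n))))"
 shows "ergodic_sequence M (\<lambda>n. int_iterate M (T i) (p i n) \<circ> int_iterate M (T j) (- p j n))"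
proof -
 interpret Ti: invertible_system M "T i" by (rule system[OF ij(1)])
 interpret Tj: invertible_system M "T j" by (rule system[OF ij(2)])
 interpret commuting_pair M "T i" "T j" by unfold_locales (rule comm)
 have "ergodic_sequence M (\<lambda>n. W (p i n) (- p j n))"
 proof (rule ergodic_sequence_of_weak)
  fix t s :: real
  show "convergent (\<lambda>N. average N (\<lambda>n. ee (of_int (p i n) * t + of_int (- p j n) * s)))"
   using conv[of t "- s"] by (simp add: mult.commute)
 next
  fix f g :: "'a => complex" and C
  assume f: "f \<in> borel_measurable M" "\<And>x. norm (f x) <= C" and g: "g \<in> borel_measurable M" "\<And>x. norm (g x) <= C"
  note [measurable] = f(1) g(1) mp_map_measurable[OF mp_W]
  have "(\<integral>x. f (W (p i n) (- p j n) x) * g x \<partial>M) = (\<integral>x. f (Ti.iter (p i n) x) * g (Tj.iter (p j n) x) \<partial>M)" for n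
  proof -
   have "(\<integral>x. f (W (p i n) (- p j n) x) * g x \<partial>M) = (\<integral>x. f (W (p i n) (- p j n) (Tj.iter (p j n) x)) * g (Tj.iter (p j n) x) \<partial>M)"
    by (rule mp_map_integral[OF Tj.mp_iter, symmetric]) measurable
   also have "... = (\<integral>x. f (Ti.iter (p i n) x) * g (Tj.iter (p j n) x) \<partial>M)"
   proof (rule Bochner_Integration.integral_cong[OF refl])
    fix x assume x: "x \<in> space M"
    show "f (W (p i n) (- p j n) (Tj.iter (p j n) x)) * g (Tj.iter (p j n) x) = f (Ti.iter (p i n) x) * g (Tj.iter (p j n) x)"
     using Tj.iter_add[OF x, of "- p j n" "p j n"] by (simp add: W_def)
   qed
   finally show ?thesis .
  qed
  thus "(\<lambda>N. average N (\<lambda>n. \<integral>x. f (W (p i n) (- p j n) x) * g x \<partial>M)) \<longlonglongrightarrow> (\<integral>x. f x \<partial>M) * (\<integral>x. g x \<partial>M)"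
   using joint_weak[OF ij f g] by simp
 qed
 thus ?thesis by (simp only: W_def)
qed

end

text \<open>
  Three ranges of growth: eventually constant sequences, for which the field may fail to contain
  the identity; sequences with \<open>x a'\<close> bounded; and all others. The first two make the
  space trivial.
\<close>

lemma (in hardy) almost_atomic_Hardy_sequence:
 assumes comp: "closed_under_composition H" and inv: "closed_under_inversion H"
  and a: "a \<in> polynomial_growth_part H"
  and sys: "invertible_system M T" and erg: "ergodic_sequence M (\<lambda>n. int_iterate M T \<lfloor>a (real n)\<rfloor>)" and A: "A \<in> sets M"
 shows "invertible_system.almost_atomic M T (\<lambda>n. \<lfloor>a (real n)\<rfloor>) A"
proof -
 interpret invertible_system M T by (rule sys)
 have aH: "a \<in> H" and pg: "poly_growth a"
  using a poly_growth_of_polynomial_growth_part[OF a] by (auto simp: polynomial_growth_part_def)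
 show ?thesis
 proof (cases "\<exists>c. \<forall>\<^sub>F x in at_top. a x = c")
  case True
  then obtain c where c: "\<forall>\<^sub>F n in sequentially. a (real n) = c" using eventually_real_nat by blast
  have c': "\<forall>\<^sub>F n in sequentially. a (real n) = c \<and> a (real (Suc n)) = c"
   using eventually_conj[OF c sequentially_offset[OF c, of 1]] by simp
  have "AE x in M. indicat_real A x = prob A"
  proof (rule trivial_of_slow_ergodic[OF erg _ _ A])
   show "\<forall>\<^sub>F n in sequentially. real n * \<bar>a (real (Suc n)) - a (real n)\<bar> <= 0" using c' by eventually_elim simp
   show "(\<forall>\<^sub>F n in sequentially. a (real n) <= a (real (Suc n))) \<or> (\<forall>\<^sub>F n in sequentially. a (real (Suc n)) <= a (real n))"
    by (rule disjI1) (use c' in eventually_elim, simp)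
  qed
  thus ?thesis by (rule almost_atomic_trivial[OF A])
 next
  case False
  interpret hardy_id H by unfold_locales (rule comp, rule identity_of_nonconstant[OF comp inv aH False])
  have as: "a \<in> real_span H" by (rule span_base[OF aH])
  show ?thesis
  proof (cases "\<exists>C. \<forall>\<^sub>F x in at_top. \<bar>x * fdiff a x\<bar> <= C")
   case True
   then obtain C where C: "\<forall>\<^sub>F n in sequentially. \<bar>real n * fdiff a (real n)\<bar> <= C" using eventually_real_nat by blast
   have "AE x in M. indicat_real A x = prob A"
   proof (rule trivial_of_slow_ergodic[OF erg _ _ A])
    show "\<forall>\<^sub>F n in sequentially. real n * \<bar>a (real (Suc n)) - a (real n)\<bar> <= C"
     using C by eventually_elim (simp add: fdiff_def abs_mult add.commute)
    from span_ge_or_lt[OF span_fdiff[OF as], of 0]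
    have "(\<forall>\<^sub>F n in sequentially. 0 <= fdiff a (real n)) \<or> (\<forall>\<^sub>F n in sequentially. fdiff a (real n) < 0)"
     using eventually_real_nat by blast
    thus "(\<forall>\<^sub>F n in sequentially. a (real n) <= a (real (Suc n))) \<or> (\<forall>\<^sub>F n in sequentially. a (real (Suc n)) <= a (real n))"
    proof
     assume "\<forall>\<^sub>F n in sequentially. 0 <= fdiff a (real n)"
     hence "\<forall>\<^sub>F n in sequentially. a (real n) <= a (real (Suc n))" by eventually_elim (simp add: fdiff_def add.commute)
     thus ?thesis ..
    next
     assume "\<forall>\<^sub>F n in sequentially. fdiff a (real n) < 0"
     hence "\<forall>\<^sub>F n in sequentially. a (real (Suc n)) <= a (real n)" by eventually_elim (simp add: fdiff_def add.commute)
     thus ?thesis ..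
    qed
   qed
   thus ?thesis by (rule almost_atomic_trivial[OF A])
  next
   case False
   have "countable {s. \<not> (\<lambda>N. average N (\<lambda>n. ee (s * a (real n)))) \<longlonglongrightarrow> 0}"
    using countable_not_equidistributing[OF as pg False] by (simp add: equidistributing_def)
   thus ?thesis by (rule almost_atomic_of_Wiener[OF erg A])
  qed
 qed
qed

text \<open>
  If both functions are eventually constant, the field may fail to contain the identity, but then
  the averaged sequence is eventually constant.
\<close>

lemma (in hardy) convergent_multipliers:
 assumes comp: "closed_under_composition H" and inv: "closed_under_inversion H"
  and a: "a \<in> polynomial_growth_part H" and b: "b \<in> polynomial_growth_part H"
  and d: "\<And>c d. almost_rational_polynomial (\<lambda>x. c * a x - d * b x) \<or> stays_log_away (\<lambda>x. c * a x - d * b x)"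
 shows "convergent (\<lambda>N. average N (\<lambda>n. ee (t * of_int \<lfloor>a (real n)\<rfloor> + s * of_int \<lfloor>b (real n)\<rfloor>)))"
proof -
 have aH: "a \<in> H" "b \<in> H" using a b by (auto simp: polynomial_growth_part_def)
 show ?thesis
 proof (cases "(\<exists>c. \<forall>\<^sub>F x in at_top. a x = c) \<and> (\<exists>c. \<forall>\<^sub>F x in at_top. b x = c)")
  case True
  then obtain c c' where "\<forall>\<^sub>F n in sequentially. a (real n) = c" "\<forall>\<^sub>F n in sequentially. b (real n) = c'"
   using eventually_real_nat by blast
  hence "\<forall>\<^sub>F n in sequentially. ee (t * of_int \<lfloor>a (real n)\<rfloor> + s * of_int \<lfloor>b (real n)\<rfloor>) = ee (t * of_int \<lfloor>c\<rfloor> + s * of_int \<lfloor>c'\<rfloor>)"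
   by eventually_elim simp
  from average_tendsto_of_tendsto[OF tendsto_eventually[OF this]] show ?thesis by (rule convergentI)
 next
  case False
  have "(\<lambda>x. x) \<in> H" using False identity_of_nonconstant[OF comp inv aH(1)] identity_of_nonconstant[OF comp inv aH(2)] by blast
  then interpret hardy_id H by unfold_locales (rule comp)
  show ?thesis
   by (rule convergent_average_floor_pair) (use aH a b d in \<open>auto intro: span_base poly_growth_of_polynomial_growth_part\<close>)
 qed
qed

theorem theorem1p7:
  fixes H0 :: "(real \<Rightarrow> real) set"
    and M :: "'a measure"
    and l :: nat
    and T :: "nat \<Rightarrow> 'a \<Rightarrow> 'a"
    and a :: "nat \<Rightarrow> real \<Rightarrow> real"
  assumes "hardy_field H0"
    and "closed_under_composition H0"
    and "closed_under_inversion H0"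
    and "mp_system M l T"
    and "\<forall>i\<in>{1..l}. a i \<in> polynomial_growth_part H0"
    and "jointly_ergodic M l T a"
  shows "product_ergodicity M l T a \<and>
    ((\<forall>i\<in>{1..l}. \<forall>j\<in>{1..l}. i \<noteq> j \<longrightarrow>
        (\<forall>ci cj :: real.
           almost_rational_polynomial (\<lambda>x. ci * a i x - cj * a j x) \<or>
           stays_log_away (\<lambda>x. ci * a i x - cj * a j x)))
     \<longrightarrow> difference_ergodicity M l T a)"
proof -
 interpret hardy H0 by unfold_locales (rule assms(1))
 interpret prob_space M using assms(4) by (auto simp: mp_system_def lebesgue_prob_space_def)
 interpret joint_system M l T "\<lambda>j n. \<lfloor>a j (real n)\<rfloor>"
 proof
  show "invertible_measure_preserving M (T j)" if "j \<in> {1..l}" for j using assms(4) that by (auto simp: mp_system_def)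
  fix f :: "nat => 'a => complex" assume "\<And>j. j \<in> {1..l} ==> f j \<in> Linfty M"
  thus "(\<lambda>N. L2norm M (\<lambda>x. average N (\<lambda>n. \<Prod>j=1..l. f j (int_iterate M (T j) \<lfloor>a j (real n)\<rfloor> x)) - (\<Prod>j=1..l. \<integral>y. f j y \<partial>M)))
    \<longlonglongrightarrow> 0" using assms(6) unfolding jointly_ergodic_def by blast
 qed
 have "product_ergodicity M l T a"
  unfolding product_ergodicity_def
 proof (rule product_ergodic)
  fix j A assume j: "j \<in> {1..l}" and A: "A \<in> sets M"
  show "invertible_system.almost_atomic M (T j) (\<lambda>n. \<lfloor>a j (real n)\<rfloor>) A"
   by (rule almost_atomic_Hardy_sequence[OF assms(2,3) _ system[OF j] ergodic_coordinate[OF j] A]) (use assms(5) j in blast)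
 qed
 moreover have "difference_ergodicity M l T a"
  if d: "\<forall>i\<in>{1..l}. \<forall>j\<in>{1..l}. i \<noteq> j \<longrightarrow> (\<forall>ci cj :: real.
      almost_rational_polynomial (\<lambda>x. ci * a i x - cj * a j x) \<or> stays_log_away (\<lambda>x. ci * a i x - cj * a j x))"
  unfolding difference_ergodicity_def
 proof (intro ballI impI)
  fix i j assume ij: "i \<in> {1..l}" "j \<in> {1..l}" "i \<noteq> j"
  show "ergodic_sequence M (\<lambda>n. int_iterate M (T i) \<lfloor>a i (real n)\<rfloor> \<circ> int_iterate M (T j) (- \<lfloor>a j (real n)\<rfloor>))"
  proof (rule difference_ergodic[OF ij])
   show "T i (T j x) = T j (T i x)" if "x \<in> space M" for x using assms(4) ij that by (auto simp: mp_system_def)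
   show "convergent (\<lambda>N. average N (\<lambda>n. ee (t * of_int \<lfloor>a i (real n)\<rfloor> + s * of_int \<lfloor>a j (real n)\<rfloor>)))" for t s
    by (rule convergent_multipliers[OF assms(2,3)]) (use assms(5) ij d in blast)+
  qed
 qed
 ultimately show ?thesis by blast
qed

end
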